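(* Let $M$ be an odd Poisson manifold. A linear differential operator $\Delta$ acting on densities of weight $w$ on $M$ and satisfying the equation $$[\Delta,f]=2\mathcal{L}_f$$ for an arbitrary function $f\in C^\infty(M)$ exists if and only if $w=1/2$. In this case $\Delta$ is defined uniquely up to a zeroth-order term. If $\boldsymbol{s}=s\boldsymbol{\rho}^{1/2}$, where $\boldsymbol{\rho}$ is some basis (non-degenerate) volume form and $s$ is a function, then $$\Delta(\boldsymbol{s})=\Delta(s\boldsymbol{\rho}^{1/2})=(\Delta_{\boldsymbol{\rho}}s)\,\boldsymbol{\rho}^{1/2}+C\boldsymbol{s},$$ where $C$ is a function on $M$ and $\Delta_{\boldsymbol{\rho}}$ is the odd Laplace operator on functions.
   Context: Setting. $M$ is a smooth supermanifold with local coordinates $x^a$ of parity $\tilde a$; tilde denotes parity; derivatives are left derivatives. An odd Poisson (Schouten) structure on $M$ is an odd function $\mathfrak{S}=\frac12\mathfrak{S}^{ab}(x)p_bp_a$ on $T^*M$, quadratic in the momenta, with $\mathfrak{S}^{ab}=(-1)^{\tilde a\tilde b}\mathfrak{S}^{ba}$ of parity $\tilde a+\tilde b+1$, satisfying $(\mathfrak{S},\mathfrak{S})=0$ for the canonical even Poisson bracket $(\ ,\ )$ on $T^*M$. The odd bracket is $\{f,g\}=(f,(\mathfrak{S},g))=-(-1)^{\tilde f(\tilde a+1)}\mathfrak{S}^{ab}\frac{\partial f}{\partial x^b}\frac{\partial g}{\partial x^a}$; the condition $(\mathfrak{S},\mathfrak{S})=0$ is equivalent to its graded Jacobi identity. A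 supermanifold with such a structure is an odd Poisson (= Schouten) manifold. Hamiltonian vector field: $X_f:=(-1)^{\tilde f+1}\{f,\ \}=(-1)^{\tilde a\tilde f}\mathfrak{S}^{ab}\frac{\partial f}{\partial x^b}\frac{\partial}{\partial x^a}$, of parity $\tilde f+1$. $\mathcal{L}_f:=\mathcal{L}_{X_f}$ is the Lie derivative along $X_f$. A volume form is locally $\boldsymbol{\rho}=\rho\,Dx$, where $Dx$ is the Berezin coordinate volume element (transforming by the Berezinian); non-degenerate (basis) means it is a basis element of the module of volume forms ($\rho$ even and invertible). Standing convention: $M$ admits a non-degenerate volume form, and $M$ is oriented and coefficients $\rho$ are positive, so that real powers make sense. The divergence is $\mathrm{div}_{\boldsymbol{\rho}}X=\frac1\rho(-1)^{\tilde a(\tilde X+1)}\frac{\partial(\rho X^a)}{\partial x^a}$, with $\mathcal{L}_X\boldsymbol{\rho}=(\mathrm{div}_{\boldsymbol{\rho}}X)\boldsymbol{\rho}$. The odd Laplace operator on functions is $\Delta_{\boldsymbol{\rho}}f:=\mathrm{div}_{\boldsymbol{\rho}}X_f=\frac1\rho\frac{\partial}{\partial x^a}\left(\rho\,\mathfrak{S}^{ab}\frac{\partial f}{\partial x^b}\right)$. Densities of weight $w$ are locally $s(x)(Dx)^w$ (transforming by the $w$-th power of the Berezinian); given a non-degenerate $\boldsymbol{\rho}$, they all have the form $\boldsymbol{s}=s\boldsymbol{\rho}^w$ with $s$ a function. Half-densities are densities of weight $1/2$. The Lie derivative on densities is $\mathcal{L}_X(s\boldsymbol{\rho}^w)=\bigl(Xs+(-1)^{\tilde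 X\tilde s}\,s\,w\,\mathrm{div}_{\boldsymbol{\rho}}X\bigr)\boldsymbol{\rho}^w$. $[\Delta,f]$ is the supercommutator of $\Delta$ with the operator of multiplication by $f$; for odd $\Delta$, $[\Delta,f]=\Delta\circ f-(-1)^{\tilde f}f\circ\Delta$.
   Formalization: The "if and only if w = 1/2" is stated for a nonzero odd Poisson structure; for the zero structure every Hamiltonian vector field vanishes and Δ = 0 satisfies the equation at every weight. Existence at w = 1/2, uniqueness and the formula are stated without this assumption. *)

theory Defs
  imports
    "HOL-Analysis.Analysis"
    "HOL-Combinatorics.Permutations"
    "HOL-Library.Function_Algebras"
begin

section \<open>Grassmann algebra\<close>

text \<open>
  An element is the formal sum of \<open>c I\<close> times the monomial
  \<open>\<xi>\<^bsub>i1\<^esub> \<dots> \<xi>\<^bsub>ik\<^esub>\<close> over finite sets \<open>I = {i1 < \<dots> < ik}\<close>. The algebra on the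
  generators \<open>\<xi>\<^sub>0, \<dots>, \<xi>\<^bsub>q-1\<^esub>\<close> is \<open>Grassmann q\<close> below; sums with infinitely many nonzero
  coefficients are in the type only to make it a ring uniformly in \<open>q\<close>.
\<close>

typedef grassmann = "{c :: nat set \<Rightarrow> real. \<forall>I. infinite I \<longrightarrow> c I = 0}"
  morphisms gr_coeff Abs_grassmann
  by (rule exI[of _ "\<lambda>_. 0"]) auto

setup_lifting type_definition_grassmann

text \<open>Sign of the permutation sorting the concatenation of the monomials \<open>I\<close> and \<open>J\<close>.\<close>

definition gr_sign :: "nat set \<Rightarrow> nat set \<Rightarrow> real" where
  "gr_sign I J = (-1) ^ card {(i, j). i \<in> I \<and> j \<in> J \<and> j < i}"

lemma gr_sign_empty [simp]: "gr_sign {} J = 1" "gr_sign I {} = 1"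
  by (simp_all add: gr_sign_def)

lemma gr_sign_Un_left:
  assumes "finite I" "finite J" "finite L" "I \<inter> J = {}"
  shows "gr_sign (I \<union> J) L = gr_sign I L * gr_sign J L"
proof -
  have "{(i, j). i \<in> I \<union> J \<and> j \<in> L \<and> j < i}
      = {(i, j). i \<in> I \<and> j \<in> L \<and> j < i} \<union> {(i, j). i \<in> J \<and> j \<in> L \<and> j < i}" by auto
  moreover have "finite {(i, j). i \<in> I \<and> j \<in> L \<and> j < i}" "finite {(i, j). i \<in> J \<and> j \<in> L \<and> j < i}"
    using assms by (auto intro: finite_subset[of _ "I \<times> L"] finite_subset[of _ "J \<times> L"])
  moreover have "{(i, j). i \<in> I \<and> j \<in> L \<and> j < i} \<inter> {(i, j). i \<in> J \<and> j \<in> L \<and> j < i} = {}"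
    using assms by auto
  ultimately show ?thesis by (simp add: gr_sign_def card_Un_disjoint power_add)
qed

lemma gr_sign_Un_right:
  assumes "finite I" "finite J" "finite L" "I \<inter> J = {}"
  shows "gr_sign L (I \<union> J) = gr_sign L I * gr_sign L J"
proof -
  have "{(i, j). i \<in> L \<and> j \<in> I \<union> J \<and> j < i}
      = {(i, j). i \<in> L \<and> j \<in> I \<and> j < i} \<union> {(i, j). i \<in> L \<and> j \<in> J \<and> j < i}" by auto
  moreover have "finite {(i, j). i \<in> L \<and> j \<in> I \<and> j < i}" "finite {(i, j). i \<in> L \<and> j \<in> J \<and> j < i}"
    using assms by (auto intro: finite_subset[of _ "L \<times> I"] finite_subset[of _ "L \<times> J"])
  moreover have "{(i, j). i \<in> L \<and> j \<in> I \<and> j < i} \<inter> {(i, j). i \<in> L \<and> j \<in> J \<and> j < i} = {}"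
    using assms by auto
  ultimately show ?thesis by (simp add: gr_sign_def card_Un_disjoint power_add)
qed

instantiation grassmann :: real_algebra_1
begin

lift_definition zero_grassmann :: grassmann is "\<lambda>_. 0" by simp

lift_definition one_grassmann :: grassmann is "\<lambda>I. if I = {} then 1 else 0" by auto

lift_definition plus_grassmann :: "grassmann \<Rightarrow> grassmann \<Rightarrow> grassmann" is
  "\<lambda>x y I. x I + y I" by simp

lift_definition minus_grassmann :: "grassmann \<Rightarrow> grassmann \<Rightarrow> grassmann" is
  "\<lambda>x y I. x I - y I" by simp

lift_definition uminus_grassmann :: "grassmann \<Rightarrow> grassmann" is
  "\<lambda>x I. - x I" by simp

lift_definition scaleR_grassmann :: "real \<Rightarrow> grassmann \<Rightarrow> grassmann" is
  "\<lambda>r x I. r * x I" by simp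

lift_definition times_grassmann :: "grassmann \<Rightarrow> grassmann \<Rightarrow> grassmann" is
  "\<lambda>x y K. \<Sum>I\<in>Pow K. gr_sign I (K - I) * x I * y (K - I)" by simp

instance
proof
  fix a b c :: grassmann and r s :: real
  show "a + b + c = a + (b + c)" by transfer (simp add: add.assoc)
  show "a + b = b + a" by transfer (simp add: add.commute)
  show "0 + a = a" by transfer simp
  show "- a + a = 0" by transfer simp
  show "a - b = a + - b" by transfer simp
  show "r *\<^sub>R (a + b) = r *\<^sub>R a + r *\<^sub>R b" by transfer (simp add: algebra_simps)
  show "(r + s) *\<^sub>R a = r *\<^sub>R a + s *\<^sub>R a" by transfer (simp add: algebra_simps)
  show "r *\<^sub>R s *\<^sub>R a = (r * s) *\<^sub>R a" by transfer (simp add: mult.assoc)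
  show "1 *\<^sub>R a = a" by transfer simp
  show "(a + b) * c = a * c + b * c"
    by transfer (simp add: algebra_simps sum.distrib fun_eq_iff)
  show "a * (b + c) = a * b + a * c"
    by transfer (simp add: algebra_simps sum.distrib fun_eq_iff)
  show "r *\<^sub>R a * b = r *\<^sub>R (a * b)"
    by transfer (simp add: sum_distrib_left mult_ac fun_eq_iff)
  show "a * r *\<^sub>R b = r *\<^sub>R (a * b)"
    by transfer (simp add: sum_distrib_left mult_ac fun_eq_iff)
  show "(0::grassmann) \<noteq> 1"
    by transfer (auto simp: fun_eq_iff)
  show "1 * a = a"
  proof transfer
    fix x :: "nat set \<Rightarrow> real" assume x: "\<forall>I. infinite I \<longrightarrow> x I = 0"
    show "(\<lambda>K. \<Sum>I\<in>Pow K. gr_sign I (K - I) * (if I = {} then 1 else 0) * x (K - I)) = x"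
    proof
      fix K
      show "(\<Sum>I\<in>Pow K. gr_sign I (K - I) * (if I = {} then 1 else 0) * x (K - I)) = x K"
      proof (cases "finite K")
        case True
        have "(\<Sum>I\<in>Pow K. gr_sign I (K - I) * (if I = {} then 1 else 0) * x (K - I))
            = (\<Sum>I\<in>Pow K. if I = {} then x K else 0)"
          by (intro sum.cong) auto
        then show ?thesis using True by (simp add: sum.delta)
      qed (use x in simp)
    qed
  qed
  show "a * 1 = a"
  proof transfer
    fix x :: "nat set \<Rightarrow> real" assume x: "\<forall>I. infinite I \<longrightarrow> x I = 0"
    show "(\<lambda>K. \<Sum>I\<in>Pow K. gr_sign I (K - I) * x I * (if K - I = {} then 1 else 0)) = x"
    proof
      fix K
      show "(\<Sum>I\<in>Pow K. gr_sign I (K - I) * x I * (if K - I = {} then 1 else 0)) = x K"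
      proof (cases "finite K")
        case True
        have "(\<Sum>I\<in>Pow K. gr_sign I (K - I) * x I * (if K - I = {} then 1 else 0))
            = (\<Sum>I\<in>Pow K. if I = K then x K else 0)"
          by (intro sum.cong) auto
        then show ?thesis using True by (simp add: sum.delta)
      qed (use x in simp)
    qed
  qed
  show "a * b * c = a * (b * c)"
  proof transfer
    fix x y z :: "nat set \<Rightarrow> real"
    show "(\<lambda>K. \<Sum>A\<in>Pow K. gr_sign A (K - A) *
              (\<Sum>I\<in>Pow A. gr_sign I (A - I) * x I * y (A - I)) * z (K - A))
        = (\<lambda>K. \<Sum>I\<in>Pow K. gr_sign I (K - I) * x I *
              (\<Sum>J\<in>Pow (K - I). gr_sign J (K - I - J) * y J * z (K - I - J)))"
    proof
      fix K :: "nat set"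
      show "(\<Sum>A\<in>Pow K. gr_sign A (K - A) *
              (\<Sum>I\<in>Pow A. gr_sign I (A - I) * x I * y (A - I)) * z (K - A))
        = (\<Sum>I\<in>Pow K. gr_sign I (K - I) * x I *
              (\<Sum>J\<in>Pow (K - I). gr_sign J (K - I - J) * y J * z (K - I - J)))"
      proof (cases "finite K")
        case True
        have fin: "finite (Pow A)" if "A \<subseteq> K" for A
          using finite_subset[OF that True] by simp
        let ?F = "\<lambda>I J. gr_sign I J * gr_sign I (K - I - J) * gr_sign J (K - I - J)
                          * x I * y J * z (K - I - J)"
        have "(\<Sum>A\<in>Pow K. gr_sign A (K - A) *
              (\<Sum>I\<in>Pow A. gr_sign I (A - I) * x I * y (A - I)) * z (K - A))
            = (\<Sum>A\<in>Pow K. \<Sum>I\<in>Pow A. ?F I (A - I))"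
        proof (rule sum.cong[OF refl])
          fix A assume A: "A \<in> Pow K"
          have "gr_sign A (K - A) * (gr_sign I (A - I) * x I * y (A - I)) * z (K - A)
              = ?F I (A - I)" if "I \<in> Pow A" for I
          proof -
            have I: "I \<union> (A - I) = A" "K - I - (A - I) = K - A" using that A by auto
            have "gr_sign A (K - A) = gr_sign I (K - A) * gr_sign (A - I) (K - A)"
              using gr_sign_Un_left[of I "A - I" "K - A"] that A True I
              by (auto dest: finite_subset)
            then show ?thesis by (simp add: I mult_ac)
          qed
          then show "gr_sign A (K - A) *
              (\<Sum>I\<in>Pow A. gr_sign I (A - I) * x I * y (A - I)) * z (K - A)
            = (\<Sum>I\<in>Pow A. ?F I (A - I))"
            unfolding sum_distrib_left sum_distrib_right by (intro sum.cong refl)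
        qed
        also have "\<dots> = (\<Sum>(A, I)\<in>Sigma (Pow K) Pow. ?F I (A - I))"
          using True fin by (subst sum.Sigma) auto
        also have "\<dots> = (\<Sum>(I, J)\<in>Sigma (Pow K) (\<lambda>I. Pow (K - I)). ?F I J)"
          by (rule sum.reindex_bij_witness[where
                i = "\<lambda>(I, J). (I \<union> J, I)" and j = "\<lambda>(A, I). (I, A - I)"]) auto
        also have "\<dots> = (\<Sum>I\<in>Pow K. \<Sum>J\<in>Pow (K - I). ?F I J)"
          using True by (subst sum.Sigma) auto
        also have "\<dots> = (\<Sum>I\<in>Pow K. gr_sign I (K - I) * x I *
              (\<Sum>J\<in>Pow (K - I). gr_sign J (K - I - J) * y J * z (K - I - J)))"
        proof (rule sum.cong[OF refl])
          fix I assume I: "I \<in> Pow K"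
          have "gr_sign I (K - I) * x I * (gr_sign J (K - I - J) * y J * z (K - I - J)) = ?F I J"
            if "J \<in> Pow (K - I)" for J
          proof -
            have J: "J \<union> (K - I - J) = K - I" using that by auto
            have "finite J" using that True by (auto dest: finite_subset)
            then have "gr_sign I (K - I) = gr_sign I J * gr_sign I (K - I - J)"
              using gr_sign_Un_right[of J "K - I - J" I] I True J
              by (auto dest: finite_subset)
            then show ?thesis by (simp add: mult_ac)
          qed
          then show "(\<Sum>J\<in>Pow (K - I). ?F I J) = gr_sign I (K - I) * x I *
              (\<Sum>J\<in>Pow (K - I). gr_sign J (K - I - J) * y J * z (K - I - J))"
            unfolding sum_distrib_left by (intro sum.cong refl) (simp only:)
        qed
        finally show ?thesis .
      qed simp
    qed
  qed
qed

end

definition Grassmann :: "nat \<Rightarrow> grassmann set" where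
  "Grassmann q = {x. \<forall>I. gr_coeff x I \<noteq> 0 \<longrightarrow> I \<subseteq> {..<q}}"

lift_definition gr_gen :: "nat \<Rightarrow> grassmann" is
  "\<lambda>j I. if I = {j} then 1 else 0" by auto

definition gr_body :: "grassmann \<Rightarrow> real" where
  "gr_body x = gr_coeff x {}"

text \<open>Parities are natural numbers, read modulo 2.\<close>

definition gr_homogeneous :: "nat \<Rightarrow> grassmann \<Rightarrow> bool" where
  "gr_homogeneous e x \<longleftrightarrow> (\<forall>I. gr_coeff x I \<noteq> 0 \<longrightarrow> card I mod 2 = e mod 2)"

lift_definition gr_part :: "nat \<Rightarrow> grassmann \<Rightarrow> grassmann" is
  "\<lambda>e x I. if card I mod 2 = e mod 2 then x I else 0" by auto

text \<open>Left derivative with respect to the generator \<open>\<xi>\<^sub>j\<close>.\<close>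

lift_definition gr_deriv :: "nat \<Rightarrow> grassmann \<Rightarrow> grassmann" is
  "\<lambda>j x I. if j \<in> I then 0 else (-1) ^ card {i \<in> I. i < j} * x (insert j I)" by auto

definition gr_inverse :: "grassmann \<Rightarrow> grassmann" where
  "gr_inverse x = (THE y. x * y = 1 \<and> y * x = 1)"

text \<open>
  Real power of an even element of \<open>Grassmann q\<close> with positive body: the binomial series in the
  nilpotent part, whose powers of exponent greater than \<open>q\<close> vanish.
\<close>

definition gr_powr :: "nat \<Rightarrow> grassmann \<Rightarrow> real \<Rightarrow> grassmann" where
  "gr_powr q x w =
     (\<Sum>k\<le>q. ((w gchoose k) * gr_body x powr (w - real k)) *\<^sub>R (x - of_real (gr_body x)) ^ k)"

text \<open>
  Matrices are functions of two indices. The determinant is only applied to matrices of even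
  (hence commuting) entries, so that the order of the factors is immaterial.
\<close>

definition gr_det :: "nat \<Rightarrow> (nat \<Rightarrow> nat \<Rightarrow> grassmann) \<Rightarrow> grassmann" where
  "gr_det n A =
     (\<Sum>\<pi> | \<pi> permutes {..<n}. of_int (sign \<pi>) * prod_list (map (\<lambda>i. A i (\<pi> i)) [0..<n]))"

definition gr_mat_inverse :: "nat \<Rightarrow> (nat \<Rightarrow> nat \<Rightarrow> grassmann) \<Rightarrow> nat \<Rightarrow> nat \<Rightarrow> grassmann" where
  "gr_mat_inverse n A = (THE B.
     (\<forall>i j. i \<ge> n \<or> j \<ge> n \<longrightarrow> B i j = 0) \<and>
     (\<forall>i<n. \<forall>j<n. (\<Sum>k<n. A i k * B k j) = of_bool (i = j)
                \<and> (\<Sum>k<n. B i k * A k j) = of_bool (i = j)))"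

text \<open>
  \<open>Ber J = det (A - B D\<^sup>-\<^sup>1 C) / det D\<close> for the even matrix \<open>J\<close> with blocks \<open>A, B\<close> (upper)
  and \<open>C, D\<close> (lower) of format \<open>p|q\<close>.
\<close>

definition Berezinian :: "nat \<Rightarrow> nat \<Rightarrow> (nat \<Rightarrow> nat \<Rightarrow> grassmann) \<Rightarrow> grassmann" where
  "Berezinian p q J =
     (let D = (\<lambda>k l. J (p + k) (p + l)); E = gr_mat_inverse q D in
      gr_det p (\<lambda>a b. J a b - (\<Sum>k<q. \<Sum>l<q. J a (p + k) * E k l * J (p + l) b))
        * gr_inverse (gr_det q D))"

section \<open>Superdomains\<close>

definition partial :: "nat \<Rightarrow> ((nat \<Rightarrow> real) \<Rightarrow> real) \<Rightarrow> (nat \<Rightarrow> real) \<Rightarrow> real" where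
  "partial i f x = deriv (\<lambda>t. f (x(i := t))) (x i)"

text \<open>All iterated partial derivatives exist and are continuous on the open set \<open>V\<close>.\<close>

definition smooth_fun :: "nat \<Rightarrow> (nat \<Rightarrow> real) set \<Rightarrow> ((nat \<Rightarrow> real) \<Rightarrow> real) \<Rightarrow> bool" where
  "smooth_fun p V f \<longleftrightarrow>
     (\<forall>is. set is \<subseteq> {..<p} \<longrightarrow>
        continuous_map (subtopology (Euclidean_space p) V) euclideanreal (foldr partial is f) \<and>
        (\<forall>i<p. \<forall>x\<in>V. (\<lambda>t. foldr partial is f (x(i := t))) field_differentiable at (x i)))"

text \<open>
  A superfunction of \<open>p|q\<close> variables is a Grassmann-valued function of the even coordinates, and
  the pointwise ring operations on functions are the operations on superfunctions. The elements
  of \<open>superfuns p q V\<close> vanish outside \<open>V\<close>, so that equal sections over \<open>V\<close> are equal functions;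
  the unit of this algebra is \<open>const_on V 1\<close>.
\<close>

type_synonym sfun = "(nat \<Rightarrow> real) \<Rightarrow> grassmann"

definition superfuns :: "nat \<Rightarrow> nat \<Rightarrow> (nat \<Rightarrow> real) set \<Rightarrow> sfun set" where
  "superfuns p q V = {f. (\<forall>x. x \<notin> V \<longrightarrow> f x = 0) \<and> (\<forall>x\<in>V. f x \<in> Grassmann q) \<and>
                         (\<forall>I. smooth_fun p V (\<lambda>x. gr_coeff (f x) I))}"

definition restr :: "(nat \<Rightarrow> real) set \<Rightarrow> sfun \<Rightarrow> sfun" where
  "restr V f = (\<lambda>x. if x \<in> V then f x else 0)"

definition const_on :: "(nat \<Rightarrow> real) set \<Rightarrow> grassmann \<Rightarrow> sfun" where
  "const_on V c = restr V (\<lambda>_. c)"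

definition smul :: "real \<Rightarrow> sfun \<Rightarrow> sfun" where
  "smul r f = (\<lambda>x. r *\<^sub>R f x)"

definition homogeneous :: "nat \<Rightarrow> sfun \<Rightarrow> bool" where
  "homogeneous e f \<longleftrightarrow> (\<forall>x. gr_homogeneous e (f x))"

text \<open>
  The coordinates of a \<open>p|q\<close>-dimensional superdomain are indexed by \<open>a < p + q\<close>, the even ones
  being those with \<open>a < p\<close>.
\<close>

definition cpar :: "nat \<Rightarrow> nat \<Rightarrow> nat" where
  "cpar p a = (if a < p then 0 else 1)"

definition coord :: "nat \<Rightarrow> (nat \<Rightarrow> real) set \<Rightarrow> nat \<Rightarrow> sfun" where
  "coord p V a = restr V (\<lambda>x. if a < p then of_real (x a) else gr_gen (a - p))"

lift_definition gr_partial :: "nat \<Rightarrow> sfun \<Rightarrow> (nat \<Rightarrow> real) \<Rightarrow> grassmann" is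
  "\<lambda>a f x I. partial a (\<lambda>y. f y I) x" by (simp add: partial_def)

text \<open>The left derivative with respect to the \<open>a\<close>-th coordinate.\<close>

definition pd :: "nat \<Rightarrow> (nat \<Rightarrow> real) set \<Rightarrow> nat \<Rightarrow> sfun \<Rightarrow> sfun" where
  "pd p V a f = restr V (if a < p then gr_partial a f else (\<lambda>x. gr_deriv (a - p) (f x)))"

section \<open>Supermanifolds\<close>

text \<open>
  A supermanifold is given by an atlas. The chart \<open>i\<close> identifies the open set \<open>chart_dom i\<close> of
  the underlying space with an open subset of \<open>R\<^sup>p\<close> through \<open>chart_map i\<close>. For open \<open>W\<close> in the
  overlap of two charts, \<open>transition i j W\<close> rewrites superfunctions on \<open>W\<close> from the \<open>j\<close>-th
  coordinates to the \<open>i\<close>-th ones. These maps are the gluing isomorphisms of sheaves of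
  superalgebras; compatibility with the underlying maps of points is then automatic.
\<close>

record ('x, 'i) supermfd =
  base :: "'x topology"
  evdim :: nat
  odim :: nat
  charts :: "'i set"
  chart_dom :: "'i \<Rightarrow> 'x set"
  chart_map :: "'i \<Rightarrow> 'x \<Rightarrow> nat \<Rightarrow> real"
  transition :: "'i \<Rightarrow> 'i \<Rightarrow> 'x set \<Rightarrow> sfun \<Rightarrow> sfun"

definition img :: "('x, 'i) supermfd \<Rightarrow> 'i \<Rightarrow> 'x set \<Rightarrow> (nat \<Rightarrow> real) set" where
  "img M i W = chart_map M i ` W"

definition vdom :: "('x, 'i) supermfd \<Rightarrow> 'i \<Rightarrow> (nat \<Rightarrow> real) set" where
  "vdom M i = img M i (chart_dom M i)"

definition overlap :: "('x, 'i) supermfd \<Rightarrow> 'i \<Rightarrow> 'i \<Rightarrow> 'x set" where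
  "overlap M i j = chart_dom M i \<inter> chart_dom M j"

definition sfuns :: "('x, 'i) supermfd \<Rightarrow> 'i \<Rightarrow> 'x set \<Rightarrow> sfun set" where
  "sfuns M i W = superfuns (evdim M) (odim M) (img M i W)"

definition supermanifold :: "('x, 'i) supermfd \<Rightarrow> bool" where
  "supermanifold M \<longleftrightarrow>
     Hausdorff_space (base M) \<and> second_countable (base M) \<and>
     (\<Union>i\<in>charts M. chart_dom M i) = topspace (base M) \<and>
     (\<forall>i\<in>charts M.
        openin (base M) (chart_dom M i) \<and>
        openin (Euclidean_space (evdim M)) (vdom M i) \<and>
        homeomorphic_map (subtopology (base M) (chart_dom M i))
          (subtopology (Euclidean_space (evdim M)) (vdom M i)) (chart_map M i)) \<and>
     (\<forall>i\<in>charts M. \<forall>j\<in>charts M. \<forall>W. openin (base M) W \<and> W \<subseteq> overlap M i j \<longrightarrow>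
        (\<forall>f\<in>sfuns M j W. transition M i j W f \<in> sfuns M i W) \<and>
        transition M i j W (const_on (img M j W) 1) = const_on (img M i W) 1 \<and>
        (\<forall>f\<in>sfuns M j W. \<forall>g\<in>sfuns M j W.
           transition M i j W (f + g) = transition M i j W f + transition M i j W g \<and>
           transition M i j W (f * g) = transition M i j W f * transition M i j W g) \<and>
        (\<forall>f\<in>sfuns M j W. \<forall>r. transition M i j W (smul r f) = smul r (transition M i j W f)) \<and>
        (\<forall>f\<in>sfuns M j W. \<forall>e. homogeneous e f \<longrightarrow> homogeneous e (transition M i j W f)) \<and>
        (\<forall>W'. openin (base M) W' \<and> W' \<subseteq> W \<longrightarrow>
           (\<forall>f\<in>sfuns M j W. transition M i j W' (restr (img M j W') f)
                              = restr (img M i W') (transition M i j W f)))) \<and>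
     (\<forall>i\<in>charts M. \<forall>W. openin (base M) W \<and> W \<subseteq> chart_dom M i \<longrightarrow>
        (\<forall>f\<in>sfuns M i W. transition M i i W f = f)) \<and>
     (\<forall>i\<in>charts M. \<forall>j\<in>charts M. \<forall>k\<in>charts M. \<forall>W.
        openin (base M) W \<and> W \<subseteq> chart_dom M i \<inter> chart_dom M j \<inter> chart_dom M k \<longrightarrow>
        (\<forall>f\<in>sfuns M k W. transition M i j W (transition M j k W f) = transition M i k W f))"

definition cdim :: "('x, 'i) supermfd \<Rightarrow> nat" where
  "cdim M = evdim M + odim M"

abbreviation par :: "('x, 'i) supermfd \<Rightarrow> nat \<Rightarrow> nat" where
  "par M a \<equiv> cpar (evdim M) a"

text \<open>\<open>\<partial>/\<partial>x\<^sup>a\<close> in the \<open>i\<close>-th chart.\<close>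

abbreviation dx :: "('x, 'i) supermfd \<Rightarrow> 'i \<Rightarrow> nat \<Rightarrow> sfun \<Rightarrow> sfun" where
  "dx M i \<equiv> pd (evdim M) (vdom M i)"

text \<open>On the overlap, the \<open>j\<close>-th chart expression rewritten in the coordinates of the \<open>i\<close>-th.\<close>

definition change :: "('x, 'i) supermfd \<Rightarrow> 'i \<Rightarrow> 'i \<Rightarrow> sfun \<Rightarrow> sfun" where
  "change M i j f = transition M i j (overlap M i j) (restr (img M j (overlap M i j)) f)"

text \<open>\<open>\<partial>x\<^sub>j\<^sup>b/\<partial>x\<^sub>i\<^sup>a\<close>, row \<open>a\<close> and column \<open>b\<close>, as superfunctions of \<open>x\<^sub>i\<close>.\<close>

definition jacobian :: "('x, 'i) supermfd \<Rightarrow> 'i \<Rightarrow> 'i \<Rightarrow> nat \<Rightarrow> nat \<Rightarrow> sfun" where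
  "jacobian M i j a b =
     pd (evdim M) (img M i (overlap M i j)) a (change M i j (coord (evdim M) (vdom M j) b))"

text \<open>\<open>Dx\<^sub>j = ber M i j Dx\<^sub>i\<close>\<close>

definition ber :: "('x, 'i) supermfd \<Rightarrow> 'i \<Rightarrow> 'i \<Rightarrow> sfun" where
  "ber M i j = (\<lambda>x. Berezinian (evdim M) (odim M) (\<lambda>a b. jacobian M i j a b x))"

definition oriented :: "('x, 'i) supermfd \<Rightarrow> bool" where
  "oriented M \<longleftrightarrow>
     (\<forall>i\<in>charts M. \<forall>j\<in>charts M. \<forall>x\<in>img M i (overlap M i j). gr_body (ber M i j x) > 0)"

section \<open>Functions and densities\<close>

text \<open>
  Global objects are families of local coefficients indexed by the charts, equal to \<open>0\<close> for
  indices that are not in the atlas. The ring operations on families are again pointwise, so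
  \<open>f * s\<close> is the product of a function and a density.
\<close>

type_synonym 'i fam = "'i \<Rightarrow> sfun"

definition local_family :: "('x, 'i) supermfd \<Rightarrow> 'i fam \<Rightarrow> bool" where
  "local_family M s \<longleftrightarrow> (\<forall>i\<in>charts M. s i \<in> sfuns M i (chart_dom M i)) \<and> (\<forall>i. i \<notin> charts M \<longrightarrow> s i = 0)"

definition smooth_functions :: "('x, 'i) supermfd \<Rightarrow> 'i fam set" where
  "smooth_functions M = {f. local_family M f \<and>
     (\<forall>i\<in>charts M. \<forall>j\<in>charts M. restr (img M i (overlap M i j)) (f i) = change M i j (f j))}"

text \<open>The family \<open>s\<close> stands for \<open>s\<^sub>i (Dx\<^sub>i)\<^sup>w\<close>.\<close>

definition densities :: "('x, 'i) supermfd \<Rightarrow> real \<Rightarrow> 'i fam set" where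
  "densities M w = {s. local_family M s \<and>
     (\<forall>i\<in>charts M. \<forall>j\<in>charts M. restr (img M i (overlap M i j)) (s i)
        = (\<lambda>x. gr_powr (odim M) (ber M i j x) w) * change M i j (s j))}"

definition nondegenerate_volume :: "('x, 'i) supermfd \<Rightarrow> 'i fam \<Rightarrow> bool" where
  "nondegenerate_volume M \<rho> \<longleftrightarrow> \<rho> \<in> densities M 1 \<and>
     (\<forall>i\<in>charts M. homogeneous 0 (\<rho> i) \<and> (\<forall>x\<in>vdom M i. gr_body (\<rho> i x) > 0))"

definition vol_powr :: "('x, 'i) supermfd \<Rightarrow> 'i fam \<Rightarrow> real \<Rightarrow> 'i fam" where
  "vol_powr M \<rho> w = (\<lambda>i x. gr_powr (odim M) (\<rho> i x) w)"

definition fam_homogeneous :: "nat \<Rightarrow> 'i fam \<Rightarrow> bool" where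
  "fam_homogeneous e s \<longleftrightarrow> (\<forall>i. homogeneous e (s i))"

definition fam_part :: "nat \<Rightarrow> 'i fam \<Rightarrow> 'i fam" where
  "fam_part e s = (\<lambda>i x. gr_part e (s i x))"

section \<open>Odd Poisson structures\<close>

text \<open>
  The cotangent bundle of a superdomain of dimension \<open>p|q\<close> is a superdomain of dimension
  \<open>2p|2q\<close>, with even coordinates \<open>x\<^sup>0, \<dots>, x\<^bsup>p-1\<^esup>, p\<^sub>0, \<dots>, p\<^bsub>p-1\<^esub>\<close> followed by the odd
  coordinates and then their momenta. The functions \<open>ct_x\<close> and \<open>ct_p\<close> give the positions of
  \<open>x\<^sup>a\<close> and \<open>p\<^sub>a\<close>, and \<open>ct_pull\<close> is the pullback along the projection to the base.
\<close>

definition ct_x :: "nat \<Rightarrow> nat \<Rightarrow> nat" where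
  "ct_x p a = (if a < p then a else p + a)"

definition ct_p :: "nat \<Rightarrow> nat \<Rightarrow> nat \<Rightarrow> nat" where
  "ct_p p q a = (if a < p then p + a else p + q + a)"

definition ct_proj :: "nat \<Rightarrow> (nat \<Rightarrow> real) \<Rightarrow> nat \<Rightarrow> real" where
  "ct_proj p z = (\<lambda>k. if k < p then z k else 0)"

definition ct_dom :: "nat \<Rightarrow> (nat \<Rightarrow> real) set \<Rightarrow> (nat \<Rightarrow> real) set" where
  "ct_dom p V = {z. (\<forall>k\<ge>2 * p. z k = 0) \<and> ct_proj p z \<in> V}"

definition ct_pull :: "nat \<Rightarrow> (nat \<Rightarrow> real) set \<Rightarrow> sfun \<Rightarrow> sfun" where
  "ct_pull p V f = restr (ct_dom p V) (f \<circ> ct_proj p)"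

text \<open>
  The canonical even Poisson bracket \<open>(F, G)\<close> for \<open>F\<close> of parity \<open>e\<close>, normalised by
  \<open>(p\<^sub>a, x\<^sup>b) = \<delta>\<^sub>a\<^sup>b\<close>. With this sign convention, \<open>(f, (S, g))\<close> is the odd bracket
  \<open>-(-1)\<^bsup>f(a+1)\<^esup> S\<^sup>a\<^sup>b \<partial>\<^sub>b f \<partial>\<^sub>a g\<close>.
\<close>

definition canonical_bracket ::
    "nat \<Rightarrow> nat \<Rightarrow> (nat \<Rightarrow> real) set \<Rightarrow> nat \<Rightarrow> sfun \<Rightarrow> sfun \<Rightarrow> sfun" where
  "canonical_bracket p q V e F G =
     (let d = pd (2 * p) (ct_dom p V) in
      \<Sum>a<p + q. (-1) ^ (cpar p a * (e + 1)) * d (ct_p p q a) F * d (ct_x p a) G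
                - (-1) ^ (cpar p a * e) * d (ct_x p a) F * d (ct_p p q a) G)"

text \<open>\<open>1/2 S\<^sup>a\<^sup>b p\<^sub>b p\<^sub>a\<close>\<close>

definition quadratic_hamiltonian ::
    "nat \<Rightarrow> nat \<Rightarrow> (nat \<Rightarrow> real) set \<Rightarrow> (nat \<Rightarrow> nat \<Rightarrow> sfun) \<Rightarrow> sfun" where
  "quadratic_hamiltonian p q V S =
     (let P = (\<lambda>a. coord (2 * p) (ct_dom p V) (ct_p p q a)) in
      smul (1 / 2) (\<Sum>a<p + q. \<Sum>b<p + q. ct_pull p V (S a b) * P b * P a))"

text \<open>
  \<open>S i a b\<close> is the component \<open>S\<^sup>a\<^sup>b\<close> in the \<open>i\<close>-th chart. The transformation law says that
  \<open>1/2 S\<^sup>a\<^sup>b p\<^sub>b p\<^sub>a\<close> is a well-defined function on the cotangent bundle, the momenta transforming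
  as \<open>p\<^sub>a = (\<partial>x\<^sub>j\<^sup>c/\<partial>x\<^sub>i\<^sup>a) p'\<^sub>c\<close>; the sign comes from moving \<open>\<partial>x\<^sub>j\<^sup>c/\<partial>x\<^sub>i\<^sup>a\<close> past \<open>p'\<^sub>d\<close>.
\<close>

definition odd_poisson :: "('x, 'i) supermfd \<Rightarrow> ('i \<Rightarrow> nat \<Rightarrow> nat \<Rightarrow> sfun) \<Rightarrow> bool" where
  "odd_poisson M S \<longleftrightarrow>
     (\<forall>i\<in>charts M. \<forall>a<cdim M. \<forall>b<cdim M.
        S i a b \<in> sfuns M i (chart_dom M i) \<and>
        homogeneous (par M a + par M b + 1) (S i a b) \<and>
        S i a b = (-1) ^ (par M a * par M b) * S i b a) \<and>
     (\<forall>i\<in>charts M. \<forall>j\<in>charts M. \<forall>c<cdim M. \<forall>d<cdim M.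
        change M i j (S j c d) =
          (\<Sum>a<cdim M. \<Sum>b<cdim M. (-1) ^ (par M d * (par M a + par M c)) *
             S i a b * jacobian M i j b d * jacobian M i j a c)) \<and>
     (\<forall>i\<in>charts M.
        (let H = quadratic_hamiltonian (evdim M) (odim M) (vdom M i) (S i) in
         canonical_bracket (evdim M) (odim M) (vdom M i) 1 H H = 0))"

definition nonzero_structure :: "('x, 'i) supermfd \<Rightarrow> ('i \<Rightarrow> nat \<Rightarrow> nat \<Rightarrow> sfun) \<Rightarrow> bool" where
  "nonzero_structure M S \<longleftrightarrow> (\<exists>i\<in>charts M. \<exists>a<cdim M. \<exists>b<cdim M. S i a b \<noteq> 0)"

text \<open>Component \<open>a\<close> of \<open>X\<^sub>f\<close> in the \<open>i\<close>-th chart, for \<open>f\<close> of parity \<open>e\<close>; \<open>X\<^sub>f\<close> has parity \<open>e + 1\<close>.\<close>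

definition ham_field ::
    "('x, 'i) supermfd \<Rightarrow> ('i \<Rightarrow> nat \<Rightarrow> nat \<Rightarrow> sfun) \<Rightarrow> nat \<Rightarrow> 'i fam \<Rightarrow> 'i \<Rightarrow> nat \<Rightarrow> sfun" where
  "ham_field M S e f i a = (-1) ^ (par M a * e) * (\<Sum>b<cdim M. S i a b * dx M i b (f i))"

text \<open>Divergence in the \<open>i\<close>-th chart of a field of parity \<open>e\<close> with respect to \<open>r Dx\<^sub>i\<close>.\<close>

definition divergence ::
    "('x, 'i) supermfd \<Rightarrow> 'i \<Rightarrow> sfun \<Rightarrow> nat \<Rightarrow> (nat \<Rightarrow> sfun) \<Rightarrow> sfun" where
  "divergence M i r e X =
     (\<lambda>x. gr_inverse (r x)) * (\<Sum>a<cdim M. (-1) ^ (par M a * (e + 1)) * dx M i a (r * X a))"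

text \<open>
  Lie derivative of a density of weight \<open>w\<close> along a field of parity \<open>e\<close> in the \<open>i\<close>-th chart, with
  the coordinate volume element \<open>Dx\<^sub>i\<close> as the basis volume form. The divergence has the parity of
  the field, so writing it on the left absorbs the sign in
  \<open>X s + (-1)\<^bsup>X s\<^esup> s w div X\<close>.
\<close>

definition lie_density ::
    "('x, 'i) supermfd \<Rightarrow> 'i \<Rightarrow> real \<Rightarrow> nat \<Rightarrow> (nat \<Rightarrow> sfun) \<Rightarrow> sfun \<Rightarrow> sfun" where
  "lie_density M i w e X s =
     (\<Sum>a<cdim M. X a * dx M i a s)
       + smul w (divergence M i (const_on (vdom M i) 1) e X) * s"

text \<open>\<open>\<L>\<^sub>f\<close> on densities of weight \<open>w\<close>, for \<open>f\<close> of parity \<open>e\<close>.\<close>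

definition lie_ham ::
    "('x, 'i) supermfd \<Rightarrow> ('i \<Rightarrow> nat \<Rightarrow> nat \<Rightarrow> sfun) \<Rightarrow> real \<Rightarrow> nat \<Rightarrow> 'i fam \<Rightarrow> 'i fam \<Rightarrow> 'i fam" where
  "lie_ham M S w e f s =
     (\<lambda>i. if i \<in> charts M then lie_density M i w (e + 1) (ham_field M S e f i) (s i) else 0)"

text \<open>\<open>\<Delta>\<^sub>\<rho> f = div\<^sub>\<rho> X\<^sub>f\<close>, extended by linearity to inhomogeneous \<open>f\<close>.\<close>

definition odd_laplace ::
    "('x, 'i) supermfd \<Rightarrow> ('i \<Rightarrow> nat \<Rightarrow> nat \<Rightarrow> sfun) \<Rightarrow> 'i fam \<Rightarrow> 'i fam \<Rightarrow> 'i fam" where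
  "odd_laplace M S \<rho> f =
     (\<lambda>i. if i \<in> charts M
          then (\<Sum>e<2. divergence M i (\<rho> i) (e + 1) (ham_field M S e (fam_part e f) i))
          else 0)"

section \<open>Differential operators on densities\<close>

text \<open>
  Finite-order operators given in each chart by a sum of coefficients times iterated derivatives.
  Repeated and reordered multi-indices are harmless, since only existence of coefficients is asked.
\<close>

definition diff_operator :: "('x, 'i) supermfd \<Rightarrow> real \<Rightarrow> ('i fam \<Rightarrow> 'i fam) \<Rightarrow> bool" where
  "diff_operator M w \<Delta> \<longleftrightarrow>
     (\<forall>s\<in>densities M w. \<Delta> s \<in> densities M w) \<and>
     (\<exists>N. \<forall>i\<in>charts M. \<exists>c.
        (\<forall>as. c as \<in> sfuns M i (chart_dom M i)) \<and>
        (\<forall>s\<in>densities M w. \<Delta> s i =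
           (\<Sum>as | set as \<subseteq> {..<cdim M} \<and> length as \<le> N. c as * foldr (dx M i) as (s i))))"

definition op_part :: "nat \<Rightarrow> ('i fam \<Rightarrow> 'i fam) \<Rightarrow> 'i fam \<Rightarrow> 'i fam" where
  "op_part d \<Delta> s = (\<Sum>k<2. fam_part (k + d) (\<Delta> (fam_part k s)))"

definition odd_operator :: "('x, 'i) supermfd \<Rightarrow> real \<Rightarrow> ('i fam \<Rightarrow> 'i fam) \<Rightarrow> bool" where
  "odd_operator M w \<Delta> \<longleftrightarrow>
     (\<forall>e. \<forall>s\<in>densities M w. fam_homogeneous e s \<longrightarrow> fam_homogeneous (e + 1) (\<Delta> s))"

text \<open>
  \<open>[\<Delta>, f]\<close> for \<open>f\<close> of parity \<open>e\<close>, that is \<open>\<Delta> \<circ> f - (-1)\<^bsup>d e\<^esup> f \<circ> \<Delta>\<close> for \<open>\<Delta>\<close> of parity \<open>d\<close>,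
  extended by linearity to inhomogeneous \<open>\<Delta>\<close>.
\<close>

definition supercommutator :: "('i fam \<Rightarrow> 'i fam) \<Rightarrow> nat \<Rightarrow> 'i fam \<Rightarrow> 'i fam \<Rightarrow> 'i fam" where
  "supercommutator \<Delta> e f s =
     (\<Sum>d<2. op_part d \<Delta> (f * s) - (-1) ^ (d * e) * (f * op_part d \<Delta> s))"

text \<open>Solutions of \<open>[\<Delta>, f] = 2 \<L>\<^sub>f\<close> among differential operators on densities of weight \<open>w\<close>.\<close>

definition lie_solution ::
    "('x, 'i) supermfd \<Rightarrow> ('i \<Rightarrow> nat \<Rightarrow> nat \<Rightarrow> sfun) \<Rightarrow> real \<Rightarrow> ('i fam \<Rightarrow> 'i fam) \<Rightarrow> bool" where
  "lie_solution M S w \<Delta> \<longleftrightarrow> diff_operator M w \<Delta> \<and>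
     (\<forall>e<2. \<forall>f\<in>smooth_functions M. fam_homogeneous e f \<longrightarrow>
        (\<forall>s\<in>densities M w. supercommutator \<Delta> e f s = 2 * lie_ham M S w e f s))"

end

theory Submission
  imports Defs "Jordan_Normal_Form.Determinant"
begin

text \<open>
  The odd Laplacian is a second-order operator with
  \<open>\<Delta>\<^sub>\<rho> (f u) = (\<Delta>\<^sub>\<rho> f) u \<plusminus> f \<Delta>\<^sub>\<rho> u + 2 X\<^sub>f u\<close>, while
  \<open>\<L>\<^sub>f (u \<rho>\<^sup>w) = (X\<^sub>f u + w (\<Delta>\<^sub>\<rho> f) u) \<rho>\<^sup>w\<close>. For \<open>w = 1/2\<close> this says that
  \<open>u \<rho>\<^sup>w \<mapsto> (\<Delta>\<^sub>\<rho> u) \<rho>\<^sup>w\<close> is a solution. It is independent of the charts because the divergence is, which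
  comes down to the chain rule and to the logarithmic derivative of the Berezinian being a supertrace.
  The difference of two solutions supercommutes with functions, so it multiplies by its value
  on \<open>\<rho>\<^sup>w\<close>. In weight \<open>w\<close>, expressing \<open>\<Delta> (f g \<rho>\<^sup>w)\<close> through \<open>\<Delta> \<rho>\<^sup>w\<close> in two ways gives
  \<open>(2 w - 1) X\<^sub>f g = 0\<close>; taking for \<open>f\<close> and \<open>g\<close> coordinates cut off by a bump function
  recovers each component of the structure, so \<open>w = 1/2\<close> unless it vanishes.
\<close>

section \<open>Grassmann algebra\<close>

text \<open>The transition maps are given only as abstract isomorphisms of superalgebras, so neither
  the chain rule nor their compatibility with real powers is automatic. Both are obtained as
  uniqueness statements. When Hadamard's lemma splits a centred coordinate off a function, the
  defect of the chain rule is merely multiplied by a factor without body; it therefore lies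
  arbitrarily deep in the degree filtration and vanishes. A real power is determined by its body and
  its odd logarithmic derivatives, which both candidates share. The second obstacle is the signs of
  odd derivatives. For the Berezinian they are avoided by multiplying each odd derivative with one
  generator outside the algebra: the result is an even derivation obeying the ordinary rules for
  determinants and inverses, and the generator is cancelled at the end. Finally, a solution is not
  assumed to be odd. Since \<open>\<L>_f\<close> shifts parity by that of \<open>f\<close> plus one,
  comparing parities shows that the odd part of a solution satisfies the equation by itself.\<close>

lemma gr_coeff_infinite: "infinite I \<Longrightarrow> gr_coeff x I = 0"
  using gr_coeff[of x] by auto

lemma gr_coeff_simps [simp]:
  "gr_coeff 0 I = 0" "gr_coeff (x + y) I = gr_coeff x I + gr_coeff y I"
  "gr_coeff (x - y) I = gr_coeff x I - gr_coeff y I" "gr_coeff (- x) I = - gr_coeff x I"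
  "gr_coeff (r *\<^sub>R x) I = r * gr_coeff x I"
  by (simp_all add: zero_grassmann.rep_eq plus_grassmann.rep_eq minus_grassmann.rep_eq
      uminus_grassmann.rep_eq scaleR_grassmann.rep_eq)

lemma gr_coeff_one: "gr_coeff 1 I = (if I = {} then 1 else 0)"
  by (simp add: one_grassmann.rep_eq)

lemma gr_coeff_mult: "gr_coeff (x * y) K = (\<Sum>I\<in>Pow K. gr_sign I (K - I) * gr_coeff x I * gr_coeff y (K - I))"
  by (simp add: times_grassmann.rep_eq)

lemma gr_coeff_of_real: "gr_coeff (of_real r) I = (if I = {} then r else 0)"
  by (simp add: of_real_def gr_coeff_one)

lemma gr_coeff_gen: "gr_coeff (gr_gen j) I = (if I = {j} then 1 else 0)"
  by (simp add: gr_gen.rep_eq)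

lemma gr_coeff_part: "gr_coeff (gr_part e x) I = (if card I mod 2 = e mod 2 then gr_coeff x I else 0)"
  by (simp add: gr_part.rep_eq)

lemma gr_coeff_deriv:
  "gr_coeff (gr_deriv j x) I = (if j \<in> I then 0 else (-1) ^ card {i \<in> I. i < j} * gr_coeff x (insert j I))"
  by (simp add: gr_deriv.rep_eq)

lemma gr_coeff_sum: "gr_coeff (sum f A) I = (\<Sum>a\<in>A. gr_coeff (f a) I)"
  by (induction A rule: infinite_finite_induct) auto

lemma gr_eqI: "(\<And>I. finite I \<Longrightarrow> gr_coeff x I = gr_coeff y I) \<Longrightarrow> x = y"
  by (metis gr_coeff_infinite gr_coeff_inject ext)

text \<open>Degree, parity and the set of generators of a product are all controlled by one pair of
  complementary monomials with nonzero coefficients.\<close>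

lemma gr_coeff_mult_nonzero:
  assumes "gr_coeff (x * y) K \<noteq> 0"
  shows "\<exists>I\<subseteq>K. finite K \<and> gr_coeff x I \<noteq> 0 \<and> gr_coeff y (K - I) \<noteq> 0"
proof -
  have "finite K" using assms gr_coeff_infinite by blast
  moreover obtain I where "I \<in> Pow K" "gr_sign I (K - I) * gr_coeff x I * gr_coeff y (K - I) \<noteq> 0"
    using assms unfolding gr_coeff_mult by (meson sum.neutral)
  ultimately show ?thesis by auto
qed

lemma card_Diff_split: "finite K \<Longrightarrow> I \<subseteq> K \<Longrightarrow> card K = card I + card (K - I)"
  by (metis card_Diff_subset card_mono finite_subset le_add_diff_inverse)

text \<open>Each pair in \<open>I \<times> J\<close> is an inversion for exactly one of the two
  orders of concatenation, so the two inversion counts add up to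
  \<open>card I * card J\<close>.\<close>

lemma gr_sign_swap:
  assumes "finite I" "finite J" "I \<inter> J = {}"
  shows "gr_sign I J = (-1) ^ (card I * card J) * gr_sign J I"
proof -
  let ?A = "{(i, j). i \<in> I \<and> j \<in> J \<and> j < i}" and ?B = "{(i, j). i \<in> I \<and> j \<in> J \<and> i < j}"
  let ?C = "{(j, i). j \<in> J \<and> i \<in> I \<and> i < j}"
  have fin: "finite ?A" "finite ?B" using assms by (auto intro: finite_subset[of _ "I \<times> J"])
  have "I \<times> J = ?A \<union> ?B" using assms(3) by (auto simp: not_less_iff_gr_or_eq)
  then have "card I * card J = card ?A + card ?B"
    using card_Un_disjoint[OF fin] by (subst card_cartesian_product[symmetric]) (simp add: disjoint_iff)
  moreover have "card ?B = card ?C"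
    by (rule bij_betw_same_card[of prod.swap]) (auto simp: bij_betw_def inj_on_def image_iff)
  ultimately have "(-1::real) ^ (card I * card J) * (-1) ^ card ?C = (-1) ^ card ?A * ((-1) ^ card ?C * (-1) ^ card ?C)"
    by (simp only: power_add mult.assoc)
  also have "(-1::real) ^ card ?C * (-1) ^ card ?C = 1" by (simp flip: power_mult_distrib)
  finally show ?thesis by (simp add: gr_sign_def)
qed

subsection \<open>Parity\<close>

lemma gr_homogeneous_cong: "even (e + e') \<Longrightarrow> gr_homogeneous e x \<Longrightarrow> gr_homogeneous e' x"
  unfolding gr_homogeneous_def by (metis even_add mod2_eq_if)

lemma gr_homogeneous_0 [simp]: "gr_homogeneous e 0"
  by (simp add: gr_homogeneous_def)

lemma gr_homogeneous_1 [simp]: "even e \<Longrightarrow> gr_homogeneous e 1"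
  by (simp add: gr_homogeneous_def gr_coeff_one even_iff_mod_2_eq_zero)

lemma gr_homogeneous_of_real [simp]: "even e \<Longrightarrow> gr_homogeneous e (of_real r)"
  by (simp add: gr_homogeneous_def gr_coeff_of_real even_iff_mod_2_eq_zero)

lemma gr_homogeneous_gen: "odd e \<Longrightarrow> gr_homogeneous e (gr_gen j)"
  by (simp add: gr_homogeneous_def gr_coeff_gen odd_iff_mod_2_eq_one)

lemma gr_homogeneous_add: "gr_homogeneous e x \<Longrightarrow> gr_homogeneous e y \<Longrightarrow> gr_homogeneous e (x + y)"
  unfolding gr_homogeneous_def by (metis add.right_neutral gr_coeff_simps(2))

lemma gr_homogeneous_uminus: "gr_homogeneous e x \<Longrightarrow> gr_homogeneous e (- x)"
  by (simp add: gr_homogeneous_def)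

lemma gr_homogeneous_diff: "gr_homogeneous e x \<Longrightarrow> gr_homogeneous e y \<Longrightarrow> gr_homogeneous e (x - y)"
  using gr_homogeneous_add[OF _ gr_homogeneous_uminus] by force

lemma gr_homogeneous_scaleR: "gr_homogeneous e x \<Longrightarrow> gr_homogeneous e (r *\<^sub>R x)"
  by (simp add: gr_homogeneous_def)

lemma gr_homogeneous_sum: "(\<And>a. a \<in> A \<Longrightarrow> gr_homogeneous e (f a)) \<Longrightarrow> gr_homogeneous e (sum f A)"
  by (induction A rule: infinite_finite_induct) (auto intro: gr_homogeneous_add)

lemma gr_homogeneous_mult:
  assumes "gr_homogeneous e x" "gr_homogeneous e' y" shows "gr_homogeneous (e + e') (x * y)"
  unfolding gr_homogeneous_def
proof (intro allI impI)
  fix K assume "gr_coeff (x * y) K \<noteq> 0"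
  then obtain I where "I \<subseteq> K" "finite K" "gr_coeff x I \<noteq> 0" "gr_coeff y (K - I) \<noteq> 0"
    using gr_coeff_mult_nonzero by blast
  then show "card K mod 2 = (e + e') mod 2"
    using assms card_Diff_split[of K I] mod_add_cong[of "card I" 2 e "card (K - I)" e']
    by (simp add: gr_homogeneous_def)
qed

lemma gr_homogeneous_mult_even [intro]:
  "gr_homogeneous 0 x \<Longrightarrow> gr_homogeneous 0 y \<Longrightarrow> gr_homogeneous 0 (x * y)"
  using gr_homogeneous_mult by fastforce

lemma gr_homogeneous_power_even: "gr_homogeneous 0 x \<Longrightarrow> gr_homogeneous 0 (x ^ n)"
  by (induction n) auto

text \<open>Passing to complements of subsets turns one product sum into the other; where both
  coefficients are nonzero, the sign from \<open>gr_sign_swap\<close> depends only on the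
  parities.\<close>

lemma gr_mult_commute:
  assumes "gr_homogeneous e x" "gr_homogeneous e' y" shows "x * y = (-1) ^ (e * e') * (y * x)"
proof (rule gr_eqI)
  fix K :: "nat set" assume K: "finite K"
  have "gr_coeff (x * y) K = (\<Sum>I\<in>Pow K. gr_sign (K - I) I * gr_coeff x (K - I) * gr_coeff y I)"
    unfolding gr_coeff_mult
    by (rule sum.reindex_bij_witness[of _ "\<lambda>I. K - I" "\<lambda>I. K - I"]) (auto simp: double_diff)
  also have "\<dots> = (\<Sum>I\<in>Pow K. (-1) ^ (e * e') * (gr_sign I (K - I) * gr_coeff y I * gr_coeff x (K - I)))"
  proof (rule sum.cong[OF refl])
    fix I assume "I \<in> Pow K"
    then have "gr_sign (K - I) I = (-1) ^ (card (K - I) * card I) * gr_sign I (K - I)"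
      using K by (intro gr_sign_swap) (auto intro: finite_subset)
    moreover have "(-1::real) ^ (card (K - I) * card I) = (-1) ^ (e * e')"
      if "gr_coeff x (K - I) \<noteq> 0" "gr_coeff y I \<noteq> 0"
    proof -
      have "even (card (K - I)) = even e" "even (card I) = even e'"
        using that assms unfolding gr_homogeneous_def even_iff_mod_2_eq_zero by metis+
      then show ?thesis unfolding minus_one_power_iff even_mult_iff by simp
    qed
    ultimately show "gr_sign (K - I) I * gr_coeff x (K - I) * gr_coeff y I
      = (-1) ^ (e * e') * (gr_sign I (K - I) * gr_coeff y I * gr_coeff x (K - I))"
      by (cases "gr_coeff x (K - I) = 0 \<or> gr_coeff y I = 0") auto
  qed
  also have "\<dots> = (-1) ^ (e * e') * gr_coeff (y * x) K"
    unfolding gr_coeff_mult[of y x] sum_distrib_left ..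
  also have "\<dots> = gr_coeff ((-1) ^ (e * e') * (y * x)) K"
    by (cases "even (e * e')") simp_all
  finally show "gr_coeff (x * y) K = gr_coeff ((-1) ^ (e * e') * (y * x)) K" .
qed

lemma gr_part_simps [simp]:
  "gr_part e 0 = 0" "gr_part e (x + y) = gr_part e x + gr_part e y" "gr_part e (- x) = - gr_part e x"
  "gr_part e (x - y) = gr_part e x - gr_part e y" "gr_part e (r *\<^sub>R x) = r *\<^sub>R gr_part e x"
  by (rule gr_eqI; simp add: gr_coeff_part)+

lemma gr_part_0_plus_1: "gr_part 0 x + gr_part (Suc 0) x = x"
  by (rule gr_eqI) (auto simp: gr_coeff_part)

lemma gr_homogeneous_part: "gr_homogeneous e (gr_part e x)"
  by (simp add: gr_homogeneous_def gr_coeff_part)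

lemma gr_part_homogeneous:
  "gr_homogeneous e x \<Longrightarrow> gr_part e' x = (if even (e + e') then x else 0)"
proof (rule gr_eqI)
  fix I :: "nat set"
  assume x: "gr_homogeneous e x"
  have "card I mod 2 = e mod 2 \<Longrightarrow> card I mod 2 = e' mod 2 \<longleftrightarrow> even (e + e')"
    by presburger
  then show "gr_coeff (gr_part e' x) I = gr_coeff (if even (e + e') then x else 0) I"
    using x unfolding gr_homogeneous_def gr_coeff_part by (cases "gr_coeff x I = 0") auto
qed

text \<open>The \<open>n\<close>-th power of the parity involution. It carries the sign of the
  graded Leibniz rule for arguments that need not be homogeneous.\<close>

definition gr_conj :: "nat \<Rightarrow> grassmann \<Rightarrow> grassmann" where
  "gr_conj n x = gr_part 0 x + (-1) ^ n * gr_part 1 x"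

lemma gr_conj_homogeneous: "gr_homogeneous e x \<Longrightarrow> gr_conj n x = (-1) ^ (n * e) * x"
  by (cases "even e") (auto simp: gr_conj_def gr_part_homogeneous minus_one_power_iff)

lemma gr_conj_even: "gr_homogeneous 0 x \<Longrightarrow> gr_conj n x = x"
  by (simp add: gr_conj_homogeneous)

lemma gr_conj_add: "gr_conj n (x + y) = gr_conj n x + gr_conj n y"
  by (simp add: gr_conj_def algebra_simps)

lemma gr_conj_0 [simp]: "gr_conj 0 x = x" "gr_conj n 0 = 0"
  by (simp_all add: gr_conj_def gr_part_0_plus_1)

text \<open>Every element is the sum of its two parity parts, so an additive identity needs checking
  on homogeneous elements only.\<close>

lemma gr_homogeneous_induct [consumes 0, case_names hom add]:
  assumes "\<And>e x. e < 2 \<Longrightarrow> gr_homogeneous e x \<Longrightarrow> P x" "\<And>x y. P x \<Longrightarrow> P y \<Longrightarrow> P (x + y)"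
  shows "P x"
  using assms(2)[OF assms(1)[OF _ gr_homogeneous_part[of 0 x]] assms(1)[OF _ gr_homogeneous_part[of 1 x]]]
  by (simp add: gr_part_0_plus_1)

lemma gr_conj_commute:
  assumes "gr_homogeneous e y" shows "y * x = gr_conj e x * y"
proof (induction x rule: gr_homogeneous_induct)
  case (hom e' x)
  then show ?case
    using gr_mult_commute[OF assms hom(2)] by (simp add: gr_conj_homogeneous mult.assoc)
qed (simp add: gr_conj_add algebra_simps)

lemma gr_even_commute: "gr_homogeneous 0 x \<Longrightarrow> x * y = y * x"
  using gr_conj_commute[of 0 x y] by simp

subsection \<open>Filtration by degree\<close>

text \<open>The degree filtration, which is the induction measure of the nilpotency arguments:
  multiplying by an element without body raises the order, and an order above \<open>q\<close> means
  zero in \<open>Grassmann q\<close>.\<close>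

definition gr_order :: "nat \<Rightarrow> grassmann \<Rightarrow> bool" where
  "gr_order n x \<longleftrightarrow> (\<forall>I. gr_coeff x I \<noteq> 0 \<longrightarrow> n \<le> card I)"

lemma gr_order_0 [simp]: "gr_order n 0" "gr_order 0 x"
  by (auto simp: gr_order_def)

lemma gr_order_add: "gr_order n x \<Longrightarrow> gr_order n y \<Longrightarrow> gr_order n (x + y)"
  unfolding gr_order_def by (metis add.right_neutral gr_coeff_simps(2))

lemma gr_order_sum: "(\<And>a. a \<in> A \<Longrightarrow> gr_order n (f a)) \<Longrightarrow> gr_order n (sum f A)"
  by (induction A rule: infinite_finite_induct) (auto intro: gr_order_add)

lemma gr_order_mult:
  assumes "gr_order m x" "gr_order n y" shows "gr_order (m + n) (x * y)"
  unfolding gr_order_def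
proof (intro allI impI)
  fix K assume "gr_coeff (x * y) K \<noteq> 0"
  then obtain I where "I \<subseteq> K" "finite K" "gr_coeff x I \<noteq> 0" "gr_coeff y (K - I) \<noteq> 0"
    using gr_coeff_mult_nonzero by blast
  then show "m + n \<le> card K"
    using assms card_Diff_split[of K I] unfolding gr_order_def by (metis add_mono)
qed

lemma gr_order_1_iff: "gr_order 1 x \<longleftrightarrow> gr_body x = 0"
proof -
  have "gr_coeff x I \<noteq> 0 \<Longrightarrow> I \<noteq> {} \<Longrightarrow> 1 \<le> card I" for I
    using gr_coeff_infinite[of I x] by (metis Suc_leI card_gt_0_iff One_nat_def)
  then show ?thesis unfolding gr_order_def gr_body_def by (metis card.empty not_one_le_zero)
qed

lemma gr_order_Suc_0_iff: "gr_order (Suc 0) x \<longleftrightarrow> gr_body x = 0"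
  using gr_order_1_iff by simp

lemma gr_order_power: "gr_body x = 0 \<Longrightarrow> gr_order n (x ^ n)"
  by (induction n) (use gr_order_mult[of 1] in \<open>auto simp: gr_order_Suc_0_iff\<close>)

lemma gr_body_simps [simp]:
  "gr_body 0 = 0" "gr_body 1 = 1" "gr_body (x + y) = gr_body x + gr_body y"
  "gr_body (x - y) = gr_body x - gr_body y" "gr_body (- x) = - gr_body x"
  "gr_body (r *\<^sub>R x) = r * gr_body x" "gr_body (of_real r) = r"
  "gr_body (gr_gen j) = 0" "gr_body (x * y) = gr_body x * gr_body y"
  by (simp_all add: gr_body_def gr_coeff_one gr_coeff_of_real gr_coeff_gen gr_coeff_mult)

lemma gr_body_power [simp]: "gr_body (x ^ n) = gr_body x ^ n"
  by (induction n) auto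

lemma gr_body_sum: "gr_body (sum f A) = (\<Sum>a\<in>A. gr_body (f a))"
  by (simp add: gr_body_def gr_coeff_sum)

lemma gr_body_odd: "gr_homogeneous e x \<Longrightarrow> odd e \<Longrightarrow> gr_body x = 0"
  unfolding gr_homogeneous_def gr_body_def by (metis card.empty even_iff_mod_2_eq_zero mod_0)

subsection \<open>The subalgebra of finitely many generators\<close>

lemma Grassmann_0 [simp]: "0 \<in> Grassmann q" "1 \<in> Grassmann q" "of_real r \<in> Grassmann q"
  by (simp_all add: Grassmann_def gr_coeff_one gr_coeff_of_real)

lemma Grassmann_gen: "j < q \<Longrightarrow> gr_gen j \<in> Grassmann q"
  by (simp add: Grassmann_def gr_coeff_gen)

lemma Grassmann_add [simp]: "x \<in> Grassmann q \<Longrightarrow> y \<in> Grassmann q \<Longrightarrow> x + y \<in> Grassmann q"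
  unfolding Grassmann_def by (simp add: subset_iff) (metis add.right_neutral)

lemma Grassmann_uminus [simp]: "x \<in> Grassmann q \<Longrightarrow> - x \<in> Grassmann q"
  by (simp add: Grassmann_def)

lemma Grassmann_diff [simp]: "x \<in> Grassmann q \<Longrightarrow> y \<in> Grassmann q \<Longrightarrow> x - y \<in> Grassmann q"
  using Grassmann_add[OF _ Grassmann_uminus] by force

lemma Grassmann_scaleR [simp]: "x \<in> Grassmann q \<Longrightarrow> r *\<^sub>R x \<in> Grassmann q"
  by (simp add: Grassmann_def)

lemma Grassmann_mult [simp]:
  assumes "x \<in> Grassmann q" "y \<in> Grassmann q" shows "x * y \<in> Grassmann q"
  unfolding Grassmann_def mem_Collect_eq
proof (intro allI impI)
  fix K assume "gr_coeff (x * y) K \<noteq> 0"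
  then obtain I where "I \<subseteq> K" "finite K" "gr_coeff x I \<noteq> 0" "gr_coeff y (K - I) \<noteq> 0"
    using gr_coeff_mult_nonzero by blast
  then show "K \<subseteq> {..<q}" using assms unfolding Grassmann_def by blast
qed

lemma Grassmann_power [simp]: "x \<in> Grassmann q \<Longrightarrow> x ^ n \<in> Grassmann q"
  by (induction n) auto

lemma Grassmann_sum: "(\<And>a. a \<in> A \<Longrightarrow> f a \<in> Grassmann q) \<Longrightarrow> sum f A \<in> Grassmann q"
  by (induction A rule: infinite_finite_induct) auto

lemma Grassmann_part [simp]: "x \<in> Grassmann q \<Longrightarrow> gr_part e x \<in> Grassmann q"
  by (simp add: Grassmann_def gr_coeff_part)

lemma Grassmann_deriv [simp]: "x \<in> Grassmann q \<Longrightarrow> gr_deriv j x \<in> Grassmann q"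
  by (auto simp: Grassmann_def gr_coeff_deriv)

lemma Grassmann_order_eq_0:
  assumes "x \<in> Grassmann q" "gr_order (Suc q) x" shows "x = 0"
proof (rule gr_eqI)
  fix I :: "nat set"
  have "gr_coeff x I \<noteq> 0 \<Longrightarrow> card I \<le> q"
    using assms(1) card_mono[of "{..<q}" I] by (auto simp: Grassmann_def)
  then show "gr_coeff x I = gr_coeff 0 I" using assms(2) by (fastforce simp: gr_order_def)
qed

lemma Grassmann_nilpotent: "x \<in> Grassmann q \<Longrightarrow> gr_body x = 0 \<Longrightarrow> q < n \<Longrightarrow> x ^ n = 0"
  by (rule Grassmann_order_eq_0[of _ q])
    (use gr_order_power[of x n] in \<open>auto simp: gr_order_def Suc_le_eq intro: less_le_trans\<close>)

text \<open>The generator of index \<open>q\<close> is the first one that does not occur in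
  \<open>Grassmann q\<close>, so multiplication by it only inserts it into each monomial. This is
  what allows an auxiliary generator to be cancelled.\<close>

lemma Grassmann_gen_mult_eq_0:
  assumes "u \<in> Grassmann q" "gr_gen q * u = 0" shows "u = 0"
proof (rule gr_eqI)
  fix I :: "nat set" assume I: "finite I"
  show "gr_coeff u I = gr_coeff 0 I"
  proof (cases "I \<subseteq> {..<q}")
    case True
    have "0 = gr_coeff (gr_gen q * u) (insert q I)" using assms by simp
    also have "\<dots> = (\<Sum>J\<in>Pow (insert q I). if J = {q} then
        gr_sign {q} (insert q I - {q}) * gr_coeff u (insert q I - {q}) else 0)"
      unfolding gr_coeff_mult by (rule sum.cong) (auto simp: gr_coeff_gen)
    also have "insert q I - {q} = I" using True by auto
    finally have "0 = gr_sign {q} I * gr_coeff u I"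
      using I by (simp add: sum.delta)
    then
    show ?thesis by (simp add: gr_sign_def)
  qed (use assms in \<open>auto simp: Grassmann_def\<close>)
qed

subsection \<open>Odd derivatives\<close>

lemma gr_deriv_simps [simp]:
  "gr_deriv j 0 = 0" "gr_deriv j (x + y) = gr_deriv j x + gr_deriv j y"
  "gr_deriv j (- x) = - gr_deriv j x" "gr_deriv j (x - y) = gr_deriv j x - gr_deriv j y"
  "gr_deriv j (r *\<^sub>R x) = r *\<^sub>R gr_deriv j x" "gr_deriv j 1 = 0" "gr_deriv j (of_real r) = 0"
  "gr_deriv j (gr_gen k) = of_bool (j = k)"
  by (rule gr_eqI; auto simp: gr_coeff_deriv gr_coeff_one gr_coeff_of_real gr_coeff_gen algebra_simps)+

lemma gr_deriv_sum: "gr_deriv j (sum f A) = (\<Sum>a\<in>A. gr_deriv j (f a))"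
  by (induction A rule: infinite_finite_induct) auto

lemma gr_homogeneous_deriv:
  assumes "gr_homogeneous e x" shows "gr_homogeneous (Suc e) (gr_deriv j x)"
  unfolding gr_homogeneous_def
proof (intro allI impI)
  fix I assume "gr_coeff (gr_deriv j x) I \<noteq> 0"
  then have "j \<notin> I" "gr_coeff x (insert j I) \<noteq> 0" by (auto simp: gr_coeff_deriv split: if_splits)
  moreover from this have "finite I" using gr_coeff_infinite by (metis finite_insert)
  ultimately have "Suc (card I) mod 2 = e mod 2" using assms by (auto simp: gr_homogeneous_def)
  then show "card I mod 2 = Suc e mod 2" by presburger
qed

text \<open>Inserting \<open>a\<close> shifts the number of generators below \<open>b\<close>
  exactly if \<open>a < b\<close>. For two distinct indices this happens in just one of the two
  orders of differentiation, which gives the sign.\<close>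

lemma gr_deriv_anticommute: "gr_deriv i (gr_deriv j x) = - gr_deriv j (gr_deriv i x)"
proof (rule gr_eqI)
  fix I :: "nat set" assume I: "finite I"
  have c: "card {l. (l = a \<or> l \<in> I) \<and> l < b} = card {l \<in> I. l < b} + of_bool (a < b)"
    if "a \<notin> I" for a b
  proof -
    have "{l. (l = a \<or> l \<in> I) \<and> l < b} = (if a < b then insert a {l \<in> I. l < b} else {l \<in> I. l < b})"
      by auto
    then show ?thesis using that I by simp
  qed
  show "gr_coeff (gr_deriv i (gr_deriv j x)) I = gr_coeff (- gr_deriv j (gr_deriv i x)) I"
    by (cases "i < j"; cases "j < i"; auto simp: gr_coeff_deriv c insert_commute)
qed

lemma gr_coeff_gen_mult:
  "gr_coeff (gr_gen j * u) K = (if j \<in> K then (-1) ^ card {l \<in> K. l < j} * gr_coeff u (K - {j}) else 0)"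
proof (cases "finite K")
  case True
  have "gr_coeff (gr_gen j * u) K = (\<Sum>J\<in>Pow K. if J = {j} then
      gr_sign {j} (K - {j}) * gr_coeff u (K - {j}) else 0)"
    unfolding gr_coeff_mult by (rule sum.cong) (auto simp: gr_coeff_gen)
  also have "\<dots> = (if j \<in> K then gr_sign {j} (K - {j}) * gr_coeff u (K - {j}) else 0)"
    using True by (simp add: sum.delta)
  also have "gr_sign {j} (K - {j}) = (-1) ^ card {l \<in> K. l < j}"
  proof -
    have "{(i, l). i \<in> {j} \<and> l \<in> K - {j} \<and> l < i} = Pair j ` {l \<in> K. l < j}" by auto
    then show ?thesis by (simp add: gr_sign_def card_image inj_on_def)
  qed
  finally show ?thesis .
qed (simp add: gr_coeff_infinite)

lemma gr_deriv_eq_0_iff: "gr_deriv j u = 0 \<longleftrightarrow> (\<forall>I. j \<in> I \<longrightarrow> gr_coeff u I = 0)"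
proof
  assume u: "gr_deriv j u = 0"
  show "\<forall>I. j \<in> I \<longrightarrow> gr_coeff u I = 0"
  proof (intro allI impI)
    fix I assume "j \<in> I"
    have "gr_coeff (gr_deriv j u) (I - {j}) = 0" by (simp add: u)
    then show "gr_coeff u I = 0" using \<open>j \<in> I\<close> by (simp add: gr_coeff_deriv insert_absorb)
  qed
next
  assume "\<forall>I. j \<in> I \<longrightarrow> gr_coeff u I = 0"
  then show "gr_deriv j u = 0" by (intro gr_eqI) (auto simp: gr_coeff_deriv)
qed

lemma gr_deriv_gen_mult:
  assumes "gr_deriv j u = 0" shows "gr_deriv j (gr_gen j * u) = u"
proof (rule gr_eqI)
  fix I :: "nat set"
  have "{l. (l = j \<or> l \<in> I) \<and> l < j} = {l \<in> I. l < j}" by auto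
  then show "gr_coeff (gr_deriv j (gr_gen j * u)) I = gr_coeff u I"
    using assms by (auto simp: gr_coeff_deriv gr_coeff_gen_mult gr_deriv_eq_0_iff simp flip: power_mult_distrib)
qed

text \<open>Separating the monomials that contain the generator reduces the Leibniz rule to factors
  free of it.\<close>

lemma gr_deriv_decompose: "\<exists>b. gr_deriv j b = 0 \<and> x = gr_gen j * gr_deriv j x + b"
proof (intro exI conjI)
  have "gr_coeff (gr_gen j * gr_deriv j x) I = gr_coeff x I" if "j \<in> I" for I
  proof -
    have "{l \<in> I - {j}. l < j} = {l \<in> I. l < j}" by auto
    then have "gr_coeff (gr_gen j * gr_deriv j x) I = (-1) ^ card {l \<in> I. l < j} * ((-1) ^ card {l \<in> I. l < j} * gr_coeff x I)"
      using that by (simp add: gr_coeff_gen_mult gr_coeff_deriv insert_absorb)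
    then show ?thesis by (simp flip: mult.assoc power_mult_distrib)
  qed
  then show "gr_deriv j (x - gr_gen j * gr_deriv j x) = 0" unfolding gr_deriv_eq_0_iff by simp
qed simp

lemma gr_deriv_mult_closed:
  assumes "gr_deriv j a = 0" "gr_deriv j b = 0" shows "gr_deriv j (a * b) = 0"
  unfolding gr_deriv_eq_0_iff
proof (intro allI impI, rule ccontr)
  fix K assume "j \<in> K" "gr_coeff (a * b) K \<noteq> 0"
  then obtain I where "I \<subseteq> K" "gr_coeff a I \<noteq> 0" "gr_coeff b (K - I) \<noteq> 0"
    using gr_coeff_mult_nonzero by blast
  with assms \<open>j \<in> K\<close> show False unfolding gr_deriv_eq_0_iff by (cases "j \<in> I") auto
qed

lemma gr_deriv_deriv_self: "gr_deriv j (gr_deriv j x) = 0"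
  by (rule gr_eqI) (auto simp: gr_coeff_deriv)

lemma gr_gen_square: "gr_gen j * gr_gen j = 0"
  by (rule gr_eqI) (auto simp: gr_coeff_gen_mult gr_coeff_gen)

text \<open>With both factors decomposed along the generator, its square kills one of the four
  products, and the signs come only from moving the generator to the front of the others.\<close>

lemma gr_deriv_mult_homogeneous:
  assumes "gr_homogeneous e x"
  shows "gr_deriv j (x * y) = gr_deriv j x * y + (-1) ^ e * (x * gr_deriv j y)"
proof -
  let ?\<xi> = "gr_gen j"
  obtain a b where x: "x = ?\<xi> * a + b" and a: "gr_deriv j a = 0" "a = gr_deriv j x" and b: "gr_deriv j b = 0"
    using gr_deriv_decompose[of j x] gr_deriv_deriv_self by metis
  obtain c d where y: "y = ?\<xi> * c + d" and c: "gr_deriv j c = 0" "c = gr_deriv j y" and d: "gr_deriv j d = 0"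
    using gr_deriv_decompose[of j y] gr_deriv_deriv_self by metis
  have \<xi>: "gr_homogeneous 1 ?\<xi>" by (simp add: gr_homogeneous_gen)
  have ha: "gr_homogeneous (Suc e) a" using gr_homogeneous_deriv assms a by blast
  have "gr_homogeneous e (?\<xi> * a)"
    using gr_homogeneous_mult[OF \<xi> ha] by (rule gr_homogeneous_cong[rotated]) simp
  then have hb: "gr_homogeneous e b" using gr_homogeneous_diff[OF assms] x by (metis add_diff_cancel_left')
  have a\<xi>: "a * ?\<xi> = (-1) ^ Suc e * (?\<xi> * a)" using gr_mult_commute[OF ha \<xi>] by simp
  have b\<xi>: "b * ?\<xi> = (-1) ^ e * (?\<xi> * b)" using gr_mult_commute[OF hb \<xi>] by simp
  have a\<xi>2: "a * (?\<xi> * z) = (-1) ^ Suc e * (?\<xi> * (a * z))" for z using a\<xi> by (simp flip: mult.assoc)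
  have b\<xi>2: "b * (?\<xi> * z) = (-1) ^ e * (?\<xi> * (b * z))" for z using b\<xi> by (simp flip: mult.assoc)
  have \<xi>\<xi>: "?\<xi> * (?\<xi> * z) = 0" for z by (simp add: gr_gen_square flip: mult.assoc)
  have xy: "x * y = ?\<xi> * (a * d + (-1) ^ e * (b * c)) + b * d"
    unfolding x y by (cases "even e") (simp_all add: algebra_simps a\<xi>2 b\<xi>2 \<xi>\<xi> minus_one_power_iff)
  have cl: "gr_deriv j (a * d + (-1) ^ e * (b * c)) = 0"
    using gr_deriv_mult_closed a b c d by (simp add: minus_one_power_iff)
  have "gr_deriv j (x * y) = a * d + (-1) ^ e * (b * c)"
    unfolding xy by (simp add: gr_deriv_gen_mult[OF cl] gr_deriv_mult_closed b d)
  also have "\<dots> = a * y + (-1) ^ e * (x * c)"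
    unfolding x y by (cases "even e") (simp_all add: algebra_simps a\<xi>2 minus_one_power_iff)
  finally show ?thesis using a c by simp
qed

lemma gr_deriv_mult: "gr_deriv j (x * y) = gr_deriv j x * y + gr_conj 1 x * gr_deriv j y"
  by (induction x rule: gr_homogeneous_induct)
    (simp_all add: gr_deriv_mult_homogeneous gr_conj_homogeneous gr_conj_add algebra_simps)

text \<open>A vanishing derivative excludes its generator from every monomial; once all are
  excluded, only the body is left.\<close>

lemma Grassmann_deriv_eq_0:
  assumes "x \<in> Grassmann q" "\<And>j. j < q \<Longrightarrow> gr_deriv j x = 0" shows "x = of_real (gr_body x)"
proof (rule gr_eqI)
  fix I :: "nat set"
  show "gr_coeff x I = gr_coeff (of_real (gr_body x)) I"
  proof (cases "I = {}")
    case False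
    then show ?thesis using assms unfolding gr_deriv_eq_0_iff Grassmann_def
      by (auto simp: gr_coeff_of_real)
  qed (simp add: gr_body_def gr_coeff_of_real)
qed

subsection \<open>Inverses and real powers\<close>

definition gr_unit :: "nat \<Rightarrow> grassmann \<Rightarrow> bool" where
  "gr_unit q x \<longleftrightarrow> x \<in> Grassmann q \<and> gr_body x \<noteq> 0"

lemma gr_soul_power_commute:
  "(x - of_real r) ^ k * x = x * (x - of_real r) ^ k" for x :: grassmann
proof -
  have "(x - of_real r) ^ k * (x - of_real r) = (x - of_real r) * (x - of_real r) ^ k"
    by (simp add: power_commutes)
  then show ?thesis by (simp add: algebra_simps of_real_def)
qed

text \<open>The geometric series in the nilpotent part.\<close>

definition gr_geom :: "nat \<Rightarrow> grassmann \<Rightarrow> grassmann" where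
  "gr_geom q x = (\<Sum>k\<le>q. ((-1) ^ k * (1 / gr_body x) ^ Suc k) *\<^sub>R (x - of_real (gr_body x)) ^ k)"

lemma gr_geom_mult:
  assumes "gr_unit q x" shows "x * gr_geom q x = 1" "gr_geom q x * x = 1"
proof -
  define b n where "b = gr_body x" and "n = x - of_real b"
  define T where "T k = ((-1) ^ k * (1 / b) ^ k) *\<^sub>R n ^ k" for k
  have b: "b \<noteq> 0" and n: "n ^ Suc q = 0"
    using assms Grassmann_nilpotent[of n q "Suc q"] by (auto simp: gr_unit_def n_def b_def)
  \<comment> \<open>Multiplication by \<open>x = b + n\<close> produces two neighbouring terms, so
    the product with the series telescopes to \<open>T 0 - T (Suc q)\<close>.\<close>
  have step: "x * (((-1) ^ k * (1 / b) ^ Suc k) *\<^sub>R n ^ k) = T k - T (Suc k)" for k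
  proof -
    have x: "x = of_real b + n" by (simp add: n_def)
    show ?thesis unfolding T_def using b
      by (subst x) (simp add: algebra_simps of_real_def)
  qed
  have "x * gr_geom q x = (\<Sum>k<Suc q. T k - T (Suc k))"
    unfolding gr_geom_def b_def[symmetric] n_def[symmetric] sum_distrib_left step lessThan_Suc_atMost ..
  also have "\<dots> = T 0 - T (Suc q)" using sum_lessThan_telescope'[of T "Suc q"] by simp
  also have "\<dots> = 1" using n by (simp add: T_def)
  finally show "x * gr_geom q x = 1" .
  moreover have "gr_geom q x * x = x * gr_geom q x"
    by (simp add: gr_geom_def sum_distrib_left sum_distrib_right gr_soul_power_commute)
  ultimately show "gr_geom q x * x = 1" by simp
qed

lemma gr_inverse_eqI: "x * y = 1 \<Longrightarrow> y * x = 1 \<Longrightarrow> gr_inverse x = y"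
  unfolding gr_inverse_def
  by (rule the_equality) (auto, metis mult.assoc mult_1 mult_1_right)

lemma gr_inverse_eq_geom: "gr_unit q x \<Longrightarrow> gr_inverse x = gr_geom q x"
  using gr_inverse_eqI gr_geom_mult by blast

lemma gr_inverse_mult: "gr_unit q x \<Longrightarrow> x * gr_inverse x = 1" "gr_unit q x \<Longrightarrow> gr_inverse x * x = 1"
  using gr_inverse_eq_geom gr_geom_mult by auto

lemma Grassmann_inverse: "gr_unit q x \<Longrightarrow> gr_inverse x \<in> Grassmann q"
  by (auto simp: gr_inverse_eq_geom gr_geom_def gr_unit_def intro!: Grassmann_sum)

lemma gr_homogeneous_inverse: "gr_unit q x \<Longrightarrow> gr_homogeneous 0 x \<Longrightarrow> gr_homogeneous 0 (gr_inverse x)"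
  by (auto simp: gr_inverse_eq_geom gr_geom_def intro!: gr_homogeneous_sum gr_homogeneous_scaleR
      gr_homogeneous_power_even gr_homogeneous_diff)

lemma gr_body_inverse: "gr_unit q x \<Longrightarrow> gr_body (gr_inverse x) = 1 / gr_body x"
  using gr_inverse_mult(1)[of q x] by (metis gr_body_simps(2,9) gr_unit_def nonzero_eq_divide_eq mult.commute)

definition gr_pos :: "nat \<Rightarrow> grassmann \<Rightarrow> bool" where
  "gr_pos q x \<longleftrightarrow> x \<in> Grassmann q \<and> gr_homogeneous 0 x \<and> gr_body x > 0"

lemma gr_pos_unit: "gr_pos q x \<Longrightarrow> gr_unit q x"
  by (auto simp: gr_pos_def gr_unit_def)

lemma gr_pos_mult: "gr_pos q x \<Longrightarrow> gr_pos q y \<Longrightarrow> gr_pos q (x * y)"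
  by (auto simp: gr_pos_def)

lemma gr_body_powr [simp]: "gr_body (gr_powr q x w) = gr_body x powr w"
proof -
  have "gr_body (gr_powr q x w) = (\<Sum>k\<le>q. (if k = 0 then gr_body x powr w else 0))"
    unfolding gr_powr_def gr_body_sum by (rule sum.cong) (auto simp: power_0_left)
  then show ?thesis by simp
qed

lemma gr_pos_powr: "gr_pos q x \<Longrightarrow> gr_pos q (gr_powr q x w)"
  unfolding gr_pos_def gr_body_powr by (auto simp: gr_powr_def intro!: Grassmann_sum gr_homogeneous_sum
      gr_homogeneous_scaleR gr_homogeneous_power_even gr_homogeneous_diff)

lemma gr_powr_zero [simp]: "gr_powr q 0 w = 0"
  by (simp add: gr_powr_def)

lemma gr_powr_1 [simp]: "gr_pos q x \<Longrightarrow> gr_powr q x 1 = x"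
proof -
  assume x: "gr_pos q x"
  let ?n = "x - of_real (gr_body x)"
  let ?t = "\<lambda>k. ((1 gchoose k) * gr_body x powr (1 - real k)) *\<^sub>R ?n ^ k"
  have n: "?n ^ Suc q = 0" using x Grassmann_nilpotent[of ?n q "Suc q"] by (auto simp: gr_pos_def)
  have z: "((1::real) gchoose k) = 0" if "k > 1" for k
    using that binomial_gbinomial[of 1 k, where 'a=real] by (metis binomial_eq_0 of_nat_0 of_nat_1)
  \<comment> \<open>The term of index \<open>Suc q\<close> is zero; it is appended so that the
    linear term is present even for \<open>q = 0\<close>.\<close>
  have "gr_powr q x 1 = sum ?t {..q} + ?t (Suc q)" unfolding gr_powr_def using n by simp
  also have "\<dots> = sum ?t {..Suc q}" by simp
  also have "\<dots> = sum ?t {..1}" by (rule sum.mono_neutral_right) (auto simp: z)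
  also have "\<dots> = of_real (gr_body x) + ?n" using x by (simp add: gr_pos_def of_real_def)
  finally show ?thesis by simp
qed

lemma gchoose_diff_1: "(w gchoose k) * (w - real k) = w * ((w - 1) gchoose k)" for w :: real
  using gbinomial_absorb_comp[of w k] gbinomial_absorption[of k w] by (simp add: mult.commute)

text \<open>Pascal's rule for the binomial series, the power \<open>n ^ Suc q\<close> being zero. It
  links neighbouring exponents before any general exponent law is available.\<close>

lemma gr_powr_minus_1_mult:
  assumes "gr_pos q x" shows "gr_powr q x (w - 1) * x = gr_powr q x w"
proof -
  define b n where "b = gr_body x" and "n = x - of_real b"
  have b: "b > 0" and n: "n ^ Suc q = 0" and x: "x = of_real b + n"
    using assms Grassmann_nilpotent[of n q "Suc q"] by (auto simp: gr_pos_def n_def b_def)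
  let ?T = "\<lambda>v k. ((v gchoose k) * b powr (w - real k)) *\<^sub>R n ^ k"
  have step: "(((w - 1) gchoose k) * b powr (w - 1 - real k)) *\<^sub>R n ^ k * x
     = ?T (w - 1) k + (((w - 1) gchoose k) * b powr (w - real (Suc k))) *\<^sub>R n ^ Suc k" for k
  proof -
    have "b powr (w - real k) = b powr (w - 1 - real k) * b" using b powr_add[of b "w - 1 - real k" 1] by (simp add: algebra_simps)
    then show ?thesis unfolding x by (simp add: algebra_simps of_real_def power_commutes)
  qed
  have "gr_powr q x (w - 1) * x = (\<Sum>k\<le>q. ?T (w - 1) k)
      + (\<Sum>k<Suc q. (((w - 1) gchoose k) * b powr (w - real (Suc k))) *\<^sub>R n ^ Suc k)"
    unfolding gr_powr_def b_def[symmetric] n_def[symmetric] sum_distrib_right step sum.distrib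
      lessThan_Suc_atMost ..
  also have "(\<Sum>k<Suc q. (((w - 1) gchoose k) * b powr (w - real (Suc k))) *\<^sub>R n ^ Suc k)
      = (\<Sum>k<q. (((w - 1) gchoose k) * b powr (w - real (Suc k))) *\<^sub>R n ^ Suc k)"
    using n by simp
  also have "(\<Sum>k\<le>q. ?T (w - 1) k) = ?T (w - 1) 0 + (\<Sum>k<q. ?T (w - 1) (Suc k))"
    by (simp add: sum.atMost_shift)
  finally have "gr_powr q x (w - 1) * x = ?T w 0 + (\<Sum>k<q. ?T w (Suc k))"
    using gbinomial_Suc_Suc[of "w - 1"] by (simp add: sum.distrib[symmetric] algebra_simps)
  also have "\<dots> = gr_powr q x w"
    unfolding gr_powr_def b_def[symmetric] n_def[symmetric] by (simp add: sum.atMost_shift)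
  finally show ?thesis .
qed

lemma gr_even_commute': "gr_homogeneous 0 x \<Longrightarrow> gr_homogeneous 0 y \<Longrightarrow> x * y = y * x"
  using gr_even_commute by blast

lemma gr_even_left_commute: "gr_homogeneous 0 x \<Longrightarrow> x * (y * z) = y * (x * z)"
  using gr_even_commute[of x y] by (simp flip: mult.assoc)

lemmas gr_even_ac = mult.assoc gr_even_commute' gr_even_left_commute

lemma gr_deriv_power:
  "gr_homogeneous 0 n \<Longrightarrow> gr_deriv j (n ^ k) = real k *\<^sub>R (n ^ (k - 1) * gr_deriv j n)"
proof (induction k)
  case (Suc k)
  have c: "gr_deriv j n * n ^ k = n ^ k * gr_deriv j n"
    using gr_even_commute[OF gr_homogeneous_power_even] Suc.prems by metis
  have "gr_deriv j (n ^ Suc k) = gr_deriv j n * n ^ k + n * gr_deriv j (n ^ k)"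
    using Suc.prems by (simp add: gr_deriv_mult gr_conj_homogeneous)
  also have "\<dots> = n ^ k * gr_deriv j n + real k *\<^sub>R (n ^ k * gr_deriv j n)"
    using Suc c by (cases k) (simp_all flip: mult.assoc)
  finally show ?case by (simp add: algebra_simps)
qed simp

text \<open>Differentiate \<open>n ^ Suc q = 0\<close>. Although \<open>n ^ q\<close> itself may be
  nonzero, this supplies the top term that the differentiated binomial series lacks.\<close>

lemma gr_nilpotent_deriv_eq_0:
  assumes "n \<in> Grassmann q" "gr_homogeneous 0 n" "gr_body n = 0"
  shows "n ^ q * gr_deriv j n = 0"
proof -
  have "gr_deriv j (n ^ Suc q) = 0" using assms by (simp only: Grassmann_nilpotent lessI gr_deriv_simps)
  then show ?thesis unfolding gr_deriv_power[OF assms(2)] by simp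
qed

lemma gr_deriv_powr:
  assumes "gr_pos q x"
  shows "gr_deriv j (gr_powr q x w) = w *\<^sub>R (gr_powr q x (w - 1) * gr_deriv j x)"
proof -
  define b n where "b = gr_body x" and "n = x - of_real b"
  have n: "n \<in> Grassmann q" "gr_homogeneous 0 n" "gr_body n = 0"
    using assms by (auto simp: gr_pos_def n_def b_def intro: gr_homogeneous_diff)
  let ?t = "\<lambda>k. (((w - 1) gchoose k) * b powr (w - 1 - real k)) *\<^sub>R (n ^ k * gr_deriv j n)"
  have "gr_deriv j (gr_powr q x w)
     = (\<Sum>k\<le>q. ((w gchoose k) * b powr (w - real k)) *\<^sub>R (real k *\<^sub>R (n ^ (k - 1) * gr_deriv j n)))"
    unfolding gr_powr_def b_def[symmetric] n_def[symmetric] gr_deriv_sum gr_deriv_simps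
      gr_deriv_power[OF n(2)] ..
  also have "\<dots> = (\<Sum>k<q. ((w gchoose Suc k) * b powr (w - real (Suc k))) *\<^sub>R (real (Suc k) *\<^sub>R (n ^ k * gr_deriv j n)))"
    by (simp add: sum.atMost_shift)
  also have "\<dots> = (\<Sum>k<q. w *\<^sub>R ?t k)"
  proof (rule sum.cong[OF refl])
    fix k
    have "(w gchoose Suc k) * real (Suc k) = w * ((w - 1) gchoose k)"
      using gbinomial_absorption[of k w] by (simp add: mult.commute)
    then have "(w gchoose Suc k) * b powr (w - real (Suc k)) * real (Suc k) = w * (((w - 1) gchoose k) * b powr (w - 1 - real k))"
      by (simp add: mult_ac diff_diff_eq)
    then show "((w gchoose Suc k) * b powr (w - real (Suc k))) *\<^sub>R (real (Suc k) *\<^sub>R (n ^ k * gr_deriv j n)) = w *\<^sub>R ?t k"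
      by (simp only: scaleR_scaleR)
  qed
  \<comment> \<open>Differentiation lowers the powers, so the sum stops before \<open>q\<close>; the
    missing term is zero by \<open>gr_nilpotent_deriv_eq_0\<close>.\<close>
  also have "\<dots> = (\<Sum>k\<le>q. w *\<^sub>R ?t k)"
    using gr_nilpotent_deriv_eq_0[OF n] by (simp flip: lessThan_Suc_atMost)
  also have "\<dots> = w *\<^sub>R (gr_powr q x (w - 1) * gr_deriv j n)"
    unfolding gr_powr_def b_def[symmetric] n_def[symmetric]
    by (simp add: sum_distrib_right scaleR_sum_right)
  finally show ?thesis by (simp add: n_def)
qed

text \<open>The quotient of \<open>u\<close> by \<open>v\<close> has vanishing odd derivatives and
  body one. Identities between real powers are thereby reduced to real bodies and logarithmic
  derivatives, without convolving binomial series.\<close>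

lemma gr_pos_eqI:
  assumes u: "gr_pos q u" and v: "gr_pos q v" and body: "gr_body u = gr_body v"
    and deriv: "\<And>j. j < q \<Longrightarrow> gr_deriv j u * v = u * gr_deriv j v"
  shows "u = v"
proof -
  let ?v = "gr_inverse v"
  have iv: "v * ?v = 1" "?v * v = 1" using gr_inverse_mult gr_pos_unit[OF v] by auto
  have ev: "gr_homogeneous 0 v" "gr_homogeneous 0 ?v" "gr_homogeneous 0 u"
    using u v gr_homogeneous_inverse[OF gr_pos_unit[OF v]] by (auto simp: gr_pos_def)
  have "gr_deriv j (u * ?v) = 0" if "j < q" for j
  proof -
    have "gr_deriv j (v * ?v) = 0" unfolding iv by simp
    then have "v * gr_deriv j ?v = - (gr_deriv j v * ?v)"
      using ev by (simp add: gr_deriv_mult gr_conj_homogeneous eq_neg_iff_add_eq_0 add.commute)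
    then have "?v * (v * gr_deriv j ?v) = - (?v * (gr_deriv j v * ?v))" by simp
    then have dv: "gr_deriv j ?v = - (?v * (gr_deriv j v * ?v))" by (simp add: iv flip: mult.assoc)
    have "gr_deriv j u = gr_deriv j u * v * ?v" by (simp add: mult.assoc iv)
    then have du: "gr_deriv j u = u * gr_deriv j v * ?v" using deriv[OF that] by simp
    have "gr_deriv j (u * ?v) = gr_deriv j u * ?v + u * gr_deriv j ?v"
      using ev by (simp add: gr_deriv_mult gr_conj_homogeneous)
    also have "\<dots> = u * (gr_deriv j v * ?v) * ?v - u * (?v * (gr_deriv j v * ?v))"
      by (subst du) (simp add: dv mult.assoc)
    also have "\<dots> = 0" using gr_even_commute[OF ev(2), of "gr_deriv j v * ?v"] by (simp add: mult.assoc)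
    finally show ?thesis .
  qed
  moreover have "u * ?v \<in> Grassmann q"
    using u v Grassmann_inverse gr_pos_unit by (auto simp: gr_pos_def)
  ultimately have "u * ?v = of_real (gr_body (u * ?v))" using Grassmann_deriv_eq_0 by blast
  also have "\<dots> = 1" using v body gr_body_inverse[OF gr_pos_unit[OF v]] by (simp add: gr_pos_def)
  finally have "u * (?v * v) = 1 * v" by (simp flip: mult.assoc)
  then show ?thesis by (simp add: iv)
qed

lemma gr_deriv_even_commute:
  "gr_homogeneous 0 z \<Longrightarrow> gr_deriv j x * z = z * gr_deriv j x"
  "gr_homogeneous 0 z \<Longrightarrow> gr_deriv j x * (z * y) = z * (gr_deriv j x * y)"
  using gr_even_commute gr_even_left_commute by metis+

text \<open>Both sides have \<open>w\<close> times the sum of the logarithmic derivatives of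
  \<open>x\<close> and \<open>y\<close>, so \<open>gr_pos_eqI\<close> applies.\<close>

lemma gr_powr_mult:
  assumes x: "gr_pos q x" and y: "gr_pos q y"
  shows "gr_powr q (x * y) w = gr_powr q x w * gr_powr q y w"
proof (rule gr_pos_eqI[of q])
  show "gr_body (gr_powr q (x * y) w) = gr_body (gr_powr q x w * gr_powr q y w)"
    using x y by (simp add: powr_mult gr_pos_def)
next
  fix j
  let ?A = "gr_powr q (x * y) (w - 1)" and ?X = "gr_powr q x (w - 1)" and ?Y = "gr_powr q y (w - 1)"
  \<comment> \<open>Trading the exponent \<open>w\<close> for \<open>w - 1\<close> times the base
    makes both sides products of the same even factors, with no inverses.\<close>
  note m = gr_powr_minus_1_mult[OF x, of w, symmetric] gr_powr_minus_1_mult[OF y, of w, symmetric]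
    gr_powr_minus_1_mult[OF gr_pos_mult[OF x y], of w, symmetric]
  have ev [simp]: "gr_homogeneous 0 x" "gr_homogeneous 0 y" "gr_homogeneous 0 ?A" "gr_homogeneous 0 ?X"
    "gr_homogeneous 0 ?Y" "gr_homogeneous 0 (gr_powr q x w)"
    using x y gr_pos_mult[OF x y] gr_pos_powr unfolding gr_pos_def by blast+
  have dX: "gr_deriv j (gr_powr q x w * gr_powr q y w)
      = w *\<^sub>R (?X * gr_deriv j x) * gr_powr q y w + gr_powr q x w * w *\<^sub>R (?Y * gr_deriv j y)"
    using x y by (simp add: gr_deriv_mult gr_conj_even gr_deriv_powr)
  have dA: "gr_deriv j (gr_powr q (x * y) w) = w *\<^sub>R (?A * (gr_deriv j x * y + x * gr_deriv j y))"
    by (simp add: gr_deriv_powr gr_pos_mult[OF x y] gr_deriv_mult gr_conj_even)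
  show "gr_deriv j (gr_powr q (x * y) w) * (gr_powr q x w * gr_powr q y w)
      = gr_powr q (x * y) w * gr_deriv j (gr_powr q x w * gr_powr q y w)"
    unfolding dA dX unfolding m
    by (simp add: distrib_left distrib_right scaleR_right_distrib gr_even_ac gr_deriv_even_commute)
qed (use x y in \<open>auto intro: gr_pos_powr gr_pos_mult\<close>)

lemma gr_powr_add:
  assumes x: "gr_pos q x"
  shows "gr_powr q x v * gr_powr q x w = gr_powr q x (v + w)"
proof (rule gr_pos_eqI[of q])
  show "gr_body (gr_powr q x v * gr_powr q x w) = gr_body (gr_powr q x (v + w))"
    using x by (simp add: powr_add)
next
  fix j
  let ?A = "gr_powr q x (v + w - 1)" and ?X = "gr_powr q x (v - 1)" and ?Y = "gr_powr q x (w - 1)"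
  note m = gr_powr_minus_1_mult[OF x, of w, symmetric] gr_powr_minus_1_mult[OF x, of v, symmetric]
    gr_powr_minus_1_mult[OF x, of "v + w", symmetric]
  have ev [simp]: "gr_homogeneous 0 x" "gr_homogeneous 0 ?A" "gr_homogeneous 0 ?X"
    "gr_homogeneous 0 ?Y" "gr_homogeneous 0 (gr_powr q x v)"
    using x gr_pos_powr unfolding gr_pos_def by blast+
  have dX: "gr_deriv j (gr_powr q x v * gr_powr q x w)
      = v *\<^sub>R (?X * gr_deriv j x) * gr_powr q x w + gr_powr q x v * w *\<^sub>R (?Y * gr_deriv j x)"
    using x by (simp add: gr_deriv_mult gr_conj_even gr_deriv_powr)
  have dA: "gr_deriv j (gr_powr q x (v + w)) = (v + w) *\<^sub>R (?A * gr_deriv j x)"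
    by (simp add: gr_deriv_powr x)
  show "gr_deriv j (gr_powr q x v * gr_powr q x w) * gr_powr q x (v + w)
      = gr_powr q x v * gr_powr q x w * gr_deriv j (gr_powr q x (v + w))"
    unfolding dA dX unfolding m
    by (simp add: distrib_left distrib_right scaleR_right_distrib scaleR_left_distrib gr_even_ac gr_deriv_even_commute)
qed (use x in \<open>auto intro: gr_pos_powr gr_pos_mult\<close>)

section \<open>Smooth functions of several variables\<close>

abbreviation open_dom :: "nat \<Rightarrow> (nat \<Rightarrow> real) set \<Rightarrow> bool" where
  "open_dom p V \<equiv> openin (Euclidean_space p) V"

lemma Euclidean_space_eq: "Euclidean_space p = top_of_set {x. \<forall>i\<ge>p. x i = 0}"
  by (simp add: Euclidean_space_def euclidean_product_topology)

lemma open_dom_iff: "open_dom p V \<longleftrightarrow> (\<exists>T. open T \<and> V = {x. \<forall>i\<ge>p. x i = 0} \<inter> T)"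
  by (simp add: Euclidean_space_eq openin_open)

lemma open_dom_zero: "open_dom p V \<Longrightarrow> x \<in> V \<Longrightarrow> p \<le> i \<Longrightarrow> x i = 0"
  by (auto simp: open_dom_iff)

lemma continuous_map_open_dom:
  assumes "open_dom p V"
  shows "continuous_map (subtopology (Euclidean_space p) V) euclideanreal f \<longleftrightarrow> continuous_on V f"
proof -
  have "{x. \<forall>i\<ge>p. x i = 0} \<inter> V = V" using assms by (auto simp: open_dom_iff)
  then have "subtopology (Euclidean_space p) V = top_of_set V"
    by (simp add: Euclidean_space_eq subtopology_subtopology)
  then show ?thesis by simp
qed

lemma continuous_on_fun_upd_const: "continuous_on S (\<lambda>t. (x :: nat \<Rightarrow> real)(i := t))"
proof (rule continuous_on_coordinatewise_then_product)
  fix k show "continuous_on S (\<lambda>t. (x(i := t)) k)" by (cases "k = i") (auto intro: continuous_intros)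
qed

lemma continuous_on_coordinate:
  "continuous_on S f \<Longrightarrow> continuous_on S (\<lambda>x. (f x :: nat \<Rightarrow> real) i)"
  by (rule continuous_on_product_then_coordinatewise)

lemma continuous_on_coord: "continuous_on S (\<lambda>x :: nat \<Rightarrow> real. x i)"
  using continuous_on_coordinate[OF continuous_on_id] .

lemma open_dom_line:
  assumes "open_dom p V" "x \<in> V" "i < p" shows "open {t. x(i := t) \<in> V}"
proof -
  obtain T where T: "open T" "V = {x. \<forall>i\<ge>p. x i = 0} \<inter> T" using assms by (auto simp: open_dom_iff)
  have "{t. x(i := t) \<in> V} = (\<lambda>t. x(i := t)) -` T" using T assms by auto
  then show ?thesis using open_vimage[OF T(1) continuous_on_fun_upd_const] by simp
qed

lemma eventually_line:
  assumes "open_dom p V" "x \<in> V" "i < p" shows "eventually (\<lambda>t. x(i := t) \<in> V) (nhds (x i))"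
  using eventually_nhds_in_open[OF open_dom_line[OF assms], of "x i"] assms(2) by simp

section \<open>Smooth functions through iterated partial derivatives\<close>

abbreviation has_partial :: "((nat \<Rightarrow> real) \<Rightarrow> real) \<Rightarrow> nat \<Rightarrow> (nat \<Rightarrow> real) \<Rightarrow> real \<Rightarrow> bool" where
  "has_partial f i x D \<equiv> ((\<lambda>t. f (x(i := t))) has_field_derivative D) (at (x i))"

lemma has_partial_imp: "has_partial f i x D \<Longrightarrow> partial i f x = D"
  by (simp add: partial_def DERIV_imp_deriv)

lemma has_partial_cong:
  assumes "open_dom p V" "x \<in> V" "i < p" "\<And>z. z \<in> V \<Longrightarrow> f z = g z"
  shows "has_partial f i x D \<longleftrightarrow> has_partial g i x D"
  by (rule DERIV_cong_ev) (use eventually_line[OF assms(1-3)] assms(4) in \<open>auto elim: eventually_mono\<close>)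

lemma partial_cong:
  assumes "open_dom p V" "x \<in> V" "i < p" "\<And>z. z \<in> V \<Longrightarrow> f z = g z"
  shows "partial i f x = partial i g x"
  unfolding partial_def
  by (rule deriv_cong_ev) (use eventually_line[OF assms(1-3)] assms(4) in \<open>auto elim: eventually_mono\<close>)

text \<open>The recursion peels off the derivative applied first, that is, the last index of the lists in \<open>smooth_fun\<close>.\<close>

primrec smoothn :: "nat \<Rightarrow> (nat \<Rightarrow> real) set \<Rightarrow> nat \<Rightarrow> ((nat \<Rightarrow> real) \<Rightarrow> real) \<Rightarrow> bool" where
  "smoothn p V 0 f \<longleftrightarrow> continuous_on V f"
| "smoothn p V (Suc n) f \<longleftrightarrow> continuous_on V f \<and>
     (\<forall>i<p. (\<forall>x\<in>V. has_partial f i x (partial i f x)) \<and> smoothn p V n (partial i f))"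

lemma smoothn_continuous: "smoothn p V n f \<Longrightarrow> continuous_on V f"
  by (cases n) auto

lemma smoothn_SucD: "smoothn p V (Suc n) f \<Longrightarrow> smoothn p V n f"
  by (induction n arbitrary: f) auto

lemma smoothn_cong:
  assumes V: "open_dom p V" and "\<And>x. x \<in> V \<Longrightarrow> f x = g x" "smoothn p V n f"
  shows "smoothn p V n g"
  using assms(2-3)
proof (induction n arbitrary: f g)
  case 0
  then show ?case using continuous_on_cong[of V V f g] by simp
next
  case (Suc n)
  have eq: "partial i g x = partial i f x" if "i < p" "x \<in> V" for i x
    using partial_cong[OF V that(2,1)] Suc.prems(1) by metis
  have "continuous_on V g" using Suc.prems continuous_on_cong[of V V f g] by simp
  moreover have "has_partial g i x (partial i g x)" if "i < p" "x \<in> V" for i x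
    using has_partial_cong[where f = f and g = g and D = "partial i f x", OF V that(2,1) Suc.prems(1)]
      Suc.prems(2) that by (simp add: eq[OF that])
  moreover have "smoothn p V n (partial i g)" if "i < p" for i
    using Suc.IH[of "partial i f" "partial i g"] Suc.prems eq that by simp
  ultimately show ?case by simp
qed

text \<open>A candidate \<open>g\<close> for the first derivatives replaces \<open>partial\<close>,
  so that closure properties become inductions on the order with explicit derivative
  formulas.\<close>

lemma smoothn_SucI:
  assumes V: "open_dom p V" and "continuous_on V f"
    and "\<And>i x. i < p \<Longrightarrow> x \<in> V \<Longrightarrow> has_partial f i x (g i x)"
    and "\<And>i. i < p \<Longrightarrow> smoothn p V n (g i)"
  shows "smoothn p V (Suc n) f"
proof -
  have "partial i f x = g i x" if "i < p" "x \<in> V" for i x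
    using assms(3)[OF that] has_partial_imp by blast
  then show ?thesis using assms smoothn_cong[OF V, of "g _" "partial _ f" n] by simp
qed

lemma smooth_fun_partial:
  assumes "smooth_fun p V f" "i < p" shows "smooth_fun p V (partial i f)"
  unfolding smooth_fun_def
proof (intro allI impI)
  fix us assume "set us \<subseteq> {..<p}"
  then have "set (us @ [i]) \<subseteq> {..<p}" using assms by simp
  then show "continuous_map (subtopology (Euclidean_space p) V) euclideanreal (foldr partial us (partial i f)) \<and>
        (\<forall>ia<p. \<forall>x\<in>V. (\<lambda>t. foldr partial us (partial i f) (x(ia := t))) field_differentiable at (x ia))"
    using assms(1)[unfolded smooth_fun_def, rule_format, of "us @ [i]"] by simp
qed

text \<open>The list in \<open>smooth_fun\<close> is consumed from its end, since the last index is
  differentiated first; hence the reverse induction in the direction from the recursion to the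
  lists.\<close>

lemma smooth_fun_iff:
  assumes V: "open_dom p V" shows "smooth_fun p V f \<longleftrightarrow> (\<forall>n. smoothn p V n f)"
proof (intro iffI allI)
  fix n assume "smooth_fun p V f"
  then show "smoothn p V n f"
  proof (induction n arbitrary: f)
    case (Suc n)
    have f: "continuous_on V (foldr partial [] f)"
      "\<And>i x. i < p \<Longrightarrow> x \<in> V \<Longrightarrow> (\<lambda>t. foldr partial [] f (x(i := t))) field_differentiable at (x i)"
      using Suc.prems unfolding smooth_fun_def continuous_map_open_dom[OF V, symmetric]
      by (metis empty_subsetI list.set(1))+
    then show ?case using smooth_fun_partial[OF Suc.prems] Suc.IH
      by (auto simp: partial_def DERIV_deriv_iff_field_differentiable)
  next
    case 0
    then show ?case unfolding smooth_fun_def continuous_map_open_dom[OF V]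
      by (metis empty_subsetI foldr.simps(1) id_apply list.set(1) smoothn.simps(1))
  qed
next
  assume f: "\<forall>n. smoothn p V n f"
  have s: "\<forall>n. smoothn p V n (foldr partial us f)" if "set us \<subseteq> {..<p}" for us
    using that f
  proof (induction us arbitrary: f rule: rev_induct)
    case (snoc i us)
    have "smoothn p V n (partial i f)" for n
      using snoc.prems(2)[rule_format, of "Suc n"] snoc.prems(1) by simp
    then show ?case using snoc.IH[of "partial i f"] snoc.prems(1) by simp
  qed simp
  show "smooth_fun p V f" unfolding smooth_fun_def continuous_map_open_dom[OF V]
  proof (intro allI impI conjI ballI)
    fix us assume "set us \<subseteq> {..<p}"
    from s[OF this, rule_format, of "Suc 0"] show "continuous_on V (foldr partial us f)" by simp
  next
    fix us i x assume us: "set us \<subseteq> {..<p}" and "i < p" "x \<in> V"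
    then show "(\<lambda>t. foldr partial us f (x(i := t))) field_differentiable at (x i)"
      using s[OF us, rule_format, of "Suc 0"] field_differentiable_def by fastforce
  qed
qed

lemma smooth_fun_continuous: "open_dom p V \<Longrightarrow> smooth_fun p V f \<Longrightarrow> continuous_on V f"
  using smooth_fun_iff smoothn_continuous by blast

lemma smooth_fun_has_partial:
  assumes "open_dom p V" "smooth_fun p V f" "i < p" "x \<in> V"
  shows "has_partial f i x (partial i f x)"
  using assms smooth_fun_iff[OF assms(1)] smoothn.simps(2) by metis

lemma smooth_fun_cong:
  "open_dom p V \<Longrightarrow> (\<And>x. x \<in> V \<Longrightarrow> f x = g x) \<Longrightarrow> smooth_fun p V f \<Longrightarrow> smooth_fun p V g"
  using smoothn_cong smooth_fun_iff by metis

lemma smoothn_const: "open_dom p V \<Longrightarrow> smoothn p V n (\<lambda>_. c)"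
proof (induction n arbitrary: c)
  case (Suc n)
  show ?case by (rule smoothn_SucI[where g = "\<lambda>_ _. 0"]) (use Suc in auto)
qed simp

lemma smoothn_add:
  assumes V: "open_dom p V" shows "smoothn p V n f \<Longrightarrow> smoothn p V n g \<Longrightarrow> smoothn p V n (\<lambda>x. f x + g x)"
proof (induction n arbitrary: f g)
  case (Suc n)
  show ?case
  proof (rule smoothn_SucI[OF V, where g = "\<lambda>i x. partial i f x + partial i g x"])
    fix i x assume "i < p" "x \<in> V"
    then have "has_partial f i x (partial i f x)" "has_partial g i x (partial i g x)" using Suc.prems by auto
    from DERIV_add[OF this] show "has_partial (\<lambda>x. f x + g x) i x (partial i f x + partial i g x)" .
  qed (use Suc in \<open>auto intro: continuous_on_add\<close>)
qed (auto intro: continuous_intros)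

lemma smoothn_mult:
  assumes V: "open_dom p V" shows "smoothn p V n f \<Longrightarrow> smoothn p V n g \<Longrightarrow> smoothn p V n (\<lambda>x. f x * g x)"
proof (induction n arbitrary: f g)
  case (Suc n)
  show ?case
  proof (rule smoothn_SucI[OF V, where g = "\<lambda>i x. partial i f x * g x + partial i g x * f x"])
    fix i x assume "i < p" "x \<in> V"
    then have "has_partial f i x (partial i f x)" "has_partial g i x (partial i g x)" using Suc.prems by auto
    from DERIV_mult[OF this] show "has_partial (\<lambda>x. f x * g x) i x (partial i f x * g x + partial i g x * f x)" by simp
  next
    fix i assume "i < p"
    then show "smoothn p V n (\<lambda>x. partial i f x * g x + partial i g x * f x)"
      using Suc.prems Suc.prems[THEN smoothn_SucD] by (intro smoothn_add[OF V] Suc.IH) simp_all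
  qed (use Suc.prems in \<open>auto intro: continuous_intros\<close>)
qed (auto intro: continuous_intros)

lemma smoothn_coord:
  assumes V: "open_dom p V" shows "smoothn p V n (\<lambda>x. x k)"
proof (cases n)
  case 0
  then show ?thesis by (auto intro: continuous_on_coord)
next
  case (Suc m)
  show ?thesis unfolding Suc
  proof (rule smoothn_SucI[OF V, where g = "\<lambda>i _. of_bool (i = k)"])
    fix i x show "has_partial (\<lambda>x. x k) i x (of_bool (i = k))" by (cases "i = k") auto
  qed (auto intro: continuous_on_coord smoothn_const[OF V])
qed

lemma smoothn_powr:
  assumes V: "open_dom p V" and pos: "\<And>x. x \<in> V \<Longrightarrow> f x > 0"
  shows "smoothn p V n f \<Longrightarrow> smoothn p V n (\<lambda>x. f x powr w)"
proof (induction n arbitrary: w)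
  case (Suc n)
  show ?case
  proof (rule smoothn_SucI[OF V, where g = "\<lambda>i x. w * (f x powr (w - 1) * partial i f x)"])
    fix i x assume ix: "i < p" "x \<in> V"
    then have "has_partial f i x (partial i f x)" using Suc.prems by auto
    from DERIV_fun_powr[OF this, of w] pos[OF ix(2)]
    show "has_partial (\<lambda>x. f x powr w) i x (w * (f x powr (w - 1) * partial i f x))" by (simp add: mult.assoc)
  next
    fix i assume "i < p"
    then show "smoothn p V n (\<lambda>x. w * (f x powr (w - 1) * partial i f x))"
      using Suc.prems Suc.IH[OF smoothn_SucD[OF Suc.prems]]
      by (intro smoothn_mult[OF V] smoothn_const[OF V]) auto
  next
    show "continuous_on V (\<lambda>x. f x powr w)" using Suc.prems pos
      by (intro continuous_on_powr continuous_on_const) (auto simp: order_less_le)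
  qed
next
  case 0
  then show ?case using pos by (auto intro!: continuous_on_powr continuous_on_const simp: order_less_le)
qed

lemma smoothn_inverse:
  assumes V: "open_dom p V" and nz: "\<And>x. x \<in> V \<Longrightarrow> f x \<noteq> 0"
  shows "smoothn p V n f \<Longrightarrow> smoothn p V n (\<lambda>x. 1 / f x)"
proof (induction n)
  case (Suc n)
  show ?case
  proof (rule smoothn_SucI[OF V, where g = "\<lambda>i x. (-1) * ((1 / f x) * ((1 / f x) * partial i f x))"])
    fix i x assume ix: "i < p" "x \<in> V"
    then have "has_partial f i x (partial i f x)" using Suc.prems by auto
    from DERIV_inverse_fun[OF this] nz[OF ix(2)]
    show "has_partial (\<lambda>x. 1 / f x) i x ((-1) * ((1 / f x) * ((1 / f x) * partial i f x)))"
      by (simp add: divide_inverse mult_ac)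
  next
    fix i assume "i < p"
    then show "smoothn p V n (\<lambda>x. (-1) * ((1 / f x) * ((1 / f x) * partial i f x)))"
      using Suc.prems Suc.IH[OF smoothn_SucD[OF Suc.prems]]
      by (intro smoothn_mult[OF V] smoothn_const[OF V]) auto
  next
    show "continuous_on V (\<lambda>x. 1 / f x)"
      using smoothn_continuous[OF Suc.prems] nz by (intro continuous_on_divide continuous_on_const) auto
  qed
next
  case 0
  then show ?case using nz by (auto intro!: continuous_on_divide continuous_on_const)
qed

text \<open>\<open>h\<close> is the whole sequence of successive derivatives of a real function;
  generalising over \<open>k\<close> lets the induction pass from \<open>h k\<close> to
  \<open>h (Suc k)\<close>.\<close>

lemma smoothn_compose:
  assumes V: "open_dom p V" and h: "\<And>k t. (h k has_field_derivative h (Suc k) t) (at t)"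
  shows "smoothn p V n f \<Longrightarrow> smoothn p V n (\<lambda>x. (h k :: real \<Rightarrow> real) (f x))"
proof (induction n arbitrary: k)
  case 0
  have "continuous_on UNIV (h k)" by (auto intro!: continuous_at_imp_continuous_on DERIV_isCont h)
  then show ?case using 0 continuous_on_compose2[of UNIV "h k" V f] by simp
next
  case (Suc n)
  have "continuous_on UNIV (h k)" by (auto intro!: continuous_at_imp_continuous_on DERIV_isCont h)
  then have c: "continuous_on V (\<lambda>x. h k (f x))" using Suc.prems continuous_on_compose2[of UNIV "h k" V f] by simp
  show ?case
  proof (rule smoothn_SucI[OF V c, where g = "\<lambda>i x. h (Suc k) (f x) * partial i f x"])
    fix i x assume ix: "i < p" "x \<in> V"
    then have "has_partial f i x (partial i f x)" using Suc.prems by auto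
    from DERIV_chain2[OF h this, of k] show "has_partial (\<lambda>x. h k (f x)) i x (h (Suc k) (f x) * partial i f x)"
      by simp
  next
    fix i assume "i < p"
    then show "smoothn p V n (\<lambda>x. h (Suc k) (f x) * partial i f x)"
      using Suc.prems Suc.IH[OF smoothn_SucD[OF Suc.prems]] by (intro smoothn_mult[OF V]) auto
  qed
qed

lemma smoothn_subset:
  assumes "smoothn p V n f" "V' \<subseteq> V" shows "smoothn p V' n f"
  using assms(1) by (induction n arbitrary: f) (use assms(2) continuous_on_subset in \<open>auto simp: subset_iff\<close>)

text \<open>Partial derivatives at a point see only a neighbourhood. The topological content is in
  order zero: a relatively open subset has the same limit filter at each of its points.\<close>

lemma smoothn_local:
  assumes V: "open_dom p V" and "\<And>x. x \<in> V \<Longrightarrow> \<exists>V'. open_dom p V' \<and> x \<in> V' \<and> V' \<subseteq> V \<and> smoothn p V' n f"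
  shows "smoothn p V n f"
  using assms(2)
proof (induction n arbitrary: f)
  case 0
  show ?case unfolding smoothn.simps continuous_on_eq_continuous_within
  proof
    fix x assume "x \<in> V"
    then obtain V' where V': "open_dom p V'" "x \<in> V'" "V' \<subseteq> V" "continuous_on V' f" using 0 by auto
    have "openin (top_of_set V) V'"
      using V V'(1,3) by (auto simp: open_dom_iff openin_open)
    then obtain T where "open T" "V' = V \<inter> T" by (auto simp: openin_open)
    then have "at x within V' = at x within V" using V'(2)
      by (intro at_within_nhd[of x T]) auto
    then show "continuous (at x within V) f"
      using V'(2,4) continuous_on_eq_continuous_within[of V' f] unfolding continuous_within by auto
  qed
next
  case (Suc n)
  have c: "smoothn p V n f"
  proof (rule Suc.IH)
    fix x assume "x \<in> V"
    from Suc.prems[OF this] obtain V' where "open_dom p V'" "x \<in> V'" "V' \<subseteq> V" "smoothn p V' (Suc n) f" by blast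
    then show "\<exists>V'. open_dom p V' \<and> x \<in> V' \<and> V' \<subseteq> V \<and> smoothn p V' n f" using smoothn_SucD[of p V' n f] by (intro exI[of _ V']) simp
  qed
  show ?case
  proof (rule smoothn_SucI[OF V smoothn_continuous[OF c], where g = "\<lambda>i. partial i f"])
    fix i x assume "i < p" "x \<in> V"
    then show "has_partial f i x (partial i f x)" using Suc.prems[of x] by auto
  next
    fix i assume "i < p"
    show "smoothn p V n (partial i f)"
    proof (rule Suc.IH)
      fix x assume "x \<in> V"
      then show "\<exists>V'. open_dom p V' \<and> x \<in> V' \<and> V' \<subseteq> V \<and> smoothn p V' n (partial i f)"
        using Suc.prems[of x] \<open>i < p\<close> by auto
    qed
  qed
qed

subsection \<open>Hadamard's lemma on a box\<close>

text \<open>A cube rather than a ball: it is stable under moving single coordinates to the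
  corresponding coordinate of the centre, which is how Hadamard's lemma travels.\<close>

definition box_dom :: "nat \<Rightarrow> (nat \<Rightarrow> real) \<Rightarrow> real \<Rightarrow> (nat \<Rightarrow> real) set" where
  "box_dom p y r = {z. (\<forall>i\<ge>p. z i = 0) \<and> (\<forall>i<p. \<bar>z i - y i\<bar> < r)}"

lemma open_box_dom: "open_dom p (box_dom p y r)"
proof -
  let ?T = "\<Inter>i\<in>{..<p}. {z. \<bar>z i - y i\<bar> < r}"
  have "open ?T"
    by (intro open_INT ballI open_Collect_less continuous_on_rabs continuous_on_diff continuous_on_const
        continuous_on_coord) auto
  moreover have "box_dom p y r = {x. \<forall>i\<ge>p. x i = 0} \<inter> ?T" by (auto simp: box_dom_def)
  ultimately show ?thesis unfolding open_dom_iff by blast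
qed

lemma box_dom_neighbourhood:
  assumes "open_dom p V" "y \<in> V" shows "\<exists>r>0. box_dom p y r \<subseteq> V"
proof -
  obtain T where T: "open T" "V = {x. \<forall>i\<ge>p. x i = 0} \<inter> T" using assms(1) by (auto simp: open_dom_iff)
  from T(1) have "openin (product_topology (\<lambda>_. euclidean) UNIV) T"
    by (metis euclidean_product_topology open_openin)
  then obtain X where X: "y \<in> Pi\<^sub>E UNIV X" "\<And>i. open (X i)" "finite {i. X i \<noteq> UNIV}" "Pi\<^sub>E UNIV X \<subseteq> T"
    using product_topology_open_contains_basis[of "\<lambda>_. euclidean" UNIV T y] assms(2)
    T(2) by auto
  have "\<exists>r>0. \<forall>t. \<bar>t - y i\<bar> < r \<longrightarrow> t \<in> X i" for i
    using X(2)[of i] X(1) by (auto simp: open_dist dist_real_def PiE_iff)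
  then obtain r where r: "\<And>i. r i > 0" "\<And>i t. \<bar>t - y i\<bar> < r i \<Longrightarrow> t \<in> X i" by metis
  \<comment> \<open>The entry 1 keeps the minimum defined for \<open>p = 0\<close>. Coordinates from
    \<open>p\<close> on impose no bound, as they are zero for both points.\<close>
  define R where "R = Min (insert 1 (r ` {..<p}))"
  have R: "R > 0" "\<And>i. i < p \<Longrightarrow> R \<le> r i" using r(1) by (auto simp: R_def)
  have "box_dom p y R \<subseteq> V"
  proof
    fix z assume z: "z \<in> box_dom p y R"
    have "z i \<in> X i" for i
    proof (cases "i < p")
      case True
      then show ?thesis using z R(2)[OF True] by (intro r(2)) (auto simp: box_dom_def)
    next
      case False
      then have "z i = y i" using z assms T by (auto simp: box_dom_def)
      then show ?thesis using X(1) by (auto simp: PiE_iff)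
    qed
    then have "z \<in> T" using X(4) by (auto simp: PiE_iff)
    then show "z \<in> V" using z T by (auto simp: box_dom_def)
  qed
  then show ?thesis using R(1) by blast
qed

definition contract :: "(nat \<Rightarrow> real) \<Rightarrow> nat \<Rightarrow> real \<Rightarrow> (nat \<Rightarrow> real) \<Rightarrow> nat \<Rightarrow> real" where
  "contract y k t z = z(k := y k + t * (z k - y k))"

lemma box_dom_contract:
  assumes "z \<in> box_dom p y r" "k < p" "0 \<le> t" "t \<le> 1"
  shows "contract y k t z \<in> box_dom p y r"
proof -
  have "\<bar>t * (z k - y k)\<bar> \<le> 1 * \<bar>z k - y k\<bar>"
    using assms(3,4) unfolding abs_mult by (intro mult_right_mono) auto
  moreover have "\<bar>z k - y k\<bar> < r" using assms by (simp add: box_dom_def)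
  ultimately have "\<bar>t * (z k - y k)\<bar> < r" by (simp only: mult_1)
  then show ?thesis using assms by (auto simp: box_dom_def contract_def)
qed

lemma continuous_on_contract:
  assumes c: "continuous_on (box_dom p y r) h" and k: "k < p"
  shows "continuous_on (box_dom p y r \<times> cbox 0 1) (\<lambda>(z, t). t ^ m * h (contract y k t z))"
proof -
  let ?c = "\<lambda>u. contract y k (snd u) (fst u)"
  have "continuous_on (box_dom p y r \<times> cbox 0 1) ?c"
  proof (rule continuous_on_coordinatewise_then_product)
    fix i show "continuous_on (box_dom p y r \<times> cbox 0 1) (\<lambda>u. ?c u i)"
      by (cases "i = k") (auto simp: contract_def intro!: continuous_intros continuous_on_coordinate[OF continuous_on_fst[OF continuous_on_id]])
  qed
  moreover have "?c ` (box_dom p y r \<times> cbox 0 1) \<subseteq> box_dom p y r"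
    using box_dom_contract[OF _ k] by auto
  ultimately have "continuous_on (box_dom p y r \<times> cbox 0 1) (\<lambda>u. h (?c u))"
    using continuous_on_compose2[OF c] by blast
  then have "continuous_on (box_dom p y r \<times> cbox 0 1) (\<lambda>u. snd u ^ m * h (?c u))"
    by (intro continuous_on_mult continuous_on_power continuous_on_snd continuous_on_id) auto
  then show ?thesis by (simp add: case_prod_beta')
qed

text \<open>Differentiating in the contracted coordinate brings out another factor \<open>t\<close>.
  The weight \<open>t ^ m\<close> is carried along so that this class of integrals is closed under
  differentiation.\<close>

lemma smoothn_parametric_integral:
  assumes k: "k < p"
  shows "smoothn p (box_dom p y r) n h \<Longrightarrow>
    smoothn p (box_dom p y r) n (\<lambda>z. integral (cbox 0 1) (\<lambda>t. t ^ m * h (contract y k t z)))"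
proof (induction n arbitrary: h m)
  case 0
  then show ?case using integral_continuous_on_param[OF continuous_on_contract[OF _ k]] by simp
next
  case (Suc n)
  let ?B = "box_dom p y r"
  have V: "open_dom p ?B" by (rule open_box_dom)
  have ch: "continuous_on ?B h" using Suc.prems smoothn_continuous by blast
  let ?g = "\<lambda>i z. integral (cbox 0 1)
     (\<lambda>t. t ^ (if i = k then Suc m else m) * partial i h (contract y k t z))"
  show ?case
  proof (rule smoothn_SucI[OF V, where g = ?g])
    show "continuous_on ?B (\<lambda>z. integral (cbox 0 1) (\<lambda>t. t ^ m * h (contract y k t z)))"
      using integral_continuous_on_param[OF continuous_on_contract[OF ch k]] by simp
    fix i assume i: "i < p"
    then show "smoothn p ?B n (?g i)" using Suc by simp
    fix x assume x: "x \<in> ?B"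
    \<comment> \<open>Differentiation under the integral sign is applied over a convex parameter
      set: the interval cut out of the box in direction \<open>i\<close>.\<close>
    define U where "U = {s. \<bar>s - y i\<bar> < r}"
    have U: "open U" "convex U" "x i \<in> U"
    proof -
      have "U = ball (y i) r" by (auto simp: U_def dist_real_def abs_minus_commute)
      then show "open U" "convex U" by simp_all
      show "x i \<in> U" using x i by (simp add: U_def box_dom_def)
    qed
    have xU: "x(i := s) \<in> ?B" if "s \<in> U" for s using that x i by (auto simp: U_def box_dom_def)
    have cp: "continuous_on ?B (partial i h)" using Suc.prems i smoothn_continuous by auto
    have hp: "has_partial h i z (partial i h z)" if "z \<in> ?B" for z using Suc.prems i that by auto
    let ?c = "\<lambda>s t. contract y k t (x(i := s))"
    let ?m = "if i = k then Suc m else m"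
    have der: "((\<lambda>s. t ^ m * h (?c s t)) has_field_derivative t ^ ?m * partial i h (?c s t)) (at s within U)"
      if s: "s \<in> U" and t: "t \<in> cbox 0 1" for s t
    proof -
      have cB: "?c s t \<in> ?B" using box_dom_contract[OF xU[OF s] k] t by simp
      have "((\<lambda>s. h (?c s t)) has_field_derivative (if i = k then t else 1) * partial i h (?c s t)) (at s)"
      proof (cases "i = k")
        case True
        have c: "((\<lambda>s. y k + t * (s - y k)) has_field_derivative t) (at s)"
          by (auto intro!: derivative_eq_intros)
        have "((\<lambda>v. h (x(i := v))) has_field_derivative partial i h (?c s t)) (at (y k + t * (s - y k)))"
          using hp[OF cB] True by (simp add: contract_def)
        from DERIV_chain2[OF this c] have "((\<lambda>s. h (x(i := y k + t * (s - y k)))) has_field_derivative partial i h (?c s t) * t) (at s)" .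
        then show ?thesis using True by (simp add: contract_def mult.commute)
      next
        case False
        have "?c s t = (x(k := y k + t * (x k - y k)))(i := s)" for s
          using False by (auto simp: fun_upd_twist contract_def)
        then show ?thesis using hp[OF cB] False by simp
      qed
      from DERIV_cmult[OF this, of "t ^ m"] have "((\<lambda>s. t ^ m * h (?c s t)) has_field_derivative
          t ^ ?m * partial i h (?c s t)) (at s)"
        by (cases "i = k") (simp_all add: mult_ac)
      then show ?thesis by (rule has_field_derivative_at_within)
    qed
    have "((\<lambda>s. integral (cbox 0 1) (\<lambda>t. t ^ m * h (?c s t))) has_field_derivative
      integral (cbox 0 1) (\<lambda>t. t ^ ?m * partial i h (?c (x i) t))) (at (x i) within U)"
    proof (rule leibniz_rule_field_derivative[OF der _ _ U(3,2)])
      fix s assume s: "s \<in> U"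
      have "continuous_on (cbox 0 1) (\<lambda>t. (\<lambda>(z, t). t ^ m * h (contract y k t z)) (x(i := s), t))"
        using xU[OF s] by (intro continuous_on_compose2[OF continuous_on_contract[OF ch k]] continuous_intros) auto
      then show "(\<lambda>t. t ^ m * h (?c s t)) integrable_on cbox 0 1"
        using integrable_continuous[of 0 1 "\<lambda>t. t ^ m * h (?c s t)"] by simp
    next
      have "continuous_on (U \<times> cbox 0 1) (\<lambda>u. (\<lambda>(z, t). t ^ ?m * partial i h (contract y k t z)) (x(i := fst u), snd u))"
      proof (rule continuous_on_compose2[OF continuous_on_contract[OF cp k]])
        show "continuous_on (U \<times> cbox 0 1) (\<lambda>u::real \<times> real. (x(i := fst u), snd u))"
          by (intro continuous_on_Pair continuous_on_compose2[OF continuous_on_fun_upd_const[of UNIV]]) (auto intro: continuous_intros)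
      qed (use xU in auto)
      then show "continuous_on (U \<times> cbox 0 1) (\<lambda>(s, t). t ^ ?m * partial i h (?c s t))"
        by (simp add: case_prod_beta')
    qed
    then show "has_partial (\<lambda>z. integral (cbox 0 1) (\<lambda>t. t ^ m * h (contract y k t z))) i x (?g i x)"
      using at_within_open[OF U(3,1)] by simp
  qed
qed

text \<open>The vertices of the axis-parallel path from \<open>z\<close> to \<open>y\<close>: the
  coordinates below \<open>k\<close> have already reached their final values.\<close>

definition freeze :: "(nat \<Rightarrow> real) \<Rightarrow> nat \<Rightarrow> (nat \<Rightarrow> real) \<Rightarrow> nat \<Rightarrow> real" where
  "freeze y k z = (\<lambda>i. if i < k then y i else z i)"

lemma freeze_box: "z \<in> box_dom p y r \<Longrightarrow> r > 0 \<Longrightarrow> freeze y k z \<in> box_dom p (y :: nat \<Rightarrow> real) r"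
  if "\<forall>i\<ge>p. y i = 0"
  using that by (auto simp: box_dom_def freeze_def)

lemma smoothn_freeze:
  assumes r: "r > 0" and y: "\<forall>i\<ge>p. y i = 0"
  shows "smoothn p (box_dom p y r) n h \<Longrightarrow> smoothn p (box_dom p y r) n (\<lambda>z. h (freeze y k z))"
proof (induction n arbitrary: h)
  case 0
  have "continuous_on (box_dom p y r) (freeze y k)"
  proof (rule continuous_on_coordinatewise_then_product)
    fix i show "continuous_on (box_dom p y r) (\<lambda>z. freeze y k z i)"
      by (cases "i < k") (auto simp: freeze_def intro: continuous_on_coord)
  qed
  then show ?case using continuous_on_compose2[of "box_dom p y r" h] 0 freeze_box[OF y _ r] by auto
next
  case (Suc n)
  let ?B = "box_dom p y r"
  have V: "open_dom p ?B" by (rule open_box_dom)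
  show ?case
  proof (rule smoothn_SucI[OF V, where g = "\<lambda>i z. of_bool (\<not> i < k) * partial i h (freeze y k z)"])
    show "continuous_on ?B (\<lambda>z. h (freeze y k z))"
      using Suc.IH[OF smoothn_SucD[OF Suc.prems]] smoothn_continuous by blast
    fix i assume i: "i < p"
    then show "smoothn p ?B n (\<lambda>z. of_bool (\<not> i < k) * partial i h (freeze y k z))"
      using Suc by (intro smoothn_mult[OF V] smoothn_const[OF V] Suc.IH) auto
    fix x assume x: "x \<in> ?B"
    show "has_partial (\<lambda>z. h (freeze y k z)) i x (of_bool (\<not> i < k) * partial i h (freeze y k x))"
    proof (cases "i < k")
      case True
      then have "freeze y k (x(i := t)) = freeze y k x" for t by (auto simp: freeze_def)
      then show ?thesis using True by simp
    next
      case False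
      then have "freeze y k (x(i := t)) = (freeze y k x)(i := t)" "freeze y k x i = x i" for t
        by (auto simp: freeze_def)
      moreover have "has_partial h i (freeze y k x) (partial i h (freeze y k x))"
        using Suc.prems i freeze_box[OF y x r] by auto
      ultimately show ?thesis using False by simp
    qed
  qed
qed

text \<open>Along each leg of the axis-parallel path the increment is \<open>z k - y k\<close> times
  the average of one partial derivative, by the fundamental theorem of calculus. These averages are
  smooth as parametric integrals, and the increments telescope.\<close>

lemma Hadamard:
  assumes r: "r > 0" and y: "\<forall>i\<ge>p. y i = 0" and f: "smooth_fun p (box_dom p y r) f"
  shows "\<exists>g. (\<forall>k<p. smooth_fun p (box_dom p y r) (g k)) \<and>
    (\<forall>z\<in>box_dom p y r. f z = f y + (\<Sum>k<p. (z k - y k) * g k z))"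
proof (intro exI conjI ballI allI impI)
  let ?B = "box_dom p y r"
  let ?G = "\<lambda>k z. integral (cbox 0 1) (\<lambda>t. t ^ 0 * partial k f (contract y k t z))"
  have V: "open_dom p ?B" by (rule open_box_dom)
  fix k assume "k < p"
  then show "smooth_fun p ?B (\<lambda>z. ?G k (freeze y k z))"
    using smooth_fun_partial[OF f] unfolding smooth_fun_iff[OF V]
    by (intro allI smoothn_freeze[OF r y] smoothn_parametric_integral) auto
next
  let ?B = "box_dom p y r"
  let ?G = "\<lambda>k z. integral (cbox 0 1) (\<lambda>t. t ^ 0 * partial k f (contract y k t z))"
  have V: "open_dom p ?B" by (rule open_box_dom)
  fix z assume z: "z \<in> ?B"
  have step: "f z - f (z(k := y k)) = (z k - y k) * ?G k z" if z: "z \<in> ?B" and k: "k < p" for z k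
  proof -
    let ?c = "\<lambda>t. contract y k t z"
    have "((\<lambda>t. (z k - y k) * partial k f (?c t)) has_integral f (?c 1) - f (?c 0)) {0..1}"
    proof (rule fundamental_theorem_of_calculus)
      fix t :: real assume t: "t \<in> {0..1}"
      then have cB: "?c t \<in> ?B" using box_dom_contract[OF z k] by simp
      have "((\<lambda>v. f (z(k := v))) has_field_derivative partial k f (?c t)) (at (y k + t * (z k - y k)))"
        using smooth_fun_has_partial[OF V f k cB] by (simp add: contract_def)
      moreover have "((\<lambda>t. y k + t * (z k - y k)) has_field_derivative (z k - y k)) (at t)"
        by (auto intro!: derivative_eq_intros)
      ultimately have "((\<lambda>t. f (?c t)) has_field_derivative partial k f (?c t) * (z k - y k)) (at t)"
        unfolding contract_def by (rule DERIV_chain2)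
      then show "((\<lambda>t. f (?c t)) has_vector_derivative (z k - y k) * partial k f (?c t)) (at t within {0..1})"
        by (simp add: has_real_derivative_iff_has_vector_derivative mult.commute has_vector_derivative_at_within)
    qed simp
    then have "integral {0..1} (\<lambda>t. (z k - y k) * partial k f (?c t)) = f (?c 1) - f (?c 0)"
      by (rule integral_unique)
    then show ?thesis by (simp add: contract_def)
  qed
  have "f z - f (freeze y j z) = (\<Sum>k<j. (z k - y k) * ?G k (freeze y k z))" if "j \<le> p" for j
    using that
  proof (induction j)
    case 0
    then show ?case by (simp add: freeze_def)
  next
    case (Suc j)
    have "f (freeze y j z) - f ((freeze y j z)(j := y j)) = (freeze y j z j - y j) * ?G j (freeze y j z)"
      using Suc.prems by (intro step freeze_box[OF y z r]) auto
    moreover have "(freeze y j z)(j := y j) = freeze y (Suc j) z" "freeze y j z j = z j"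
      by (auto simp: freeze_def)
    ultimately show ?case using Suc by simp
  qed
  from this[of p] have "f z - f (freeze y p z) = (\<Sum>k<p. (z k - y k) * ?G k (freeze y k z))" by simp
  moreover have "freeze y p z = y" using z y by (auto simp: freeze_def box_dom_def)
  ultimately show "f z = f y + (\<Sum>k<p. (z k - y k) * ?G k (freeze y k z))" by simp
qed

subsection \<open>A flat function and bump functions\<close>

text \<open>The polynomial in \<open>1 / t\<close> makes the family closed under differentiation, so
  all derivatives of the extension of \<open>exp (- (1 / t))\<close> by zero are treated at
  once.\<close>

definition flat :: "real poly \<Rightarrow> real \<Rightarrow> real" where
  "flat P t = (if t > 0 then poly P (1 / t) * exp (- (1 / t)) else 0)"

lemma poly_exp_tendsto: "((\<lambda>s. poly P s * exp (- s)) \<longlongrightarrow> 0) (at_top :: real filter)"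
proof -
  have "((\<lambda>s. \<Sum>i\<le>degree P. coeff P i * (s ^ i / exp s)) \<longlongrightarrow> (\<Sum>i\<le>degree P. coeff P i * 0)) (at_top :: real filter)"
    by (intro tendsto_sum tendsto_mult tendsto_const tendsto_power_div_exp_0)
  moreover have "(\<Sum>i\<le>degree P. coeff P i * (s ^ i / exp s)) = poly P s * exp (- s)" for s
    by (simp add: poly_altdef sum_distrib_right exp_minus divide_inverse mult.assoc)
  ultimately show ?thesis by simp
qed

lemma flat_tendsto: "((flat P) \<longlongrightarrow> 0) (at_right 0)"
proof -
  have "((\<lambda>t. poly P (1 / t) * exp (- (1 / t))) \<longlongrightarrow> 0) (at_right (0::real))"
    using filterlim_compose[OF poly_exp_tendsto filterlim_inverse_at_top_right] by (simp add: divide_inverse)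
  moreover have "\<forall>\<^sub>F t in at_right 0. poly P (1 / t) * exp (- (1 / t)) = flat P t"
    using eventually_at_right_less by (rule eventually_mono) (simp add: flat_def)
  ultimately show ?thesis by (rule Lim_transform_eventually)
qed

text \<open>\<open>monom 1 2\<close> is the square of \<open>1 / t\<close> from the inner
  derivative, and \<open>P - pderiv P\<close> collects what the exponential and the polynomial
  contribute.\<close>

lemma flat_deriv: "(flat P has_field_derivative flat (monom 1 2 * (P - pderiv P)) t) (at t)"
proof -
  consider "t > 0" | "t < 0" | "t = 0" by linarith
  then show ?thesis
  proof cases
    case 1
    have "((\<lambda>t. poly P (1 / t) * exp (- (1 / t))) has_field_derivative
        flat (monom 1 2 * (P - pderiv P)) t) (at t)"
      using 1 by (auto intro!: derivative_eq_intros simp: flat_def poly_monom field_simps power2_eq_square)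
    moreover have "\<forall>\<^sub>F s in nhds t. flat P s = poly P (1 / s) * exp (- (1 / s))"
      using eventually_nhds_in_open[of "{0<..}" t] 1 by (auto simp: flat_def elim: eventually_mono)
    ultimately show ?thesis using DERIV_cong_ev[of t t "flat P"] by simp
  next
    case 2
    have "\<forall>\<^sub>F s in nhds t. flat P s = 0"
      using eventually_nhds_in_open[of "{..<0}" t] 2 by (auto simp: flat_def elim: eventually_mono)
    then show ?thesis using DERIV_cong_ev[of t t "flat P" "\<lambda>_. 0"] 2 by (simp add: flat_def)
  next
    case 3
    have "((\<lambda>h. (flat P (0 + h) - flat P 0) / h) \<longlongrightarrow> 0) (at 0)"
    proof (rule filterlim_split_at)
      have "\<forall>\<^sub>F h in at_left (0::real). 0 = (flat P (0 + h) - flat P 0) / h"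
        by (simp add: flat_def eventually_at_filter)
      then show "((\<lambda>h. (flat P (0 + h) - flat P 0) / h) \<longlongrightarrow> 0) (at_left 0)"
        by (rule Lim_transform_eventually[OF tendsto_const])
    next
      \<comment> \<open>Division by \<open>h\<close> multiplies the polynomial by its variable, so
        the difference quotient at zero is again flat and tends to zero.\<close>
      have "\<forall>\<^sub>F h in at_right 0. flat (pCons 0 P) h = (flat P (0 + h) - flat P 0) / h"
        using eventually_at_right_less by (rule eventually_mono) (simp add: flat_def)
      then show "((\<lambda>h. (flat P (0 + h) - flat P 0) / h) \<longlongrightarrow> 0) (at_right 0)"
        by (rule Lim_transform_eventually[OF flat_tendsto])
    qed
    then have "(flat P has_field_derivative 0) (at 0)" by (simp add: DERIV_def)
    then show ?thesis using 3 by (simp add: flat_def)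
  qed
qed

lemma smooth_fun_const: "open_dom p V \<Longrightarrow> smooth_fun p V (\<lambda>_. c)"
  using smooth_fun_iff smoothn_const by blast

lemma smooth_fun_coord: "open_dom p V \<Longrightarrow> smooth_fun p V (\<lambda>x. x k)"
  using smooth_fun_iff smoothn_coord by blast

lemma smooth_fun_add:
  "open_dom p V \<Longrightarrow> smooth_fun p V f \<Longrightarrow> smooth_fun p V g \<Longrightarrow> smooth_fun p V (\<lambda>x. f x + g x)"
  using smooth_fun_iff[of p V] smoothn_add[of p V] by meson

lemma smooth_fun_mult:
  "open_dom p V \<Longrightarrow> smooth_fun p V f \<Longrightarrow> smooth_fun p V g \<Longrightarrow> smooth_fun p V (\<lambda>x. f x * g x)"
  using smooth_fun_iff[of p V] smoothn_mult[of p V] by meson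

lemma smooth_fun_cmult: "open_dom p V \<Longrightarrow> smooth_fun p V f \<Longrightarrow> smooth_fun p V (\<lambda>x. c * f x)"
  using smooth_fun_mult[where f = "\<lambda>_. c", OF _ smooth_fun_const] .

lemma smooth_fun_diff:
  "open_dom p V \<Longrightarrow> smooth_fun p V f \<Longrightarrow> smooth_fun p V g \<Longrightarrow> smooth_fun p V (\<lambda>x. f x - g x)"
  using smooth_fun_add[of p V f "\<lambda>x. (-1) * g x"] smooth_fun_cmult[of p V g "-1"] by simp

lemma smooth_fun_sum:
  assumes V: "open_dom p V"
  shows "(\<And>a. a \<in> A \<Longrightarrow> smooth_fun p V (f a)) \<Longrightarrow> smooth_fun p V (\<lambda>x. \<Sum>a\<in>A. f a x)"
proof (induction A rule: infinite_finite_induct)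
  case (insert a A)
  then show ?case using smooth_fun_add[OF V, of "f a" "\<lambda>x. \<Sum>a\<in>A. f a x"] by simp
qed (simp_all add: smooth_fun_const[OF V])

lemma smooth_fun_power:
  assumes V: "open_dom p V" shows "smooth_fun p V f \<Longrightarrow> smooth_fun p V (\<lambda>x. f x ^ n)"
  by (induction n) (simp_all add: smooth_fun_const[OF V] smooth_fun_mult[OF V])

lemma smooth_fun_powr:
  "open_dom p V \<Longrightarrow> (\<And>x. x \<in> V \<Longrightarrow> f x > 0) \<Longrightarrow> smooth_fun p V f \<Longrightarrow> smooth_fun p V (\<lambda>x. f x powr w)"
  by (simp add: smooth_fun_iff smoothn_powr)

lemma smooth_fun_divide1:
  "open_dom p V \<Longrightarrow> (\<And>x. x \<in> V \<Longrightarrow> f x \<noteq> 0) \<Longrightarrow> smooth_fun p V f \<Longrightarrow> smooth_fun p V (\<lambda>x. 1 / f x)"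
  by (simp add: smooth_fun_iff smoothn_inverse)

lemma smooth_fun_subset:
  "open_dom p V \<Longrightarrow> open_dom p V' \<Longrightarrow> V' \<subseteq> V \<Longrightarrow> smooth_fun p V f \<Longrightarrow> smooth_fun p V' f"
  using smooth_fun_iff[of p V] smooth_fun_iff[of p V'] smoothn_subset[of p V] by simp

lemma smooth_fun_local:
  assumes V: "open_dom p V" and "\<And>x. x \<in> V \<Longrightarrow> \<exists>V'. open_dom p V' \<and> x \<in> V' \<and> V' \<subseteq> V \<and> smooth_fun p V' f"
  shows "smooth_fun p V f"
  unfolding smooth_fun_iff[OF V]
proof
  fix n show "smoothn p V n f"
  proof (rule smoothn_local[OF V])
    fix x assume "x \<in> V"
    then obtain V' where "open_dom p V'" "x \<in> V'" "V' \<subseteq> V" "smooth_fun p V' f" using assms(2) by blast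
    then show "\<exists>V'. open_dom p V' \<and> x \<in> V' \<and> V' \<subseteq> V \<and> smoothn p V' n f" using smooth_fun_iff[of p V'] by auto
  qed
qed

definition closed_box :: "nat \<Rightarrow> (nat \<Rightarrow> real) \<Rightarrow> real \<Rightarrow> (nat \<Rightarrow> real) set" where
  "closed_box p y r = {z. (\<forall>i\<ge>p. z i = 0) \<and> (\<forall>i<p. \<bar>z i - y i\<bar> \<le> r)}"

text \<open>Tychonoff's theorem, with the factor \<open>{0}\<close> for every coordinate from
  \<open>p\<close> on.\<close>

lemma compactin_closed_box: "compactin (Euclidean_space p) (closed_box p y r)"
proof -
  have eq: "closed_box p y r = Pi\<^sub>E UNIV (\<lambda>i. if i < p then {y i - r..y i + r} else {0})" (is "_ = ?R")
  proof (intro subset_antisym subsetI)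
    fix z assume z: "z \<in> closed_box p y r"
    have "z i \<in> (if i < p then {y i - r..y i + r} else {0})" for i
      using z by (cases "i < p") (auto simp: closed_box_def abs_le_iff)
    then show "z \<in> ?R" by (simp add: PiE_iff)
  next
    fix z assume "z \<in> ?R"
    then have z: "z i \<in> (if i < p then {y i - r..y i + r} else {0})" for i by (simp add: PiE_iff)
    have "z i = 0" if "i \<ge> p" for i using z[of i] that by simp
    moreover have "\<bar>z i - y i\<bar> \<le> r" if "i < p" for i using z[of i] that by (auto simp: abs_le_iff)
    ultimately show "z \<in> closed_box p y r" by (simp add: closed_box_def)
  qed
  have "compactin (powertop_real UNIV) (closed_box p y r)"
    unfolding eq compactin_PiE by auto
  then show ?thesis unfolding Euclidean_space_def by (auto simp: compactin_subtopology closed_box_def)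
qed

text \<open>The flat function of \<open>r\<^sup>2\<close> minus the squared distance to
  \<open>y\<close>. It is not constant near \<open>y\<close>, but the squared distance is critical
  there; a positive value with vanishing first derivatives is enough for cutting off coordinates in
  the weight argument.\<close>

lemma bump_function:
  assumes V: "open_dom p V" and r: "r > 0"
  obtains b :: "(nat \<Rightarrow> real) \<Rightarrow> real" where "smooth_fun p V b" "b y > 0" "\<And>k. k < p \<Longrightarrow> partial k b y = 0"
    "\<And>z. z \<in> V \<Longrightarrow> z \<notin> closed_box p y r \<Longrightarrow> b z = 0"
proof
  define P where "P k = ((\<lambda>P. monom 1 2 * (P - pderiv P)) ^^ k) [:1::real:]" for k
  let ?d = "\<lambda>z. r\<^sup>2 - (\<Sum>k<p. (z k - y k)\<^sup>2)"
  let ?b = "\<lambda>z. flat (P 0) (?d z)"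
  have "smooth_fun p V ?d"
    by (intro smooth_fun_diff[OF V] smooth_fun_const[OF V] smooth_fun_sum[OF V] smooth_fun_power[OF V] smooth_fun_coord[OF V])
  then show "smooth_fun p V ?b"
    using smoothn_compose[OF V, of "\<lambda>k. flat (P k)" _ ?d 0] flat_deriv unfolding smooth_fun_iff[OF V]
    by (simp add: P_def)
  show "?b y > 0" using r by (simp add: P_def flat_def)
  show "?b z = 0" if z: "z \<in> V" "z \<notin> closed_box p y r" for z
  proof -
    obtain i where i: "i < p" "\<bar>z i - y i\<bar> > r"
      using z open_dom_zero[OF V z(1)] unfolding closed_box_def by force
    then have "r\<^sup>2 \<le> (z i - y i)\<^sup>2" using r by (metis abs_le_square_iff abs_of_pos less_imp_le)
    also have "\<dots> \<le> (\<Sum>k<p. (z k - y k)\<^sup>2)"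
      using i by (intro member_le_sum[of i "{..<p}"]) auto
    finally show ?thesis by (simp add: flat_def)
  qed
  fix k assume k: "k < p"
  have "((\<lambda>t. (\<Sum>l<p. ((y(k := t)) l - y l)\<^sup>2)) has_field_derivative 0) (at (y k))"
  proof -
    have "(\<Sum>l<p. ((y(k := t)) l - y l)\<^sup>2) = (\<Sum>l<p. if l = k then (t - y k)\<^sup>2 else 0)" for t
      by (rule sum.cong) auto
    then have "(\<lambda>t. (\<Sum>l<p. ((y(k := t)) l - y l)\<^sup>2)) = (\<lambda>t. (t - y k)\<^sup>2)" using k by (simp add: sum.delta)
    then show ?thesis by (auto intro!: derivative_eq_intros)
  qed
  then have "((\<lambda>t. ?d (y(k := t))) has_field_derivative 0) (at (y k))"
    using DERIV_diff[OF DERIV_const[of "r\<^sup>2"]] by fastforce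
  from DERIV_chain2[OF flat_deriv this, of "P 0"] show "partial k ?b y = 0"
    by (intro has_partial_imp) simp
qed

section \<open>Superfunctions\<close>

lemma gr_coeff_partial: "gr_coeff (gr_partial a f x) I = partial a (\<lambda>y. gr_coeff (f y) I) x"
  by (simp add: gr_partial.rep_eq)

lemma restr_apply [simp]: "x \<in> V \<Longrightarrow> restr V f x = f x" "x \<notin> V \<Longrightarrow> restr V f x = 0"
  by (simp_all add: restr_def)

lemma restr_simps:
  "restr V (f + g) = restr V f + restr V g" "restr V (f * g) = restr V f * restr V g"
  "restr V (f - g) = restr V f - restr V g" "restr V (- f) = - restr V f" "restr V 0 = 0"
  "restr V (smul r f) = smul r (restr V f)" "restr V ((-1) ^ n * f) = (-1) ^ n * restr V f"
  "restr V (restr U f) = restr (V \<inter> U) f"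
  by (auto simp: restr_def fun_eq_iff smul_def minus_one_power_iff)

lemma sum_fun_apply: "(\<Sum>a\<in>A. f a) x = (\<Sum>a\<in>A. f a x)" for f :: "'a \<Rightarrow> 'b \<Rightarrow> 'c::comm_monoid_add"
  by (induction A rule: infinite_finite_induct) auto

lemma restr_sum: "restr V (sum f A) = (\<Sum>a\<in>A. restr V (f a))"
  by (rule ext) (simp add: restr_def sum_fun_apply)

lemma restr_coord: "U \<subseteq> V \<Longrightarrow> restr U (coord p V b) = coord p U b"
  by (auto simp: coord_def restr_def fun_eq_iff)

lemma const_on_apply [simp]: "x \<in> V \<Longrightarrow> const_on V c x = c" "x \<notin> V \<Longrightarrow> const_on V c x = 0"
  by (simp_all add: const_on_def)

lemma power_fun_apply: "(f ^ n) x = f x ^ n" for f :: "'b \<Rightarrow> 'c::monoid_mult"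
  by (induction n) auto

lemma neg1_commute: "f * (-1) ^ n = (-1) ^ n * f" "f * ((-1) ^ n * g) = (-1) ^ n * (f * g)"
  for f :: "'c::ring_1"
  by (simp_all add: minus_one_power_iff)

definition sconj :: "nat \<Rightarrow> sfun \<Rightarrow> sfun" where
  "sconj n f = (\<lambda>x. gr_conj n (f x))"

lemma homogeneous_0 [simp]: "homogeneous e 0"
  by (simp add: homogeneous_def)

lemma homogeneous_add: "homogeneous e f \<Longrightarrow> homogeneous e g \<Longrightarrow> homogeneous e (f + g)"
  by (simp add: homogeneous_def gr_homogeneous_add)

lemma homogeneous_uminus: "homogeneous e f \<Longrightarrow> homogeneous e (- f)"
  by (simp add: homogeneous_def gr_homogeneous_uminus)

lemma homogeneous_diff: "homogeneous e f \<Longrightarrow> homogeneous e g \<Longrightarrow> homogeneous e (f - g)"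
  by (simp add: homogeneous_def gr_homogeneous_diff)

lemma homogeneous_mult: "homogeneous e f \<Longrightarrow> homogeneous e' g \<Longrightarrow> homogeneous (e + e') (f * g)"
  by (simp add: homogeneous_def gr_homogeneous_mult)

lemma homogeneous_sum: "(\<And>a. a \<in> A \<Longrightarrow> homogeneous e (f a)) \<Longrightarrow> homogeneous e (sum f A)"
  by (induction A rule: infinite_finite_induct) (auto intro: homogeneous_add)

lemma homogeneous_neg1: "homogeneous e f \<Longrightarrow> homogeneous e ((-1) ^ n * f)"
  by (cases "even n") (auto simp: minus_one_power_iff intro: homogeneous_uminus)

lemma homogeneous_cong: "even (e + e') \<Longrightarrow> homogeneous e f \<Longrightarrow> homogeneous e' f"
  unfolding homogeneous_def using gr_homogeneous_cong by blast

lemma homogeneous_restr: "homogeneous e f \<Longrightarrow> homogeneous e (restr V f)"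
  by (simp add: homogeneous_def restr_def)

lemma homogeneous_const_on: "gr_homogeneous e c \<Longrightarrow> homogeneous e (const_on V c)"
  by (simp add: homogeneous_def const_on_def restr_def)

lemma homogeneous_smul: "homogeneous e f \<Longrightarrow> homogeneous e (smul r f)"
  by (simp add: homogeneous_def smul_def gr_homogeneous_scaleR)

lemma homogeneous_coord: "homogeneous (cpar p b) (coord p V b)"
  by (auto simp: homogeneous_def coord_def restr_def cpar_def intro: gr_homogeneous_gen)

lemma homogeneous_pd: "homogeneous e f \<Longrightarrow> homogeneous (e + cpar p a) (pd p V a f)"
proof (cases "a < p")
  case True
  assume f: "homogeneous e f"
  have "partial a (\<lambda>y. gr_coeff (f y) I) x = 0" if "card I mod 2 \<noteq> e mod 2" for x I
  proof -
    have "gr_coeff (f y) I = 0" for y using f that by (auto simp: homogeneous_def gr_homogeneous_def)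
    then show ?thesis by (simp add: partial_def)
  qed
  then show ?thesis using True
    by (auto simp: homogeneous_def pd_def restr_def cpar_def gr_homogeneous_def gr_coeff_partial)
next
  case False
  assume "homogeneous e f"
  then show ?thesis using False by (auto simp: homogeneous_def pd_def restr_def cpar_def gr_homogeneous_deriv)
qed

lemma sfun_commute:
  "homogeneous e f \<Longrightarrow> homogeneous e' g \<Longrightarrow> f * g = (-1) ^ (e * e') * (g * f)" for f g :: sfun
  using gr_mult_commute[of e "f _" e' "g _"] by (simp add: homogeneous_def fun_eq_iff power_fun_apply)

lemma sfun_even_commute: "homogeneous 0 f \<Longrightarrow> f * g = g * f" for f g :: sfun
  using gr_even_commute[of "f _" "g _"] by (simp add: homogeneous_def fun_eq_iff)

lemma sconj_homogeneous: "homogeneous e f \<Longrightarrow> sconj n f = (-1) ^ (n * e) * f"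
  by (rule ext) (simp add: sconj_def homogeneous_def gr_conj_homogeneous power_fun_apply)

lemma pd_0 [simp]: "pd p V a 0 = 0"
proof -
  have "gr_partial a 0 x = 0" for x by (rule gr_eqI) (simp add: gr_coeff_partial partial_def)
  then show ?thesis by (auto simp: pd_def restr_def fun_eq_iff)
qed

lemma pd_outside: "x \<notin> V \<Longrightarrow> pd p V a f x = 0"
  by (simp add: pd_def)

locale superdomain =
  fixes p q :: nat and V :: "(nat \<Rightarrow> real) set"
  assumes V: "open_dom p V"
begin

abbreviation "R \<equiv> superfuns p q V"
abbreviation "D \<equiv> pd p V"

lemma superfunI:
  "(\<And>x. x \<notin> V \<Longrightarrow> f x = 0) \<Longrightarrow> (\<And>x. x \<in> V \<Longrightarrow> f x \<in> Grassmann q) \<Longrightarrow>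
    (\<And>I. finite I \<Longrightarrow> smooth_fun p V (\<lambda>x. gr_coeff (f x) I)) \<Longrightarrow> f \<in> R"
  unfolding superfuns_def
  by (auto, metis (mono_tags, lifting) V gr_coeff_infinite smooth_fun_cong smooth_fun_const)

lemma superfun_outside: "f \<in> R \<Longrightarrow> x \<notin> V \<Longrightarrow> f x = 0"
  by (simp add: superfuns_def)

lemma superfun_Grassmann: "f \<in> R \<Longrightarrow> f x \<in> Grassmann q"
  by (cases "x \<in> V") (auto simp: superfuns_def)

lemma superfun_smooth: "f \<in> R \<Longrightarrow> smooth_fun p V (\<lambda>x. gr_coeff (f x) I)"
  by (simp add: superfuns_def)

lemma superfun_has_partial:
  "f \<in> R \<Longrightarrow> i < p \<Longrightarrow> x \<in> V \<Longrightarrow> has_partial (\<lambda>y. gr_coeff (f y) I) i x (gr_coeff (gr_partial i f x) I)"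
  using smooth_fun_has_partial[OF V superfun_smooth] by (simp add: gr_coeff_partial)

lemma superfun_eqI: "f \<in> R \<Longrightarrow> g \<in> R \<Longrightarrow> (\<And>x. x \<in> V \<Longrightarrow> f x = g x) \<Longrightarrow> f = g"
  by (rule ext) (metis superfun_outside)

lemma smooth_const_coeff: "smooth_fun p V (\<lambda>x. c)"
  by (rule smooth_fun_const[OF V])

lemma superfun_const [simp]: "c \<in> Grassmann q \<Longrightarrow> const_on V c \<in> R"
  by (rule superfunI) (auto intro: smooth_fun_cong[OF V _ smooth_const_coeff])

lemma superfun_0 [simp]: "0 \<in> R"
  by (rule superfunI) (auto intro: smooth_fun_const[OF V])

lemma superfun_add [simp]: "f \<in> R \<Longrightarrow> g \<in> R \<Longrightarrow> f + g \<in> R"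
  by (rule superfunI)
    (auto simp: superfun_outside superfun_Grassmann intro: smooth_fun_add[OF V] superfun_smooth)

lemma superfun_mult [simp]: "f \<in> R \<Longrightarrow> g \<in> R \<Longrightarrow> f * g \<in> R"
  by (rule superfunI)
    (auto simp: superfun_outside superfun_Grassmann gr_coeff_mult
      intro!: smooth_fun_sum[OF V] smooth_fun_mult[OF V] superfun_smooth smooth_fun_const[OF V])

lemma superfun_smul [simp]: "f \<in> R \<Longrightarrow> smul r f \<in> R"
  by (rule superfunI)
    (auto simp: superfun_outside superfun_Grassmann smul_def intro: smooth_fun_cmult[OF V] superfun_smooth)

lemma superfun_uminus [simp]: "f \<in> R \<Longrightarrow> - f \<in> R"
  using superfun_smul[of f "-1"] by (simp add: smul_def fun_Compl_def)

lemma superfun_diff [simp]: "f \<in> R \<Longrightarrow> g \<in> R \<Longrightarrow> f - g \<in> R"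
  using superfun_add[of f "- g"] by simp

lemma superfun_neg1 [simp]: "f \<in> R \<Longrightarrow> (-1) ^ n * f \<in> R"
  by (simp add: minus_one_power_iff)

lemma superfun_sum: "(\<And>a. a \<in> A \<Longrightarrow> f a \<in> R) \<Longrightarrow> sum f A \<in> R"
  by (induction A rule: infinite_finite_induct) auto

lemma superfun_one_mult: "f \<in> R \<Longrightarrow> const_on V 1 * f = f" "f \<in> R \<Longrightarrow> f * const_on V 1 = f"
  by (rule ext, metis const_on_apply mult.left_neutral mult_zero_right superfun_outside times_fun_apply mult.right_neutral)+

lemma superfun_part [simp]: "f \<in> R \<Longrightarrow> (\<lambda>x. gr_part e (f x)) \<in> R"
proof (rule superfunI)
  fix I :: "nat set" assume "f \<in> R"
  then show "smooth_fun p V (\<lambda>x. gr_coeff (gr_part e (f x)) I)"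
    by (cases "card I mod 2 = e mod 2") (auto simp: gr_coeff_part intro: superfun_smooth smooth_fun_const[OF V])
qed (auto simp: superfun_outside superfun_Grassmann)

lemma sconj_eq: "sconj n f = (\<lambda>x. gr_part 0 (f x)) + (-1) ^ n * (\<lambda>x. gr_part 1 (f x))"
  by (rule ext) (simp add: sconj_def gr_conj_def power_fun_apply)

lemma superfun_conj [simp]: "f \<in> R \<Longrightarrow> sconj n f \<in> R"
  by (simp add: sconj_eq)

lemma superfun_coord [simp]: "b < p + q \<Longrightarrow> coord p V b \<in> R"
proof (rule superfunI)
  fix I :: "nat set" assume "b < p + q"
  have "smooth_fun p V (\<lambda>x. if b < p then (if I = {} then x b else 0) else (if I = {b - p} then 1 else 0))"
    by (cases "b < p"; cases "I = {}"; cases "I = {b - p}") (simp_all add: smooth_fun_coord[OF V] smooth_fun_const[OF V])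
  then show "smooth_fun p V (\<lambda>x. gr_coeff (coord p V b x) I)"
    by (rule smooth_fun_cong[OF V, rotated]) (auto simp: coord_def gr_coeff_of_real gr_coeff_gen)
qed (auto simp: coord_def Grassmann_gen)

lemma superfun_pd [simp]: "f \<in> R \<Longrightarrow> D a f \<in> R"
proof (rule superfunI)
  assume f: "f \<in> R"
  fix x assume x: "x \<in> V"
  show "D a f x \<in> Grassmann q"
  proof (cases "a < p")
    case True
    have "gr_coeff (gr_partial a f x) I = 0" if "\<not> I \<subseteq> {..<q}" for I
    proof -
      have "gr_coeff (f y) I = 0" for y using superfun_Grassmann[OF f, of y] that by (auto simp: Grassmann_def)
      then show ?thesis by (simp add: gr_coeff_partial partial_def)
    qed
    then show ?thesis using True x by (auto simp: pd_def Grassmann_def)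
  qed (use x superfun_Grassmann[OF f] in \<open>simp add: pd_def\<close>)
next
  assume f: "f \<in> R"
  fix I :: "nat set"
  show "smooth_fun p V (\<lambda>x. gr_coeff (D a f x) I)"
  proof (cases "a < p")
    case True
    show ?thesis
      by (rule smooth_fun_cong[OF V _ smooth_fun_partial[OF superfun_smooth[OF f] True], of I])
        (use True in \<open>simp add: pd_def gr_coeff_partial\<close>)
  next
    case False
    have "smooth_fun p V (\<lambda>x. gr_coeff (gr_deriv (a - p) (f x)) I)"
      by (cases "a - p \<in> I") (simp_all add: gr_coeff_deriv smooth_fun_cmult[OF V] superfun_smooth[OF f] smooth_fun_const[OF V])
    then show ?thesis by (rule smooth_fun_cong[OF V, rotated]) (use False in \<open>simp add: pd_def\<close>)
  qed
qed (simp add: pd_outside)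

lemma pd_add: "f \<in> R \<Longrightarrow> g \<in> R \<Longrightarrow> D a (f + g) = D a f + D a g"
proof (rule ext)
  fix x assume f: "f \<in> R" "g \<in> R"
  have "gr_partial a (f + g) x = gr_partial a f x + gr_partial a g x" if "a < p" "x \<in> V"
  proof (rule gr_eqI)
    fix I
    from DERIV_add[OF superfun_has_partial[OF f(1) that] superfun_has_partial[OF f(2) that], of I I]
    show "gr_coeff (gr_partial a (f + g) x) I = gr_coeff (gr_partial a f x + gr_partial a g x) I"
      using has_partial_imp[where f = "\<lambda>y. gr_coeff ((f + g) y) I" and i = a and x = x] by (simp add: gr_coeff_partial[of a "f + g"])
  qed
  then show "D a (f + g) x = (D a f + D a g) x" by (simp add: pd_def restr_def)
qed

lemma pd_smul: "f \<in> R \<Longrightarrow> D a (smul r f) = smul r (D a f)"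
proof (rule ext)
  fix x assume f: "f \<in> R"
  have "gr_partial a (smul r f) x = r *\<^sub>R gr_partial a f x" if "a < p" "x \<in> V"
  proof (rule gr_eqI)
    fix I
    from DERIV_cmult[OF superfun_has_partial[OF f that], of r I]
    show "gr_coeff (gr_partial a (smul r f) x) I = gr_coeff (r *\<^sub>R gr_partial a f x) I"
      using has_partial_imp[where f = "\<lambda>y. gr_coeff (smul r f y) I" and i = a and x = x] by (simp add: gr_coeff_partial[of a "\<lambda>x. r *\<^sub>R f x"] smul_def)
  qed
  then show "D a (smul r f) x = smul r (D a f) x" by (simp add: pd_def restr_def smul_def)
qed

lemma pd_uminus: "f \<in> R \<Longrightarrow> D a (- f) = - D a f"
  using pd_smul[of f a "-1"] by (simp add: smul_def fun_Compl_def)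

lemma pd_diff: "f \<in> R \<Longrightarrow> g \<in> R \<Longrightarrow> D a (f - g) = D a f - D a g"
  using pd_add[of f "- g"] pd_uminus by simp

lemma pd_neg1: "f \<in> R \<Longrightarrow> D a ((-1) ^ n * f) = (-1) ^ n * D a f"
  by (simp add: minus_one_power_iff pd_uminus)

lemma pd_sum: "(\<And>b. b \<in> A \<Longrightarrow> f b \<in> R) \<Longrightarrow> D a (sum f A) = (\<Sum>b\<in>A. D a (f b))"
  by (induction A rule: infinite_finite_induct) (simp_all add: pd_add superfun_sum)

lemma pd_mult:
  assumes f: "f \<in> R" and g: "g \<in> R" shows "D a (f * g) = D a f * g + sconj (cpar p a) f * D a g"
proof (rule ext)
  fix x
  have "gr_partial a (f * g) x = gr_partial a f x * g x + f x * gr_partial a g x" if a: "a < p" "x \<in> V"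
  proof (rule gr_eqI)
    fix K
    let ?c = "\<lambda>y. \<Sum>I\<in>Pow K. gr_sign I (K - I) * (gr_coeff (f y) I * gr_coeff (g y) (K - I))"
    let ?d = "\<Sum>I\<in>Pow K. gr_sign I (K - I) * (gr_coeff (gr_partial a f x) I * gr_coeff (g x) (K - I)
           + gr_coeff (gr_partial a g x) (K - I) * gr_coeff (f x) I)"
    have "has_partial ?c a x ?d"
    proof (rule DERIV_sum)
      fix I
      from DERIV_mult[OF superfun_has_partial[OF f a, of I] superfun_has_partial[OF g a, of "K - I"]]
      show "has_partial (\<lambda>y. gr_sign I (K - I) * (gr_coeff (f y) I * gr_coeff (g y) (K - I))) a x
        (gr_sign I (K - I) * (gr_coeff (gr_partial a f x) I * gr_coeff (g x) (K - I)
           + gr_coeff (gr_partial a g x) (K - I) * gr_coeff (f x) I))"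
        by (intro DERIV_cmult) simp
    qed
    then have "gr_coeff (gr_partial a (f * g) x) K = ?d"
      using has_partial_imp by (simp add: gr_coeff_partial[of a "f * g"] gr_coeff_mult mult.assoc)
    then show "gr_coeff (gr_partial a (f * g) x) K = gr_coeff (gr_partial a f x * g x + f x * gr_partial a g x) K"
      by (simp add: gr_coeff_mult distrib_left sum.distrib mult_ac)
  qed
  then show "D a (f * g) x = (D a f * g + sconj (cpar p a) f * D a g) x"
    by (simp add: pd_def restr_def cpar_def sconj_def gr_deriv_mult)
qed

lemma pd_mult_homogeneous:
  "f \<in> R \<Longrightarrow> g \<in> R \<Longrightarrow> homogeneous e f \<Longrightarrow>
    D a (f * g) = D a f * g + (-1) ^ (cpar p a * e) * (f * D a g)"
  by (simp add: pd_mult sconj_homogeneous mult.assoc)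

lemma pd_mult_even: "f \<in> R \<Longrightarrow> g \<in> R \<Longrightarrow> homogeneous 0 f \<Longrightarrow> D a (f * g) = D a f * g + f * D a g"
  using pd_mult_homogeneous[of f g 0] by simp

lemma pd_const: "D a (const_on V (of_real c)) = 0"
proof (rule ext)
  fix x
  have "gr_partial a (const_on V (of_real c)) x = 0" if "a < p" "x \<in> V"
  proof (rule gr_eqI)
    fix I
    have "partial a (\<lambda>y. gr_coeff (const_on V (of_real c) y) I) x = partial a (\<lambda>y. gr_coeff (of_real c) I) x"
      by (rule partial_cong[OF V that(2,1)]) simp
    then show "gr_coeff (gr_partial a (const_on V (of_real c)) x) I = gr_coeff 0 I"
      by (simp add: gr_coeff_partial partial_def)
  qed
  then show "D a (const_on V (of_real c)) x = 0 x"
    by (cases "x \<in> V") (auto simp: pd_def)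
qed

lemma pd_one: "D a (const_on V 1) = 0"
  using pd_const[of a 1] by simp

lemma pd_coord:
  assumes "b < p + q" shows "D a (coord p V b) = const_on V (of_bool (a = b))"
proof (rule ext)
  fix x
  show "D a (coord p V b) x = const_on V (of_bool (a = b)) x"
  proof (cases "x \<in> V")
    case True
    have "gr_partial a (coord p V b) x = of_bool (a = b)" if a: "a < p"
    proof (rule gr_eqI)
      fix I :: "nat set"
      let ?c = "\<lambda>x :: nat \<Rightarrow> real. if b < p then (if I = {} then x b else 0) else (if I = {b - p} then 1 else 0)"
      have "partial a (\<lambda>y. gr_coeff (coord p V b y) I) x = partial a ?c x"
        by (rule partial_cong[OF V True a]) (auto simp: coord_def gr_coeff_of_real gr_coeff_gen)
      also have "has_partial ?c a x (if a = b \<and> I = {} then 1 else 0)"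
        using a by (cases "a = b"; cases "b < p"; cases "I = {}") auto
      then have "partial a ?c x = (if a = b \<and> I = {} then 1 else 0)" by (rule has_partial_imp)
      finally show "gr_coeff (gr_partial a (coord p V b) x) I = gr_coeff (of_bool (a = b)) I"
        by (simp add: gr_coeff_partial gr_coeff_one)
    qed
    then show ?thesis using True by (auto simp: pd_def coord_def)
  qed (simp add: pd_outside)
qed

text \<open>Schwarz's theorem from Hadamard's lemma: if \<open>f\<close> is \<open>f y\<close> plus
  the sum of the \<open>(z k - y k) * g k z\<close>, the second derivative at \<open>y\<close> is
  \<open>partial i (g j) y + partial j (g i) y\<close>, which is visibly symmetric.\<close>

lemma real_partial_commute:
  assumes f: "smooth_fun p V f" and y: "y \<in> V" and i: "i < p" and j: "j < p"
  shows "partial i (partial j f) y = partial j (partial i f) y"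
proof -
  obtain r where r: "r > 0" "box_dom p y r \<subseteq> V" using box_dom_neighbourhood[OF V y] by blast
  let ?B = "box_dom p y r"
  have B: "open_dom p ?B" by (rule open_box_dom)
  have yB: "y \<in> ?B" using r open_dom_zero[OF V y] by (simp add: box_dom_def)
  obtain g where g: "\<And>k. k < p \<Longrightarrow> smooth_fun p ?B (g k)"
    and fg: "\<And>z. z \<in> ?B \<Longrightarrow> f z = f y + (\<Sum>k<p. (z k - y k) * g k z)"
    using Hadamard[OF r(1) _ smooth_fun_subset[OF V B r(2) f]] open_dom_zero[OF V y] by blast
  have lin: "has_partial (\<lambda>z. z k - y k) i x (of_bool (k = i))" for k i x
    by (cases "k = i") (auto intro!: derivative_eq_intros)
  have d1: "partial j f z = g j z + (\<Sum>k<p. (z k - y k) * partial j (g k) z)" if z: "z \<in> ?B" and j: "j < p" for z j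
  proof -
    have "has_partial (\<lambda>z. f y + (\<Sum>k<p. (z k - y k) * g k z)) j z
        (0 + (\<Sum>k<p. of_bool (k = j) * g k z + partial j (g k) z * (z k - y k)))"
    proof (intro DERIV_add DERIV_const DERIV_sum)
      fix k assume "k \<in> {..<p}"
      then have k: "k < p" by simp
      from DERIV_mult[OF lin[where k = k and i = j and x = z] smooth_fun_has_partial[OF B g[OF k] j z]]
      show "has_partial (\<lambda>z. (z k - y k) * g k z) j z (of_bool (k = j) * g k z + partial j (g k) z * (z k - y k))"
        by simp
    qed
    then have "partial j f z = (\<Sum>k<p. of_bool (k = j) * g k z + partial j (g k) z * (z k - y k))"
      using partial_cong[OF B z j fg] has_partial_imp by simp
    also have "\<dots> = g j z + (\<Sum>k<p. (z k - y k) * partial j (g k) z)"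
    proof -
      have "(\<Sum>k<p. of_bool (k = j) * g k z) = (\<Sum>k<p. if k = j then g k z else 0)" by (rule sum.cong) auto
      then show ?thesis using j by (simp add: sum.distrib mult.commute)
    qed
    finally show ?thesis .
  qed
  have d2: "partial i (partial j f) y = partial i (g j) y + partial j (g i) y" if i: "i < p" and j: "j < p" for i j
  proof -
    have "has_partial (\<lambda>z. g j z + (\<Sum>k<p. (z k - y k) * partial j (g k) z)) i y
        (partial i (g j) y + (\<Sum>k<p. of_bool (k = i) * partial j (g k) y + partial i (partial j (g k)) y * (y k - y k)))"
    proof (intro DERIV_add DERIV_sum)
      fix k assume "k \<in> {..<p}"
      then have k: "k < p" by simp
      from DERIV_mult[OF lin[where k = k and i = i and x = y] smooth_fun_has_partial[OF B smooth_fun_partial[OF g[OF k] j] i yB]]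
      show "has_partial (\<lambda>z. (z k - y k) * partial j (g k) z) i y
        (of_bool (k = i) * partial j (g k) y + partial i (partial j (g k)) y * (y k - y k))" by simp
    qed (use smooth_fun_has_partial[OF B g[OF j] i yB] in simp)
    then have "partial i (partial j f) y = partial i (g j) y + (\<Sum>k<p. of_bool (k = i) * partial j (g k) y)"
      using partial_cong[OF B yB i d1[OF _ j]] has_partial_imp by simp
    also have "(\<Sum>k<p. of_bool (k = i) * partial j (g k) y) = (\<Sum>k<p. if k = i then partial j (g k) y else 0)"
      by (rule sum.cong) auto
    finally show ?thesis using i by simp
  qed
  show ?thesis using d2[OF i j] d2[OF j i] by simp
qed

text \<open>An odd derivative only rearranges coefficients with constant signs, so it commutes with
  even ones. Two even derivatives commute by Schwarz's theorem, and two odd ones give the only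
  sign.\<close>

lemma pd_commute:
  assumes f: "f \<in> R" shows "D a (D b f) = (-1) ^ (cpar p a * cpar p b) * D b (D a f)"
proof (rule superfun_eqI)
  fix x assume x: "x \<in> V"
  have eo: "D a (D b f) x = D b (D a f) x" if a: "a < p" and b: "\<not> b < p" for a b
  proof (rule gr_eqI)
    fix I :: "nat set" assume "finite I"
    have "gr_coeff (D a (D b f) x) I = partial a (\<lambda>y. gr_coeff (gr_deriv (b - p) (f y)) I) x"
      unfolding pd_def[of p V a] using a x
      by (simp add: gr_coeff_partial) (rule partial_cong[OF V x a], use b in \<open>simp add: pd_def\<close>)
    also have "\<dots> = gr_coeff (D b (D a f) x) I"
    proof (cases "b - p \<in> I")
      case True
      then show ?thesis using a b x by (simp add: pd_def gr_coeff_deriv partial_def)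
    next
      case False
      let ?c = "(-1) ^ card {i \<in> I. i < b - p} :: real"
      have "has_partial (\<lambda>y. gr_coeff (gr_deriv (b - p) (f y)) I) a x (?c * gr_coeff (gr_partial a f x) (insert (b - p) I))"
        using DERIV_cmult[OF superfun_has_partial[OF f a x, of "insert (b - p) I"], of ?c] False
        by (simp add: gr_coeff_deriv)
      then show ?thesis using has_partial_imp a b x False by (simp add: pd_def gr_coeff_deriv)
    qed
    finally show "gr_coeff (D a (D b f) x) I = gr_coeff (D b (D a f) x) I" .
  qed
  have ee: "D a (D b f) x = D b (D a f) x" if a: "a < p" and b: "b < p"
  proof (rule gr_eqI)
    fix I :: "nat set"
    have "gr_coeff (D a (D b f) x) I = partial a (partial b (\<lambda>y. gr_coeff (f y) I)) x" if a: "a < p" and b: "b < p" for a b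
      unfolding pd_def[of p V a] using a x
      by (simp add: gr_coeff_partial) (rule partial_cong[OF V x a], use b in \<open>simp add: pd_def gr_coeff_partial\<close>)
    then show "gr_coeff (D a (D b f) x) I = gr_coeff (D b (D a f) x) I"
      using real_partial_commute[OF superfun_smooth[OF f] x a b] a b by simp
  qed
  show "D a (D b f) x = ((-1) ^ (cpar p a * cpar p b) * D b (D a f)) x"
  proof (cases "a < p \<or> b < p")
    case True
    then have "D a (D b f) x = D b (D a f) x" using ee eo[of a b] eo[of b a] by metis
    then show ?thesis using True by (auto simp: cpar_def)
  next
    case False
    then show ?thesis using x gr_deriv_anticommute[of "a - p" "b - p"] by (simp add: pd_def cpar_def)
  qed
qed (use f in simp_all)

lemma pd_restr:
  assumes "open_dom p U" "U \<subseteq> V" shows "pd p U a (restr U f) = restr U (D a f)"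
proof (rule ext)
  fix x show "pd p U a (restr U f) x = restr U (D a f) x"
  proof (cases "x \<in> U")
    case True
    have "gr_partial a (restr U f) x = gr_partial a f x" if "a < p"
    proof (rule gr_eqI)
      fix I
      show "gr_coeff (gr_partial a (restr U f) x) I = gr_coeff (gr_partial a f x) I"
        unfolding gr_coeff_partial by (rule partial_cong[OF assms(1) True that]) simp
    qed
    then show ?thesis using True assms by (auto simp: pd_def)
  qed (simp add: pd_def)
qed

lemma superfun_restr: "f \<in> R \<Longrightarrow> open_dom p U \<Longrightarrow> U \<subseteq> V \<Longrightarrow> restr U f \<in> superfuns p q U"
proof -
  assume f: "f \<in> R" and U: "open_dom p U" "U \<subseteq> V"
  have "smooth_fun p U (\<lambda>x. gr_coeff (restr U f x) I)" for I
    by (rule smooth_fun_cong[OF U(1) _ smooth_fun_subset[OF V U superfun_smooth[OF f]], of I]) simp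
  then show ?thesis using superfun_Grassmann[OF f] by (auto simp: superfuns_def restr_def)
qed

end

section \<open>Inverses and real powers of superfunctions\<close>

definition real_sfun :: "(nat \<Rightarrow> real) set \<Rightarrow> ((nat \<Rightarrow> real) \<Rightarrow> real) \<Rightarrow> sfun" where
  "real_sfun V u = restr V (\<lambda>x. of_real (u x))"

definition sinv :: "(nat \<Rightarrow> real) set \<Rightarrow> sfun \<Rightarrow> sfun" where
  "sinv V f = restr V (\<lambda>x. gr_inverse (f x))"

definition spow :: "(nat \<Rightarrow> real) set \<Rightarrow> sfun \<Rightarrow> nat \<Rightarrow> sfun" where
  "spow V f k = restr V (\<lambda>x. f x ^ k)"

lemma homogeneous_real_sfun: "homogeneous 0 (real_sfun V u)"
  by (simp add: homogeneous_def real_sfun_def restr_def)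

text \<open>Collects the monomials whose smallest generator is \<open>j\<close>, with that generator
  removed. Unlike the derivative, this assigns every nonconstant monomial to exactly one
  \<open>j\<close>.\<close>

lift_definition gr_tail :: "nat \<Rightarrow> grassmann \<Rightarrow> grassmann" is
  "\<lambda>j x L. if \<forall>l\<in>L. j < l then x (insert j L) else 0" by auto

lemma gr_coeff_tail: "gr_coeff (gr_tail j x) L = (if \<forall>l\<in>L. j < l then gr_coeff x (insert j L) else 0)"
  by (simp add: gr_tail.rep_eq)

text \<open>Sorting the monomials of \<open>x\<close> by their first generator.\<close>

lemma gr_tail_decompose:
  assumes "x \<in> Grassmann q" shows "x = of_real (gr_body x) + (\<Sum>j<q. gr_gen j * gr_tail j x)"
proof (rule gr_eqI)
  fix K :: "nat set" assume K: "finite K"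
  have "(\<Sum>j<q. gr_coeff (gr_gen j * gr_tail j x) K) = (if K = {} then 0 else gr_coeff x K)"
  proof (cases "K = {} \<or> \<not> K \<subseteq> {..<q}")
    case True
    have z: "gr_coeff (gr_gen j * gr_tail j x) K = 0" if "\<not> K \<subseteq> {..<q}" for j
      using that assms by (auto simp: gr_coeff_gen_mult gr_coeff_tail Grassmann_def insert_absorb)
    moreover have "gr_coeff x K = 0" if "\<not> K \<subseteq> {..<q}" using that assms by (auto simp: Grassmann_def)
    ultimately show ?thesis using True
      by (cases "K = {}") (simp_all add: gr_coeff_gen_mult[of _ _ "{}"] z)
  next
    case False
    have "gr_coeff (gr_gen j * gr_tail j x) K = (if j = Min K then gr_coeff x K else 0)" for j
    proof (cases "j \<in> K \<and> (\<forall>l\<in>K - {j}. j < l)")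
      case True
      then have le: "j \<le> l" if "l \<in> K" for l using that by (cases "l = j") (auto intro: less_imp_le)
      then have "Min K = j" using K True by (intro Min_eqI) auto
      moreover have e: "{l \<in> K. l < j} = {}" using le by (auto simp: not_less)
      have "gr_coeff (gr_gen j * gr_tail j x) K = gr_coeff x K"
        unfolding gr_coeff_gen_mult e gr_coeff_tail using True by (simp add: insert_absorb)
      ultimately show ?thesis by simp
    next
      case nt: False
      then have "j \<noteq> Min K" using K False Min_in[of K] Min_le[of K] by (metis Diff_iff insertCI le_neq_implies_less)
      then show ?thesis using nt by (auto simp: gr_coeff_gen_mult gr_coeff_tail)
    qed
    moreover have "Min K < q" using False K Min_in by blast
    ultimately show ?thesis using False by (simp add: sum.delta)
  qed
  then show "gr_coeff x K = gr_coeff (of_real (gr_body x) + (\<Sum>j<q. gr_gen j * gr_tail j x)) K"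
    by (simp add: gr_coeff_sum gr_coeff_of_real gr_body_def)
qed

context superdomain
begin

lemma superfun_real [simp]: "smooth_fun p V u \<Longrightarrow> real_sfun V u \<in> R"
proof (rule superfunI)
  fix I :: "nat set" assume "smooth_fun p V u"
  then have "smooth_fun p V (\<lambda>x. if I = {} then u x else 0)" by (cases "I = {}") (auto intro: smooth_fun_const[OF V])
  then show "smooth_fun p V (\<lambda>x. gr_coeff (real_sfun V u x) I)"
    by (rule smooth_fun_cong[OF V, rotated]) (simp add: real_sfun_def gr_coeff_of_real)
qed (auto simp: real_sfun_def)

lemma superfun_body_smooth: "f \<in> R \<Longrightarrow> smooth_fun p V (\<lambda>x. gr_body (f x))"
  unfolding gr_body_def by (rule superfun_smooth)

lemma superfun_spow [simp]: "f \<in> R \<Longrightarrow> spow V f k \<in> R"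
proof (induction k)
  case (Suc k)
  have "spow V f (Suc k) = f * spow V f k" by (auto simp: spow_def restr_def fun_eq_iff superfun_outside[OF Suc.prems])
  then show ?case using superfun_mult[OF Suc.prems Suc.IH[OF Suc.prems]] by metis
next
  case 0
  have "spow V f 0 = const_on V 1" by (simp add: spow_def const_on_def)
  then show ?case by simp
qed

abbreviation "body_fun f \<equiv> real_sfun V (\<lambda>x. gr_body (f x))"
abbreviation "soul f \<equiv> f - body_fun f"

lemma soul_apply: "f \<in> R \<Longrightarrow> soul f x = f x - of_real (gr_body (f x))"
  by (cases "x \<in> V") (auto simp: real_sfun_def superfun_outside)

text \<open>The geometric series consists of powers of the soul with coefficients rational in the
  body, so smoothness reduces to that of real functions.\<close>

lemma superfun_inverse [simp]:
  assumes f: "f \<in> R" and nz: "\<And>x. x \<in> V \<Longrightarrow> gr_body (f x) \<noteq> 0" shows "sinv V f \<in> R"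
proof -
  let ?F = "\<Sum>k\<le>q. smul ((-1) ^ k) (real_sfun V (\<lambda>x. (1 / gr_body (f x)) ^ Suc k) * spow V (soul f) k)"
  have "smooth_fun p V (\<lambda>x. 1 / gr_body (f x))" by (rule smooth_fun_divide1[OF V nz superfun_body_smooth[OF f]])
  then have "?F \<in> R"
    by (intro superfun_sum superfun_smul superfun_mult superfun_real superfun_spow superfun_diff f
        smooth_fun_power[OF V] superfun_body_smooth)
  moreover have "sinv V f = ?F"
  proof (rule ext)
    fix x
    show "sinv V f x = ?F x"
    proof (cases "x \<in> V")
      case True
      then have "gr_unit q (f x)" using nz superfun_Grassmann[OF f] by (simp add: gr_unit_def)
      then have "sinv V f x = gr_geom q (f x)" using True gr_inverse_eq_geom by (simp add: sinv_def)
      also have "\<dots> = ?F x" unfolding gr_geom_def sum_fun_apply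
      proof (rule sum.cong[OF refl])
        fix k
        show "((-1) ^ k * (1 / gr_body (f x)) ^ Suc k) *\<^sub>R (f x - of_real (gr_body (f x))) ^ k
          = smul ((-1) ^ k) (real_sfun V (\<lambda>x. (1 / gr_body (f x)) ^ Suc k) * spow V (soul f) k) x"
          using True soul_apply[OF f, of x] unfolding smul_def times_fun_apply spow_def real_sfun_def
          by (simp add: of_real_def mult.assoc)
      qed
      finally show ?thesis .
    qed (simp add: sinv_def sum_fun_apply smul_def spow_def)
  qed
  ultimately show ?thesis by simp
qed

lemma superfun_inverse_mult:
  assumes f: "f \<in> R" and nz: "\<And>x. x \<in> V \<Longrightarrow> gr_body (f x) \<noteq> 0"
  shows "f * sinv V f = const_on V 1" "sinv V f * f = const_on V 1"
proof -
  have "gr_unit q (f x)" if "x \<in> V" for x using nz that superfun_Grassmann[OF f] by (simp add: gr_unit_def)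
  then show "f * sinv V f = const_on V 1" "sinv V f * f = const_on V 1"
    by (auto simp: sinv_def const_on_def restr_def fun_eq_iff gr_inverse_mult[of q])
qed

lemma homogeneous_sinv:
  assumes f: "f \<in> R" and nz: "\<And>x. x \<in> V \<Longrightarrow> gr_body (f x) \<noteq> 0" and "homogeneous 0 f"
  shows "homogeneous 0 (sinv V f)"
  using assms superfun_Grassmann[OF f] gr_homogeneous_inverse[of q]
  by (auto simp: homogeneous_def sinv_def restr_def gr_unit_def)

definition pos_fun :: "sfun \<Rightarrow> bool" where
  "pos_fun f \<longleftrightarrow> f \<in> R \<and> homogeneous 0 f \<and> (\<forall>x\<in>V. gr_body (f x) > 0)"

lemma pos_funD: "pos_fun f \<Longrightarrow> x \<in> V \<Longrightarrow> gr_pos q (f x)"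
  using superfun_Grassmann by (auto simp: pos_fun_def gr_pos_def homogeneous_def)

definition powf :: "sfun \<Rightarrow> real \<Rightarrow> sfun" where
  "powf f w = (\<lambda>x. gr_powr q (f x) w)"

lemma powf_eq:
  assumes f: "f \<in> R"
  shows "powf f w = (\<Sum>k\<le>q. smul (w gchoose k)
    (real_sfun V (\<lambda>x. gr_body (f x) powr (w - real k)) * spow V (soul f) k))"
proof (rule ext)
  fix x
  show "powf f w x = (\<Sum>k\<le>q. smul (w gchoose k)
    (real_sfun V (\<lambda>x. gr_body (f x) powr (w - real k)) * spow V (soul f) k)) x"
    using soul_apply[OF f, of x] superfun_outside[OF f, of x]
    unfolding powf_def gr_powr_def sum_fun_apply smul_def times_fun_apply spow_def real_sfun_def
    by (cases "x \<in> V") (simp_all add: of_real_def)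
qed

lemma powf_outside: "f \<in> R \<Longrightarrow> x \<notin> V \<Longrightarrow> powf f w x = 0"
  by (simp add: powf_def superfun_outside)

lemma superfun_powf [simp]: assumes "pos_fun f" shows "powf f w \<in> R"
proof -
  have f: "f \<in> R" using assms by (simp add: pos_fun_def)
  show ?thesis unfolding powf_eq[OF f]
    by (intro superfun_sum superfun_smul superfun_mult superfun_real superfun_spow superfun_diff f
        smooth_fun_powr[OF V] superfun_body_smooth) (use assms in \<open>auto simp: pos_fun_def\<close>)
qed

lemma pos_fun_powf: assumes f: "pos_fun f" shows "pos_fun (powf f w)"
  unfolding pos_fun_def
proof (intro conjI ballI)
  show "homogeneous 0 (powf f w)" unfolding homogeneous_def
  proof
    fix x show "gr_homogeneous 0 (powf f w x)"
    proof (cases "x \<in> V")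
      case True
      then show ?thesis using gr_pos_powr[OF pos_funD[OF f]] by (simp add: powf_def gr_pos_def)
    next
      case False
      then show ?thesis using f powf_outside by (simp add: pos_fun_def)
    qed
  qed
  show "gr_body (powf f w x) > 0" if "x \<in> V" for x
    using gr_pos_powr[OF pos_funD[OF f that]] by (simp add: powf_def gr_pos_def)
qed (use f in simp)

lemma pos_fun_mult: "pos_fun f \<Longrightarrow> pos_fun g \<Longrightarrow> pos_fun (f * g)"
  using homogeneous_mult[of 0 f 0 g] by (simp add: pos_fun_def)

lemma powf_add: "pos_fun f \<Longrightarrow> powf f v * powf f w = powf f (v + w)"
proof (rule superfun_eqI)
  assume f: "pos_fun f"
  fix x assume "x \<in> V"
  from gr_powr_add[OF pos_funD[OF f this]] show "(powf f v * powf f w) x = powf f (v + w) x" by (simp add: powf_def)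
qed simp_all

lemma powf_mult: "pos_fun f \<Longrightarrow> pos_fun g \<Longrightarrow> powf (f * g) w = powf f w * powf g w"
proof (rule superfun_eqI)
  assume f: "pos_fun f" "pos_fun g"
  fix x assume "x \<in> V"
  from gr_powr_mult[OF pos_funD[OF f(1) this] pos_funD[OF f(2) this]]
  show "powf (f * g) w x = (powf f w * powf g w) x" by (simp add: powf_def)
qed (simp_all add: pos_fun_mult)

lemma powf_1: "pos_fun f \<Longrightarrow> powf f 1 = f"
proof (rule superfun_eqI)
  assume f: "pos_fun f"
  fix x assume "x \<in> V"
  from gr_powr_1[OF pos_funD[OF f this]] show "powf f 1 x = f x" by (simp add: powf_def)
qed (simp_all add: pos_fun_def)

lemma powf_0: "pos_fun f \<Longrightarrow> powf f 0 = const_on V 1"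
proof -
  assume f: "pos_fun f"
  have "gr_powr q (f x) 0 = 1" if "x \<in> V" for x
  proof -
    have g: "gr_pos q (f x)" by (rule pos_funD[OF f that])
    have "gr_powr q (f x) 0 = (\<Sum>k\<le>q. if k = 0 then 1 else 0)"
      unfolding gr_powr_def
    proof (rule sum.cong[OF refl])
      fix k show "((0 gchoose k) * gr_body (f x) powr (0 - real k)) *\<^sub>R (f x - of_real (gr_body (f x))) ^ k
        = (if k = 0 then 1 else 0)" using g by (cases k) (auto simp: gr_pos_def)
    qed
    then show ?thesis by simp
  qed
  then have "powf f 0 x = const_on V 1 x" if "x \<in> V" for x using that by (simp add: powf_def)
  with superfun_powf[OF f] superfun_const[OF Grassmann_0(2)] show ?thesis by (rule superfun_eqI)
qed

lemma pd_spow: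
  assumes f: "f \<in> R" "homogeneous 0 f"
  shows "D a (spow V f k) = smul (real k) (spow V f (k - 1) * D a f)"
proof (induction k)
  case 0
  have "spow V f 0 = const_on V (of_real 1)" by (simp add: spow_def const_on_def)
  then show ?case using pd_const[of a 1] by (simp add: smul_def zero_fun_def)
next
  case (Suc k)
  have s: "spow V f (Suc k) = f * spow V f k" for k
    by (auto simp: spow_def restr_def fun_eq_iff superfun_outside[OF f(1)])
  have s0: "spow V f 0 * D a f = D a f"
    using superfun_one_mult(1)[OF superfun_pd[OF f(1)]] by (simp add: spow_def const_on_def)
  have h: "homogeneous 0 (spow V f k)"
    using f(2) by (simp add: homogeneous_def spow_def restr_def gr_homogeneous_power_even)
  have "D a (spow V f (Suc k)) = D a f * spow V f k + f * D a (spow V f k)"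
    unfolding s using f by (simp add: pd_mult_even)
  also have "\<dots> = spow V f k * D a f + smul (real k) (f * spow V f (k - 1) * D a f)"
    unfolding Suc using sfun_even_commute[OF h, of "D a f"] by (simp add: smul_def fun_eq_iff mult.assoc)
  also have "\<dots> = smul (real (Suc k)) (spow V f k * D a f)"
  proof (cases k)
    case (Suc l)
    then have "f * spow V f (k - 1) = spow V f k" using s by simp
    then show ?thesis by (simp add: smul_def fun_eq_iff scaleR_left_distrib)
  qed (simp add: s0 smul_def fun_eq_iff)
  finally show ?case unfolding diff_Suc_1 .
qed

lemma pd_real_powr:
  assumes u: "smooth_fun p V u" "\<And>x. x \<in> V \<Longrightarrow> u x > 0"
  shows "D a (real_sfun V (\<lambda>x. u x powr w))
    = smul w (real_sfun V (\<lambda>x. u x powr (w - 1)) * D a (real_sfun V u))"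
proof (rule ext)
  fix x
  show "D a (real_sfun V (\<lambda>x. u x powr w)) x = smul w (real_sfun V (\<lambda>x. u x powr (w - 1)) * D a (real_sfun V u)) x"
  proof (cases "x \<in> V \<and> a < p")
    case True
    then have x: "x \<in> V" and a: "a < p" by auto
    have c: "gr_partial a (real_sfun V h) x = of_real (partial a h x)" for h
    proof (rule gr_eqI)
      fix I :: "nat set"
      have "partial a (\<lambda>y. gr_coeff (real_sfun V h y) I) x = partial a (\<lambda>y. if I = {} then h y else 0) x"
        by (rule partial_cong[OF V x a]) (simp add: real_sfun_def gr_coeff_of_real)
      then show "gr_coeff (gr_partial a (real_sfun V h) x) I = gr_coeff (of_real (partial a h x)) I"
        by (cases "I = {}") (simp_all add: gr_coeff_partial gr_coeff_of_real partial_def)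
    qed
    have rx: "real_sfun V h x = of_real (h x)" for h using x by (simp add: real_sfun_def)
    have "partial a (\<lambda>x. u x powr w) x = w * u x powr (w - 1) * partial a u x"
      using DERIV_fun_powr[OF smooth_fun_has_partial[OF V u(1) a x], of w] u(2)[OF x]
      by (intro has_partial_imp) simp
    then show ?thesis using x a by (simp add: pd_def c smul_def rx scaleR_conv_of_real mult.assoc)
  next
    case False
    then show ?thesis by (cases "x \<in> V") (auto simp: pd_def smul_def real_sfun_def)
  qed
qed

text \<open>Body and soul both vary with the point. Differentiating the real powers of the body and
  the powers of the soul separately yields the two parts of \<open>D a f\<close>, each through its
  own absorption identity for binomial coefficients.\<close>

lemma pd_powf:
  assumes f: "pos_fun f"
  shows "D a (powf f w) = smul w (powf f (w - 1) * D a f)"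
proof (rule superfun_eqI)
  have fR: "f \<in> R" and fh: "homogeneous 0 f" and fp: "\<And>x. x \<in> V \<Longrightarrow> gr_body (f x) > 0"
    using f by (auto simp: pos_fun_def)
  show "D a (powf f w) \<in> R" "smul w (powf f (w - 1) * D a f) \<in> R" using f fR by simp_all
  fix x assume x: "x \<in> V"
  let ?\<beta> = "\<lambda>v. real_sfun V (\<lambda>x. gr_body (f x) powr v)"
  let ?n = "soul f"
  have nR: "?n \<in> R" and bR: "body_fun f \<in> R" and \<beta>R: "?\<beta> v \<in> R" for v
    using fR fp by (auto intro!: superfun_diff superfun_real superfun_body_smooth smooth_fun_powr[OF V])
  have nh: "homogeneous 0 ?n" using fh homogeneous_real_sfun by (rule homogeneous_diff)
  define b n A C where "b = gr_body (f x)" and "n = ?n x" and "A = D a (body_fun f) x" and "C = D a ?n x"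
  have b: "b > 0" using fp[OF x] by (simp add: b_def)
  have n: "n = f x - of_real b" using soul_apply[OF fR] unfolding n_def b_def .
  have AC: "D a f x = A + C"
    using pd_add[OF bR nR, of a] by (simp add: A_def C_def fun_eq_iff)
  have d\<beta>: "D a (?\<beta> v) x = (v * b powr (v - 1)) *\<^sub>R A" for v
    using pd_real_powr[OF superfun_body_smooth[OF fR] fp, of a v] x
    by (simp add: smul_def A_def real_sfun_def b_def scaleR_conv_of_real mult.assoc)
  have dn: "D a (spow V ?n k) x = real k *\<^sub>R (n ^ (k - 1) * C)" for k
    unfolding pd_spow[OF nR nh] using x by (simp add: smul_def spow_def n_def C_def)
  \<comment> \<open>The derivative of the vanishing power \<open>Suc q\<close> of the soul; it
    restores the top term of the shifted sum below.\<close>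
  have nq: "n ^ q * C = 0"
  proof -
    have "spow V ?n (Suc q) = 0"
    proof (rule ext)
      fix z
      have "?n z ^ Suc q = 0"
        using superfun_Grassmann[OF nR, of z]
        by (rule Grassmann_nilpotent) (simp_all only: soul_apply[OF fR] gr_body_simps diff_self lessI)
      then show "spow V ?n (Suc q) z = 0 z" by (cases "z \<in> V") (simp_all add: spow_def)
    qed
    then have "0 = D a (spow V ?n (Suc q)) x" by simp
    then show ?thesis unfolding dn by simp
  qed
  have tm: "D a (smul (w gchoose k) (?\<beta> (w - real k) * spow V ?n k)) x
     = (w * ((w - 1) gchoose k) * b powr (w - 1 - real k)) *\<^sub>R (n ^ k * A)
     + ((w gchoose k) * real k * b powr (w - real k)) *\<^sub>R (n ^ (k - 1) * C)" for k
  proof -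
    have c: "A * n ^ k = n ^ k * A"
      using gr_even_commute[OF gr_homogeneous_power_even, of n k A] nh by (simp add: homogeneous_def n_def)
    have sx: "spow V ?n k x = n ^ k" and bx: "?\<beta> v x = of_real (b powr v)" for v
      using x unfolding n_def b_def by (simp_all add: spow_def real_sfun_def)
    have "D a (smul (w gchoose k) (?\<beta> (w - real k) * spow V ?n k)) x
      = (w gchoose k) *\<^sub>R (D a (?\<beta> (w - real k)) x * spow V ?n k x + ?\<beta> (w - real k) x * D a (spow V ?n k) x)"
      using pd_smul[of "?\<beta> (w - real k) * spow V ?n k"] pd_mult_even[OF \<beta>R superfun_spow[OF nR] homogeneous_real_sfun]
        \<beta>R nR by (simp add: smul_def)
    also have "\<dots> = ((w gchoose k) * (w - real k) * b powr (w - 1 - real k)) *\<^sub>R (n ^ k * A)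
       + ((w gchoose k) * real k * b powr (w - real k)) *\<^sub>R (n ^ (k - 1) * C)"
      unfolding d\<beta> dn sx bx by (simp add: c scaleR_right_distrib of_real_def diff_diff_eq add.commute mult_ac)
    finally show ?thesis by (simp add: gchoose_diff_1)
  qed
  have P: "powf f v x = (\<Sum>k\<le>q. ((v gchoose k) * b powr (v - real k)) *\<^sub>R n ^ k)" for v
    by (simp add: powf_def gr_powr_def b_def n)
  have "D a (powf f w) x = (\<Sum>k\<le>q. (w * ((w - 1) gchoose k) * b powr (w - 1 - real k)) *\<^sub>R (n ^ k * A))
     + (\<Sum>k\<le>q. ((w gchoose k) * real k * b powr (w - real k)) *\<^sub>R (n ^ (k - 1) * C))"
    unfolding powf_eq[OF fR] using \<beta>R nR
    by (subst pd_sum) (simp_all add: sum_fun_apply tm sum.distrib)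
  also have "(\<Sum>k\<le>q. (w * ((w - 1) gchoose k) * b powr (w - 1 - real k)) *\<^sub>R (n ^ k * A))
      = w *\<^sub>R (powf f (w - 1) x * A)"
    unfolding P by (simp add: sum_distrib_right scaleR_sum_right mult.assoc)
  also have "(\<Sum>k\<le>q. ((w gchoose k) * real k * b powr (w - real k)) *\<^sub>R (n ^ (k - 1) * C))
      = (\<Sum>k<q. ((w gchoose Suc k) * real (Suc k) * b powr (w - real (Suc k))) *\<^sub>R (n ^ k * C))"
    by (simp add: sum.atMost_shift)
  also have "\<dots> = (\<Sum>k<q. (w * ((w - 1) gchoose k) * b powr (w - 1 - real k)) *\<^sub>R (n ^ k * C))"
  proof (rule sum.cong[OF refl])
    fix k
    have "(w gchoose Suc k) * real (Suc k) = w * ((w - 1) gchoose k)"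
      using gbinomial_absorption[of k w] by (simp add: mult.commute)
    then show "((w gchoose Suc k) * real (Suc k) * b powr (w - real (Suc k))) *\<^sub>R (n ^ k * C)
      = (w * ((w - 1) gchoose k) * b powr (w - 1 - real k)) *\<^sub>R (n ^ k * C)"
      by (simp only: of_nat_Suc diff_diff_eq add.commute)
  qed
  also have "\<dots> = (\<Sum>k\<le>q. (w * ((w - 1) gchoose k) * b powr (w - 1 - real k)) *\<^sub>R (n ^ k * C))"
    using nq by (simp flip: lessThan_Suc_atMost)
  also have "\<dots> = w *\<^sub>R (powf f (w - 1) x * C)"
    unfolding P by (simp add: sum_distrib_right scaleR_sum_right mult.assoc)
  finally show "D a (powf f w) x = smul w (powf f (w - 1) * D a f) x"
    by (simp add: smul_def AC distrib_left scaleR_right_distrib)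
qed

end

text \<open>By Hadamard's lemma every superfunction is a constant plus multiples of the shifted coordinates;
  a map that pulls out the latter as nilpotent factors thus raises the degree at every step.\<close>

lemma derivation_eq_0:
  fixes E :: "sfun \<Rightarrow> grassmann"
  assumes B_def: "B = box_dom p y r" and r: "r > 0" and y: "\<forall>i\<ge>p. y i = 0"
    and add: "\<And>f g. f \<in> superfuns p q B \<Longrightarrow> g \<in> superfuns p q B \<Longrightarrow> E (f + g) = E f + E g"
    and const: "\<And>c. E (const_on B (of_real c)) = 0"
    and even: "\<And>k g. k < p \<Longrightarrow> g \<in> superfuns p q B \<Longrightarrow>
      \<exists>m. gr_body m = 0 \<and> E ((coord p B k - const_on B (of_real (y k))) * g) = m * E g"
    and odd: "\<And>j g. j < q \<Longrightarrow> g \<in> superfuns p q B \<Longrightarrow>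
      \<exists>m. gr_body m = 0 \<and> E (coord p B (p + j) * g) = m * E g"
    and range: "\<And>f. f \<in> superfuns p q B \<Longrightarrow> E f \<in> Grassmann q"
    and f: "f \<in> superfuns p q B"
  shows "E f = 0"
proof -
  interpret superdomain p q B by unfold_locales (simp add: B_def open_box_dom)
  have E0: "E 0 = 0"
  proof -
    have "const_on B (of_real 0) = 0" by (auto simp: const_on_def restr_def fun_eq_iff)
    then show ?thesis using const[of 0] by simp
  qed
  have Esum: "E (sum h A) = (\<Sum>a\<in>A. E (h a))" if "\<And>a. a \<in> A \<Longrightarrow> h a \<in> R" for h :: "nat \<Rightarrow> sfun" and A
    using that by (induction A rule: infinite_finite_induct) (simp_all add: E0 add superfun_sum)
  \<comment> \<open>The claim is for all \<open>f\<close> at once because the step passes from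
    \<open>f\<close> to its Hadamard quotients and tails. Order \<open>Suc q\<close> then forces
    zero.\<close>
  have "gr_order n (E f)" if "f \<in> R" for n f
    using that
  proof (induction n arbitrary: f)
    case (Suc n)
    note f = Suc.prems
    obtain g where g: "\<And>k. k < p \<Longrightarrow> smooth_fun p B (g k)"
      and fg: "\<And>z. z \<in> B \<Longrightarrow> gr_body (f z) = gr_body (f y) + (\<Sum>k<p. (z k - y k) * g k z)"
      using Hadamard[OF r y superfun_body_smooth[OF f, unfolded B_def]] unfolding B_def by blast
    let ?h = "\<lambda>j x. gr_tail j (f x)"
    have hR: "?h j \<in> R" if "j < q" for j
    proof (rule superfunI)
      fix x show "?h j x \<in> Grassmann q"
        using superfun_Grassmann[OF f, of x] that by (auto simp: Grassmann_def gr_coeff_tail split: if_splits)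
    next
      fix I show "smooth_fun p B (\<lambda>x. gr_coeff (?h j x) I)"
      proof (cases "\<forall>l\<in>I. j < l")
        case True
        then have "(\<lambda>x. gr_coeff (?h j x) I) = (\<lambda>x. gr_coeff (f x) (insert j I))" by (simp add: gr_coeff_tail)
        then show ?thesis using superfun_smooth[OF f] by metis
      next
        case False
        then have "(\<lambda>x. gr_coeff (?h j x) I) = (\<lambda>x. 0)" by (simp only: gr_coeff_tail if_False)
        then show ?thesis using smooth_fun_const[OF V] by metis
      qed
    qed (auto simp: superfun_outside[OF f] gr_coeff_tail intro!: gr_eqI)
    let ?c = "const_on B (of_real (gr_body (f y)))"
    let ?G = "\<Sum>k<p. (coord p B k - const_on B (of_real (y k))) * real_sfun B (g k)"
    let ?H = "\<Sum>j<q. coord p B (p + j) * ?h j"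
    have GR: "(coord p B k - const_on B (of_real (y k))) * real_sfun B (g k) \<in> R" if "k < p" for k
      using that g by simp
    have HR: "coord p B (p + j) * ?h j \<in> R" if "j < q" for j using that hR by simp
    have "f = ?c + (?G + ?H)"
    proof (rule superfun_eqI[OF f])
      show "?c + (?G + ?H) \<in> R" by (intro superfun_add superfun_sum GR HR superfun_const) auto
      fix x assume x: "x \<in> B"
      have "?G x = (\<Sum>k<p. of_real ((x k - y k) * g k x))"
        unfolding sum_fun_apply by (rule sum.cong) (use x in \<open>auto simp: coord_def real_sfun_def\<close>)
      then have G: "?G x = of_real (\<Sum>k<p. (x k - y k) * g k x)" by (simp only: of_real_sum)
      have H: "?H x = (\<Sum>j<q. gr_gen j * gr_tail j (f x))"
        unfolding sum_fun_apply by (rule sum.cong) (use x in \<open>auto simp: coord_def\<close>)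
      have "(?c + (?G + ?H)) x = of_real (gr_body (f y)) + (of_real (\<Sum>k<p. (x k - y k) * g k x) + (\<Sum>j<q. gr_gen j * gr_tail j (f x)))"
        unfolding plus_fun_apply G H using x by (simp only: const_on_apply)
      also have "\<dots> = of_real (gr_body (f x)) + (\<Sum>j<q. gr_gen j * gr_tail j (f x))"
        unfolding fg[OF x] of_real_add add.assoc ..
      also have "\<dots> = f x" using gr_tail_decompose[OF superfun_Grassmann[OF f]] by metis
      finally show "f x = (?c + (?G + ?H)) x" by simp
    qed
    then have "E f = E (?c + (?G + ?H))" by simp
    also have "\<dots> = E ?G + E ?H"
      using superfun_sum[OF GR, of "{..<p}"] superfun_sum[OF HR, of "{..<q}"] by (simp add: add const)
    also have "\<dots> = (\<Sum>k<p. E ((coord p B k - const_on B (of_real (y k))) * real_sfun B (g k)))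
        + (\<Sum>j<q. E (coord p B (p + j) * ?h j))"
      using Esum[of "{..<p}", OF GR] Esum[of "{..<q}", OF HR] by simp
    finally have Ef: "E f = \<dots>" .
    have "gr_order (Suc n) (m * E g)" if "gr_body m = 0" "g \<in> R" for m g
      using gr_order_mult[of 1 m n "E g"] that Suc.IH by (simp add: gr_order_Suc_0_iff)
    then show ?case unfolding Ef
      by (intro gr_order_add gr_order_sum) (metis even odd g hR superfun_real lessThan_iff)+
  qed simp
  then show ?thesis using Grassmann_order_eq_0[OF range[OF f]] f by blast
qed

section \<open>Transition maps\<close>

lemma supermanifold_chart:
  assumes "supermanifold M" "i \<in> charts M"
  shows "openin (base M) (chart_dom M i)" "open_dom (evdim M) (vdom M i)"
    "homeomorphic_map (subtopology (base M) (chart_dom M i))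
      (subtopology (Euclidean_space (evdim M)) (vdom M i)) (chart_map M i)"
  using assms(1)[unfolded supermanifold_def, THEN conjunct2, THEN conjunct2, THEN conjunct2, THEN conjunct1] assms(2)
  by blast+

lemma chart_topspace:
  assumes "supermanifold M" "i \<in> charts M"
  shows "topspace (subtopology (base M) (chart_dom M i)) = chart_dom M i"
  using openin_subset[OF supermanifold_chart(1)[OF assms]] by auto

lemma chart_inj: "supermanifold M \<Longrightarrow> i \<in> charts M \<Longrightarrow> inj_on (chart_map M i) (chart_dom M i)"
  using homeomorphic_imp_injective_map[OF supermanifold_chart(3)] chart_topspace by metis

lemma open_img:
  assumes "supermanifold M" "i \<in> charts M" "openin (base M) W" "W \<subseteq> chart_dom M i"
  shows "open_dom (evdim M) (img M i W)"
proof -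
  have "openin (subtopology (base M) (chart_dom M i)) W"
    using assms(3,4) by (simp add: openin_subset_topspace_eq openin_subtopology) blast
  then have "openin (subtopology (Euclidean_space (evdim M)) (vdom M i)) (chart_map M i ` W)"
    using homeomorphic_map_openness[OF supermanifold_chart(3)[OF assms(1,2)], of W] chart_topspace[OF assms(1,2)] assms(4)
    by (metis)
  then show ?thesis using supermanifold_chart(2)[OF assms(1,2)] openin_trans_full by (auto simp: img_def)
qed

lemma open_preimg:
  assumes "supermanifold M" "i \<in> charts M" "openin (base M) W" "W \<subseteq> chart_dom M i" "open_dom (evdim M) B"
  shows "openin (base M) {P \<in> W. chart_map M i P \<in> B}"
proof -
  have "openin (subtopology (Euclidean_space (evdim M)) (vdom M i)) (B \<inter> vdom M i)"
    using assms(5) by (rule openin_subtopology_Int)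
  moreover have "continuous_map (subtopology (base M) (chart_dom M i))
      (subtopology (Euclidean_space (evdim M)) (vdom M i)) (chart_map M i)"
    using supermanifold_chart(3)[OF assms(1,2)] homeomorphic_imp_continuous_map by blast
  ultimately have "openin (subtopology (base M) (chart_dom M i)) {P \<in> chart_dom M i. chart_map M i P \<in> B \<inter> vdom M i}"
    using openin_continuous_map_preimage chart_topspace[OF assms(1,2)] by fastforce
  then have "openin (base M) {P \<in> chart_dom M i. chart_map M i P \<in> B \<inter> vdom M i}"
    using supermanifold_chart(1)[OF assms(1,2)] openin_trans_full by blast
  then have "openin (base M) (W \<inter> {P \<in> chart_dom M i. chart_map M i P \<in> B \<inter> vdom M i})"
    using assms(3) by (rule openin_Int[rotated])
  moreover have "W \<inter> {P \<in> chart_dom M i. chart_map M i P \<in> B \<inter> vdom M i} = {P \<in> W. chart_map M i P \<in> B}"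
    using assms(4) by (auto simp: vdom_def img_def)
  ultimately show ?thesis by simp
qed

lemma open_overlap:
  assumes "supermanifold M" "i \<in> charts M" "j \<in> charts M" shows "openin (base M) (overlap M i j)"
  unfolding overlap_def using supermanifold_chart(1)[OF assms(1)] assms by blast

locale transition_map =
  fixes M :: "('x, 'i) supermfd" and i j :: 'i and U :: "'x set"
  assumes M: "supermanifold M" and i: "i \<in> charts M" and j: "j \<in> charts M"
    and U: "openin (base M) U" "U \<subseteq> overlap M i j"
begin

abbreviation "p \<equiv> evdim M"
abbreviation "q \<equiv> odim M"
abbreviation "Vi \<equiv> img M i U"
abbreviation "Vj \<equiv> img M j U"
abbreviation "\<phi> \<equiv> transition M i j U"
abbreviation "\<psi> \<equiv> transition M j i U"

lemma Ui: "U \<subseteq> chart_dom M i" and Uj: "U \<subseteq> chart_dom M j"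
  using U(2) by (auto simp: overlap_def)

sublocale I: superdomain p q Vi
  by unfold_locales (rule open_img[OF M i U(1) Ui])

sublocale J: superdomain p q Vj
  by unfold_locales (rule open_img[OF M j U(1) Uj])

lemma trans_all:
  assumes "openin (base M) W" "W \<subseteq> overlap M i j"
  shows "(\<forall>f\<in>sfuns M j W. transition M i j W f \<in> sfuns M i W) \<and>
        transition M i j W (const_on (img M j W) 1) = const_on (img M i W) 1 \<and>
        (\<forall>f\<in>sfuns M j W. \<forall>g\<in>sfuns M j W.
           transition M i j W (f + g) = transition M i j W f + transition M i j W g \<and>
           transition M i j W (f * g) = transition M i j W f * transition M i j W g) \<and>
        (\<forall>f\<in>sfuns M j W. \<forall>r. transition M i j W (smul r f) = smul r (transition M i j W f)) \<and>
        (\<forall>f\<in>sfuns M j W. \<forall>e. homogeneous e f \<longrightarrow> homogeneous e (transition M i j W f)) \<and>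
        (\<forall>W'. openin (base M) W' \<and> W' \<subseteq> W \<longrightarrow>
           (\<forall>f\<in>sfuns M j W. transition M i j W' (restr (img M j W') f)
                              = restr (img M i W') (transition M i j W f)))"
  using M[unfolded supermanifold_def, THEN conjunct2, THEN conjunct2, THEN conjunct2, THEN conjunct2, THEN conjunct1,
    rule_format, OF i j, OF conjI, OF assms] by blast

lemma \<phi>_closed [simp]: "f \<in> J.R \<Longrightarrow> \<phi> f \<in> I.R"
  using trans_all[OF U, unfolded sfuns_def, THEN conjunct1] by blast

lemma \<phi>_one [simp]: "\<phi> (const_on Vj 1) = const_on Vi 1"
  using trans_all[OF U, unfolded sfuns_def, THEN conjunct2, THEN conjunct1] by blast

lemma \<phi>_add: "f \<in> J.R \<Longrightarrow> g \<in> J.R \<Longrightarrow> \<phi> (f + g) = \<phi> f + \<phi> g"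
  using trans_all[OF U, unfolded sfuns_def, THEN conjunct2, THEN conjunct2, THEN conjunct1] by blast

lemma \<phi>_mult: "f \<in> J.R \<Longrightarrow> g \<in> J.R \<Longrightarrow> \<phi> (f * g) = \<phi> f * \<phi> g"
  using trans_all[OF U, unfolded sfuns_def, THEN conjunct2, THEN conjunct2, THEN conjunct1] by blast

lemma \<phi>_smul: "f \<in> J.R \<Longrightarrow> \<phi> (smul r f) = smul r (\<phi> f)"
  using trans_all[OF U, unfolded sfuns_def, THEN conjunct2, THEN conjunct2, THEN conjunct2, THEN conjunct1] by blast

lemma \<phi>_homogeneous: "f \<in> J.R \<Longrightarrow> homogeneous e f \<Longrightarrow> homogeneous e (\<phi> f)"
  using trans_all[OF U, unfolded sfuns_def, THEN conjunct2, THEN conjunct2, THEN conjunct2, THEN conjunct2, THEN conjunct1] by blast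

lemma \<phi>_restr:
  "f \<in> J.R \<Longrightarrow> openin (base M) W \<Longrightarrow> W \<subseteq> U \<Longrightarrow>
    transition M i j W (restr (img M j W) f) = restr (img M i W) (\<phi> f)"
  using trans_all[OF U, unfolded sfuns_def, THEN conjunct2, THEN conjunct2, THEN conjunct2, THEN conjunct2, THEN conjunct2] by blast

lemma \<phi>_0 [simp]: "\<phi> 0 = 0"
proof -
  have "\<phi> (smul 0 0) = smul 0 (\<phi> 0)" by (rule \<phi>_smul) simp
  moreover have "smul 0 f = 0" for f by (simp add: smul_def fun_eq_iff)
  ultimately show ?thesis by simp
qed

lemma \<phi>_uminus: "f \<in> J.R \<Longrightarrow> \<phi> (- f) = - \<phi> f"
  using \<phi>_smul[of f "-1"] by (simp add: smul_def fun_Compl_def)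

lemma \<phi>_diff: "f \<in> J.R \<Longrightarrow> g \<in> J.R \<Longrightarrow> \<phi> (f - g) = \<phi> f - \<phi> g"
  using \<phi>_add[of f "- g"] \<phi>_uminus[of g] by simp

lemma \<phi>_neg1: "f \<in> J.R \<Longrightarrow> \<phi> ((-1) ^ n * f) = (-1) ^ n * \<phi> f"
  by (simp add: minus_one_power_iff \<phi>_uminus)

lemma \<phi>_sum: "(\<And>a. a \<in> A \<Longrightarrow> f a \<in> J.R) \<Longrightarrow> \<phi> (sum f A) = (\<Sum>a\<in>A. \<phi> (f a))"
  by (induction A rule: infinite_finite_induct) (simp_all add: \<phi>_add J.superfun_sum)

lemma smul_const_on: "smul c (const_on V 1) = const_on V (of_real c)"
  by (auto simp: smul_def const_on_def restr_def fun_eq_iff of_real_def)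

lemma \<phi>_const: "\<phi> (const_on Vj (of_real c)) = const_on Vi (of_real c)"
  using \<phi>_smul[of "const_on Vj 1" c] by (simp add: smul_const_on)

lemma \<phi>_of_bool: "\<phi> (const_on Vj (of_bool b)) = const_on Vi (of_bool b)"
  using \<phi>_const[of 0] \<phi>_const[of 1] by (cases b) simp_all

lemma swap: "transition_map M j i U"
  using M i j U by unfold_locales (auto simp: overlap_def)

lemma shrink: "openin (base M) W \<Longrightarrow> W \<subseteq> U \<Longrightarrow> transition_map M i j W"
  using M i j U by unfold_locales auto

lemma \<psi>_\<phi>: "f \<in> J.R \<Longrightarrow> \<psi> (\<phi> f) = f"
proof -
  assume f: "f \<in> J.R"
  note m = M[unfolded supermanifold_def, THEN conjunct2, THEN conjunct2, THEN conjunct2, THEN conjunct2, THEN conjunct2]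
  have "transition M j j U f = f"
    using m[THEN conjunct1, rule_format, OF j conjI, OF U(1) Uj] f unfolding sfuns_def by blast
  moreover have "\<psi> (\<phi> f) = transition M j j U f"
    using m[THEN conjunct2, rule_format, OF j i j conjI, of U f] U(1) Ui Uj f unfolding sfuns_def by blast
  ultimately show ?thesis by simp
qed

lemma \<phi>_\<psi>: "f \<in> I.R \<Longrightarrow> \<phi> (\<psi> f) = f"
  using transition_map.\<psi>_\<phi>[OF swap] .

lemma \<psi>_closed [simp]: "f \<in> I.R \<Longrightarrow> \<psi> f \<in> J.R"
  using transition_map.\<phi>_closed[OF swap] .

text \<open>A function with nonzero body at a point is invertible nearby, and this is seen in every chart.\<close>

lemma body_zero:
  assumes P: "P \<in> U" and f: "f \<in> J.R" and z: "gr_body (f (chart_map M j P)) = 0"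
  shows "gr_body (\<phi> f (chart_map M i P)) = 0"
proof (rule ccontr)
  assume nz: "gr_body (\<phi> f (chart_map M i P)) \<noteq> 0"
  let ?B = "{x \<in> Vi. gr_body (\<phi> f x) \<noteq> 0}"
  have "continuous_on Vi (\<lambda>x. gr_body (\<phi> f x))"
    using smooth_fun_continuous[OF I.V I.superfun_body_smooth] f by simp
  then have "openin (top_of_set Vi) {x \<in> Vi. gr_body (\<phi> f x) \<in> - {0}}"
    using continuous_openin_preimage_gen[of Vi "\<lambda>x. gr_body (\<phi> f x)" "- {0}"]
    by (simp add: vimage_def Int_def open_Compl)
  then obtain T where T: "open T" "?B = Vi \<inter> T" by (auto simp: openin_open)
  obtain T' where T': "open T'" "Vi = {x. \<forall>i\<ge>p. x i = 0} \<inter> T'" using I.V unfolding open_dom_iff by blast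
  have "?B = {x. \<forall>i\<ge>p. x i = 0} \<inter> (T' \<inter> T)" unfolding T(2) by (subst T'(2)) (simp only: Int_assoc)
  with open_Int[OF T'(1) T(1)] have B: "open_dom p ?B" unfolding open_dom_iff by (intro exI[of _ "T' \<inter> T"] conjI)
  define W where "W = {P \<in> U. chart_map M i P \<in> ?B}"
  have W: "openin (base M) W" "W \<subseteq> U" using open_preimg[OF M i U(1) Ui B] by (auto simp: W_def)
  have PW: "P \<in> W" using P nz by (auto simp: W_def img_def)
  interpret W: transition_map M i j W by (rule shrink[OF W])
  let ?g = "restr (img M i W) (\<phi> f)"
  have iW: "img M i W \<subseteq> Vi" "img M j W \<subseteq> Vj" using W(2) by (auto simp: img_def)
  have fW: "restr (img M j W) f \<in> W.J.R" by (rule J.superfun_restr[OF f W.J.V iW(2)])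
  have g: "?g = W.\<phi> (restr (img M j W) f)" using \<phi>_restr[OF f W] by simp
  have gR: "?g \<in> W.I.R" unfolding g using fW by simp
  have gnz: "gr_body (?g x) \<noteq> 0" if "x \<in> img M i W" for x
    using that by (auto simp: W_def img_def)
  have h: "sinv (img M i W) ?g \<in> W.I.R" by (rule W.I.superfun_inverse[OF gR gnz])
  have "restr (img M j W) f * W.\<psi> (sinv (img M i W) ?g) = W.\<psi> ?g * W.\<psi> (sinv (img M i W) ?g)"
    unfolding g using W.\<psi>_\<phi>[OF fW] by simp
  also have "\<dots> = W.\<psi> (?g * sinv (img M i W) ?g)"
    using transition_map.\<phi>_mult[OF W.swap gR h] by simp
  also have "\<dots> = const_on (img M j W) 1"
    using W.I.superfun_inverse_mult(1)[OF gR gnz] transition_map.\<phi>_one[OF W.swap] by simp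
  finally have "(restr (img M j W) f * W.\<psi> (sinv (img M i W) ?g)) (chart_map M j P) = const_on (img M j W) 1 (chart_map M j P)"
    by simp
  moreover have "chart_map M j P \<in> img M j W" using PW by (auto simp: img_def)
  ultimately have "gr_body (f (chart_map M j P) * W.\<psi> (sinv (img M i W) ?g) (chart_map M j P)) = 1" by simp
  then show False using z by simp
qed

text \<open>Subtracting the value as a constant, which the transition preserves, reduces to
  \<open>body_zero\<close>. The abstract algebra map thus induces the given map of points.\<close>

lemma body_\<phi>:
  assumes P: "P \<in> U" and f: "f \<in> J.R"
  shows "gr_body (\<phi> f (chart_map M i P)) = gr_body (f (chart_map M j P))"
proof -
  let ?c = "of_real (gr_body (f (chart_map M j P)))"
  have PV: "chart_map M j P \<in> Vj" "chart_map M i P \<in> Vi" using P by (auto simp: img_def)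
  have "gr_body (\<phi> (f - const_on Vj ?c) (chart_map M i P)) = 0"
    using P f PV by (intro body_zero) simp_all
  then show ?thesis using f PV by (simp add: \<phi>_diff \<phi>_const)
qed

section \<open>The chain rule for transition maps\<close>

definition Jac :: "nat \<Rightarrow> nat \<Rightarrow> sfun" where
  "Jac a b = I.D a (\<phi> (coord p Vj b))"

lemma Jac_closed [simp]: "b < p + q \<Longrightarrow> Jac a b \<in> I.R"
  by (simp add: Jac_def)

lemma Jac_homogeneous: "b < p + q \<Longrightarrow> homogeneous (cpar p a + cpar p b) (Jac a b)"
  unfolding Jac_def using homogeneous_pd[OF \<phi>_homogeneous[OF J.superfun_coord homogeneous_coord]]
  by (metis add.commute)

text \<open>The failure of the chain rule. As an additive map that kills constants, it is accessible
  to \<open>derivation_eq_0\<close> once its behaviour on multiples of a coordinate is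
  known.\<close>

definition chain_defect :: "nat \<Rightarrow> sfun \<Rightarrow> sfun" where
  "chain_defect a f = I.D a (\<phi> f) - (\<Sum>b<p + q. Jac a b * \<phi> (J.D b f))"

lemma chain_defect_closed: "f \<in> J.R \<Longrightarrow> chain_defect a f \<in> I.R"
  unfolding chain_defect_def by (intro I.superfun_diff I.superfun_sum I.superfun_mult) auto

text \<open>The terms that differentiate \<open>h\<close> agree on both sides of the chain rule,
  because \<open>h\<close> has the derivatives of a coordinate; only those that differentiate
  \<open>g\<close> survive.\<close>

lemma chain_defect_mult:
  assumes h: "h \<in> J.R" "homogeneous (cpar p k) h" and k: "k < p + q"
    and dh: "\<And>b. b < p + q \<Longrightarrow> J.D b h = const_on Vj (of_bool (b = k))" "I.D a (\<phi> h) = Jac a k"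
    and g: "g \<in> J.R"
  shows "chain_defect a (h * g) = (-1) ^ (cpar p a * cpar p k) * (\<phi> h * chain_defect a g)"
proof -
  let ?s = "(-1) ^ (cpar p a * cpar p k) :: sfun"
  have \<phi>h: "homogeneous (cpar p k) (\<phi> h)" using \<phi>_homogeneous h by blast
  have 1: "I.D a (\<phi> (h * g)) = Jac a k * \<phi> g + ?s * (\<phi> h * I.D a (\<phi> g))"
    using I.pd_mult_homogeneous[OF _ _ \<phi>h] h g by (simp add: \<phi>_mult dh(2))
  have 2: "Jac a b * \<phi> (J.D b (h * g))
      = Jac a b * const_on Vi (of_bool (b = k)) * \<phi> g + ?s * (\<phi> h * (Jac a b * \<phi> (J.D b g)))"
    if b: "b < p + q" for b
  proof -
    have "\<phi> (J.D b (h * g)) = const_on Vi (of_bool (b = k)) * \<phi> g + (-1) ^ (cpar p b * cpar p k) * (\<phi> h * \<phi> (J.D b g))"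
      unfolding J.pd_mult_homogeneous[OF h(1) g h(2)] using h g b
      by (simp add: \<phi>_add \<phi>_mult \<phi>_neg1 dh(1) \<phi>_of_bool)
    moreover have "Jac a b * ((-1) ^ (cpar p b * cpar p k) * (\<phi> h * \<phi> (J.D b g))) = ?s * (\<phi> h * (Jac a b * \<phi> (J.D b g)))"
    proof -
      have "Jac a b * \<phi> h = (-1) ^ ((cpar p a + cpar p b) * cpar p k) * (\<phi> h * Jac a b)"
        by (rule sfun_commute[OF Jac_homogeneous[OF b] \<phi>h])
      \<comment> \<open>Moving \<open>\<phi> h\<close> past \<open>Jac a b\<close> gives a sign for
        \<open>a\<close> and one for \<open>b\<close>; the latter cancels the sign of
        \<open>J.D b\<close>, so a single sign serves all \<open>b\<close>.\<close>
      then have "(-1) ^ (cpar p b * cpar p k) * (Jac a b * \<phi> h) = ?s * (\<phi> h * Jac a b)"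
        by (simp add: minus_one_power_iff cpar_def)
      then show ?thesis by (simp only: neg1_commute mult.assoc[symmetric])
    qed
    ultimately show ?thesis by (simp add: distrib_left mult.assoc)
  qed
  have 3: "(\<Sum>b<p + q. Jac a b * const_on Vi (of_bool (b = k))) = Jac a k"
  proof -
    have "Jac a b * const_on Vi (of_bool (b = k)) = (if b = k then Jac a k else 0)" if "b < p + q" for b
    proof (cases "b = k")
      case True
      then show ?thesis using I.superfun_one_mult(2)[OF Jac_closed[OF k]] by simp
    qed (auto simp: fun_eq_iff const_on_def restr_def)
    then have "(\<Sum>b<p + q. Jac a b * const_on Vi (of_bool (b = k))) = (\<Sum>b<p + q. if b = k then Jac a k else 0)"
      by (intro sum.cong) auto
    then show ?thesis using k by simp
  qed
  have "(\<Sum>b<p + q. Jac a b * \<phi> (J.D b (h * g)))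
      = Jac a k * \<phi> g + ?s * (\<phi> h * (\<Sum>b<p + q. Jac a b * \<phi> (J.D b g)))"
    by (simp add: 2 sum.distrib sum_distrib_left flip: 3 sum_distrib_right)
  then show ?thesis unfolding chain_defect_def 1 by (simp add: algebra_simps)
qed

text \<open>Centred coordinates have zero body at the point, and by \<open>body_\<phi>\<close> so do
  their images: these are the bodiless multipliers that \<open>derivation_eq_0\<close> asks
  for.\<close>

lemma chain_rule_box:
  assumes P: "P \<in> U" and r: "r > 0" and box: "Vj = box_dom p (chart_map M j P) r" and f: "f \<in> J.R"
  shows "chain_defect a f (chart_map M i P) = 0"
proof (rule derivation_eq_0[OF box r, of q "\<lambda>f. chain_defect a f (chart_map M i P)"])
  let ?y = "chart_map M j P" and ?x = "chart_map M i P"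
  have PV: "?y \<in> Vj" "?x \<in> Vi" using P by (auto simp: img_def)
  show "\<forall>i\<ge>p. ?y i = 0" using open_dom_zero[OF J.V PV(1)] by blast
  show "chain_defect a (f + g) ?x = chain_defect a f ?x + chain_defect a g ?x" if "f \<in> J.R" "g \<in> J.R" for f g
    using that by (simp add: chain_defect_def \<phi>_add I.pd_add J.pd_add distrib_left sum.distrib)
  show "chain_defect a (const_on Vj (of_real c)) ?x = 0" for c
    by (simp add: chain_defect_def \<phi>_const I.pd_const J.pd_const sum_fun_apply)
  have body: "gr_body (\<phi> h ?x) = 0" if "h \<in> J.R" "gr_body (h ?y) = 0" for h
    using body_\<phi>[OF P that(1)] that(2) by simp
  have m: "\<exists>m. gr_body m = 0 \<and> chain_defect a (h * g) ?x = m * chain_defect a g ?x"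
    if "h \<in> J.R" "homogeneous (cpar p k) h" "k < p + q" "gr_body (h ?y) = 0"
      "\<And>b. b < p + q \<Longrightarrow> J.D b h = const_on Vj (of_bool (b = k))" "I.D a (\<phi> h) = Jac a k" "g \<in> J.R" for h k g
  proof (intro exI conjI)
    show "gr_body ((-1) ^ (cpar p a * cpar p k) * \<phi> h ?x) = 0" using body[OF that(1,4)] by simp
    show "chain_defect a (h * g) ?x = (-1) ^ (cpar p a * cpar p k) * \<phi> h ?x * chain_defect a g ?x"
      using chain_defect_mult[OF that(1-3,5-7)] by (simp add: power_fun_apply mult.assoc)
  qed
  show "\<exists>m. gr_body m = 0 \<and> chain_defect a ((coord p Vj k - const_on Vj (of_real (?y k))) * g) ?x = m * chain_defect a g ?x"
    if k: "k < p" "g \<in> J.R" for k g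
  proof (rule m[where k = k])
    have c: "cpar p k = 0" using k by (simp add: cpar_def)
    show "homogeneous (cpar p k) (coord p Vj k - const_on Vj (of_real (?y k)))"
      using homogeneous_coord[of p k Vj] by (intro homogeneous_diff homogeneous_const_on) (simp_all add: c)
    show "J.D b (coord p Vj k - const_on Vj (of_real (?y k))) = const_on Vj (of_bool (b = k))" for b
      using k by (simp add: J.pd_diff J.pd_const J.pd_coord)
    show "I.D a (\<phi> (coord p Vj k - const_on Vj (of_real (?y k)))) = Jac a k"
      using k by (simp add: \<phi>_diff \<phi>_const I.pd_diff I.pd_const Jac_def)
  qed (use k PV in simp_all, simp add: coord_def)
  show "\<exists>m. gr_body m = 0 \<and> chain_defect a (coord p Vj (p + k) * g) ?x = m * chain_defect a g ?x"
    if k: "k < q" "g \<in> J.R" for k g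
    using k PV by (intro m[where k = "p + k"]) (simp_all add: homogeneous_coord J.pd_coord Jac_def, simp add: coord_def)
  show "chain_defect a f ?x \<in> Grassmann q" if "f \<in> J.R" for f
    using I.superfun_Grassmann chain_defect_closed[OF that] by blast
qed (rule f)

text \<open>Derivatives and transitions commute with restriction, so near each point the overlap may
  be replaced by the preimage of a cube, where Hadamard's lemma is available.\<close>

theorem chain_rule:
  assumes f: "f \<in> J.R" shows "I.D a (\<phi> f) = (\<Sum>b<p + q. Jac a b * \<phi> (J.D b f))"
proof -
  have "chain_defect a f = 0"
  proof (rule I.superfun_eqI[OF chain_defect_closed[OF f] I.superfun_0])
    fix x assume "x \<in> Vi"
    then obtain P where P: "P \<in> U" "x = chart_map M i P" by (auto simp: img_def)
    let ?y = "chart_map M j P"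
    have y: "?y \<in> Vj" using P by (auto simp: img_def)
    obtain r where r: "r > 0" "box_dom p ?y r \<subseteq> Vj" using box_dom_neighbourhood[OF J.V y] by blast
    define W where "W = {P \<in> U. chart_map M j P \<in> box_dom p ?y r}"
    have W: "openin (base M) W" "W \<subseteq> U"
      using open_preimg[OF M j U(1) Uj open_box_dom] by (auto simp: W_def)
    have PW: "P \<in> W" using P r open_dom_zero[OF J.V y] by (auto simp: W_def box_dom_def)
    have imW: "img M j W = box_dom p ?y r" using r(2) by (auto simp: W_def img_def)
    interpret W: transition_map M i j W by (rule shrink[OF W])
    have iW: "img M i W \<subseteq> Vi" "img M j W \<subseteq> Vj" using W(2) by (auto simp: img_def)
    have R: "W.\<phi> (restr (img M j W) g) = restr (img M i W) (\<phi> g)" if "g \<in> J.R" for g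
      using \<phi>_restr[OF that W] .
    have RD: "pd p (img M i W) a (restr (img M i W) g) = restr (img M i W) (I.D a g)" for g
      by (rule I.pd_restr[OF W.I.V iW(1)])
    have WJ: "W.Jac a b = restr (img M i W) (Jac a b)" if "b < p + q" for b
      using R[OF J.superfun_coord[OF that]] RD unfolding W.Jac_def Jac_def by (simp add: restr_coord[OF iW(2)])
    have "W.chain_defect a (restr (img M j W) f) = restr (img M i W) (chain_defect a f)"
      unfolding W.chain_defect_def chain_defect_def restr_simps restr_sum
      using R[OF f] RD WJ J.pd_restr[OF W.J.V iW(2)] R[OF J.superfun_pd[OF f]] by simp
    moreover have "W.chain_defect a (restr (img M j W) f) (chart_map M i P) = 0"
      by (rule W.chain_rule_box[OF PW r(1) imW J.superfun_restr[OF f W.J.V iW(2)]])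
    moreover have "x \<in> img M i W" using PW P(2) by (auto simp: img_def)
    ultimately show "chain_defect a f x = 0 x" using P(2) by (metis restr_apply(1) zero_fun_apply)
  qed
  then show ?thesis by (simp add: chain_defect_def)
qed

end

section \<open>The Berezinian\<close>

subsection \<open>Determinants of even matrices\<close>

text \<open>The even elements form a commutative ring, to which the theory of determinants applies.\<close>

typedef egr = "{x. gr_homogeneous 0 x}"
  morphisms of_egr Abs_egr by (rule exI[of _ 0]) simp

setup_lifting type_definition_egr

instantiation egr :: comm_ring_1
begin

lift_definition zero_egr :: egr is 0 by simp
lift_definition one_egr :: egr is 1 by simp
lift_definition plus_egr :: "egr \<Rightarrow> egr \<Rightarrow> egr" is "(+)" by (rule gr_homogeneous_add)
lift_definition minus_egr :: "egr \<Rightarrow> egr \<Rightarrow> egr" is "(-)" by (rule gr_homogeneous_diff)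
lift_definition uminus_egr :: "egr \<Rightarrow> egr" is uminus by (rule gr_homogeneous_uminus)
lift_definition times_egr :: "egr \<Rightarrow> egr \<Rightarrow> egr" is "(*)" by (rule gr_homogeneous_mult_even)

lemma of_egr_even: "gr_homogeneous 0 (of_egr x)"
  using of_egr[of x] by simp

instance
proof
  fix x y z :: egr
  note rep = of_egr_inject[symmetric] zero_egr.rep_eq one_egr.rep_eq plus_egr.rep_eq minus_egr.rep_eq
    uminus_egr.rep_eq times_egr.rep_eq
  show "x + y + z = x + (y + z)" "x + y = y + x" "0 + x = x" "- x + x = 0" "x - y = x + - y"
    "x * y * z = x * (y * z)" "1 * x = x" "(x + y) * z = x * z + y * z" "(0::egr) \<noteq> 1"
    by (simp_all add: rep algebra_simps)
  show "x * y = y * x" unfolding rep by (rule gr_even_commute[OF of_egr_even])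
qed

end

lemma of_egr_simps:
  "of_egr 0 = 0" "of_egr 1 = 1" "of_egr (x + y) = of_egr x + of_egr y" "of_egr (x * y) = of_egr x * of_egr y"
  "of_egr (- x) = - of_egr x" "of_egr (x - y) = of_egr x - of_egr y"
  by (simp_all add: zero_egr.rep_eq one_egr.rep_eq plus_egr.rep_eq minus_egr.rep_eq
    uminus_egr.rep_eq times_egr.rep_eq)

lemma of_egr_sum: "of_egr (sum f A) = (\<Sum>a\<in>A. of_egr (f a))"
  by (induction A rule: infinite_finite_induct) (simp_all add: of_egr_simps)

lemma of_egr_inverse: "gr_homogeneous 0 x \<Longrightarrow> of_egr (Abs_egr x) = x"
  by (simp add: Abs_egr_inverse)

definition emat :: "nat \<Rightarrow> (nat \<Rightarrow> nat \<Rightarrow> grassmann) \<Rightarrow> egr mat" where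
  "emat n A = mat n n (\<lambda>(i, j). Abs_egr (A i j))"

definition even_mat :: "nat \<Rightarrow> (nat \<Rightarrow> nat \<Rightarrow> grassmann) \<Rightarrow> bool" where
  "even_mat n A \<longleftrightarrow> (\<forall>i<n. \<forall>j<n. gr_homogeneous 0 (A i j))"

lemma emat_carrier [simp]: "emat n A \<in> carrier_mat n n" "dim_row (emat n A) = n" "dim_col (emat n A) = n"
  by (simp_all add: emat_def)

lemma emat_index: "even_mat n A \<Longrightarrow> i < n \<Longrightarrow> j < n \<Longrightarrow> of_egr (emat n A $$ (i, j)) = A i j"
  by (simp add: emat_def even_mat_def of_egr_inverse)

lemma of_egr_prod_list: "of_egr (prod_list (map f xs)) = prod_list (map (\<lambda>x. of_egr (f x)) xs)"
  by (induction xs) (simp_all add: of_egr_simps)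

lemma gr_det_emat:
  assumes A: "even_mat n A" shows "gr_det n A = of_egr (det (emat n A))"
proof -
  have "of_egr (of_int (sign \<pi>)) = of_int (sign \<pi>)" for \<pi> :: "nat \<Rightarrow> nat"
    by (simp add: sign_def of_egr_simps)
  moreover have "of_egr (\<Prod>i = 0..<n. emat n A $$ (i, \<pi> i)) = prod_list (map (\<lambda>i. A i (\<pi> i)) [0..<n])"
    if \<pi>: "\<pi> permutes {0..<n}" for \<pi>
  proof -
    have "(\<Prod>i = 0..<n. emat n A $$ (i, \<pi> i)) = prod_list (map (\<lambda>i. emat n A $$ (i, \<pi> i)) [0..<n])"
      by (subst prod.distinct_set_conv_list[symmetric]) auto
    also have "of_egr \<dots> = prod_list (map (\<lambda>i. A i (\<pi> i)) [0..<n])"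
      unfolding of_egr_prod_list
      by (intro arg_cong[where f = prod_list] map_cong refl)
        (use \<pi> permutes_in_image[OF \<pi>] in \<open>simp add: emat_index[OF A]\<close>)
    finally show ?thesis .
  qed
  ultimately show ?thesis
    unfolding gr_det_def det_def'[OF emat_carrier(1)] of_egr_sum
    by (intro sum.cong) (auto simp: atLeast0LessThan of_egr_simps)
qed

lemma gr_det_cong:
  assumes "\<And>i j. i < n \<Longrightarrow> j < n \<Longrightarrow> A i j = B i j" shows "gr_det n A = gr_det n B"
  unfolding gr_det_def
proof (rule sum.cong[OF refl])
  fix \<pi> assume "\<pi> \<in> {\<pi>. \<pi> permutes {..<n}}"
  then have "\<pi> i < n" if "i < n" for i using that permutes_in_image[of \<pi> "{..<n}" i] by simp
  then have "map (\<lambda>i. A i (\<pi> i)) [0..<n] = map (\<lambda>i. B i (\<pi> i)) [0..<n]" using assms by simp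
  from arg_cong[OF this, of prod_list] show "of_int (sign \<pi>) * prod_list (map (\<lambda>i. A i (\<pi> i)) [0..<n])
    = of_int (sign \<pi>) * prod_list (map (\<lambda>i. B i (\<pi> i)) [0..<n])" by (simp only:)
qed

lemma gr_homogeneous_det: "even_mat n A \<Longrightarrow> gr_homogeneous 0 (gr_det n A)"
  by (simp add: gr_det_emat of_egr_even)

lemma emat_mult:
  assumes "even_mat n A" "even_mat n B" "\<And>i j. i < n \<Longrightarrow> j < n \<Longrightarrow> (\<Sum>k<n. A i k * B k j) = of_bool (i = j)"
  shows "emat n A * emat n B = 1\<^sub>m n"
proof (rule eq_matI)
  fix i j assume ij: "i < dim_row (1\<^sub>m n)" "j < dim_col (1\<^sub>m n)"
  have "of_egr ((emat n A * emat n B) $$ (i, j)) = (\<Sum>k<n. A i k * B k j)"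
    using ij by (simp add: scalar_prod_def of_egr_sum of_egr_simps atLeast0LessThan emat_index[OF assms(1)] emat_index[OF assms(2)])
  also have "\<dots> = of_egr (1\<^sub>m n $$ (i, j))" using assms(3) ij by (simp add: of_egr_simps)
  finally show "(emat n A * emat n B) $$ (i, j) = 1\<^sub>m n $$ (i, j)" by (simp add: of_egr_inject)
qed simp_all

lemma gr_det_inverse:
  assumes "even_mat n A" "even_mat n B" "\<And>i j. i < n \<Longrightarrow> j < n \<Longrightarrow> (\<Sum>k<n. A i k * B k j) = of_bool (i = j)"
  shows "gr_det n A * gr_det n B = 1"
  using emat_mult[OF assms] det_mult[OF emat_carrier(1) emat_carrier(1), of n A B]
  by (simp add: gr_det_emat assms flip: of_egr_simps)

text \<open>Multiplying the adjugate by \<open>A * B\<close>, which is the unit matrix, exhibits it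
  as \<open>det A\<close> times \<open>B\<close>; no division is involved.\<close>

lemma cofactor_inverse:
  fixes A B :: "'a :: comm_ring_1 mat"
  assumes A: "A \<in> carrier_mat n n" and B: "B \<in> carrier_mat n n" and AB: "A * B = 1\<^sub>m n" and i: "i < n" and j: "j < n"
  shows "cofactor A i j = det A * B $$ (j, i)"
proof -
  note adj = adj_mat[OF A]
  have "adj_mat A = adj_mat A * (A * B)" using adj AB by simp
  also have "\<dots> = (adj_mat A * A) * B" using assoc_mult_mat[OF adj(1) A B] by simp
  also have "\<dots> = det A \<cdot>\<^sub>m B" using adj B by (simp add: mult_smult_assoc_mat[of _ n n])
  finally have "adj_mat A $$ (j, i) = (det A \<cdot>\<^sub>m B) $$ (j, i)" by simp
  then show ?thesis using i j A B by (simp add: adj_mat_def)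
qed

text \<open>The cofactors along row \<open>i\<close> do not see that row, so the Laplace expansion
  of the changed matrix uses those of \<open>A\<close>.\<close>

lemma det_row_replace:
  fixes A B :: "'a :: comm_ring_1 mat"
  assumes A: "A \<in> carrier_mat n n" and B: "B \<in> carrier_mat n n" and AB: "A * B = 1\<^sub>m n" and i: "i < n"
  shows "det (mat n n (\<lambda>(k, j). if k = i then D j else A $$ (k, j))) = (\<Sum>j<n. D j * (det A * B $$ (j, i)))"
    (is "det ?M = _")
proof -
  have "mat_delete ?M i j = mat_delete A i j" if "j < n" for j
    using A i that by (auto simp: mat_delete_def)
  then have "cofactor ?M i j = det A * B $$ (j, i)" if "j < n" for j
    using cofactor_inverse[OF A B AB i that] that by (simp add: cofactor_def)
  then show ?thesis using laplace_expansion_row[of ?M n i] i by simp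
qed

text \<open>The algebraic half of Jacobi's formula: if \<open>D\<close> is a derivative of
  \<open>A\<close>, the sum on the left is what the product rule gives for the determinant.\<close>

lemma gr_det_row_replace:
  assumes A: "even_mat n A" and B: "even_mat n B" and AB: "\<And>i j. i < n \<Longrightarrow> j < n \<Longrightarrow> (\<Sum>k<n. A i k * B k j) = of_bool (i = j)"
    and D: "even_mat n D"
  shows "(\<Sum>i<n. gr_det n (\<lambda>k j. if k = i then D i j else A k j)) = gr_det n A * (\<Sum>i<n. \<Sum>j<n. B i j * D j i)"
proof -
  have "gr_det n (\<lambda>k j. if k = i then D i j else A k j) = gr_det n A * (\<Sum>j<n. D i j * B j i)" if i: "i < n" for i
  proof -
    let ?M = "\<lambda>k j. if k = i then D i j else A k j"
    have e: "even_mat n ?M" using A D i by (auto simp: even_mat_def)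
    have "emat n ?M = mat n n (\<lambda>(k, j). if k = i then Abs_egr (D i j) else emat n A $$ (k, j))"
      by (auto simp: emat_def)
    then have "gr_det n ?M = of_egr (\<Sum>j<n. Abs_egr (D i j) * (det (emat n A) * emat n B $$ (j, i)))"
      using det_row_replace[OF emat_carrier(1) emat_carrier(1) emat_mult[OF A B AB] i] by (simp add: gr_det_emat[OF e])
    also have "\<dots> = of_egr (det (emat n A) * (\<Sum>j<n. Abs_egr (D i j) * emat n B $$ (j, i)))"
      by (simp add: sum_distrib_left mult_ac)
    also have "\<dots> = gr_det n A * (\<Sum>j<n. D i j * B j i)"
      using i D by (simp add: of_egr_simps of_egr_sum gr_det_emat[OF A] emat_index[OF B] of_egr_inverse even_mat_def)
    finally show ?thesis .
  qed
  then have "(\<Sum>i<n. gr_det n (\<lambda>k j. if k = i then D i j else A k j)) = gr_det n A * (\<Sum>i<n. \<Sum>j<n. D i j * B j i)"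
    by (simp add: sum_distrib_left)
  also have "(\<Sum>i<n. \<Sum>j<n. D i j * B j i) = (\<Sum>j<n. \<Sum>i<n. D i j * B j i)" by (rule sum.swap)
  also have "\<dots> = (\<Sum>i<n. \<Sum>j<n. B i j * D j i)"
    using B D by (intro sum.cong refl gr_even_commute') (auto simp: even_mat_def)
  finally show ?thesis .
qed

subsection \<open>Matrices of superfunctions\<close>

definition mm :: "nat \<Rightarrow> (nat \<Rightarrow> nat \<Rightarrow> 'a::semiring_0) \<Rightarrow> (nat \<Rightarrow> nat \<Rightarrow> 'a) \<Rightarrow> nat \<Rightarrow> nat \<Rightarrow> 'a" where
  "mm n A B = (\<lambda>i j. \<Sum>k<n. A i k * B k j)"

lemma mm_assoc: "mm m (mm n A B) C = mm n A (mm m B C)"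
  unfolding mm_def sum_distrib_left sum_distrib_right mult.assoc by (intro ext sum.swap)

lemma mm_add:
  "mm n (A + B) C = mm n A C + mm n B C" "mm n A (B + C) = mm n A B + mm n A C"
  unfolding mm_def by (intro ext; simp add: distrib_left distrib_right sum.distrib)+

lemma mm_diff:
  fixes A B C :: "nat \<Rightarrow> nat \<Rightarrow> 'a::ring"
  shows "mm n (A - B) C = mm n A C - mm n B C" "mm n A (B - C) = mm n A B - mm n A C"
  unfolding mm_def by (intro ext; simp add: left_diff_distrib right_diff_distrib sum_subtractf)+

lemma mm_uminus:
  fixes A B C :: "nat \<Rightarrow> nat \<Rightarrow> 'a::ring"
  shows "mm n (- A) C = - mm n A C" "mm n A (- B) = - mm n A B"
  unfolding mm_def by (intro ext; simp add: sum_negf)+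

lemma mm_0 [simp]: "mm n 0 A = 0" "mm n A 0 = 0"
  unfolding mm_def by (intro ext; simp)+

definition tr :: "nat \<Rightarrow> (nat \<Rightarrow> nat \<Rightarrow> 'a::comm_monoid_add) \<Rightarrow> 'a" where
  "tr n A = (\<Sum>i<n. A i i)"

lemma tr_simps:
  fixes A B :: "nat \<Rightarrow> nat \<Rightarrow> 'a::ab_group_add"
  shows "tr n (A + B) = tr n A + tr n B" "tr n (A - B) = tr n A - tr n B" "tr n (- A) = - tr n A"
  by (simp_all add: tr_def sum.distrib sum_subtractf sum_negf)

text \<open>Cyclicity holds up to the exchange sign of the entries. For two odd factors this is a
  minus sign, the origin of the supertrace.\<close>

lemma tr_mm_commute:
  fixes A B :: "nat \<Rightarrow> nat \<Rightarrow> grassmann"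
  assumes "\<And>i j. gr_homogeneous e (A i j)" "\<And>i j. gr_homogeneous e' (B i j)"
  shows "tr n (mm m A B) = (-1) ^ (e * e') * tr m (mm n B A)"
  unfolding tr_def mm_def sum_distrib_left using gr_mult_commute[OF assms] by (subst sum.swap) simp

lemma sum_lessThan_add: "(\<Sum>b<p + q. f b) = (\<Sum>b<p. f b) + (\<Sum>k<q. f (p + k))" for f :: "nat \<Rightarrow> 'a::comm_monoid_add"
  by (induction q) (simp_all add: add.assoc)

text \<open>The unit is an argument because the unit matrix over \<open>V\<close> has
  \<open>const_on V 1\<close> on its diagonal, which is not the one of the ring of all
  functions.\<close>

primrec npow :: "(nat \<Rightarrow> nat \<Rightarrow> 'a::semiring_0) \<Rightarrow> nat \<Rightarrow> (nat \<Rightarrow> nat \<Rightarrow> 'a) \<Rightarrow> nat \<Rightarrow> nat \<Rightarrow> nat \<Rightarrow> 'a" where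
  "npow u n N 0 = u"
| "npow u n N (Suc k) = mm n N (npow u n N k)"

context superdomain
begin

text \<open>Entries outside the format are zero, so that matrix identities are equalities of
  functions of two indices.\<close>

definition Mat :: "nat \<Rightarrow> nat \<Rightarrow> (nat \<Rightarrow> nat \<Rightarrow> sfun) \<Rightarrow> bool" where
  "Mat m n F \<longleftrightarrow> (\<forall>i j. F i j \<in> R) \<and> (\<forall>i j. m \<le> i \<or> n \<le> j \<longrightarrow> F i j = 0)"

definition unit :: "nat \<Rightarrow> nat \<Rightarrow> nat \<Rightarrow> sfun" where
  "unit n = (\<lambda>i j. if i = j \<and> i < n then const_on V 1 else 0)"

definition hom_mat :: "nat \<Rightarrow> (nat \<Rightarrow> nat \<Rightarrow> sfun) \<Rightarrow> bool" where
  "hom_mat e F \<longleftrightarrow> (\<forall>i j. homogeneous e (F i j))"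

lemma MatD: "Mat m n F \<Longrightarrow> F i j \<in> R" "Mat m n F \<Longrightarrow> m \<le> i \<or> n \<le> j \<Longrightarrow> F i j = 0"
  by (auto simp: Mat_def)

lemma Mat_mm: "Mat m n F \<Longrightarrow> Mat n l G \<Longrightarrow> Mat m l (mm n F G)"
  unfolding Mat_def mm_def by (auto intro!: superfun_sum sum.neutral)

lemma Mat_diff: "Mat m n F \<Longrightarrow> Mat m n G \<Longrightarrow> Mat m n (F - G)"
  by (auto simp: Mat_def)

lemma Mat_sum: "(\<And>a. a \<in> A \<Longrightarrow> Mat m n (F a)) \<Longrightarrow> Mat m n (sum F A)"
  unfolding Mat_def sum_fun_apply[of "\<lambda>a. F a"] by (auto simp: sum_fun_apply intro!: superfun_sum sum.neutral)

lemma Mat_unit: "Mat n n (unit n)"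
  by (auto simp: Mat_def unit_def)

lemma unit_mm:
  assumes F: "Mat m n F" shows "mm m (unit m) F = F" "mm n F (unit n) = F"
proof -
  have "(\<Sum>k<m. unit m i k * F k j) = F i j" for i j
  proof -
    have "unit m i k * F k j = (if k = i then F i j else 0)" if "k < m" for k
      using that superfun_one_mult(1)[OF MatD(1)[OF F]] by (simp add: unit_def)
    then have "(\<Sum>k<m. unit m i k * F k j) = (\<Sum>k<m. if k = i then F i j else 0)" by (intro sum.cong) auto
    also have "\<dots> = (if i < m then F i j else 0)" by (simp only: sum.delta' finite_lessThan sum.delta lessThan_iff)
    also have "\<dots> = F i j" using MatD(2)[OF F, of i j] by (metis not_less)
    finally show ?thesis .
  qed
  then show "mm m (unit m) F = F" unfolding mm_def by (intro ext) metis
  have "(\<Sum>k<n. F i k * unit n k j) = F i j" for i j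
  proof -
    have "F i k * unit n k j = (if k = j then F i j else 0)" if "k < n" for k
      using that superfun_one_mult(2)[OF MatD(1)[OF F]] by (simp add: unit_def)
    then have "(\<Sum>k<n. F i k * unit n k j) = (\<Sum>k<n. if k = j then F i j else 0)" by (intro sum.cong) auto
    also have "\<dots> = (if j < n then F i j else 0)" by (simp only: sum.delta' finite_lessThan sum.delta lessThan_iff)
    also have "\<dots> = F i j" using MatD(2)[OF F, of i j] by (metis not_less)
    finally show ?thesis .
  qed
  then show "mm n F (unit n) = F" unfolding mm_def by (intro ext) metis
qed

lemma hom_mat_mm: "hom_mat e F \<Longrightarrow> hom_mat e' G \<Longrightarrow> hom_mat (e + e') (mm n F G)"
  by (simp add: hom_mat_def mm_def homogeneous_sum homogeneous_mult)

lemma hom_mat_cong: "even (e + e') \<Longrightarrow> hom_mat e F \<Longrightarrow> hom_mat e' F"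
  unfolding hom_mat_def using homogeneous_cong by blast

lemma hom_mat_unit: "hom_mat 0 (unit n)"
  by (auto simp: hom_mat_def unit_def intro: homogeneous_const_on)

lemma hom_mat_diff: "hom_mat e F \<Longrightarrow> hom_mat e G \<Longrightarrow> hom_mat e (F - G)"
  by (simp add: hom_mat_def homogeneous_diff)

lemma hom_mat_sum: "(\<And>a. a \<in> A \<Longrightarrow> hom_mat e (F a)) \<Longrightarrow> hom_mat e (sum F A)"
  unfolding hom_mat_def sum_fun_apply[of "\<lambda>a. F a"] by (auto simp: sum_fun_apply[of "\<lambda>a. F a _"] intro!: homogeneous_sum)

lemma Mat_npow: "Mat n n N \<Longrightarrow> Mat n n (npow (unit n) n N k)"
  by (induction k) (auto intro: Mat_unit Mat_mm)

lemma hom_mat_npow: "hom_mat 0 N \<Longrightarrow> hom_mat 0 (npow (unit n) n N k)"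
  using hom_mat_mm[of 0 N 0] by (induction k) (auto intro: hom_mat_unit)

text \<open>Powers are built by multiplication from the left; the left inverse in
  \<open>geom_inverse\<close> needs the other side.\<close>

lemma npow_Suc_right: "Mat n n N \<Longrightarrow> npow (unit n) n N (Suc k) = mm n (npow (unit n) n N k) N"
proof (induction k)
  case 0
  then show ?case using unit_mm[OF 0] by simp
next
  case (Suc k)
  have "npow (unit n) n N (Suc (Suc k)) = mm n N (npow (unit n) n N (Suc k))" by (rule npow.simps(2))
  also have "\<dots> = mm n (npow (unit n) n N (Suc k)) N"
    unfolding Suc.IH[OF Suc.prems] unfolding mm_assoc[symmetric] by (simp only: npow.simps(2)[symmetric] Suc.IH[OF Suc.prems])
  finally show ?case .
qed

definition geom :: "nat \<Rightarrow> (nat \<Rightarrow> nat \<Rightarrow> sfun) \<Rightarrow> nat \<Rightarrow> nat \<Rightarrow> sfun" where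
  "geom n N = (\<Sum>k\<le>q. npow (unit n) n N k)"

text \<open>Every factor without body raises the degree of all entries by one, and degree
  \<open>Suc q\<close> cannot occur in \<open>Grassmann q\<close>.\<close>

lemma npow_nilpotent:
  assumes N: "Mat n n N" and body: "\<And>i j x. gr_body (N i j x) = 0"
  shows "npow (unit n) n N (Suc q) = 0"
proof -
  have "gr_order k (npow (unit n) n N k i j x)" for k i j x
  proof (induction k arbitrary: i)
    case (Suc k)
    have "gr_order (1 + k) (N i l x * npow (unit n) n N k l j x)" for l
      by (rule gr_order_mult[OF _ Suc.IH]) (simp add: gr_order_Suc_0_iff body)
    then show ?case by (simp add: mm_def sum_fun_apply gr_order_sum)
  qed simp
  from Grassmann_order_eq_0[OF superfun_Grassmann[OF MatD(1)[OF Mat_npow[OF N]]] this]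
  show ?thesis by (intro ext) simp
qed

lemma mm_sum: "mm n A (sum F S) = (\<Sum>k\<in>S. mm n A (F k))" "mm n (sum F S) A = (\<Sum>k\<in>S. mm n (F k) A)"
  for A :: "nat \<Rightarrow> nat \<Rightarrow> sfun" and F :: "nat \<Rightarrow> nat \<Rightarrow> nat \<Rightarrow> sfun"
  unfolding mm_def by (intro ext; simp add: sum_fun_apply sum_distrib_left sum_distrib_right, rule sum.swap)+

lemma geom_inverse:
  assumes N: "Mat n n N" and body: "\<And>i j x. gr_body (N i j x) = 0"
  shows "mm n (unit n - N) (geom n N) = unit n" "mm n (geom n N) (unit n - N) = unit n"
proof -
  let ?P = "npow (unit n) n N"
  have t: "(\<Sum>k<Suc q. ?P k - ?P (Suc k)) = unit n"
    using sum_lessThan_telescope'[of ?P "Suc q"] npow_nilpotent[OF assms] by (simp only: npow.simps(1) diff_0_right)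
  have "mm n (unit n - N) (?P k) = ?P k - ?P (Suc k)" for k
    unfolding mm_diff by (simp only: unit_mm[OF Mat_npow[OF N]] npow.simps)
  then show "mm n (unit n - N) (geom n N) = unit n"
    unfolding geom_def mm_sum using t by (simp only: lessThan_Suc_atMost)
  have "mm n (?P k) (unit n - N) = ?P k - ?P (Suc k)" for k
    unfolding mm_diff npow_Suc_right[OF N] by (simp only: unit_mm[OF Mat_npow[OF N]])
  then show "mm n (geom n N) (unit n - N) = unit n"
    unfolding geom_def mm_sum using t by (simp only: lessThan_Suc_atMost)
qed

lemma Mat_geom: "Mat n n N \<Longrightarrow> Mat n n (geom n N)"
  unfolding geom_def by (intro Mat_sum Mat_npow)

lemma hom_mat_geom: "hom_mat 0 N \<Longrightarrow> hom_mat 0 (geom n N)"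
  unfolding geom_def by (intro hom_mat_sum hom_mat_npow)

definition detf :: "nat \<Rightarrow> (nat \<Rightarrow> nat \<Rightarrow> sfun) \<Rightarrow> sfun" where
  "detf n F = restr V (\<lambda>x. gr_det n (\<lambda>i j. F i j x))"

definition prodf :: "(nat \<Rightarrow> sfun) \<Rightarrow> nat list \<Rightarrow> sfun" where
  "prodf f xs = restr V (\<lambda>x. prod_list (map (\<lambda>i. f i x) xs))"

lemma prodf_simps: "prodf f [] = const_on V 1" "f i \<in> R \<Longrightarrow> prodf f (i # xs) = f i * prodf f xs"
  by (auto simp: prodf_def const_on_def restr_def fun_eq_iff superfun_outside)

lemma superfun_prodf: "(\<And>i. f i \<in> R) \<Longrightarrow> prodf f xs \<in> R"
  by (induction xs) (simp_all only: prodf_simps superfun_mult superfun_const Grassmann_0)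

lemma detf_eq: "detf n F = (\<Sum>\<pi> | \<pi> permutes {..<n}. smul (of_int (sign \<pi>)) (prodf (\<lambda>i. F i (\<pi> i)) [0..<n]))"
proof (rule ext)
  fix x
  show "detf n F x = (\<Sum>\<pi> | \<pi> permutes {..<n}. smul (of_int (sign \<pi>)) (prodf (\<lambda>i. F i (\<pi> i)) [0..<n])) x"
    by (cases "x \<in> V") (auto simp: detf_def gr_det_def sum_fun_apply smul_def prodf_def sign_def intro!: sum.cong)
qed

lemma superfun_detf: "Mat n n F \<Longrightarrow> detf n F \<in> R"
  unfolding detf_eq by (intro superfun_sum superfun_smul superfun_prodf) (simp add: MatD)

lemma even_mat_ev: "hom_mat 0 F \<Longrightarrow> even_mat n (\<lambda>i j. F i j x)"
  by (simp add: hom_mat_def even_mat_def homogeneous_def)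

lemma homogeneous_detf: "hom_mat 0 F \<Longrightarrow> homogeneous 0 (detf n F)"
  using gr_homogeneous_det[OF even_mat_ev] by (simp add: homogeneous_def detf_def restr_def)

lemma ev_inverse:
  assumes "mm n F G = unit n" "i < n" "j < n" "x \<in> V"
  shows "(\<Sum>k<n. F i k x * G k j x) = of_bool (i = j)"
proof -
  have "mm n F G i j x = unit n i j x" using assms(1) by simp
  then show ?thesis using assms(2-4) by (simp add: mm_def sum_fun_apply unit_def)
qed

lemma detf_body:
  assumes "hom_mat 0 F" "hom_mat 0 G" "mm n F G = unit n" "x \<in> V" shows "gr_body (detf n F x) \<noteq> 0"
proof -
  have "gr_det n (\<lambda>i j. F i j x) * gr_det n (\<lambda>i j. G i j x) = 1"
    by (rule gr_det_inverse[OF even_mat_ev[OF assms(1)] even_mat_ev[OF assms(2)] ev_inverse[OF assms(3) _ _ assms(4)]])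
  then have "gr_body (detf n F x) * gr_body (gr_det n (\<lambda>i j. G i j x)) = 1"
    using assms(4) by (metis detf_def gr_body_simps(2,9) restr_apply(1))
  then show ?thesis by auto
qed

end

text \<open>The coefficient of an auxiliary odd generator turns odd derivatives into even derivations.\<close>

lemma gr_conj_conj: "gr_conj n (gr_conj n x) = x"
proof (induction x rule: gr_homogeneous_induct)
  case (hom e x)
  then show ?case using gr_conj_homogeneous[OF gr_homogeneous_uminus[OF hom(2)], of n]
    by (cases "even (n * e)") (simp_all add: gr_conj_homogeneous)
qed (simp add: gr_conj_add)

locale point_derivation = superdomain +
  fixes a :: nat and x :: "nat \<Rightarrow> real"
  assumes x: "x \<in> V"
begin

text \<open>For an odd direction, \<open>\<eta>\<close> is the generator of index \<open>q\<close>,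
  the first one foreign to \<open>Grassmann q\<close>. It makes \<open>d\<close> preserve parity and
  is removed by \<open>Grassmann_gen_mult_eq_0\<close>.\<close>

definition \<eta> :: grassmann where
  "\<eta> = (if a < p then 1 else gr_gen q)"

definition d :: "sfun \<Rightarrow> grassmann" where
  "d f = \<eta> * D a f x"

lemma \<eta>_homogeneous: "gr_homogeneous (cpar p a) \<eta>"
  by (simp add: \<eta>_def cpar_def gr_homogeneous_gen)

lemma d_add: "f \<in> R \<Longrightarrow> g \<in> R \<Longrightarrow> d (f + g) = d f + d g"
  by (simp add: d_def pd_add distrib_left)

lemma d_diff: "f \<in> R \<Longrightarrow> g \<in> R \<Longrightarrow> d (f - g) = d f - d g"
  by (simp add: d_def pd_diff right_diff_distrib)

lemma d_0 [simp]: "d 0 = 0"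
  by (simp add: d_def)

lemma d_one [simp]: "d (const_on V 1) = 0"
  by (simp add: d_def pd_one)

lemma d_smul: "f \<in> R \<Longrightarrow> d (smul r f) = r *\<^sub>R d f"
  by (simp add: d_def pd_smul, simp add: smul_def)

lemma d_sum: "(\<And>b. b \<in> A \<Longrightarrow> f b \<in> R) \<Longrightarrow> d (sum f A) = (\<Sum>b\<in>A. d (f b))"
  by (induction A rule: infinite_finite_induct) (simp_all add: d_add superfun_sum)

text \<open>The sign acquired when the derivative passes \<open>f\<close> is undone by moving
  \<open>\<eta>\<close> past \<open>f\<close> as well, so the ordinary Leibniz rule holds in every
  direction.\<close>

lemma d_mult: assumes "f \<in> R" "g \<in> R" shows "d (f * g) = d f * g x + f x * d g"
proof -
  have "\<eta> * gr_conj (cpar p a) (f x) = f x * \<eta>"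
    using gr_conj_commute[OF \<eta>_homogeneous, of "gr_conj (cpar p a) (f x)"] by (simp add: gr_conj_conj)
  then have "\<eta> * (gr_conj (cpar p a) (f x) * D a g x) = f x * (\<eta> * D a g x)" by (simp flip: mult.assoc)
  then show ?thesis unfolding d_def pd_mult[OF assms] by (simp add: sconj_def distrib_left mult.assoc)
qed

lemma d_homogeneous: "homogeneous e f \<Longrightarrow> gr_homogeneous e (d f)"
proof -
  assume "homogeneous e f"
  then have "gr_homogeneous (cpar p a + (e + cpar p a)) (d f)"
    unfolding d_def using homogeneous_pd[of e f p a V] \<eta>_homogeneous
    by (intro gr_homogeneous_mult) (simp_all add: homogeneous_def)
  then show ?thesis by (rule gr_homogeneous_cong[rotated]) auto
qed

abbreviation "ev F \<equiv> \<lambda>i j. (F i j :: sfun) x"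
abbreviation "dm F \<equiv> \<lambda>i j. d (F i j)"

lemma ev_mm: "ev (mm n F G) = mm n (ev F) (ev G)"
  by (simp add: mm_def sum_fun_apply)

lemma dm_mm:
  assumes "Mat m n F" "Mat n l G" shows "dm (mm n F G) = mm n (dm F) (ev G) + mm n (ev F) (dm G)"
proof (intro ext)
  fix i j
  show "d (mm n F G i j) = (mm n (dm F) (ev G) + mm n (ev F) (dm G)) i j"
    using assms by (simp add: mm_def d_sum MatD superfun_sum d_mult sum.distrib)
qed

lemma dm_diff: "Mat m n F \<Longrightarrow> Mat m n G \<Longrightarrow> dm (F - G) = dm F - dm G"
  by (intro ext) (simp add: d_diff MatD)

lemma unit_mm_dm: "Mat m n F \<Longrightarrow> mm m (ev (unit m)) (dm F) = dm F" "Mat m n F \<Longrightarrow> mm n (dm F) (ev (unit n)) = dm F"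
proof -
  assume F: "Mat m n F"
  have e: "ev (unit m) = (\<lambda>i j. of_bool (i = j \<and> i < m))" for m using x by (auto simp: unit_def fun_eq_iff)
  show "mm m (ev (unit m)) (dm F) = dm F"
  proof (intro ext)
    fix i j
    have "mm m (ev (unit m)) (dm F) i j = (\<Sum>k<m. if k = i then d (F i j) else 0)"
      unfolding mm_def e by (rule sum.cong) auto
    then show "mm m (ev (unit m)) (dm F) i j = d (F i j)" using MatD(2)[OF F, of i j] by (cases "i < m") auto
  qed
  show "mm n (dm F) (ev (unit n)) = dm F"
  proof (intro ext)
    fix i j
    have "mm n (dm F) (ev (unit n)) i j = (\<Sum>k<n. if k = j then d (F i j) else 0)"
      unfolding mm_def e by (rule sum.cong) auto
    then show "mm n (dm F) (ev (unit n)) i j = d (F i j)" using MatD(2)[OF F, of i j] by (cases "j < n") auto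
  qed
qed

lemma dm_inverse:
  assumes F: "Mat n n F" and G: "Mat n n G" and FG: "mm n F G = unit n" and GF: "mm n G F = unit n"
  shows "dm G = - mm n (mm n (ev G) (dm F)) (ev G)"
proof -
  have "mm n (dm F) (ev G) + mm n (ev F) (dm G) = 0"
    unfolding dm_mm[OF F G, symmetric] FG by (intro ext) (simp add: unit_def)
  then have "mm n (ev G) (mm n (dm F) (ev G) + mm n (ev F) (dm G)) = 0" by (simp only: mm_0)
  then have "mm n (ev G) (mm n (dm F) (ev G)) + mm n (mm n (ev G) (ev F)) (dm G) = 0"
    by (simp only: mm_add mm_assoc)
  moreover have "mm n (mm n (ev G) (ev F)) (dm G) = dm G"
    unfolding ev_mm[symmetric] GF by (rule unit_mm_dm[OF G])
  ultimately show ?thesis unfolding mm_assoc by (metis add.commute eq_neg_iff_add_eq_0)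
qed

lemma d_prodf:
  assumes "\<And>i. f i \<in> R" "distinct xs"
  shows "d (prodf f xs) = (\<Sum>i\<in>set xs. prod_list (map (\<lambda>k. if k = i then d (f k) else f k x) xs))"
  using assms(2)
proof (induction xs)
  case (Cons i xs)
  have f: "prodf f xs \<in> R" "prodf f xs x = prod_list (map (\<lambda>k. f k x) xs)"
    using superfun_prodf[OF assms(1)] x by (simp_all add: prodf_def)
  have "d (prodf f (i # xs)) = d (f i) * prod_list (map (\<lambda>k. f k x) xs)
     + f i x * (\<Sum>j\<in>set xs. prod_list (map (\<lambda>k. if k = j then d (f k) else f k x) xs))"
    using Cons unfolding prodf_simps(2)[OF assms(1)] d_mult[OF assms(1) f(1)] by (simp add: f(2))
  also have "map (\<lambda>k. f k x) xs = map (\<lambda>k. if k = i then d (f k) else f k x) xs"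
    using Cons.prems by auto
  also have "f i x * (\<Sum>j\<in>set xs. prod_list (map (\<lambda>k. if k = j then d (f k) else f k x) xs))
      = (\<Sum>j\<in>set xs. prod_list (map (\<lambda>k. if k = j then d (f k) else f k x) (i # xs)))"
    unfolding sum_distrib_left by (rule sum.cong) (use Cons.prems in auto)
  finally show ?case using Cons.prems by simp
qed (simp add: prodf_simps)

lemma d_detf:
  assumes F: "Mat n n F" shows "d (detf n F) = (\<Sum>i<n. gr_det n (\<lambda>k j. if k = i then dm F i j else ev F k j))"
proof -
  have "d (detf n F) = (\<Sum>\<pi> | \<pi> permutes {..<n}. of_int (sign \<pi>) *\<^sub>R (\<Sum>i<n. prod_list (map (\<lambda>k. if k = i then d (F k (\<pi> k)) else F k (\<pi> k) x) [0..<n])))"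
    unfolding detf_eq using MatD(1)[OF F]
    by (subst d_sum) (auto simp: superfun_prodf d_smul d_prodf atLeast0LessThan)
  also have "\<dots> = (\<Sum>\<pi> | \<pi> permutes {..<n}. (\<Sum>i<n. of_int (sign \<pi>) * prod_list (map (\<lambda>k. if k = i then dm F i (\<pi> k) else ev F k (\<pi> k)) [0..<n])))"
  proof (rule sum.cong[OF refl])
    fix \<pi> :: "nat \<Rightarrow> nat"
    have "prod_list (map (\<lambda>k. if k = i then d (F k (\<pi> k)) else F k (\<pi> k) x) [0..<n])
      = prod_list (map (\<lambda>k. if k = i then dm F i (\<pi> k) else ev F k (\<pi> k)) [0..<n])" for i
      by (intro arg_cong[where f = prod_list] map_cong) auto
    then show "of_int (sign \<pi>) *\<^sub>R (\<Sum>i<n. prod_list (map (\<lambda>k. if k = i then d (F k (\<pi> k)) else F k (\<pi> k) x) [0..<n]))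
      = (\<Sum>i<n. of_int (sign \<pi>) * prod_list (map (\<lambda>k. if k = i then dm F i (\<pi> k) else ev F k (\<pi> k)) [0..<n]))"
      by (simp add: sign_def sum_negf)
  qed
  finally show ?thesis unfolding gr_det_def by (simp add: sum.swap[of _ "{..<n}"])
qed

text \<open>The product rule differentiates one row at a time, and \<open>gr_det_row_replace\<close>
  sums the results: Jacobi's formula.\<close>

lemma d_detf_inverse:
  assumes F: "Mat n n F" "hom_mat 0 F" and G: "hom_mat 0 G" and FG: "mm n F G = unit n"
  shows "d (detf n F) = detf n F x * tr n (mm n (ev G) (dm F))"
proof -
  have "even_mat n (dm F)" using F(2) d_homogeneous by (simp add: even_mat_def hom_mat_def)
  from gr_det_row_replace[OF even_mat_ev[OF F(2)] even_mat_ev[OF G] ev_inverse[OF FG _ _ x] this]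
  show ?thesis unfolding d_detf[OF F(1)] using x by (simp add: detf_def tr_def mm_def)
qed

lemma d_sinv:
  assumes u: "u \<in> R" "homogeneous 0 u" "\<And>x. x \<in> V \<Longrightarrow> gr_body (u x) \<noteq> 0"
  shows "d (sinv V u) = - (sinv V u x * sinv V u x * d u)"
proof -
  let ?v = "sinv V u"
  have v: "?v \<in> R" using superfun_inverse u by blast
  have uv: "?v x * u x = 1"
    using superfun_inverse_mult(2)[OF u(1,3)] x by (metis const_on_apply(1) times_fun_apply)
  have ev: "gr_homogeneous 0 (?v x)"
    using homogeneous_sinv[OF u(1,3,2)] by (simp add: homogeneous_def)
  have "d (u * ?v) = 0" using superfun_inverse_mult(1)[OF u(1,3)] by simp
  then have "u x * d ?v = - (d u * ?v x)" unfolding d_mult[OF u(1) v] by (simp add: eq_neg_iff_add_eq_0 add.commute)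
  then have "?v x * (u x * d ?v) = - (?v x * (d u * ?v x))" by simp
  then have "d ?v = - (?v x * (d u * ?v x))" by (simp add: uv flip: mult.assoc)
  then show ?thesis using gr_even_commute[OF ev, of "d u"] by (simp add: mult.assoc)
qed

end

subsection \<open>Derivatives of the Berezinian\<close>

text \<open>An even supermatrix with a two-sided inverse, in the application the Jacobian of a
  transition and the inverse Jacobian. The derivative of the Berezinian is computed from this
  alone.\<close>

locale super_matrix = superdomain +
  fixes J K :: "nat \<Rightarrow> nat \<Rightarrow> sfun"
  assumes JR [simp]: "b < p + q \<Longrightarrow> c < p + q \<Longrightarrow> J b c \<in> R"
    and KR [simp]: "b < p + q \<Longrightarrow> c < p + q \<Longrightarrow> K b c \<in> R"
    and Jh: "b < p + q \<Longrightarrow> c < p + q \<Longrightarrow> homogeneous (cpar p b + cpar p c) (J b c)"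
    and Kh: "b < p + q \<Longrightarrow> c < p + q \<Longrightarrow> homogeneous (cpar p b + cpar p c) (K b c)"
    and JK: "b < p + q \<Longrightarrow> c < p + q \<Longrightarrow> (\<Sum>k<p + q. J b k * K k c) = const_on V (of_bool (b = c))"
    and KJ: "b < p + q \<Longrightarrow> c < p + q \<Longrightarrow> (\<Sum>k<p + q. K b k * J k c) = const_on V (of_bool (b = c))"
begin

definition block :: "nat \<Rightarrow> nat \<Rightarrow> nat \<Rightarrow> nat \<Rightarrow> (nat \<Rightarrow> nat \<Rightarrow> sfun) \<Rightarrow> nat \<Rightarrow> nat \<Rightarrow> sfun" where
  "block m n r s F = (\<lambda>i j. if i < m \<and> j < n then F (r + i) (s + j) else 0)"

abbreviation "jA \<equiv> block p p 0 0 J"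
abbreviation "jB \<equiv> block p q 0 p J"
abbreviation "jC \<equiv> block q p p 0 J"
abbreviation "jD \<equiv> block q q p p J"
abbreviation "kA \<equiv> block p p 0 0 K"
abbreviation "kB \<equiv> block p q 0 p K"
abbreviation "kC \<equiv> block q p p 0 K"
abbreviation "kD \<equiv> block q q p p K"

lemma Mat_blocks:
  "Mat p p jA" "Mat p q jB" "Mat q p jC" "Mat q q jD" "Mat p p kA" "Mat p q kB" "Mat q p kC" "Mat q q kD"
  by (auto simp: Mat_def block_def)

lemma hom_blocks:
  "hom_mat 0 jA" "hom_mat 1 jB" "hom_mat 1 jC" "hom_mat 0 jD" "hom_mat 0 kA" "hom_mat 1 kB" "hom_mat 1 kC" "hom_mat 0 kD"
proof -
  have "hom_mat (cpar p r + cpar p s) (block m n r s F)"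
    if F: "\<And>b c. b < p + q \<Longrightarrow> c < p + q \<Longrightarrow> homogeneous (cpar p b + cpar p c) (F b c)"
      and "(r = 0 \<and> m = p) \<or> (r = p \<and> m = q)" "(s = 0 \<and> n = p) \<or> (s = p \<and> n = q)" for F m n r s
  proof -
    have "homogeneous (cpar p r + cpar p s) (F (r + i) (s + j))" if ij: "i < m" "j < n" for i j
    proof -
      have "cpar p (r + i) = cpar p r" "cpar p (s + j) = cpar p s" "r + i < p + q" "s + j < p + q"
        using ij \<open>(r = 0 \<and> m = p) \<or> (r = p \<and> m = q)\<close> \<open>(s = 0 \<and> n = p) \<or> (s = p \<and> n = q)\<close> by (auto simp: cpar_def)
      then show ?thesis using F by metis
    qed
    then show ?thesis by (simp add: hom_mat_def block_def)
  qed
  note h = this[OF Jh] this[OF Kh]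
  have odd_q: "cpar p p = 1" and even_p: "p > 0 \<Longrightarrow> cpar p 0 = 0" by (auto simp: cpar_def)
  \<comment> \<open>For \<open>p = 0\<close> the index 0 is odd, and the parity read off from the
    corner of a block would be wrong; but then the blocks in question are empty.\<close>
  have z: "hom_mat e (block m n r s F)" if "m = 0 \<or> n = 0" for e m n r s F
    using that by (auto simp: hom_mat_def block_def)
  have c: "hom_mat 2 F \<Longrightarrow> hom_mat 0 F" for F using hom_mat_cong[of 2 0 F] by simp
  show "hom_mat 0 jA" "hom_mat 0 kA" using h[of 0 p 0 p] z even_p by (cases "p = 0"; simp)+
  show "hom_mat 1 jB" "hom_mat 1 kB" using h[of 0 p p q] z even_p odd_q by (cases "p = 0"; simp)+
  show "hom_mat 1 jC" "hom_mat 1 kC" using h[of p q 0 p] z even_p odd_q by (cases "p = 0"; simp)+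
  show "hom_mat 0 jD" "hom_mat 0 kD" using h[of p q p q] odd_q c by (simp_all add: numeral_2_eq_2)
qed

lemma block_mult:
  assumes "\<forall>b<p + q. \<forall>c<p + q. (\<Sum>k<p + q. F b k * G k c) = const_on V (of_bool (b = c))"
  shows "mm p (block p p 0 0 F) (block p p 0 0 G) + mm q (block p q 0 p F) (block q p p 0 G) = unit p"
    "mm p (block p p 0 0 F) (block p q 0 p G) + mm q (block p q 0 p F) (block q q p p G) = 0"
    "mm p (block q p p 0 F) (block p p 0 0 G) + mm q (block q q p p F) (block q p p 0 G) = 0"
    "mm p (block q p p 0 F) (block p q 0 p G) + mm q (block q q p p F) (block q q p p G) = unit q"
proof -
  have c0: "const_on V 0 = 0" by (auto simp: const_on_def restr_def fun_eq_iff)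
  have E: "(mm p (block m p r 0 F) (block p n 0 s G) + mm q (block m q r p F) (block q n p s G)) i j
    = (if i < m \<and> j < n then const_on V (of_bool (r + i = s + j)) else 0)"
    if "(r = 0 \<and> m = p) \<or> (r = p \<and> m = q)" "(s = 0 \<and> n = p) \<or> (s = p \<and> n = q)" for m n r s i j
  proof (cases "i < m \<and> j < n")
    case True
    then have "r + i < p + q" "s + j < p + q" using that by auto
    from assms[rule_format, OF this] show ?thesis
      using True unfolding sum_lessThan_add by (simp add: mm_def block_def)
  next
    case False
    then show ?thesis by (auto simp: mm_def block_def)
  qed
  show "mm p (block p p 0 0 F) (block p p 0 0 G) + mm q (block p q 0 p F) (block q p p 0 G) = unit p"
    by (intro ext, subst E) (auto simp: unit_def c0)
  show "mm p (block p p 0 0 F) (block p q 0 p G) + mm q (block p q 0 p F) (block q q p p G) = 0"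
    by (intro ext, subst E) (auto simp: c0)
  show "mm p (block q p p 0 F) (block p p 0 0 G) + mm q (block q q p p F) (block q p p 0 G) = 0"
    by (intro ext, subst E) (auto simp: c0)
  show "mm p (block q p p 0 F) (block p q 0 p G) + mm q (block q q p p F) (block q q p p G) = unit q"
    by (intro ext, subst E) (auto simp: unit_def c0)
qed

lemma JK_all: "\<forall>b<p + q. \<forall>c<p + q. (\<Sum>k<p + q. J b k * K k c) = const_on V (of_bool (b = c))"
  and KJ_all: "\<forall>b<p + q. \<forall>c<p + q. (\<Sum>k<p + q. K b k * J k c) = const_on V (of_bool (b = c))"
  using JK KJ by blast+

lemmas JK_block = block_mult[OF JK_all]
lemmas KJ_block = block_mult[OF KJ_all]

text \<open>\<open>D\<close> is invertible because \<open>D K\<^sub>2\<^sub>2 = 1 - C K\<^sub>1\<^sub>2\<close> with \<open>C K\<^sub>1\<^sub>2\<close> nilpotent.\<close>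

definition jE :: "nat \<Rightarrow> nat \<Rightarrow> sfun" where
  "jE = mm q kD (geom q (mm p jC kB))"

lemma odd_odd_body:
  assumes "hom_mat 1 F" "hom_mat 1 G" shows "gr_body (mm n F G i j x) = 0"
proof -
  have "gr_body (F i k x) = 0" for k
    using assms(1) gr_body_odd[of 1] by (simp add: hom_mat_def homogeneous_def)
  then show ?thesis by (simp add: mm_def sum_fun_apply gr_body_sum)
qed

lemma Mat_jE: "Mat q q jE"
  unfolding jE_def by (intro Mat_mm[of _ q] Mat_geom Mat_mm[of _ p] Mat_blocks)

lemma hom_jE: "hom_mat 0 jE"
proof -
  have "hom_mat 0 (mm p jC kB)"
    using hom_mat_cong[OF _ hom_mat_mm[OF hom_blocks(3,6)]] by simp
  from hom_mat_mm[OF hom_blocks(8) hom_mat_geom[OF this]] show ?thesis unfolding jE_def by simp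
qed

text \<open>The relations for \<open>J\<close> times \<open>K\<close> give a right inverse of
  \<open>jD\<close>, those for \<open>K\<close> times \<open>J\<close> a left inverse; associativity
  identifies the two.\<close>

lemma DE: "mm q jD jE = unit q" and ED: "mm q jE jD = unit q"
proof -
  let ?N = "mm p jC kB" and ?N' = "mm p kC jB"
  have N: "Mat q q ?N" "Mat q q ?N'" by (intro Mat_mm[of _ p] Mat_blocks)+
  have b: "gr_body (?N i j x) = 0" "gr_body (?N' i j x) = 0" for i j x
    using odd_odd_body hom_blocks by blast+
  have "mm q jD kD = unit q - ?N" using JK_block(4) by (simp add: eq_diff_eq add.commute)
  then have DE: "mm q jD jE = unit q" unfolding jE_def mm_assoc[symmetric] by (simp only: geom_inverse(1)[OF N(1) b(1)])
  let ?E = "mm q (geom q ?N') kD"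
  have "mm q kD jD = unit q - ?N'" using KJ_block(4) by (simp add: eq_diff_eq add.commute)
  then have ED': "mm q ?E jD = unit q" unfolding mm_assoc by (simp only: geom_inverse(2)[OF N(2) b(2)])
  have ME: "Mat q q ?E" by (intro Mat_mm[of _ q] Mat_geom N Mat_blocks)
  have "?E = mm q ?E (mm q jD jE)" unfolding DE unit_mm[OF ME] ..
  also have "\<dots> = jE" unfolding mm_assoc[symmetric] ED' unit_mm[OF Mat_jE] ..
  finally show "mm q jD jE = unit q" "mm q jE jD = unit q" using DE ED' by simp_all
qed

text \<open>The Schur complement of the odd-odd block, whose determinant is the numerator of the
  Berezinian.\<close>

definition jG :: "nat \<Rightarrow> nat \<Rightarrow> sfun" where
  "jG = jA - mm q (mm q jB jE) jC"

lemma Mat_jG: "Mat p p jG"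
  unfolding jG_def by (intro Mat_diff Mat_mm[of _ q] Mat_blocks Mat_jE)

lemma hom_jG: "hom_mat 0 jG"
  unfolding jG_def
  by (intro hom_mat_diff hom_blocks hom_mat_cong[OF _ hom_mat_mm[OF hom_mat_mm[OF hom_blocks(2) hom_jE] hom_blocks(3)]]) simp

text \<open>Multiplying an off-diagonal relation between \<open>K\<close> and \<open>J\<close> by
  the inverse of \<open>jD\<close> solves for the block. Together with \<open>K21\<close> and
  \<open>K22\<close> this is block inversion, by which the terms of the logarithmic derivative are
  recognised as entries of \<open>K\<close>.\<close>

lemma K12: "kB = - mm q (mm p kA jB) jE"
proof -
  have "mm q (mm p kA jB + mm q kB jD) jE = 0" unfolding KJ_block(2) by (rule mm_0)
  then have "mm q (mm p kA jB) jE + kB = 0"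
    unfolding mm_add mm_assoc[of _ _ kB] DE unit_mm[OF Mat_blocks(6)] .
  then show ?thesis by (metis add.commute eq_neg_iff_add_eq_0)
qed

lemma K21: "kC = - mm p (mm q jE jC) kA"
proof -
  have "mm q jE (mm p jC kA + mm q jD kC) = 0" unfolding JK_block(3) by (rule mm_0)
  then have "mm p (mm q jE jC) kA + kC = 0"
    unfolding mm_add mm_assoc[symmetric] ED unit_mm[OF Mat_blocks(7)] .
  then show ?thesis by (metis add.commute eq_neg_iff_add_eq_0)
qed

lemma K22: "kD = jE + mm p (mm q jE jC) (mm q (mm p kA jB) jE)"
proof -
  have "mm q jE (mm p jC kB + mm q jD kD) = jE" unfolding JK_block(4) unit_mm[OF Mat_jE] ..
  then have "mm p (mm q jE jC) kB + kD = jE"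
    unfolding mm_add mm_assoc[symmetric] ED unit_mm[OF Mat_blocks(8)] .
  then have "kD = jE - mm p (mm q jE jC) kB" by (simp add: eq_diff_eq add.commute)
  then show ?thesis by (subst (asm) K12) (simp add: mm_uminus)
qed

text \<open>Inserting the formulas for the off-diagonal blocks turns the products with the Schur
  complement into the upper left relations between \<open>K\<close> and \<open>J\<close>.\<close>

lemma PG: "mm p kA jG = unit p" and GP: "mm p jG kA = unit p"
proof -
  have "mm p kA jG = mm p kA jA + mm q kB jC"
    unfolding jG_def mm_diff by (subst K12) (simp only: mm_uminus mm_assoc diff_conv_add_uminus)
  then show "mm p kA jG = unit p" using KJ_block(1) by simp
  have "mm p jG kA = mm p jA kA + mm q jB kC"
    unfolding jG_def mm_diff by (subst K21) (simp only: mm_uminus mm_assoc diff_conv_add_uminus)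
  then show "mm p jG kA = unit p" using JK_block(1) by simp
qed

definition berf :: sfun where
  "berf = detf p jG * sinv V (detf q jD)"

lemma detD: "detf q jD \<in> R" "homogeneous 0 (detf q jD)" "x \<in> V \<Longrightarrow> gr_body (detf q jD x) \<noteq> 0"
  using superfun_detf[OF Mat_blocks(4)] homogeneous_detf[OF hom_blocks(4)] detf_body[OF hom_blocks(4) hom_jE DE]
  by blast+

lemma detG: "detf p jG \<in> R" "homogeneous 0 (detf p jG)" "x \<in> V \<Longrightarrow> gr_body (detf p jG x) \<noteq> 0"
  using superfun_detf[OF Mat_jG] homogeneous_detf[OF hom_jG] detf_body[OF hom_jG hom_blocks(5) GP]
  by blast+

lemma berf_closed: "berf \<in> R" and berf_even: "homogeneous 0 berf"
  unfolding berf_def using superfun_inverse[OF detD(1,3)] detG homogeneous_sinv[OF detD(1,3,2)]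
    homogeneous_mult[OF detG(2), of 0 "sinv V (detf q jD)"] by simp_all

lemma berf_body: "x \<in> V \<Longrightarrow> gr_body (berf x) \<noteq> 0"
  using detG(3) detD(3) superfun_Grassmann[OF detD(1)]
  by (simp add: berf_def sinv_def gr_body_inverse[of q] gr_unit_def)

text \<open>\<open>Berezinian\<close> takes its inverse by definite description, so uniqueness is
  needed: \<open>jE\<close> is an inverse, and associativity excludes any other.\<close>

lemma berf_eq: assumes x: "x \<in> V" shows "berf x = Berezinian p q (\<lambda>b c. J b c x)"
proof -
  let ?D = "\<lambda>k l. J (p + k) (p + l) x"
  have E: "gr_mat_inverse q ?D = (\<lambda>k l. jE k l x)"
    unfolding gr_mat_inverse_def
  proof (rule the_equality)
    have D: "J (p + i) (p + j) x = jD i j x" if "i < q" "j < q" for i j using that by (simp add: block_def)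
    show *: "(\<forall>i j. i \<ge> q \<or> j \<ge> q \<longrightarrow> jE i j x = 0) \<and>
     (\<forall>i<q. \<forall>j<q. (\<Sum>k<q. ?D i k * jE k j x) = of_bool (i = j) \<and> (\<Sum>k<q. jE i k x * ?D k j) = of_bool (i = j))"
      using ev_inverse[OF DE _ _ x] ev_inverse[OF ED _ _ x] MatD(2)[OF Mat_jE] by (simp add: D)
    fix B assume B: "(\<forall>i j. i \<ge> q \<or> j \<ge> q \<longrightarrow> B i j = 0) \<and>
     (\<forall>i<q. \<forall>j<q. (\<Sum>k<q. ?D i k * B k j) = of_bool (i = j) \<and> (\<Sum>k<q. B i k * ?D k j) = of_bool (i = j))"
    show "B = (\<lambda>k l. jE k l x)"
    proof (intro ext)
      fix i j show "B i j = jE i j x"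
      proof (cases "i < q \<and> j < q")
        case True
        have "(\<Sum>k<q. B i k * (\<Sum>l<q. ?D k l * jE l j x)) = (\<Sum>l<q. (\<Sum>k<q. B i k * ?D k l) * jE l j x)"
          unfolding sum_distrib_left sum_distrib_right mult.assoc by (rule sum.swap)
        moreover have "(\<Sum>k<q. B i k * (\<Sum>l<q. ?D k l * jE l j x)) = (\<Sum>k<q. if k = j then B i j else 0)"
          using * True by (intro sum.cong) auto
        moreover have "(\<Sum>l<q. (\<Sum>k<q. B i k * ?D k l) * jE l j x) = (\<Sum>l<q. if l = i then jE i j x else 0)"
          using B True by (intro sum.cong) auto
        ultimately show ?thesis using True by simp
      next
        case False
        then show ?thesis using B MatD(2)[OF Mat_jE, of i j] by (auto simp: not_less)
      qed
    qed
  qed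
  have G: "gr_det p (\<lambda>a b. J a b x - (\<Sum>k<q. \<Sum>l<q. J a (p + k) x * jE k l x * J (p + l) b x)) = detf p jG x"
    unfolding detf_def using x
  proof (simp, intro gr_det_cong)
    fix a b assume "a < p" "b < p"
    moreover have "(\<Sum>k<q. \<Sum>l<q. J a (p + k) x * jE k l x * J (p + l) b x)
      = (\<Sum>l<q. \<Sum>k<q. J a (p + k) x * jE k l x * J (p + l) b x)" by (rule sum.swap)
    ultimately show "J a b x - (\<Sum>k<q. \<Sum>l<q. J a (p + k) x * jE k l x * J (p + l) b x) = jG a b x"
      by (simp add: jG_def mm_def sum_fun_apply block_def sum_distrib_right)
  qed
  have "gr_det q ?D = detf q jD x"
    unfolding detf_def using x by (simp, intro gr_det_cong) (simp add: block_def)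
  then show ?thesis unfolding Berezinian_def Let_def E G using x by (simp add: berf_def sinv_def)
qed

text \<open>The logarithmic derivative is the trace of \<open>kA\<close> times the derivative of the
  Schur complement, minus the trace of \<open>jE\<close> times the derivative of \<open>jD\<close>.
  Expanding the Schur complement and cycling the factors collects the block derivatives with the
  blocks of \<open>K\<close>, which is the supertrace of \<open>K\<close> times the derivative of
  \<open>J\<close>.\<close>

lemma d_berf:
  assumes x: "x \<in> V"
  shows "point_derivation.d p q V a x berf = berf x * (\<Sum>b<p + q. (-1) ^ cpar p b *
     (\<Sum>c<p + q. K b c x * point_derivation.d p q V a x (J c b)))"
proof -
  interpret point_derivation p q V a x by unfold_locales (rule x)
  let ?A = "ev kA" and ?B = "ev jB" and ?C = "ev jC" and ?E = "ev jE"
  have evd: "ev (F - G) = ev F - ev G" for F G by (intro ext) simp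
  have h: "gr_homogeneous e (F i j x)" if "hom_mat e F" for e F i j
    using that by (simp add: hom_mat_def homogeneous_def)
  have dh: "gr_homogeneous e (d (F i j))" if "hom_mat e F" for e F i j
    using that d_homogeneous by (simp add: hom_mat_def)
  have dE: "dm jE = - mm q (mm q ?E (dm jD)) ?E" by (rule dm_inverse[OF Mat_blocks(4) Mat_jE DE ED])
  have dG: "dm jG = dm jA - (mm q (mm q (dm jB) ?E - mm q ?B (mm q (mm q ?E (dm jD)) ?E)) ?C + mm q (mm q ?B ?E) (dm jC))"
    unfolding jG_def dm_diff[OF Mat_blocks(1) Mat_mm[OF Mat_mm[OF Mat_blocks(2) Mat_jE] Mat_blocks(3)]]
      dm_mm[OF Mat_mm[OF Mat_blocks(2) Mat_jE] Mat_blocks(3)] dm_mm[OF Mat_blocks(2) Mat_jE] ev_mm dE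
    by (simp only: mm_uminus mm_add mm_diff diff_conv_add_uminus)
  let ?X = "mm p ?A (dm jB)" and ?Y = "mm q ?E ?C" and ?Z = "mm q (mm q (mm p ?A ?B) ?E) (dm jD)"
  have t1: "tr p (mm p ?A (dm jG)) = tr p (mm p ?A (dm jA)) - tr p (mm q ?X ?Y) + tr p (mm q ?Z ?Y)
      - tr p (mm q (mm q (mm p ?A ?B) ?E) (dm jC))"
    unfolding dG by (simp only: mm_diff mm_add tr_simps mm_assoc) (simp add: algebra_simps)
  have hY: "gr_homogeneous 1 (?Y i j)" for i j
    using h[OF hom_mat_mm[OF hom_jE hom_blocks(3)], of q i j] by (simp add: mm_def sum_fun_apply)
  have hX: "gr_homogeneous 1 (?X i j)" for i j
    using gr_homogeneous_mult[OF h[OF hom_blocks(5)] dh[OF hom_blocks(2)]]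
    by (simp add: mm_def gr_homogeneous_sum)
  have hZ: "gr_homogeneous 1 (?Z i j)" for i j
  proof -
    have "gr_homogeneous 1 (mm q (mm p ?A ?B) ?E i k)" for k
      using h[OF hom_mat_mm[OF hom_mat_mm[OF hom_blocks(5,2)] hom_jE], of q p i k] by (simp add: mm_def sum_fun_apply)
    from gr_homogeneous_mult[OF this dh[OF hom_blocks(4)]] show ?thesis by (simp add: mm_def[of q _ "dm jD"] gr_homogeneous_sum)
  qed
  \<comment> \<open>Both factors are odd matrices, so the exchange turns these traces of size
    \<open>p\<close> into negative traces of size \<open>q\<close>, as the supertrace
    requires.\<close>
  have XY: "tr p (mm q ?X ?Y) = - tr q (mm p ?Y ?X)" "tr p (mm q ?Z ?Y) = - tr q (mm p ?Y ?Z)"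
    using tr_mm_commute[OF hX hY, of p q] tr_mm_commute[OF hZ hY, of p q] by simp_all
  have k12: "ev kB = - mm q (mm p ?A ?B) ?E" unfolding ev_mm[symmetric] by (subst K12) (intro ext, simp)
  have k21: "ev kC = - mm p ?Y ?A" unfolding ev_mm[symmetric] by (subst K21) (intro ext, simp)
  have k22: "ev kD = ?E + mm p ?Y (mm q (mm p ?A ?B) ?E)" unfolding ev_mm[symmetric] by (subst K22) (intro ext, simp)
  have sum: "tr p (mm p ?A (dm jG)) - tr q (mm q ?E (dm jD))
    = tr p (mm p ?A (dm jA)) + tr p (mm q (ev kB) (dm jC)) - (tr q (mm p (ev kC) (dm jB)) + tr q (mm q (ev kD) (dm jD)))"
    unfolding t1 unfolding XY k12 k21 k22 unfolding mm_uminus mm_add tr_simps mm_assoc by (simp add: algebra_simps)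
  have ev1: "gr_homogeneous 0 (sinv V (detf q jD) x)"
    using homogeneous_sinv[OF detD(1,3,2)] by (simp add: homogeneous_def)
  have ev2: "gr_homogeneous 0 (detf p jG x)" using detG(2) by (simp add: homogeneous_def)
  have inv: "sinv V (detf q jD) x * detf q jD x = 1"
    using superfun_inverse_mult(2)[OF detD(1,3)] x by (metis const_on_apply(1) times_fun_apply)
  have ds: "d (sinv V (detf q jD)) = - (sinv V (detf q jD) x * sinv V (detf q jD) x * d (detf q jD))"
    by (rule d_sinv) (use detD in blast)+
  have "d berf = d (detf p jG) * sinv V (detf q jD) x + detf p jG x * d (sinv V (detf q jD))"
    unfolding berf_def by (rule d_mult[OF detG(1) superfun_inverse[OF detD(1,3)]])
  also have "\<dots> = detf p jG x * tr p (mm p ?A (dm jG)) * sinv V (detf q jD) x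
     - detf p jG x * (sinv V (detf q jD) x * sinv V (detf q jD) x * (detf q jD x * tr q (mm q ?E (dm jD))))"
    unfolding ds d_detf_inverse[OF Mat_jG hom_jG hom_blocks(5) GP] d_detf_inverse[OF Mat_blocks(4) hom_blocks(4) hom_jE DE]
    by simp
  also have "\<dots> = berf x * (tr p (mm p ?A (dm jG)) - tr q (mm q ?E (dm jD)))"
  proof -
    have "sinv V (detf q jD) x * (sinv V (detf q jD) x * (detf q jD x * z)) = sinv V (detf q jD) x * z" for z
      using inv by (metis mult.assoc mult_1)
    then show ?thesis using gr_even_commute[OF ev1, of "tr p (mm p ?A (dm jG))"]
      by (simp add: berf_def right_diff_distrib mult.assoc)
  qed
  also have "tr p (mm p ?A (dm jG)) - tr q (mm q ?E (dm jD))
    = (\<Sum>b<p + q. (-1) ^ cpar p b * (\<Sum>c<p + q. K b c x * d (J c b)))"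
    unfolding sum unfolding sum_lessThan_add tr_def mm_def
    by (simp add: block_def cpar_def sum.distrib sum_negf sum_subtractf)
  finally show ?thesis .
qed

text \<open>In \<open>d_berf\<close>, \<open>\<eta>\<close> is moved to the far left past the
  entries of \<open>K\<close>, which produces the part of the exponent containing
  \<open>cpar p a\<close>; then it is cancelled.\<close>

theorem pd_berf:
  "D a berf = berf * (\<Sum>b<p + q. \<Sum>c<p + q. (-1) ^ (cpar p b + cpar p a * (cpar p b + cpar p c)) * (K b c * D a (J c b)))"
  (is "_ = berf * ?S")
proof (rule superfun_eqI)
  have S: "?S \<in> R" by (intro superfun_sum superfun_neg1 superfun_mult superfun_pd) auto
  then show "D a berf \<in> R" "berf * ?S \<in> R" using berf_closed by simp_all
  fix x assume x: "x \<in> V"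
  interpret point_derivation p q V a x by unfold_locales (rule x)
  have "\<eta> * D a berf x = berf x * (\<Sum>b<p + q. (-1) ^ cpar p b * (\<Sum>c<p + q. K b c x * (\<eta> * D a (J c b) x)))"
    using d_berf[OF x, of a] unfolding d_def .
  also have "\<dots> = berf x * (\<eta> * ?S x)"
  proof -
    have k: "K b c x * (\<eta> * D a (J c b) x) = \<eta> * ((-1) ^ (cpar p a * (cpar p b + cpar p c)) * (K b c x * D a (J c b) x))"
      if "b < p + q" "c < p + q" for b c
    proof -
      have "K b c x * \<eta> = (-1) ^ ((cpar p b + cpar p c) * cpar p a) * (\<eta> * K b c x)"
        using Kh[OF that] by (intro gr_mult_commute \<eta>_homogeneous) (simp add: homogeneous_def)
      then have "K b c x * (\<eta> * z) = (-1) ^ (cpar p a * (cpar p b + cpar p c)) * (\<eta> * (K b c x * z))" for z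
        unfolding mult.commute[of "cpar p a"] mult.assoc[symmetric] by (simp only:)
      then show ?thesis unfolding neg1_commute(2)[of \<eta>] .
    qed
    then have tm: "(-1) ^ cpar p b * (K b c x * (\<eta> * D a (J c b) x))
      = \<eta> * ((-1) ^ (cpar p b + cpar p a * (cpar p b + cpar p c)) * (K b c x * D a (J c b) x))"
      if "b < p + q" "c < p + q" for b c
      using that by (simp only: power_add mult.assoc neg1_commute(2)[of \<eta>])
    have Sx: "?S x = (\<Sum>b<p + q. \<Sum>c<p + q.
        (-1) ^ (cpar p b + cpar p a * (cpar p b + cpar p c)) * (K b c x * D a (J c b) x))"
      by (simp add: sum_fun_apply power_fun_apply)
    show ?thesis unfolding Sx sum_distrib_left
      by (intro sum.cong refl arg_cong[where f = "(*) (berf x)"] tm) auto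
  qed
  also have "\<dots> = \<eta> * (berf x * ?S x)"
    using gr_even_left_commute[of "berf x" \<eta> "?S x"] berf_even by (simp add: homogeneous_def)
  finally have eq: "\<eta> * (D a berf x - berf x * ?S x) = 0" by (simp add: right_diff_distrib)
  have "D a berf x - berf x * ?S x \<in> Grassmann q"
    using superfun_Grassmann[OF superfun_pd[OF berf_closed], of a x] superfun_Grassmann[OF S, of x]
      superfun_Grassmann[OF berf_closed, of x] by simp
  with eq have "D a berf x - berf x * ?S x = 0"
    by (cases "a < p") (auto simp: \<eta>_def dest: Grassmann_gen_mult_eq_0)
  then show "D a berf x = (berf * ?S) x" by simp
qed

end

section \<open>Invariance of the divergence\<close>

text \<open>Signs are kept as powers of minus one in front of a term. This and
  \<open>neg1_cong\<close> reduce each sign identity to the parity of a sum of exponents.\<close>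

lemma neg1_merge: "even (k + l + m) \<Longrightarrow> (-1) ^ k * ((-1) ^ l * z) = (-1) ^ m * (z :: 'a::ring_1)"
  by (cases "even k"; cases "even l") (simp_all add: minus_one_power_iff)

lemma neg1_cong: "even (k + l) \<Longrightarrow> (-1) ^ k * z = (-1) ^ l * (z :: 'a::ring_1)"
  by (cases "even k") (simp_all add: minus_one_power_iff)

context superdomain
begin

definition sdiv :: "sfun \<Rightarrow> nat \<Rightarrow> (nat \<Rightarrow> sfun) \<Rightarrow> sfun" where
  "sdiv \<rho> e X = sinv V \<rho> * (\<Sum>a<p + q. (-1) ^ (cpar p a * (e + 1)) * D a (\<rho> * X a))"

text \<open>Pulling out the even factor \<open>\<rho>\<close> separates the coordinate divergence
  from the derivative of the logarithm of \<open>\<rho>\<close> along the field.\<close>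

lemma div_expand:
  assumes \<rho>: "\<rho> \<in> R" "homogeneous 0 \<rho>" "\<And>x. x \<in> V \<Longrightarrow> gr_body (\<rho> x) \<noteq> 0"
    and X: "\<And>a. a < p + q \<Longrightarrow> X a \<in> R" "\<And>a. a < p + q \<Longrightarrow> homogeneous (cpar p a + e) (X a)"
  shows "sdiv \<rho> e X = (\<Sum>a<p + q. (-1) ^ (cpar p a * (e + 1)) * D a (X a)) + sinv V \<rho> * (\<Sum>a<p + q. X a * D a \<rho>)"
proof -
  have "(-1) ^ (cpar p a * (e + 1)) * D a (\<rho> * X a)
      = \<rho> * ((-1) ^ (cpar p a * (e + 1)) * D a (X a)) + X a * D a \<rho>" if a: "a < p + q" for a
  proof -
    have "D a \<rho> * X a = (-1) ^ (cpar p a * (cpar p a + e)) * (X a * D a \<rho>)"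
      using sfun_commute[OF homogeneous_pd[OF \<rho>(2), of p a V] X(2)[OF a]] by simp
    then have "(-1) ^ (cpar p a * (e + 1)) * (D a \<rho> * X a) = (-1) ^ 0 * (X a * D a \<rho>)"
      by (simp only:) (rule neg1_merge, auto)
    then show ?thesis
      by (simp add: pd_mult_even \<rho> X a distrib_left neg1_commute(2)[of \<rho>])
  qed
  then have "(\<Sum>a<p + q. (-1) ^ (cpar p a * (e + 1)) * D a (\<rho> * X a))
    = (\<Sum>a<p + q. \<rho> * ((-1) ^ (cpar p a * (e + 1)) * D a (X a)) + X a * D a \<rho>)"
    by (intro sum.cong refl) simp
  then have "sdiv \<rho> e X = sinv V \<rho> * \<rho> * (\<Sum>a<p + q. (-1) ^ (cpar p a * (e + 1)) * D a (X a))
     + sinv V \<rho> * (\<Sum>a<p + q. X a * D a \<rho>)"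
    unfolding sdiv_def by (simp add: sum.distrib distrib_left sum_distrib_left mult.assoc)
  moreover have "(\<Sum>a<p + q. (-1) ^ (cpar p a * (e + 1)) * D a (X a)) \<in> R"
    using X by (intro superfun_sum superfun_neg1 superfun_pd) simp
  ultimately show ?thesis by (simp add: superfun_inverse_mult \<rho> superfun_one_mult)
qed

end

context transition_map
begin

interpretation T: transition_map M j i U by (rule swap)

text \<open>The Jacobian of the reverse transition, rewritten in the first chart so that it can be
  multiplied with \<open>Jac\<close>.\<close>

definition Kac :: "nat \<Rightarrow> nat \<Rightarrow> sfun" where
  "Kac b c = \<phi> (transition_map.Jac M j i U b c)"

text \<open>The chain rule for a coordinate of the first chart carried to the second chart and
  back.\<close>

lemma Jac_Kac: 
  assumes "a < p + q" "c < p + q"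
  shows "(\<Sum>b<p + q. Jac a b * Kac b c) = const_on Vi (of_bool (a = c))"
  using chain_rule[OF T.\<phi>_closed[OF I.superfun_coord[OF assms(2)]], of a] assms
  by (simp add: \<phi>_\<psi> I.pd_coord Kac_def T.Jac_def)

lemma Kac_Jac:
  assumes a: "a < p + q" and c: "c < p + q"
  shows "(\<Sum>b<p + q. Kac a b * Jac b c) = const_on Vi (of_bool (a = c))"
proof -
  have "const_on Vj (of_bool (a = c)) = J.D a (\<psi> (\<phi> (coord p Vj c)))"
    using c by (simp add: \<psi>_\<phi> J.pd_coord)
  also have "\<dots> = (\<Sum>b<p + q. T.Jac a b * \<psi> (Jac b c))"
    using T.chain_rule[OF \<phi>_closed[OF J.superfun_coord[OF c]], of a] by (simp add: Jac_def)
  finally have "\<phi> (const_on Vj (of_bool (a = c))) = (\<Sum>b<p + q. \<phi> (T.Jac a b) * Jac b c)"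
  proof -
    assume e: "const_on Vj (of_bool (a = c)) = (\<Sum>b<p + q. T.Jac a b * \<psi> (Jac b c))"
    have "\<phi> (\<Sum>b<p + q. T.Jac a b * \<psi> (Jac b c)) = (\<Sum>b<p + q. \<phi> (T.Jac a b * \<psi> (Jac b c)))"
      by (rule \<phi>_sum) (use c in auto)
    also have "\<dots> = (\<Sum>b<p + q. \<phi> (T.Jac a b) * Jac b c)"
      by (rule sum.cong) (use c in \<open>auto simp: \<phi>_mult \<phi>_\<psi>\<close>)
    finally show ?thesis unfolding e .
  qed
  then show ?thesis by (simp add: Kac_def \<phi>_of_bool)
qed

sublocale SM: super_matrix p q Vi Jac Kac
proof
  fix b c assume "b < p + q" "c < p + q"
  then show "homogeneous (cpar p b + cpar p c) (Kac b c)"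
    unfolding Kac_def using T.Jac_homogeneous by (intro \<phi>_homogeneous) auto
qed (auto simp: Jac_homogeneous Kac_def Jac_Kac[unfolded Kac_def] Kac_Jac[unfolded Kac_def])

lemma inverse_chain_rule:
  assumes f: "f \<in> J.R" and b: "b < p + q" shows "\<phi> (J.D b f) = (\<Sum>c<p + q. Kac b c * I.D c (\<phi> f))"
proof -
  have "(\<Sum>c<p + q. Kac b c * I.D c (\<phi> f)) = (\<Sum>c<p + q. \<Sum>d<p + q. Kac b c * Jac c d * \<phi> (J.D d f))"
    unfolding chain_rule[OF f] by (simp add: sum_distrib_left mult.assoc)
  also have "\<dots> = (\<Sum>d<p + q. (\<Sum>c<p + q. Kac b c * Jac c d) * \<phi> (J.D d f))"
    unfolding sum_distrib_right by (rule sum.swap)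
  also have "\<dots> = (\<Sum>d<p + q. if d = b then \<phi> (J.D b f) else 0)"
  proof (rule sum.cong[OF refl])
    fix d assume "d \<in> {..<p + q}"
    then have e: "(\<Sum>c<p + q. Kac b c * Jac c d) = const_on Vi (of_bool (b = d))" using Kac_Jac[OF b] by simp
    show "(\<Sum>c<p + q. Kac b c * Jac c d) * \<phi> (J.D d f) = (if d = b then \<phi> (J.D b f) else 0)"
    proof (cases "d = b")
      case True
      then show ?thesis unfolding e using I.superfun_one_mult(1)[of "\<phi> (J.D b f)"] f by simp
    next
      case False
      then show ?thesis unfolding e by (auto simp: fun_eq_iff const_on_def restr_def)
    qed
  qed
  finally show ?thesis using b by simp
qed

lemma Jac_symmetric: "b < p + q \<Longrightarrow> I.D c (Jac a b) = (-1) ^ (cpar p c * cpar p a) * I.D a (Jac c b)"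
  unfolding Jac_def by (rule I.pd_commute) simp

text \<open>By \<open>pd_berf\<close>, the logarithmic derivative of the Berezinian in direction
  \<open>a\<close>.\<close>

definition trace_term :: "nat \<Rightarrow> sfun" where
  "trace_term a = (\<Sum>b<p + q. \<Sum>c<p + q.
     (-1) ^ (cpar p b + cpar p a * (cpar p b + cpar p c)) * (Kac b c * I.D a (Jac c b)))"

text \<open>Rewrite the derivatives by the inverse chain rule and apply the Leibniz rule. Where
  \<open>X\<close> is differentiated, \<open>Jac\<close> and \<open>Kac\<close> contract to the
  identity; where \<open>Jac\<close> is differentiated, the symmetry of second derivatives produces
  the trace term.\<close>

lemma pd_field_transform:
  assumes X: "\<And>a. a < p + q \<Longrightarrow> X a \<in> I.R" "\<And>a. a < p + q \<Longrightarrow> homogeneous (cpar p a + e) (X a)"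
    and Y: "\<And>b. b < p + q \<Longrightarrow> Y b \<in> J.R"
    and XY: "\<And>b. b < p + q \<Longrightarrow> \<phi> (Y b) = (\<Sum>a<p + q. X a * Jac a b)"
  shows "\<phi> (\<Sum>b<p + q. (-1) ^ (cpar p b * (e + 1)) * J.D b (Y b))
    = (\<Sum>a<p + q. (-1) ^ (cpar p a * (e + 1)) * I.D a (X a)) + (\<Sum>a<p + q. X a * trace_term a)"
proof -
  let ?n = "p + q"
  let ?F = "\<lambda>a b c. (-1) ^ (cpar p a * (e + 1)) * (Jac a b * Kac b c * I.D c (X a))"
  let ?G = "\<lambda>a b c. X a * ((-1) ^ (cpar p b + cpar p a * (cpar p b + cpar p c)) * (Kac b c * I.D a (Jac c b)))"
  have tm: "(-1) ^ (cpar p b * (e + 1)) * (Kac b c * I.D c (X a * Jac a b)) = ?F a b c + ?G a b c"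
    if a: "a < ?n" and b: "b < ?n" and c: "c < ?n" for a b c
  proof -
    have 1: "I.D c (X a * Jac a b) = I.D c (X a) * Jac a b + (-1) ^ (cpar p c * (cpar p a + e)) * (X a * I.D c (Jac a b))"
      using X a b by (intro I.pd_mult_homogeneous) auto
    have "homogeneous (cpar p b + cpar p c + (cpar p a + e + cpar p c)) (Kac b c * I.D c (X a))"
      by (intro homogeneous_mult homogeneous_pd X SM.Kh a b c)
    from sfun_commute[OF this SM.Jh[OF a b]]
    have "(-1) ^ (cpar p b * (e + 1)) * (Kac b c * I.D c (X a) * Jac a b)
      = (-1) ^ (cpar p b * (e + 1)) * ((-1) ^ ((cpar p b + cpar p c + (cpar p a + e + cpar p c)) * (cpar p a + cpar p b)) * (Jac a b * (Kac b c * I.D c (X a))))"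
      by (simp only:)
    also have "\<dots> = ?F a b c" unfolding mult.assoc[of "Jac a b"] by (rule neg1_merge) auto
    finally have 2: "(-1) ^ (cpar p b * (e + 1)) * (Kac b c * (I.D c (X a) * Jac a b)) = ?F a b c"
      by (simp only: mult.assoc)
    have s: "(-1) ^ (cpar p b * (e + 1)) * ((-1) ^ (cpar p c * (cpar p a + e)) * ((-1) ^ (cpar p c * cpar p a)
         * ((-1) ^ ((cpar p b + cpar p c) * (cpar p a + e)) * z)))
      = (-1) ^ (cpar p b + cpar p a * (cpar p b + cpar p c)) * (z :: sfun)" for z
      unfolding mult.assoc[symmetric] power_add[symmetric] by (rule neg1_cong) auto
    have "Kac b c * (X a * I.D a (Jac c b)) = (-1) ^ ((cpar p b + cpar p c) * (cpar p a + e)) * (X a * (Kac b c * I.D a (Jac c b)))"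
      using sfun_commute[OF SM.Kh[OF b c] X(2)[OF a]] by (simp only: mult.assoc[symmetric])
    then have "(-1) ^ (cpar p b * (e + 1)) * (Kac b c * ((-1) ^ (cpar p c * (cpar p a + e)) * (X a * I.D c (Jac a b))))
       = (-1) ^ (cpar p b + cpar p a * (cpar p b + cpar p c)) * (X a * (Kac b c * I.D a (Jac c b)))"
      unfolding Jac_symmetric[OF b, of c a] neg1_commute(2)[of "X a"] neg1_commute(2)[of "Kac b c"] by (simp only: s)
    then have 3: "(-1) ^ (cpar p b * (e + 1)) * (Kac b c * ((-1) ^ (cpar p c * (cpar p a + e)) * (X a * I.D c (Jac a b)))) = ?G a b c"
      by (simp only: neg1_commute(2)[of "X a"])
    show ?thesis
      by (simp only: 1 distrib_left[of "Kac b c"] distrib_left[of "(-1) ^ (cpar p b * (e + 1))"] 2 3)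
  qed
  have "\<phi> (\<Sum>b<?n. (-1) ^ (cpar p b * (e + 1)) * J.D b (Y b))
    = (\<Sum>b<?n. (-1) ^ (cpar p b * (e + 1)) * (\<Sum>c<?n. Kac b c * I.D c (\<Sum>a<?n. X a * Jac a b)))"
    using Y by (subst \<phi>_sum) (simp_all add: \<phi>_neg1 inverse_chain_rule XY)
  also have "\<dots> = (\<Sum>b<?n. \<Sum>c<?n. \<Sum>a<?n. (-1) ^ (cpar p b * (e + 1)) * (Kac b c * I.D c (X a * Jac a b)))"
  proof (intro sum.cong refl)
    fix b assume b: "b \<in> {..<?n}"
    have "I.D c (\<Sum>a<?n. X a * Jac a b) = (\<Sum>a<?n. I.D c (X a * Jac a b))" for c
      by (rule I.pd_sum) (use X b in auto)
    then show "(-1) ^ (cpar p b * (e + 1)) * (\<Sum>c<?n. Kac b c * I.D c (\<Sum>a<?n. X a * Jac a b))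
      = (\<Sum>c<?n. \<Sum>a<?n. (-1) ^ (cpar p b * (e + 1)) * (Kac b c * I.D c (X a * Jac a b)))"
      by (simp only: sum_distrib_left)
  qed
  also have "\<dots> = (\<Sum>b<?n. \<Sum>c<?n. \<Sum>a<?n. ?F a b c + ?G a b c)"
    by (intro sum.cong refl tm) auto
  also have "\<dots> = (\<Sum>a<?n. \<Sum>c<?n. \<Sum>b<?n. ?F a b c) + (\<Sum>a<?n. \<Sum>b<?n. \<Sum>c<?n. ?G a b c)"
  proof -
    have s3: "(\<Sum>b<?n. \<Sum>c<?n. \<Sum>a<?n. H a b c) = (\<Sum>a<?n. \<Sum>b<?n. \<Sum>c<?n. H a b c)" for H :: "nat \<Rightarrow> nat \<Rightarrow> nat \<Rightarrow> sfun"
    proof -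
      have "(\<Sum>b<?n. \<Sum>c<?n. \<Sum>a<?n. H a b c) = (\<Sum>b<?n. \<Sum>a<?n. \<Sum>c<?n. H a b c)"
        by (intro sum.cong refl sum.swap)
      also have "\<dots> = (\<Sum>a<?n. \<Sum>b<?n. \<Sum>c<?n. H a b c)" by (rule sum.swap)
      finally show ?thesis .
    qed
    have F: "(\<Sum>a<?n. \<Sum>b<?n. \<Sum>c<?n. ?F a b c) = (\<Sum>a<?n. \<Sum>c<?n. \<Sum>b<?n. ?F a b c)"
      by (intro sum.cong refl sum.swap)
    show ?thesis unfolding sum.distrib s3[of ?F] s3[of ?G] F ..
  qed
  also have "(\<Sum>a<?n. \<Sum>c<?n. \<Sum>b<?n. ?F a b c) = (\<Sum>a<?n. (-1) ^ (cpar p a * (e + 1)) * I.D a (X a))"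
  proof (rule sum.cong[OF refl])
    fix a assume "a \<in> {..<?n}"
    then have a: "a < ?n" by simp
    have "(\<Sum>b<?n. ?F a b c) = (if c = a then (-1) ^ (cpar p a * (e + 1)) * I.D a (X a) else 0)" if c: "c < ?n" for c
    proof -
      have "(\<Sum>b<?n. ?F a b c) = (-1) ^ (cpar p a * (e + 1)) * (const_on Vi (of_bool (a = c)) * I.D c (X a))"
        unfolding Jac_Kac[OF a c, symmetric] sum_distrib_left sum_distrib_right ..
      moreover have "const_on Vi (of_bool (a = c)) * I.D c (X a) = (if c = a then I.D a (X a) else 0)"
      proof (cases "c = a")
        case True
        then show ?thesis using I.superfun_one_mult(1)[of "I.D a (X a)"] X a by simp
      qed (auto simp: fun_eq_iff const_on_def restr_def)
      ultimately show ?thesis by simp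
    qed
    then have "(\<Sum>c<?n. \<Sum>b<?n. ?F a b c) = (\<Sum>c<?n. if c = a then (-1) ^ (cpar p a * (e + 1)) * I.D a (X a) else 0)"
      by (intro sum.cong refl) auto
    then show "(\<Sum>c<?n. \<Sum>b<?n. ?F a b c) = (-1) ^ (cpar p a * (e + 1)) * I.D a (X a)" using a by simp
  qed
  also have "(\<Sum>a<?n. \<Sum>b<?n. \<Sum>c<?n. ?G a b c) = (\<Sum>a<?n. X a * trace_term a)"
    by (simp only: trace_term_def sum_distrib_left)
  finally show ?thesis .
qed

text \<open>The coordinate divergences in the two charts differ by the trace term. The Berezinian
  factor in \<open>\<rho>\<close> contributes the same term through its logarithmic derivative, so
  the full divergences agree.\<close>

theorem div_transform:
  assumes X: "\<And>a. a < p + q \<Longrightarrow> X a \<in> I.R" "\<And>a. a < p + q \<Longrightarrow> homogeneous (cpar p a + e) (X a)"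
    and Y: "\<And>b. b < p + q \<Longrightarrow> Y b \<in> J.R" "\<And>b. b < p + q \<Longrightarrow> homogeneous (cpar p b + e) (Y b)"
    and XY: "\<And>b. b < p + q \<Longrightarrow> \<phi> (Y b) = (\<Sum>a<p + q. X a * Jac a b)"
    and \<sigma>: "\<sigma> \<in> J.R" "homogeneous 0 \<sigma>" "\<And>x. x \<in> Vj \<Longrightarrow> gr_body (\<sigma> x) \<noteq> 0"
    and \<rho>: "\<rho> = SM.berf * \<phi> \<sigma>"
  shows "I.sdiv \<rho> e X = \<phi> (J.sdiv \<sigma> e Y)"
proof -
  let ?B = "SM.berf" and ?s = "\<phi> \<sigma>" and ?t = "\<phi> (sinv Vj \<sigma>)"
  have sinv: "sinv Vj \<sigma> \<in> J.R" by (rule J.superfun_inverse[OF \<sigma>(1,3)])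
  have B: "?B \<in> I.R" "homogeneous 0 ?B" by (rule SM.berf_closed SM.berf_even)+
  have s: "?s \<in> I.R" "homogeneous 0 ?s" using \<sigma> \<phi>_homogeneous by auto
  have t: "?t \<in> I.R" "?s * ?t = const_on Vi 1"
    using \<phi>_mult[OF \<sigma>(1) sinv] J.superfun_inverse_mult(1)[OF \<sigma>(1,3)] sinv by auto
  have \<rho>R: "\<rho> \<in> I.R" "homogeneous 0 \<rho>" using B s homogeneous_mult[of 0 ?B 0 ?s] by (auto simp: \<rho>)
  have body: "gr_body (\<rho> x) \<noteq> 0" if x: "x \<in> Vi" for x
  proof -
    obtain P where P: "P \<in> U" "x = chart_map M i P" using x by (auto simp: img_def)
    then have "gr_body (?s x) \<noteq> 0" using body_\<phi>[OF P(1) \<sigma>(1)] \<sigma>(3)[of "chart_map M j P"] by (auto simp: img_def)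
    then show ?thesis using SM.berf_body[OF x] by (simp add: \<rho>)
  qed
  have inv: "sinv Vi \<rho> \<in> I.R" by (rule I.superfun_inverse[OF \<rho>R(1) body])
  have inv\<rho>: "sinv Vi \<rho> * \<rho> = const_on Vi 1" by (rule I.superfun_inverse_mult(2)[OF \<rho>R(1) body])
  have invB: "sinv Vi \<rho> * ?B = ?t"
  proof -
    have "?t = sinv Vi \<rho> * \<rho> * ?t" unfolding inv\<rho> by (rule I.superfun_one_mult(1)[OF t(1), symmetric])
    also have "\<dots> = sinv Vi \<rho> * (?B * (?s * ?t))" by (simp only: \<rho> mult.assoc)
    also have "\<dots> = sinv Vi \<rho> * ?B" unfolding t(2) by (simp only: I.superfun_one_mult(2)[OF B(1)])
    finally show ?thesis by simp
  qed
  have T: "trace_term a \<in> I.R" for a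
    unfolding trace_term_def by (intro I.superfun_sum I.superfun_neg1 I.superfun_mult I.superfun_pd) auto
  have D\<rho>: "I.D a \<rho> = \<rho> * trace_term a + ?B * I.D a ?s" for a
  proof -
    have "I.D a \<rho> = ?B * trace_term a * ?s + ?B * I.D a ?s"
      unfolding \<rho> I.pd_mult_even[OF B(1) s(1) B(2)] SM.pd_berf trace_term_def ..
    also have "?B * trace_term a * ?s = \<rho> * trace_term a"
      using sfun_even_commute[OF s(2), of "trace_term a"] by (simp only: \<rho> mult.assoc)
    finally show ?thesis .
  qed
  have ev: "X a * \<rho> = \<rho> * X a" "X a * ?B = ?B * X a" for a
    using sfun_even_commute[OF \<rho>R(2)] sfun_even_commute[OF B(2)] by simp_all
  have XD: "X a * I.D a \<rho> = \<rho> * (X a * trace_term a) + ?B * (X a * I.D a ?s)" for a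
    unfolding D\<rho> distrib_left by (simp only: mult.assoc[symmetric] ev)
  have XT: "(\<Sum>a<p + q. X a * trace_term a) \<in> I.R" using X T by (intro I.superfun_sum) simp
  have Xs: "(\<Sum>a<p + q. X a * I.D a ?s) = \<phi> (\<Sum>b<p + q. Y b * J.D b \<sigma>)"
  proof -
    have "(\<Sum>a<p + q. X a * I.D a ?s) = (\<Sum>a<p + q. \<Sum>b<p + q. X a * Jac a b * \<phi> (J.D b \<sigma>))"
      unfolding chain_rule[OF \<sigma>(1)] by (simp add: sum_distrib_left mult.assoc)
    also have "\<dots> = (\<Sum>b<p + q. \<phi> (Y b) * \<phi> (J.D b \<sigma>))"
      by (subst sum.swap) (intro sum.cong refl, simp add: XY sum_distrib_right)
    also have "\<dots> = \<phi> (\<Sum>b<p + q. Y b * J.D b \<sigma>)"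
      using Y(1) \<sigma>(1) by (subst \<phi>_sum) (auto simp: \<phi>_mult)
    finally show ?thesis .
  qed
  have d1: "I.sdiv \<rho> e X = (\<Sum>a<p + q. (-1) ^ (cpar p a * (e + 1)) * I.D a (X a))
      + sinv Vi \<rho> * (\<Sum>a<p + q. X a * I.D a \<rho>)"
    by (rule I.div_expand) (use \<rho>R body X in blast)+
  have d2: "J.sdiv \<sigma> e Y = (\<Sum>b<p + q. (-1) ^ (cpar p b * (e + 1)) * J.D b (Y b))
      + sinv Vj \<sigma> * (\<Sum>b<p + q. Y b * J.D b \<sigma>)"
    by (rule J.div_expand) (use \<sigma> Y in blast)+
  have pf: "\<phi> (\<Sum>b<p + q. (-1) ^ (cpar p b * (e + 1)) * J.D b (Y b))
    = (\<Sum>a<p + q. (-1) ^ (cpar p a * (e + 1)) * I.D a (X a)) + (\<Sum>a<p + q. X a * trace_term a)"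
    by (rule pd_field_transform) (use X Y XY in blast)+
  have YR: "(\<Sum>b<p + q. (-1) ^ (cpar p b * (e + 1)) * J.D b (Y b)) \<in> J.R" "(\<Sum>b<p + q. Y b * J.D b \<sigma>) \<in> J.R"
    using Y(1) \<sigma>(1) by (auto intro!: J.superfun_sum)
  have "sinv Vi \<rho> * (\<Sum>a<p + q. X a * I.D a \<rho>)
      = sinv Vi \<rho> * \<rho> * (\<Sum>a<p + q. X a * trace_term a) + sinv Vi \<rho> * ?B * (\<Sum>a<p + q. X a * I.D a ?s)"
    unfolding XD sum.distrib by (simp only: sum_distrib_left distrib_left mult.assoc)
  also have "\<dots> = (\<Sum>a<p + q. X a * trace_term a) + ?t * \<phi> (\<Sum>b<p + q. Y b * J.D b \<sigma>)"
    unfolding inv\<rho> I.superfun_one_mult(1)[OF XT] invB Xs ..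
  finally have "I.sdiv \<rho> e X = \<phi> (\<Sum>b<p + q. (-1) ^ (cpar p b * (e + 1)) * J.D b (Y b))
      + ?t * \<phi> (\<Sum>b<p + q. Y b * J.D b \<sigma>)"
    unfolding d1 pf by (simp only: add.assoc)
  also have "\<dots> = \<phi> (J.sdiv \<sigma> e Y)"
    unfolding d2 using YR sinv by (simp add: \<phi>_add \<phi>_mult)
  finally show ?thesis .
qed

end

section \<open>Functions and densities\<close>

context transition_map
begin

lemma pos_fun_\<phi>: assumes f: "J.pos_fun f" shows "I.pos_fun (\<phi> f)"
  unfolding I.pos_fun_def
proof (intro conjI ballI)
  fix x assume "x \<in> Vi"
  then obtain P where P: "P \<in> U" "x = chart_map M i P" by (auto simp: img_def)
  then have "chart_map M j P \<in> Vj" by (auto simp: img_def)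
  then show "gr_body (\<phi> f x) > 0"
    using body_\<phi>[OF P(1), of f] f P(2) by (simp add: J.pos_fun_def)
qed (use f \<phi>_homogeneous in \<open>auto simp: J.pos_fun_def\<close>)

text \<open>An algebra map need not respect real powers a priori. Here both sides have the same body
  by \<open>body_\<phi>\<close>, and by the chain rule both have \<open>w\<close> times the
  logarithmic derivative of \<open>\<phi> f\<close>.\<close>

lemma \<phi>_powf:
  assumes f: "J.pos_fun f" shows "\<phi> (J.powf f w) = I.powf (\<phi> f) w"
proof (rule I.superfun_eqI)
  have g: "I.pos_fun (\<phi> f)" by (rule pos_fun_\<phi>[OF f])
  have fR: "f \<in> J.R" using f by (simp add: J.pos_fun_def)
  let ?A = "\<phi> (J.powf f (w - 1))" and ?B = "I.powf (\<phi> f) (w - 1)"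
  show "\<phi> (J.powf f w) \<in> I.R" "I.powf (\<phi> f) w \<in> I.R" using f g by simp_all
  fix x assume x: "x \<in> Vi"
  have hom: "homogeneous 0 (\<phi> f)" "homogeneous 0 ?A" "homogeneous 0 ?B"
    using g pos_fun_\<phi>[OF J.pos_fun_powf[OF f]] I.pos_fun_powf[OF g] by (auto simp: I.pos_fun_def)
  have A: "\<phi> (J.powf f w) = ?A * \<phi> f"
    using J.powf_add[OF f, of "w - 1" 1] \<phi>_mult[of "J.powf f (w - 1)" f] f fR by (simp add: J.powf_1)
  have B: "I.powf (\<phi> f) w = ?B * \<phi> f"
    using I.powf_add[OF g, of "w - 1" 1] g by (simp add: I.powf_1)
  have DA: "I.D a (\<phi> (J.powf f w)) = smul w (?A * I.D a (\<phi> f))" for a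
  proof -
    have "I.D a (\<phi> (J.powf f w)) = (\<Sum>b<p + q. Jac a b * smul w (?A * \<phi> (J.D b f)))"
      using f fR by (simp add: chain_rule J.pd_powf \<phi>_smul \<phi>_mult)
    also have "\<dots> = (\<Sum>b<p + q. smul w (?A * (Jac a b * \<phi> (J.D b f))))"
    proof (rule sum.cong[OF refl])
      fix b
      have "Jac a b * (?A * z) = ?A * (Jac a b * z)" for z
        using sfun_even_commute[OF hom(2), of "Jac a b"] by (simp flip: mult.assoc)
      moreover have "Jac a b * smul w z = smul w (Jac a b * z)" for z by (simp add: smul_def fun_eq_iff)
      ultimately show "Jac a b * smul w (?A * \<phi> (J.D b f)) = smul w (?A * (Jac a b * \<phi> (J.D b f)))" by simp
    qed
    also have "\<dots> = smul w (?A * I.D a (\<phi> f))"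
      unfolding chain_rule[OF fR] by (simp add: smul_def fun_eq_iff sum_fun_apply sum_distrib_left scaleR_sum_right)
    finally show ?thesis .
  qed
  have DB: "I.D a (I.powf (\<phi> f) w) = smul w (?B * I.D a (\<phi> f))" for a by (rule I.pd_powf[OF g])
  show "\<phi> (J.powf f w) x = I.powf (\<phi> f) w x"
  proof (rule gr_pos_eqI[of q])
    show "gr_pos q (\<phi> (J.powf f w) x)" "gr_pos q (I.powf (\<phi> f) w x)"
      using I.pos_funD[OF pos_fun_\<phi>[OF J.pos_fun_powf[OF f]] x] I.pos_funD[OF I.pos_fun_powf[OF g] x] .
    obtain P where P: "P \<in> U" "x = chart_map M i P" using x by (auto simp: img_def)
    show "gr_body (\<phi> (J.powf f w) x) = gr_body (I.powf (\<phi> f) w x)"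
      using body_\<phi>[OF P(1) J.superfun_powf[OF f], of w] body_\<phi>[OF P(1) fR] unfolding P(2)
      by (simp add: J.powf_def I.powf_def)
    fix l assume "l < q"
    have der: "gr_deriv l (h x) = I.D (p + l) h x" for h using x by (simp add: pd_def)
    show "gr_deriv l (\<phi> (J.powf f w) x) * I.powf (\<phi> f) w x = \<phi> (J.powf f w) x * gr_deriv l (I.powf (\<phi> f) w x)"
      unfolding der DA DB
    proof -
      let ?d = "I.D (p + l) (\<phi> f) x"
      have ev: "gr_homogeneous 0 (\<phi> f x)" "gr_homogeneous 0 (?A x)" "gr_homogeneous 0 (?B x)"
        using hom by (auto simp: homogeneous_def)
      have "?A x * ?d * (?B x * \<phi> f x) = ?A x * \<phi> f x * (?B x * ?d)"
      proof -
        have "?d * (?B x * \<phi> f x) = ?B x * \<phi> f x * ?d"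
          by (rule gr_even_commute[OF gr_homogeneous_mult_even[OF ev(3,1)], symmetric])
        also have "\<dots> = \<phi> f x * (?B x * ?d)" using gr_even_commute[OF ev(3), of "\<phi> f x"] by (simp only: mult.assoc)
        finally show ?thesis by (simp only: mult.assoc)
      qed
      then show "smul w (?A * I.D (p + l) (\<phi> f)) x * I.powf (\<phi> f) w x = \<phi> (J.powf f w) x * smul w (?B * I.D (p + l) (\<phi> f)) x"
        unfolding A B by (simp add: smul_def)
    qed
  qed
qed

end

section \<open>Global densities, their products and parity components\<close>

locale smfd =
  fixes M :: "('x, 'i) supermfd"
  assumes M: "supermanifold M" and oriented: "oriented M"
begin

abbreviation "p \<equiv> evdim M"
abbreviation "q \<equiv> odim M"
abbreviation "OL i j \<equiv> img M i (overlap M i j)"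
abbreviation "Rc i \<equiv> superfuns p q (vdom M i)"

lemma sfuns_chart: "sfuns M i (chart_dom M i) = Rc i"
  by (simp add: sfuns_def vdom_def)

lemma cdim_eq: "cdim M = p + q"
  by (simp add: cdim_def)

lemma chart_domain: "i \<in> charts M \<Longrightarrow> superdomain p (vdom M i)"
  using supermanifold_chart(2)[OF M] by (simp add: superdomain_def)

lemma overlap_map: "i \<in> charts M \<Longrightarrow> j \<in> charts M \<Longrightarrow> transition_map M i j (overlap M i j)"
  using M open_overlap[OF M] by unfold_locales auto

lemma OL_subset: "OL i j \<subseteq> vdom M i" "OL j i = img M j (overlap M i j)"
  by (auto simp: img_def vdom_def overlap_def)

lemma OL_open: "i \<in> charts M \<Longrightarrow> j \<in> charts M \<Longrightarrow> open_dom p (OL i j)"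
  using open_img[OF M _ open_overlap[OF M]] by (simp add: overlap_def)

lemma restr_closed: "i \<in> charts M \<Longrightarrow> j \<in> charts M \<Longrightarrow> f \<in> Rc i \<Longrightarrow> restr (OL i j) f \<in> superfuns p q (OL i j)"
  by (rule superdomain.superfun_restr[OF chart_domain _ OL_open OL_subset(1)])

lemma change_eq: "change M i j f = transition M i j (overlap M i j) (restr (img M j (overlap M i j)) f)"
  by (simp add: change_def)

lemma restr_closed_j: "i \<in> charts M \<Longrightarrow> j \<in> charts M \<Longrightarrow> f \<in> Rc j \<Longrightarrow>
    restr (img M j (overlap M i j)) f \<in> superfuns p q (img M j (overlap M i j))"
  using restr_closed[of j i f] by (simp add: OL_subset(2))

lemma jacobian_eq:
  assumes "i \<in> charts M" "j \<in> charts M"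
  shows "jacobian M i j a b = transition_map.Jac M i j (overlap M i j) a b"
proof -
  interpret T: transition_map M i j "overlap M i j" by (rule overlap_map[OF assms])
  show ?thesis unfolding jacobian_def T.Jac_def change_eq
    by (subst restr_coord) (auto simp: img_def vdom_def overlap_def)
qed

text \<open>Densities are defined with the pointwise Berezinian, whose values off the overlap are
  not controlled. This power of \<open>berf\<close> vanishes there, so the transition law becomes an
  identity between superfunctions.\<close>

abbreviation "bf i j \<equiv> superdomain.powf q (super_matrix.berf p q (OL i j) (transition_map.Jac M i j (overlap M i j)) (transition_map.Kac M i j (overlap M i j)))"

lemma berf_pos:
  assumes ij: "i \<in> charts M" "j \<in> charts M"
  shows "superdomain.pos_fun p q (OL i j) (super_matrix.berf p q (OL i j)
    (transition_map.Jac M i j (overlap M i j)) (transition_map.Kac M i j (overlap M i j)))"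
    and "x \<in> OL i j \<Longrightarrow> ber M i j x = super_matrix.berf p q (OL i j)
      (transition_map.Jac M i j (overlap M i j)) (transition_map.Kac M i j (overlap M i j)) x"
proof -
  interpret T: transition_map M i j "overlap M i j" by (rule overlap_map[OF ij])
  show b: "ber M i j x = T.SM.berf x" if "x \<in> OL i j" for x
    using T.SM.berf_eq[OF that] by (simp add: ber_def jacobian_eq[OF ij])
  then show "T.I.pos_fun T.SM.berf"
    using oriented[unfolded oriented_def, rule_format, OF ij] T.SM.berf_closed T.SM.berf_even
    by (simp add: T.I.pos_fun_def flip: b)
qed

lemma density_law:
  assumes ij: "i \<in> charts M" "j \<in> charts M" and f: "f \<in> Rc j"
  shows "(\<lambda>x. gr_powr q (ber M i j x) w) * change M i j f = bf i j w * change M i j f"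
proof (rule ext)
  fix x
  interpret T: transition_map M i j "overlap M i j" by (rule overlap_map[OF ij])
  have c: "change M i j f \<in> T.I.R" unfolding change_eq using restr_closed_j[OF ij f] by simp
  show "((\<lambda>x. gr_powr q (ber M i j x) w) * change M i j f) x = (bf i j w * change M i j f) x"
  proof (cases "x \<in> OL i j")
    case True
    then show ?thesis using berf_pos(2)[OF ij] by (simp add: T.I.powf_def)
  next
    case False
    then show ?thesis using T.I.superfun_outside[OF c] by simp
  qed
qed

lemma densities_iff:
  "s \<in> densities M w \<longleftrightarrow> (\<forall>i\<in>charts M. s i \<in> Rc i) \<and> (\<forall>i. i \<notin> charts M \<longrightarrow> s i = 0) \<and>
     (\<forall>i\<in>charts M. \<forall>j\<in>charts M. restr (OL i j) (s i) = bf i j w * change M i j (s j))"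
  unfolding densities_def local_family_def sfuns_chart using density_law by auto

lemma densityD:
  assumes "s \<in> densities M w"
  shows "i \<in> charts M \<Longrightarrow> s i \<in> Rc i" "i \<notin> charts M \<Longrightarrow> s i = 0"
    "i \<in> charts M \<Longrightarrow> j \<in> charts M \<Longrightarrow> restr (OL i j) (s i) = bf i j w * change M i j (s j)"
  using assms unfolding densities_iff by blast+

lemma change_simps:
  assumes ij: "i \<in> charts M" "j \<in> charts M" and fg: "f \<in> Rc j" "g \<in> Rc j"
  shows "change M i j f \<in> superfuns p q (OL i j)" "change M i j (f + g) = change M i j f + change M i j g"
    "change M i j (f * g) = change M i j f * change M i j g" "change M i j (- f) = - change M i j f"
    "homogeneous e f \<Longrightarrow> homogeneous e (change M i j f)"
    "change M i j 0 = 0" "change M i j ((-1) ^ n * f) = (-1) ^ n * change M i j f"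
proof -
  interpret T: transition_map M i j "overlap M i j" by (rule overlap_map[OF ij])
  note r = restr_closed_j[OF ij fg(1)] restr_closed_j[OF ij fg(2)]
  show "change M i j f \<in> T.I.R" "change M i j (f + g) = change M i j f + change M i j g"
    "change M i j (f * g) = change M i j f * change M i j g" "change M i j (- f) = - change M i j f"
    "change M i j 0 = 0"
    unfolding change_eq restr_simps using r by (simp_all add: T.\<phi>_add T.\<phi>_mult T.\<phi>_uminus)
  then show "change M i j ((-1) ^ n * f) = (-1) ^ n * change M i j f" by (cases "even n") simp_all
  show "homogeneous e (change M i j f)" if "homogeneous e f"
    unfolding change_eq using T.\<phi>_homogeneous[OF r(1) homogeneous_restr[OF that]] .
qed

lemma bf_simps:
  assumes ij: "i \<in> charts M" "j \<in> charts M"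
  shows "homogeneous 0 (bf i j w)" "bf i j v * bf i j w = bf i j (v + w)" "bf i j 0 = const_on (OL i j) 1"
    "bf i j w \<in> superfuns p q (OL i j)"
    "bf i j 1 = super_matrix.berf p q (OL i j) (transition_map.Jac M i j (overlap M i j)) (transition_map.Kac M i j (overlap M i j))"
proof -
  interpret T: transition_map M i j "overlap M i j" by (rule overlap_map[OF ij])
  note b = berf_pos(1)[OF ij]
  show "homogeneous 0 (bf i j w)" using T.I.pos_fun_powf[OF b] by (simp add: T.I.pos_fun_def)
  show "bf i j v * bf i j w = bf i j (v + w)" by (rule T.I.powf_add[OF b])
  show "bf i j 0 = const_on (OL i j) 1" by (rule T.I.powf_0[OF b])
  show "bf i j w \<in> T.I.R" by (rule T.I.superfun_powf[OF b])
  show "bf i j 1 = T.SM.berf" by (rule T.I.powf_1[OF b])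
qed

text \<open>The zeroth power of the Berezinian is the unit on the overlap, so results on densities
  also cover functions.\<close>

lemma smooth_functions_eq: "smooth_functions M = densities M 0"
proof (rule Set.set_eqI)
  fix f :: "'i fam"
  have "const_on (OL i j) 1 * change M i j (f j) = change M i j (f j)"
    if ij: "i \<in> charts M" "j \<in> charts M" and f: "f j \<in> Rc j" for i j
    using superdomain.superfun_one_mult(1)[of p "OL i j"] change_simps(1)[OF ij f f] OL_open[OF ij]
    by (simp add: superdomain_def)
  then show "f \<in> smooth_functions M \<longleftrightarrow> f \<in> densities M 0"
    unfolding densities_iff smooth_functions_def local_family_def sfuns_chart
    using bf_simps(3) by auto
qed

lemma densities_mult:
  assumes s: "s \<in> densities M v" and t: "t \<in> densities M w" shows "s * t \<in> densities M (v + w)"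
  unfolding densities_iff
proof (intro conjI ballI allI impI)
  fix i assume i: "i \<in> charts M"
  then show "(s * t) i \<in> Rc i"
    using densityD(1)[OF s i] densityD(1)[OF t i] superdomain.superfun_mult[OF chart_domain[OF i]] by simp
  fix j assume j: "j \<in> charts M"
  let ?a = "change M i j (s j)" and ?b = "change M i j (t j)"
  have "restr (OL i j) ((s * t) i) = bf i j v * (?a * bf i j w) * ?b"
    using densityD(3)[OF s i j] densityD(3)[OF t i j] by (simp add: restr_simps mult.assoc)
  also have "?a * bf i j w = bf i j w * ?a" using sfun_even_commute[OF bf_simps(1)[OF i j]] by metis
  also have "bf i j v * (bf i j w * ?a) * ?b = (bf i j v * bf i j w) * (?a * ?b)" by (simp only: mult.assoc)
  also have "\<dots> = bf i j (v + w) * change M i j ((s * t) j)"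
    unfolding bf_simps(2)[OF i j] using change_simps(3)[OF i j densityD(1)[OF s j] densityD(1)[OF t j]] by simp
  finally show "restr (OL i j) ((s * t) i) = bf i j (v + w) * change M i j ((s * t) j)" .
next
  fix i assume "i \<notin> charts M"
  then show "(s * t) i = 0" using densityD(2)[OF s] by simp
qed

lemma densities_add:
  assumes s: "s \<in> densities M w" and t: "t \<in> densities M w" shows "s + t \<in> densities M w"
  unfolding densities_iff
proof (intro conjI ballI allI impI)
  fix i assume i: "i \<in> charts M"
  then show "(s + t) i \<in> Rc i"
    using densityD(1)[OF s i] densityD(1)[OF t i] superdomain.superfun_add[OF chart_domain[OF i]] by simp
  fix j assume j: "j \<in> charts M"
  show "restr (OL i j) ((s + t) i) = bf i j w * change M i j ((s + t) j)"
    using densityD(3)[OF s i j] densityD(3)[OF t i j]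
      change_simps(2)[OF i j densityD(1)[OF s j] densityD(1)[OF t j]] by (simp add: restr_simps distrib_left)
next
  fix i assume "i \<notin> charts M"
  then show "(s + t) i = 0" using densityD(2)[OF s] densityD(2)[OF t] by simp
qed

lemma densities_uminus:
  assumes s: "s \<in> densities M w" shows "- s \<in> densities M w"
  unfolding densities_iff
proof (intro conjI ballI allI impI)
  fix i assume i: "i \<in> charts M"
  then show "(- s) i \<in> Rc i"
    using densityD(1)[OF s i] superdomain.superfun_uminus[OF chart_domain[OF i]] by simp
  fix j assume j: "j \<in> charts M"
  show "restr (OL i j) ((- s) i) = bf i j w * change M i j ((- s) j)"
    using densityD(3)[OF s i j] change_simps(4)[OF i j densityD(1)[OF s j] densityD(1)[OF s j]]
    by (simp add: restr_simps)
next
  fix i assume "i \<notin> charts M"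
  then show "(- s) i = 0" using densityD(2)[OF s] by simp
qed

lemma densities_diff: "s \<in> densities M w \<Longrightarrow> t \<in> densities M w \<Longrightarrow> s - t \<in> densities M w"
  using densities_add[of s w "- t"] densities_uminus[of t] by simp

lemma densities_0: "0 \<in> densities M w"
  unfolding densities_iff
proof (intro conjI ballI allI impI)
  fix i j assume i: "i \<in> charts M" and j: "j \<in> charts M"
  then show "restr (OL i j) (0 i) = bf i j w * change M i j (0 j)"
    using change_simps(6)[OF i j, of 0 0] superdomain.superfun_0[OF chart_domain[OF j]] by (simp add: restr_simps)
next
  fix i assume i: "i \<in> charts M"
  then show "0 i \<in> Rc i" using superdomain.superfun_0[OF chart_domain[OF i]] by simp
qed simp

lemma fam_part_sum: "fam_part 0 s + fam_part 1 s = s"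
  by (intro ext) (simp add: fam_part_def gr_part_0_plus_1)

lemma fam_part_homogeneous: "fam_homogeneous e s \<Longrightarrow> fam_part k s = (if even (e + k) then s else 0)"
  using gr_part_homogeneous[of e "s _ _" k]
  by (intro ext) (simp add: fam_part_def fam_homogeneous_def homogeneous_def)

lemma fam_homogeneous_part: "fam_homogeneous e (fam_part e s)"
  by (simp add: fam_homogeneous_def homogeneous_def fam_part_def gr_homogeneous_part)

lemma homogeneous_split:
  assumes "homogeneous 0 a" "homogeneous 1 b" "homogeneous 0 c" "homogeneous 1 d" "a + b = c + d"
  shows "a = c" "b = d"
proof -
  have "gr_part e (a x + b x) = gr_part e (c x + d x)" for e x using assms(5) by (metis plus_fun_apply)
  from this[of 0] this[of 1] show "a = c" "b = d"
    using assms(1-4) gr_part_homogeneous[of 0 "a _"] gr_part_homogeneous[of 1 "b _"]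
      gr_part_homogeneous[of 0 "c _"] gr_part_homogeneous[of 1 "d _"]
    by (simp_all add: fun_eq_iff homogeneous_def)
qed

text \<open>The transition law multiplies by an even factor and preserves parity, so it splits into
  one law for each parity component.\<close>

lemma densities_part:
  assumes s: "s \<in> densities M w" shows "fam_part e s \<in> densities M w"
proof -
  have law: "restr (OL i j) (fam_part k s i) = bf i j w * change M i j (fam_part k s j) \<and> fam_part k s i \<in> Rc i"
    if ij: "i \<in> charts M" "j \<in> charts M" and k: "k = 0 \<or> k = 1" for i j k
  proof -
    have R: "fam_part k s i \<in> Rc i" if "i \<in> charts M" for i k
      using superdomain.superfun_part[OF chart_domain[OF that] densityD(1)[OF s that]] by (simp add: fam_part_def)
    have h: "homogeneous k (fam_part k s i)" for i k
      using fam_homogeneous_part[of k s] by (simp add: fam_homogeneous_def)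
    let ?c = "\<lambda>k. change M i j (fam_part k s j)"
    have hc: "homogeneous k (?c k)" for k
      using change_simps(5)[OF ij R[OF ij(2)] R[OF ij(2)]] h by blast
    have "bf i j w * (?c 0 + ?c 1) = bf i j w * change M i j (s j)"
      using change_simps(2)[OF ij R[OF ij(2)] R[OF ij(2)], of 0 1] fam_part_sum[of s] by (metis plus_fun_apply)
    also have "\<dots> = restr (OL i j) (fam_part 0 s i + fam_part 1 s i)"
      using densityD(3)[OF s ij] fam_part_sum[of s] by (metis plus_fun_apply)
    finally have eq: "restr (OL i j) (fam_part 0 s i) + restr (OL i j) (fam_part 1 s i) = bf i j w * ?c 0 + bf i j w * ?c 1"
      by (simp add: restr_simps distrib_left)
    have "homogeneous 0 (bf i j w * ?c 0)" "homogeneous 1 (bf i j w * ?c 1)"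
      using homogeneous_mult[OF bf_simps(1)[OF ij, of w] hc[of 0]] homogeneous_mult[OF bf_simps(1)[OF ij, of w] hc[of 1]] by simp_all
    from homogeneous_split[OF homogeneous_restr[OF h] homogeneous_restr[OF h] this eq] k R ij show ?thesis by auto
  qed
  have "fam_part 0 s \<in> densities M w" "fam_part 1 s \<in> densities M w"
    unfolding densities_iff using law densityD(2)[OF s] by (auto simp: fam_part_def)
  moreover have "fam_part e s = (if even e then fam_part 0 s else fam_part 1 s)"
    by (intro ext gr_eqI) (auto simp: fam_part_def gr_coeff_part mod2_eq_if)
  ultimately show ?thesis by simp
qed

lemma pos_fun_volume:
  assumes "nondegenerate_volume M \<rho>" "i \<in> charts M" shows "superdomain.pos_fun p q (vdom M i) (\<rho> i)"
proof -
  interpret superdomain p q "vdom M i" by (rule chart_domain[OF assms(2)])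
  show ?thesis using assms densityD(1)[of \<rho> 1] by (auto simp: nondegenerate_volume_def pos_fun_def)
qed

lemma vol_powr_eq: "i \<in> charts M \<Longrightarrow> vol_powr M \<rho> w i = superdomain.powf q (\<rho> i) w"
  by (simp add: vol_powr_def superdomain.powf_def[OF chart_domain])

text \<open>Take the \<open>w\<close>-th power of the transition law of \<open>\<rho>\<close>:
  powers are multiplicative by \<open>powf_mult\<close> and commute with the transition by
  \<open>\<phi>_powf\<close>.\<close>

lemma density_vol_powr:
  assumes \<rho>: "nondegenerate_volume M \<rho>" shows "vol_powr M \<rho> w \<in> densities M w"
  unfolding densities_iff
proof (intro conjI ballI allI impI)
  have \<rho>d: "\<rho> \<in> densities M 1" using \<rho> by (simp add: nondegenerate_volume_def)
  fix i assume i: "i \<in> charts M"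
  show "vol_powr M \<rho> w i \<in> Rc i"
    unfolding vol_powr_eq[OF i] by (rule superdomain.superfun_powf[OF chart_domain[OF i] pos_fun_volume[OF \<rho> i]])
  fix j assume j: "j \<in> charts M"
  interpret T: transition_map M i j "overlap M i j" by (rule overlap_map[OF i j])
  interpret Ci: superdomain p q "vdom M i" by (rule chart_domain[OF i])
  interpret Cj: superdomain p q "vdom M j" by (rule chart_domain[OF j])
  have r: "restr W (vol_powr M \<rho> w k) = superdomain.powf q (restr W (\<rho> k)) w" for W k
    by (auto simp: vol_powr_def T.I.powf_def restr_def fun_eq_iff)
  let ?r = "restr T.Vj (\<rho> j)"
  have rj: "T.J.pos_fun ?r"
    using pos_fun_volume[OF \<rho> j] restr_closed_j[OF i j, of "\<rho> j"] OL_subset(1)[of j i] OL_subset(2)[of j i]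
    by (auto simp: T.J.pos_fun_def Cj.pos_fun_def intro: homogeneous_restr)
  have "restr (OL i j) (\<rho> i) = T.SM.berf * T.\<phi> ?r"
    using densityD(3)[OF \<rho>d i j] bf_simps(5)[OF i j] by (simp add: change_eq)
  then have "restr (OL i j) (vol_powr M \<rho> w i) = T.I.powf (T.SM.berf * T.\<phi> ?r) w" using r by simp
  also have "\<dots> = bf i j w * T.\<phi> (T.J.powf ?r w)"
    using T.I.powf_mult[OF berf_pos(1)[OF i j] T.pos_fun_\<phi>[OF rj]] T.\<phi>_powf[OF rj] by simp
  finally show "restr (OL i j) (vol_powr M \<rho> w i) = bf i j w * change M i j (vol_powr M \<rho> w j)"
    unfolding change_eq r .
next
  fix i assume "i \<notin> charts M"
  then have "\<rho> i = 0" using \<rho> densityD(2) by (auto simp: nondegenerate_volume_def)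
  then show "vol_powr M \<rho> w i = 0" by (simp add: vol_powr_def fun_eq_iff)
qed

lemma vol_powr_mult:
  assumes \<rho>: "nondegenerate_volume M \<rho>" and s: "s \<in> densities M v"
  shows "s * vol_powr M \<rho> w * vol_powr M \<rho> (- w) = s"
proof (rule ext)
  fix i
  show "(s * vol_powr M \<rho> w * vol_powr M \<rho> (- w)) i = s i"
  proof (cases "i \<in> charts M")
    case True
    interpret Ci: superdomain p q "vdom M i" by (rule chart_domain[OF True])
    note f = pos_fun_volume[OF \<rho> True]
    have "vol_powr M \<rho> w i * vol_powr M \<rho> (- w) i = const_on (vdom M i) 1"
      unfolding vol_powr_eq[OF True] using Ci.powf_add[OF f, of w "- w"] Ci.powf_0[OF f] by simp
    then show ?thesis using Ci.superfun_one_mult(2)[OF densityD(1)[OF s True]] by (simp add: mult.assoc)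
  next
    case False
    then show ?thesis using densityD(2)[OF s] by simp
  qed
qed

lemma fam_homogeneous_vol_powr: "nondegenerate_volume M \<rho> \<Longrightarrow> fam_homogeneous 0 (vol_powr M \<rho> w)"
  unfolding fam_homogeneous_def
proof
  fix i assume \<rho>: "nondegenerate_volume M \<rho>"
  show "homogeneous 0 (vol_powr M \<rho> w i)"
  proof (cases "i \<in> charts M")
    case True
    interpret Ci: superdomain p q "vdom M i" by (rule chart_domain[OF True])
    show ?thesis unfolding vol_powr_eq[OF True] using Ci.pos_fun_powf[OF pos_fun_volume[OF \<rho> True]] by (simp add: Ci.pos_fun_def)
  next
    case False
    then show ?thesis using density_vol_powr[OF \<rho>] densityD(2) by (metis homogeneous_0)
  qed
qed

end

section \<open>Local form of the odd Laplace operator\<close>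

lemma foldr_closed: "(\<And>a f. f \<in> A \<Longrightarrow> F a f \<in> A) \<Longrightarrow> s \<in> A \<Longrightarrow> foldr F as s \<in> A"
  by (induction as) auto

context superdomain
begin

definition multi_indices :: "nat \<Rightarrow> nat list set" where
  "multi_indices N = {as. set as \<subseteq> {..<p + q} \<and> length as \<le> N}"

text \<open>The condition of \<open>diff_operator\<close> in a single chart, isolated so that
  operators can be assembled from multiplications and derivatives.\<close>

definition local_operator :: "nat \<Rightarrow> (sfun \<Rightarrow> sfun) \<Rightarrow> bool" where
  "local_operator N F \<longleftrightarrow> (\<exists>c. (\<forall>as. c as \<in> R) \<and> (\<forall>s\<in>R. F s = (\<Sum>as\<in>multi_indices N. c as * foldr D as s)))"

lemma finite_multi_indices: "finite (multi_indices N)"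
  unfolding multi_indices_def by (rule finite_lists_length_le) simp

lemma local_operatorI:
  "(\<And>as. c as \<in> R) \<Longrightarrow> (\<And>s. s \<in> R \<Longrightarrow> F s = (\<Sum>as\<in>multi_indices N. c as * foldr D as s)) \<Longrightarrow> local_operator N F"
  unfolding local_operator_def by blast

lemma superfun_foldr: "s \<in> R \<Longrightarrow> foldr D as s \<in> R"
  by (rule foldr_closed) auto

lemma local_operator_mult:
  assumes "local_operator N F" "h \<in> R" shows "local_operator N (\<lambda>s. h * F s)"
proof -
  obtain c where "\<forall>as. c as \<in> R" "\<forall>s\<in>R. F s = (\<Sum>as\<in>multi_indices N. c as * foldr D as s)"
    using assms(1) unfolding local_operator_def by blast
  then show ?thesis using assms(2)
    by (intro local_operatorI[of "\<lambda>as. h * c as"]) (simp_all add: sum_distrib_left mult.assoc)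
qed

lemma local_operator_const: "h \<in> R \<Longrightarrow> local_operator 0 (\<lambda>s. h * s)"
proof (rule local_operatorI[of "\<lambda>as. h"])
  have "multi_indices 0 = {[]}" by (auto simp: multi_indices_def)
  then show "h * s = (\<Sum>as\<in>multi_indices 0. h * foldr D as s)" for s by simp
qed simp

lemma local_operator_add:
  assumes "local_operator N F" "local_operator N G" shows "local_operator N (\<lambda>s. F s + G s)"
proof -
  obtain c d where "\<forall>as. c as \<in> R" "\<forall>s\<in>R. F s = (\<Sum>as\<in>multi_indices N. c as * foldr D as s)"
    "\<forall>as. d as \<in> R" "\<forall>s\<in>R. G s = (\<Sum>as\<in>multi_indices N. d as * foldr D as s)"
    using assms unfolding local_operator_def by blast
  then show ?thesis
    by (intro local_operatorI[of "\<lambda>as. c as + d as"]) (simp_all add: distrib_right sum.distrib)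
qed

lemma local_operator_mono:
  assumes "local_operator N F" "N \<le> N'" shows "local_operator N' F"
proof -
  obtain c where c: "\<forall>as. c as \<in> R" "\<forall>s\<in>R. F s = (\<Sum>as\<in>multi_indices N. c as * foldr D as s)"
    using assms(1) unfolding local_operator_def by blast
  show ?thesis
  proof (rule local_operatorI[of "\<lambda>as. if length as \<le> N then c as else 0"])
    fix s assume "s \<in> R"
    then have "F s = (\<Sum>as\<in>multi_indices N. c as * foldr D as s)" using c by blast
    also have "\<dots> = (\<Sum>as\<in>multi_indices N'. (if length as \<le> N then c as else 0) * foldr D as s)"
      using finite_multi_indices assms(2)
      by (intro sum.mono_neutral_cong_left) (auto simp: multi_indices_def)
    finally show "F s = \<dots>" .
  qed (use c in simp)
qed

lemma local_operator_0: "local_operator N (\<lambda>s. 0)"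
  by (rule local_operatorI[of "\<lambda>as. 0"]) auto

lemma local_operator_sum:
  assumes "finite A" "\<And>a. a \<in> A \<Longrightarrow> local_operator N (F a)"
  shows "local_operator N (\<lambda>s. \<Sum>a\<in>A. F a s)"
  using assms by (induction A) (simp_all add: local_operator_0 local_operator_add)

lemma local_operator_D:
  assumes "local_operator N F" and a: "a < p + q" shows "local_operator (Suc N) (\<lambda>s. D a (F s))"
proof -
  obtain c where c: "\<And>as. c as \<in> R" "\<And>s. s \<in> R \<Longrightarrow> F s = (\<Sum>as\<in>multi_indices N. c as * foldr D as s)"
    using assms(1) unfolding local_operator_def by blast
  \<comment> \<open>By the Leibniz rule, \<open>?c1\<close> differentiates the coefficient and keeps
    the multi-index, while \<open>?c2\<close> prefixes \<open>a\<close> and keeps the coefficient up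
    to conjugation.\<close>
  let ?c1 = "\<lambda>as. if length as \<le> N then D a (c as) else 0"
  let ?c2 = "\<lambda>as. if as \<noteq> [] \<and> hd as = a then sconj (cpar p a) (c (tl as)) else 0"
  show ?thesis
  proof (rule local_operatorI[of "\<lambda>as. ?c1 as + ?c2 as"])
    fix s assume s: "s \<in> R"
    have "D a (F s) = (\<Sum>as\<in>multi_indices N. D a (c as) * foldr D as s)
        + (\<Sum>as\<in>multi_indices N. sconj (cpar p a) (c as) * foldr D (a # as) s)"
      unfolding c(2)[OF s] using c(1) superfun_foldr[OF s] by (simp add: pd_sum pd_mult sum.distrib)
    also have "(\<Sum>as\<in>multi_indices N. D a (c as) * foldr D as s) = (\<Sum>as\<in>multi_indices (Suc N). ?c1 as * foldr D as s)"
      using finite_multi_indices by (intro sum.mono_neutral_cong_left) (auto simp: multi_indices_def)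
    also have "(\<Sum>as\<in>multi_indices N. sconj (cpar p a) (c as) * foldr D (a # as) s)
        = (\<Sum>as\<in>(#) a ` multi_indices N. ?c2 as * foldr D as s)"
      by (subst sum.reindex) (auto simp: inj_on_def)
    also have "\<dots> = (\<Sum>as\<in>multi_indices (Suc N). ?c2 as * foldr D as s)"
    proof (rule sum.mono_neutral_left[OF finite_multi_indices])
      show "(#) a ` multi_indices N \<subseteq> multi_indices (Suc N)" using a by (auto simp: multi_indices_def)
      show "\<forall>as\<in>multi_indices (Suc N) - (#) a ` multi_indices N. ?c2 as * foldr D as s = 0"
      proof
        fix as assume as: "as \<in> multi_indices (Suc N) - (#) a ` multi_indices N"
        have "\<not> (as \<noteq> [] \<and> hd as = a)"
        proof
          assume "as \<noteq> [] \<and> hd as = a"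
          then have "as = a # tl as" by auto
          moreover have "tl as \<in> multi_indices N" using as by (cases as) (auto simp: multi_indices_def)
          ultimately show False using as by blast
        qed
        then show "?c2 as * foldr D as s = 0" by (simp only: if_False mult_zero_left)
      qed
    qed
    finally show "D a (F s) = (\<Sum>as\<in>multi_indices (Suc N). (?c1 as + ?c2 as) * foldr D as s)"
      by (simp only: distrib_right sum.distrib)
  qed (use c(1) in simp)
qed

end

section \<open>Leibniz rules for the Laplace operator and the Lie derivative in one chart\<close>

locale local_poisson = superdomain +
  fixes S :: "nat \<Rightarrow> nat \<Rightarrow> sfun" and \<rho> :: sfun
  assumes SR [simp]: "a < p + q \<Longrightarrow> b < p + q \<Longrightarrow> S a b \<in> R"
    and Sh: "a < p + q \<Longrightarrow> b < p + q \<Longrightarrow> homogeneous (cpar p a + cpar p b + 1) (S a b)"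
    and Ssym: "a < p + q \<Longrightarrow> b < p + q \<Longrightarrow> S a b = (-1) ^ (cpar p a * cpar p b) * S b a"
    and \<rho>: "pos_fun \<rho>"
begin

lemma \<rho>_facts [simp]: "\<rho> \<in> R" "homogeneous 0 \<rho>" and \<rho>_body: "x \<in> V \<Longrightarrow> gr_body (\<rho> x) \<noteq> 0"
  using \<rho> by (auto simp: pos_fun_def)

lemma \<rho>_inv: "sinv V \<rho> \<in> R" "homogeneous 0 (sinv V \<rho>)" "sinv V \<rho> * \<rho> = const_on V 1" "\<rho> * sinv V \<rho> = const_on V 1"
  using superfun_inverse[OF \<rho>_facts(1) \<rho>_body] homogeneous_sinv[OF \<rho>_facts(1) \<rho>_body \<rho>_facts(2)]
    superfun_inverse_mult[OF \<rho>_facts(1) \<rho>_body] by blast+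

definition G :: "sfun \<Rightarrow> nat \<Rightarrow> sfun" where
  "G f a = (\<Sum>b<p + q. S a b * D b f)"

definition X :: "nat \<Rightarrow> sfun \<Rightarrow> nat \<Rightarrow> sfun" where
  "X e f a = (-1) ^ (cpar p a * e) * G f a"

text \<open>The sign in the Hamiltonian field cancels the one in the divergence (see
  \<open>sdiv_X\<close>), so this form of the odd Laplacian mentions no parity and is additive on
  inhomogeneous functions.\<close>

definition L :: "sfun \<Rightarrow> sfun" where
  "L f = sinv V \<rho> * (\<Sum>a<p + q. D a (\<rho> * G f a))"

lemma G_closed [simp]: "a < p + q \<Longrightarrow> f \<in> R \<Longrightarrow> G f a \<in> R"
  unfolding G_def by (intro superfun_sum) simp

lemma G_homogeneous: "a < p + q \<Longrightarrow> homogeneous e f \<Longrightarrow> homogeneous (cpar p a + (e + 1)) (G f a)"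
  unfolding G_def
proof (rule homogeneous_sum)
  fix b assume a: "a < p + q" and f: "homogeneous e f" and b: "b \<in> {..<p + q}"
  have "homogeneous (cpar p a + cpar p b + 1 + (e + cpar p b)) (S a b * D b f)"
    using a b by (intro homogeneous_mult Sh homogeneous_pd f) auto
  then show "homogeneous (cpar p a + (e + 1)) (S a b * D b f)" by (rule homogeneous_cong[rotated]) auto
qed

lemma X_closed [simp]: "a < p + q \<Longrightarrow> f \<in> R \<Longrightarrow> X e f a \<in> R"
  by (simp add: X_def)

lemma X_homogeneous: "a < p + q \<Longrightarrow> homogeneous e f \<Longrightarrow> homogeneous (cpar p a + (e + 1)) (X e f a)"
  unfolding X_def by (intro homogeneous_neg1 G_homogeneous)

lemma L_closed [simp]: "f \<in> R \<Longrightarrow> L f \<in> R"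
  unfolding L_def by (intro superfun_mult \<rho>_inv superfun_sum superfun_pd) auto

lemma L_homogeneous: "homogeneous e f \<Longrightarrow> homogeneous (e + 1) (L f)"
proof -
  assume f: "homogeneous e f"
  have "homogeneous (e + 1) (D a (\<rho> * G f a))" if "a < p + q" for a
    using homogeneous_pd[OF homogeneous_mult[OF \<rho>_facts(2) G_homogeneous[OF that f]], of p a V]
    by (rule homogeneous_cong[rotated]) auto
  then have "homogeneous (0 + (e + 1)) (L f)"
    unfolding L_def by (intro homogeneous_mult \<rho>_inv homogeneous_sum) simp
  then show ?thesis by simp
qed

lemma sdiv_X: "f \<in> R \<Longrightarrow> sdiv \<rho> (e + 1) (X e f) = L f"
proof -
  assume f: "f \<in> R"
  have "(-1) ^ (cpar p a * (e + 1 + 1)) * D a (\<rho> * X e f a) = D a (\<rho> * G f a)" if "a < p + q" for a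
  proof -
    have "(-1) ^ (cpar p a * (e + 1 + 1)) * D a (\<rho> * X e f a)
      = (-1) ^ (cpar p a * (e + 1 + 1)) * ((-1) ^ (cpar p a * e) * D a (\<rho> * G f a))"
      unfolding X_def neg1_commute(2)[of \<rho>] using that f by (subst pd_neg1) auto
    also have "\<dots> = (-1) ^ 0 * D a (\<rho> * G f a)" by (rule neg1_merge) auto
    finally show ?thesis by simp
  qed
  then show ?thesis unfolding sdiv_def L_def by simp
qed

lemma L_add: "f \<in> R \<Longrightarrow> g \<in> R \<Longrightarrow> L (f + g) = L f + L g"
proof -
  assume f: "f \<in> R" and g: "g \<in> R"
  have G: "G (f + g) a = G f a + G g a" for a
    using f g by (simp add: G_def pd_add distrib_left sum.distrib)
  have "(\<Sum>a<p + q. D a (\<rho> * G (f + g) a)) = (\<Sum>a<p + q. D a (\<rho> * G f a) + D a (\<rho> * G g a))"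
    using f g by (intro sum.cong refl) (simp add: G distrib_left pd_add)
  then show ?thesis by (simp only: L_def sum.distrib distrib_left)
qed

lemma G_mult:
  assumes f: "f \<in> R" "homogeneous e f" and g: "g \<in> R" and a: "a < p + q"
  shows "G (f * g) a = G f a * g + (-1) ^ (e * (cpar p a + 1)) * (f * G g a)"
proof -
  have "S a b * D b (f * g) = S a b * D b f * g + (-1) ^ (e * (cpar p a + 1)) * (f * (S a b * D b g))"
    if b: "b < p + q" for b
  proof -
    have "S a b * f = (-1) ^ ((cpar p a + cpar p b + 1) * e) * (f * S a b)"
      by (rule sfun_commute[OF Sh[OF a b] f(2)])
    then have "(-1) ^ (cpar p b * e) * (S a b * f) = (-1) ^ (cpar p b * e) * ((-1) ^ ((cpar p a + cpar p b + 1) * e) * (f * S a b))"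
      by simp
    also have "\<dots> = (-1) ^ (e * (cpar p a + 1)) * (f * S a b)" by (rule neg1_merge) auto
    finally have "(-1) ^ (cpar p b * e) * (S a b * (f * D b g)) = (-1) ^ (e * (cpar p a + 1)) * (f * (S a b * D b g))"
      by (simp only: mult.assoc[symmetric])
    then show ?thesis
      unfolding pd_mult_homogeneous[OF f(1) g f(2)] distrib_left neg1_commute(2)[of "S a b"] by (simp only: mult.assoc)
  qed
  then have "G (f * g) a = (\<Sum>b<p + q. S a b * D b f * g + (-1) ^ (e * (cpar p a + 1)) * (f * (S a b * D b g)))"
    unfolding G_def by (intro sum.cong refl) simp
  then show ?thesis by (simp only: G_def sum.distrib sum_distrib_left sum_distrib_right)
qed

text \<open>By the symmetry of \<open>S\<close>, the bracket obtained by differentiating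
  \<open>f\<close> in front of the gradient of \<open>g\<close> equals the one given by the
  Hamiltonian field of \<open>f\<close>. This is the origin of the factor 2.\<close>

lemma bracket_swap:
  assumes f: "f \<in> R" "homogeneous e f" and g: "g \<in> R"
  shows "(\<Sum>a<p + q. (-1) ^ (e * (cpar p a + 1)) * (D a f * G g a)) = (\<Sum>a<p + q. X e f a * D a g)"
proof -
  have tm: "(-1) ^ (e * (cpar p a + 1)) * (D a f * (S a b * D b g)) = (-1) ^ (cpar p b * e) * (S b a * D a f * D b g)"
    if a: "a < p + q" and b: "b < p + q" for a b
  proof -
    have "D a f * S a b = (-1) ^ ((e + cpar p a) * (cpar p a + cpar p b + 1)) * (S a b * D a f)"
      by (rule sfun_commute[OF homogeneous_pd[OF f(2)] Sh[OF a b]])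
    also have "S a b * D a f = (-1) ^ (cpar p a * cpar p b) * (S b a * D a f)"
      by (subst Ssym[OF a b]) (simp only: mult.assoc)
    finally have "(-1) ^ (e * (cpar p a + 1)) * (D a f * S a b) = (-1) ^ (e * (cpar p a + 1))
        * ((-1) ^ ((e + cpar p a) * (cpar p a + cpar p b + 1)) * ((-1) ^ (cpar p a * cpar p b) * (S b a * D a f)))"
      by (simp only:)
    also have "\<dots> = (-1) ^ (cpar p b * e) * (S b a * D a f)"
      unfolding mult.assoc[symmetric] power_add[symmetric] unfolding mult.assoc by (rule neg1_cong) auto
    finally show ?thesis by (simp only: mult.assoc[symmetric])
  qed
  have "(\<Sum>a<p + q. (-1) ^ (e * (cpar p a + 1)) * (D a f * G g a))
    = (\<Sum>a<p + q. \<Sum>b<p + q. (-1) ^ (cpar p b * e) * (S b a * D a f * D b g))"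
    unfolding G_def sum_distrib_left by (intro sum.cong refl tm) auto
  also have "\<dots> = (\<Sum>b<p + q. \<Sum>a<p + q. (-1) ^ (cpar p b * e) * (S b a * D a f * D b g))" by (rule sum.swap)
  also have "\<dots> = (\<Sum>b<p + q. X e f b * D b g)"
    unfolding X_def G_def sum_distrib_left sum_distrib_right by (simp only: mult.assoc)
  finally show ?thesis .
qed

text \<open>The cross term arises twice: once when the outer derivative hits \<open>g\<close> behind
  the gradient of \<open>f\<close>, and once when it hits \<open>f\<close> in front of the gradient
  of \<open>g\<close>. By \<open>bracket_swap\<close> the two are equal.\<close>

theorem L_mult:
  assumes f: "f \<in> R" "homogeneous e f" and g: "g \<in> R"
  shows "L (f * g) = L f * g + (-1) ^ e * (f * L g) + 2 * (\<Sum>a<p + q. X e f a * D a g)"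
proof -
  have tm: "D a (\<rho> * G (f * g) a) = D a (\<rho> * G f a) * g + \<rho> * (X e f a * D a g)
      + \<rho> * ((-1) ^ (e * (cpar p a + 1)) * (D a f * G g a)) + (-1) ^ e * (f * D a (\<rho> * G g a))"
    if a: "a < p + q" for a
  proof -
    have Gh: "homogeneous (cpar p a + (e + 1)) (\<rho> * G f a)"
      using homogeneous_mult[OF \<rho>_facts(2) G_homogeneous[OF a f(2)]] by simp
    have R: "\<rho> * G f a \<in> R" "\<rho> * G g a \<in> R" "f * (\<rho> * G g a) \<in> R" using a f g by simp_all
    have \<rho>f: "\<rho> * (f * z) = f * (\<rho> * z)" for z
      using sfun_even_commute[OF \<rho>_facts(2), of f] by (simp only: mult.assoc[symmetric])
    have "\<rho> * G (f * g) a = \<rho> * G f a * g + (-1) ^ (e * (cpar p a + 1)) * (f * (\<rho> * G g a))"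
      unfolding G_mult[OF f g a] distrib_left neg1_commute(2)[of \<rho>] \<rho>f by (simp only: mult.assoc)
    then have "D a (\<rho> * G (f * g) a) = D a (\<rho> * G f a * g) + (-1) ^ (e * (cpar p a + 1)) * D a (f * (\<rho> * G g a))"
      using R g by (simp add: pd_add pd_neg1)
    moreover have "D a (\<rho> * G f a * g) = D a (\<rho> * G f a) * g + \<rho> * (X e f a * D a g)"
    proof -
      have "(-1) ^ (cpar p a * (cpar p a + (e + 1))) * (\<rho> * G f a * D a g) = (-1) ^ (cpar p a * e) * (\<rho> * G f a * D a g)"
        by (rule neg1_cong) auto
      also have "\<dots> = \<rho> * (X e f a * D a g)" by (simp only: X_def mult.assoc neg1_commute(2)[of \<rho>])
      finally show ?thesis unfolding pd_mult_homogeneous[OF R(1) g Gh] by simp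
    qed
    moreover have "(-1) ^ (e * (cpar p a + 1)) * D a (f * (\<rho> * G g a))
      = \<rho> * ((-1) ^ (e * (cpar p a + 1)) * (D a f * G g a)) + (-1) ^ e * (f * D a (\<rho> * G g a))"
    proof -
      have "D a f * (\<rho> * G g a) = \<rho> * (D a f * G g a)"
        using sfun_even_commute[OF \<rho>_facts(2), of "D a f"] by (simp only: mult.assoc[symmetric])
      moreover have "(-1) ^ (e * (cpar p a + 1)) * ((-1) ^ (cpar p a * e) * (f * D a (\<rho> * G g a))) = (-1) ^ e * (f * D a (\<rho> * G g a))"
        by (rule neg1_merge) auto
      ultimately show ?thesis
        unfolding pd_mult_homogeneous[OF f(1) R(2) f(2)] distrib_left
        by (simp only: neg1_commute(2)[of \<rho>])
    qed
    ultimately show ?thesis by (simp only: add.assoc)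
  qed
  let ?B = "\<Sum>a<p + q. X e f a * D a g"
  have BR: "?B \<in> R" using f g by (intro superfun_sum) simp
  have "(\<Sum>a<p + q. D a (\<rho> * G (f * g) a)) = (\<Sum>a<p + q. D a (\<rho> * G f a) * g + \<rho> * (X e f a * D a g)
      + \<rho> * ((-1) ^ (e * (cpar p a + 1)) * (D a f * G g a)) + (-1) ^ e * (f * D a (\<rho> * G g a)))"
    by (intro sum.cong refl tm) simp
  also have "\<dots> = (\<Sum>a<p + q. D a (\<rho> * G f a)) * g + \<rho> * ?B + \<rho> * ?B + (-1) ^ e * (f * (\<Sum>a<p + q. D a (\<rho> * G g a)))"
    unfolding bracket_swap[OF f g, symmetric]
    by (simp only: bracket_swap[OF f g] sum.distrib sum_distrib_left sum_distrib_right)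
      (simp only: sum_distrib_left[symmetric] bracket_swap[OF f g])
  finally have "L (f * g) = sinv V \<rho> * ((\<Sum>a<p + q. D a (\<rho> * G f a)) * g) + sinv V \<rho> * \<rho> * ?B + sinv V \<rho> * \<rho> * ?B
      + sinv V \<rho> * ((-1) ^ e * (f * (\<Sum>a<p + q. D a (\<rho> * G g a))))"
    unfolding L_def by (simp only: distrib_left mult.assoc)
  also have "sinv V \<rho> * ((-1) ^ e * (f * (\<Sum>a<p + q. D a (\<rho> * G g a)))) = (-1) ^ e * (f * L g)"
    using sfun_even_commute[OF \<rho>_inv(2), of f] unfolding L_def neg1_commute(2)[of "sinv V \<rho>"]
    by (simp only: mult.assoc[symmetric])
  finally show ?thesis
    unfolding \<rho>_inv(3) superfun_one_mult(1)[OF BR] unfolding L_def[of f] by (simp only: mult_2 mult.assoc add_ac)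
qed

text \<open>The Lie derivative uses the coordinate volume. Differentiating the power of
  \<open>\<rho>\<close> adds \<open>w\<close> times the derivative of the logarithm of
  \<open>\<rho>\<close> along the field, which completes the coordinate divergence to the divergence
  with respect to \<open>\<rho>\<close>, that is, to \<open>L f\<close>.\<close>

theorem lie_powf:
  assumes f: "f \<in> R" "homogeneous e f" and u: "u \<in> R"
  shows "(\<Sum>a<p + q. X e f a * D a (u * powf \<rho> w)) + smul w (sdiv (const_on V 1) (e + 1) (X e f)) * (u * powf \<rho> w)
    = ((\<Sum>a<p + q. X e f a * D a u) + smul w (L f) * u) * powf \<rho> w"
proof -
  let ?P = "powf \<rho> w" and ?i = "sinv V \<rho>"
  let ?d = "\<Sum>a<p + q. (-1) ^ (cpar p a * (e + 1 + 1)) * D a (X e f a)"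
  have one: "const_on V 1 \<in> R" "homogeneous 0 (const_on V 1)" "x \<in> V \<Longrightarrow> gr_body (const_on V 1 x) \<noteq> 0" for x
    by (simp_all add: homogeneous_const_on)
  have d1: "sdiv (const_on V 1) (e + 1) (X e f) = ?d"
  proof -
    have "sdiv (const_on V 1) (e + 1) (X e f) = ?d + sinv V (const_on V 1) * (\<Sum>a<p + q. X e f a * D a (const_on V 1))"
      by (rule div_expand) (use one f X_homogeneous in auto)
    then show ?thesis by (simp add: pd_one)
  qed
  have d2: "L f = ?d + ?i * (\<Sum>a<p + q. X e f a * D a \<rho>)"
    unfolding sdiv_X[OF f(1), of e, symmetric] by (rule div_expand) (use \<rho>_body f X_homogeneous in auto)
  have PR: "?P \<in> R" and Ph: "homogeneous 0 ?P" using pos_fun_powf[OF \<rho>, of w] by (auto simp: pos_fun_def)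
  have Pm: "powf \<rho> (w - 1) = ?P * ?i"
  proof -
    have "?P * ?i = powf \<rho> (w - 1) * powf \<rho> 1 * ?i" unfolding powf_add[OF \<rho>] by simp
    also have "\<dots> = powf \<rho> (w - 1)"
      unfolding powf_1[OF \<rho>] mult.assoc \<rho>_inv(4) by (rule superfun_one_mult(2)) (use \<rho> in simp)
    finally show ?thesis by simp
  qed
  have Pc: "?P * z = z * ?P" for z by (rule sfun_even_commute[OF Ph])
  have sm: "smul w (x * y) = x * smul w y" "smul w (x * y) = smul w x * y" "smul w (x + y) = smul w x + smul w y" for x y
    by (simp_all add: smul_def fun_eq_iff scaleR_right_distrib)
  have tm: "X e f a * D a (u * ?P) = ?P * (X e f a * D a u) + ?P * (smul w (?i * (X e f a * D a \<rho>)) * u)" for a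
  proof -
    have "D a (u * ?P) = smul w (?P * ?i * D a \<rho>) * u + ?P * D a u"
      unfolding Pc[of u, symmetric] pd_mult_even[OF PR u Ph] pd_powf[OF \<rho>] Pm ..
    moreover have "X e f a * (smul w (?P * ?i * D a \<rho>) * u) = ?P * (smul w (?i * (X e f a * D a \<rho>)) * u)"
    proof -
      have "X e f a * (?P * ?i * D a \<rho>) = ?P * (?i * (X e f a * D a \<rho>))"
      proof -
        have lc: "x * (z * y) = z * (x * y)" if "homogeneous 0 z" for x y z :: sfun
          using sfun_even_commute[OF that, of x] by (simp only: mult.assoc[symmetric])
        show ?thesis unfolding mult.assoc lc[OF Ph, of "X e f a"] lc[OF \<rho>_inv(2), of "X e f a"] ..
      qed
      then show ?thesis by (simp only: mult.assoc[symmetric] sm(1)[symmetric])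
    qed
    moreover have "X e f a * (?P * D a u) = ?P * (X e f a * D a u)"
      using Pc[of "X e f a"] by (simp only: mult.assoc[symmetric])
    ultimately show ?thesis by (simp only: distrib_left add.commute)
  qed
  have "(\<Sum>a<p + q. X e f a * D a (u * ?P)) = ?P * ((\<Sum>a<p + q. X e f a * D a u) + smul w (?i * (\<Sum>a<p + q. X e f a * D a \<rho>)) * u)"
  proof -
    have "smul w (?i * (\<Sum>a<p + q. X e f a * D a \<rho>)) = (\<Sum>a<p + q. smul w (?i * (X e f a * D a \<rho>)))"
      by (simp add: smul_def fun_eq_iff sum_fun_apply sum_distrib_left scaleR_sum_right)
    then show ?thesis unfolding tm by (simp only: sum.distrib sum_distrib_left sum_distrib_right distrib_left)
  qed
  moreover have "smul w ?d * (u * ?P) = ?P * (smul w ?d * u)" using Pc[of "smul w ?d * u"] by (simp only: mult.assoc)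
  ultimately show ?thesis unfolding d1 unfolding d2 sm(3) Pc[symmetric]
    by (simp only: distrib_left distrib_right add_ac)
qed

lemma local_operator_L: 
  assumes "h \<in> R" "k \<in> R" shows "local_operator 2 (\<lambda>s. k * L (h * s))"
proof -
  have "local_operator (Suc (Suc 0)) (\<lambda>s. k * (sinv V \<rho> * (\<Sum>a<p + q. D a (\<rho> * (\<Sum>b<p + q. S a b * D b (h * s))))))"
    by (intro local_operator_mult local_operator_sum local_operator_D local_operator_const assms \<rho>_inv \<rho>_facts) auto
  then show ?thesis by (simp add: L_def G_def numeral_2_eq_2)
qed

end

section \<open>Operators on half-densities\<close>

lemma (in superdomain) sdiv_restr:
  assumes "open_dom p U" "U \<subseteq> V"
  shows "restr U (sdiv \<rho> e X) = superdomain.sdiv p q U (restr U \<rho>) e (\<lambda>a. restr U (X a))"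
proof -
  interpret U: superdomain p q U by unfold_locales (rule assms)
  have "restr U (sinv V \<rho>) = sinv U (restr U \<rho>)" using assms(2) by (auto simp: sinv_def restr_def fun_eq_iff)
  moreover have t: "restr U (D a (\<rho> * X a)) = U.D a (restr U \<rho> * restr U (X a))" for a
    using pd_restr[OF assms, of a "\<rho> * X a"] by (simp add: restr_simps)
  have "restr U (\<Sum>a<p + q. (-1) ^ (cpar p a * (e + 1)) * D a (\<rho> * X a))
      = (\<Sum>a<p + q. (-1) ^ (cpar p a * (e + 1)) * U.D a (restr U \<rho> * restr U (X a)))"
    unfolding restr_sum restr_simps(7) t ..
  ultimately show ?thesis unfolding sdiv_def U.sdiv_def by (simp only: restr_simps(2))
qed

section \<open>Chart independence of the odd Laplacian\<close>

locale poisson = smfd +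
  fixes S :: "'b \<Rightarrow> nat \<Rightarrow> nat \<Rightarrow> sfun"
  assumes S: "odd_poisson M S"
begin

lemma local_poisson:
  assumes nv: "nondegenerate_volume M \<rho>" and i: "i \<in> charts M"
  shows "local_poisson p q (vdom M i) (S i) (\<rho> i)"
proof -
  interpret superdomain p q "vdom M i" by (rule chart_domain[OF i])
  note s = S[unfolded odd_poisson_def sfuns_chart cdim_eq, THEN conjunct1, rule_format, OF i]
  show ?thesis by unfold_locales (use s pos_fun_volume[OF nv i] in blast)+
qed

lemma S_change:
  assumes "i \<in> charts M" "j \<in> charts M" "c < p + q" "d < p + q"
  shows "change M i j (S j c d) = (\<Sum>a<p + q. \<Sum>b<p + q. (-1) ^ (par M d * (par M a + par M c)) *
             S i a b * jacobian M i j b d * jacobian M i j a c)"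
  using S[unfolded odd_poisson_def cdim_eq, THEN conjunct2, THEN conjunct1, rule_format, OF assms] .

lemma smoothD:
  assumes "f \<in> smooth_functions M"
  shows "i \<in> charts M \<Longrightarrow> f i \<in> Rc i" "i \<notin> charts M \<Longrightarrow> f i = 0"
    "i \<in> charts M \<Longrightarrow> j \<in> charts M \<Longrightarrow> restr (OL i j) (f i) = change M i j (f j)"
  using assms unfolding smooth_functions_def local_family_def sfuns_chart by blast+

lemma smoothI:
  assumes "\<And>i. i \<in> charts M \<Longrightarrow> f i \<in> Rc i" "\<And>i. i \<notin> charts M \<Longrightarrow> f i = 0"
    "\<And>i j. i \<in> charts M \<Longrightarrow> j \<in> charts M \<Longrightarrow> restr (OL i j) (f i) = change M i j (f j)"
  shows "f \<in> smooth_functions M"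
  using assms unfolding smooth_functions_def local_family_def sfuns_chart by blast

lemma divergence_eq:
  assumes i: "i \<in> charts M" shows "divergence M i r e X = superdomain.sdiv p q (vdom M i) r e X"
proof (rule ext)
  fix x
  interpret superdomain p q "vdom M i" by (rule chart_domain[OF i])
  show "divergence M i r e X x = sdiv r e X x"
    by (cases "x \<in> vdom M i")
      (simp_all add: divergence_def sdiv_def cdim_eq sinv_def sum_fun_apply pd_outside)
qed

lemma ham_field_eq:
  assumes "nondegenerate_volume M \<rho>" "i \<in> charts M"
  shows "ham_field M S e f i = local_poisson.X p q (vdom M i) (S i) e (f i)"
proof (rule ext)
  fix a
  interpret local_poisson p q "vdom M i" "S i" "\<rho> i" by (rule local_poisson[OF assms])
  show "ham_field M S e f i a = X e (f i) a" by (simp add: ham_field_def X_def G_def cdim_eq)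
qed

lemma fam_part_closed: "i \<in> charts M \<Longrightarrow> f i \<in> Rc i \<Longrightarrow> fam_part e f i \<in> Rc i"
  using superdomain.superfun_part[OF chart_domain] by (simp add: fam_part_def)

lemma odd_laplace_eq:
  assumes nv: "nondegenerate_volume M \<rho>" and i: "i \<in> charts M" and f: "f i \<in> Rc i"
  shows "odd_laplace M S \<rho> f i = local_poisson.L p q (vdom M i) (S i) (\<rho> i) (f i)"
proof -
  interpret local_poisson p q "vdom M i" "S i" "\<rho> i" by (rule local_poisson[OF nv i])
  have "divergence M i (\<rho> i) (e + 1) (ham_field M S e (fam_part e f) i) = L (fam_part e f i)" for e
    unfolding divergence_eq[OF i] ham_field_eq[OF nv i] by (rule sdiv_X[OF fam_part_closed[of i f, OF i f]])
  then have "odd_laplace M S \<rho> f i = L (fam_part 0 f i) + L (fam_part 1 f i)"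
    using i by (simp add: odd_laplace_def numeral_2_eq_2)
  also have "\<dots> = L (fam_part 0 f i + fam_part 1 f i)" using L_add[OF fam_part_closed[of i f, OF i f] fam_part_closed[of i f, OF i f]] by simp
  also have "fam_part 0 f i + fam_part 1 f i = f i" using fam_part_sum[of f] by (metis plus_fun_apply)
  finally show ?thesis .
qed

text \<open>Combine the transformation law of \<open>S\<close> with the chain rule for
  \<open>f\<close>; moving the derivative of \<open>f\<close> past a Jacobian entry converts the
  sign for \<open>c\<close> into the sign for \<open>a\<close>.\<close>

lemma ham_field_transform:
  assumes nv: "nondegenerate_volume M \<rho>" and ij: "i \<in> charts M" "j \<in> charts M"
    and f: "f \<in> smooth_functions M" "fam_homogeneous e f" and c: "c < p + q"
  shows "change M i j (ham_field M S e f j c) = (\<Sum>a<p + q. restr (OL i j) (ham_field M S e f i a) * jacobian M i j a c)"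
proof -
  interpret T: transition_map M i j "overlap M i j" by (rule overlap_map[OF ij])
  interpret Ci: local_poisson p q "vdom M i" "S i" "\<rho> i" by (rule local_poisson[OF nv ij(1)])
  interpret Cj: local_poisson p q "vdom M j" "S j" "\<rho> j" by (rule local_poisson[OF nv ij(2)])
  have sub: "T.Vi \<subseteq> vdom M i" "T.Vj \<subseteq> vdom M j" by (auto simp: img_def vdom_def overlap_def)
  let ?f = "restr T.Vj (f j)" and ?g = "restr T.Vi (f i)"
  let ?F = "\<lambda>d. T.\<phi> (T.J.D d ?f)" and ?S = "\<lambda>a b. restr T.Vi (S i a b)"
  have fR: "?f \<in> T.J.R" by (rule restr_closed_j[OF ij smoothD(1)[OF f(1) ij(2)]])
  have g: "?g = T.\<phi> ?f" using smoothD(3)[OF f(1) ij] by (simp add: change_eq)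
  have Fh: "homogeneous (e + par M d) (?F d)" for d
    using f(2) fR by (intro T.\<phi>_homogeneous homogeneous_pd homogeneous_restr) (auto simp: fam_homogeneous_def)
  have J: "jacobian M i j a b = T.Jac a b" for a b by (rule jacobian_eq[OF ij])
  have out: "S i a b * T.Jac b' d = ?S a b * T.Jac b' d" if "d < p + q" for a b b' d
    using T.I.superfun_outside[OF T.Jac_closed[OF that]] by (intro ext) (simp add: restr_def)
  have X: "ham_field M S e f k = local_poisson.X p q (vdom M k) (S k) e (f k)" if "k \<in> charts M" for k
    by (rule ham_field_eq[OF nv that])
  have neg: "restr W ((-1) ^ n * h) = (-1) ^ n * restr W h" for W n h by (rule restr_simps)
  have tm: "(-1) ^ (par M c * e) * ((-1) ^ (par M d * (par M a + par M c)) * ?S a b * T.Jac b d * T.Jac a c * ?F d)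
      = (-1) ^ (par M a * e) * (?S a b * (T.Jac b d * ?F d)) * T.Jac a c"
    if a: "a < p + q" and b: "b < p + q" and d: "d < p + q" for a b d
  proof -
    have "T.Jac a c * ?F d = (-1) ^ ((par M a + par M c) * (e + par M d)) * (?F d * T.Jac a c)"
      by (rule sfun_commute[OF T.Jac_homogeneous[OF c] Fh])
    then have "(-1) ^ (par M c * e) * ((-1) ^ (par M d * (par M a + par M c)) * (?S a b * (T.Jac b d * (T.Jac a c * ?F d))))
      = (-1) ^ (par M c * e) * ((-1) ^ (par M d * (par M a + par M c)) * ((-1) ^ ((par M a + par M c) * (e + par M d)) * (?S a b * (T.Jac b d * (?F d * T.Jac a c)))))"
      by (simp only: neg1_commute(2)[of "T.Jac b d"] neg1_commute(2)[of "?S a b"])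
    also have "\<dots> = (-1) ^ (par M a * e) * (?S a b * (T.Jac b d * (?F d * T.Jac a c)))"
      unfolding mult.assoc[symmetric] power_add[symmetric] unfolding mult.assoc by (rule neg1_cong) auto
    finally show ?thesis by (simp only: mult.assoc)
  qed
  have Sch: "T.\<phi> (restr T.Vj (S j c d)) = (\<Sum>a<p + q. \<Sum>b<p + q. (-1) ^ (par M d * (par M a + par M c)) *
             ?S a b * T.Jac b d * T.Jac a c)" if d: "d < p + q" for d
    unfolding change_eq[symmetric] S_change[OF ij c d] J using out[OF d] by (simp add: mult.assoc)
  have SR: "restr T.Vj (S j c d) \<in> T.J.R" if "d < p + q" for d
    by (rule restr_closed_j[OF ij Cj.SR[OF c that]])
  have hj: "restr T.Vj (ham_field M S e f j c) = (-1) ^ (par M c * e) * (\<Sum>d<p + q. restr T.Vj (S j c d) * T.J.D d ?f)"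
    unfolding X[OF ij(2)] Cj.X_def Cj.G_def neg
    by (simp only: restr_sum restr_simps(2) Cj.pd_restr[OF T.J.V sub(2)])
  have hi: "restr (OL i j) (ham_field M S e f i a) = (-1) ^ (par M a * e) * (\<Sum>b<p + q. ?S a b * T.I.D b ?g)" for a
    unfolding X[OF ij(1)] Ci.X_def Ci.G_def neg
    by (simp only: restr_sum restr_simps(2) Ci.pd_restr[OF T.I.V sub(1)])
  have "change M i j (ham_field M S e f j c)
      = (-1) ^ (par M c * e) * (\<Sum>d<p + q. T.\<phi> (restr T.Vj (S j c d)) * ?F d)"
  proof -
    have dR: "restr T.Vj (S j c d) * T.J.D d ?f \<in> T.J.R" if "d < p + q" for d using SR[OF that] fR by simp
    then have "T.\<phi> (\<Sum>d<p + q. restr T.Vj (S j c d) * T.J.D d ?f) = (\<Sum>d<p + q. T.\<phi> (restr T.Vj (S j c d) * T.J.D d ?f))"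
      by (intro T.\<phi>_sum) simp
    also have "\<dots> = (\<Sum>d<p + q. T.\<phi> (restr T.Vj (S j c d)) * ?F d)"
      using SR fR by (intro sum.cong refl T.\<phi>_mult) auto
    finally show ?thesis
      unfolding change_eq hj by (subst T.\<phi>_neg1) (use dR in \<open>auto intro: T.J.superfun_sum\<close>)
  qed
  also have "\<dots> = (\<Sum>d<p + q. \<Sum>a<p + q. \<Sum>b<p + q. (-1) ^ (par M c * e) *
      ((-1) ^ (par M d * (par M a + par M c)) * ?S a b * T.Jac b d * T.Jac a c * ?F d))"
    unfolding sum_distrib_left by (intro sum.cong refl) (simp add: Sch sum_distrib_left sum_distrib_right)
  also have "\<dots> = (\<Sum>d<p + q. \<Sum>a<p + q. \<Sum>b<p + q. (-1) ^ (par M a * e) * (?S a b * (T.Jac b d * ?F d)) * T.Jac a c)"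
    by (intro sum.cong refl tm) auto
  also have "\<dots> = (\<Sum>a<p + q. \<Sum>b<p + q. \<Sum>d<p + q. (-1) ^ (par M a * e) * (?S a b * (T.Jac b d * ?F d)) * T.Jac a c)"
    by (subst sum.swap) (intro sum.cong refl sum.swap)
  also have "\<dots> = (\<Sum>a<p + q. (-1) ^ (par M a * e) * (\<Sum>b<p + q. ?S a b * T.I.D b ?g) * T.Jac a c)"
    unfolding g T.chain_rule[OF fR] by (simp only: sum_distrib_left sum_distrib_right)
  also have "\<dots> = (\<Sum>a<p + q. restr (OL i j) (ham_field M S e f i a) * jacobian M i j a c)"
    unfolding hi J ..
  finally show ?thesis .
qed

text \<open>The invariance of the divergence applies because the components of the Hamiltonian field
  transform as a vector field and \<open>\<rho>\<close> as a volume form.\<close>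

lemma odd_laplace_homogeneous_smooth:
  assumes nv: "nondegenerate_volume M \<rho>" and f: "f \<in> smooth_functions M" "fam_homogeneous e f"
  shows "odd_laplace M S \<rho> f \<in> smooth_functions M"
proof (rule smoothI)
  fix i assume i: "i \<in> charts M"
  interpret Ci: local_poisson p q "vdom M i" "S i" "\<rho> i" by (rule local_poisson[OF nv i])
  have L: "odd_laplace M S \<rho> f i = Ci.L (f i)" by (rule odd_laplace_eq[where f = f, OF nv i smoothD(1)[OF f(1) i]])
  then show "odd_laplace M S \<rho> f i \<in> Rc i" using Ci.L_closed[OF smoothD(1)[OF f(1) i]] by simp
  fix j assume j: "j \<in> charts M"
  interpret Cj: local_poisson p q "vdom M j" "S j" "\<rho> j" by (rule local_poisson[OF nv j])
  interpret T: transition_map M i j "overlap M i j" by (rule overlap_map[OF i j])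
  have sub: "T.Vi \<subseteq> vdom M i" "T.Vj \<subseteq> vdom M j" by (auto simp: img_def vdom_def overlap_def)
  have Lj: "odd_laplace M S \<rho> f j = Cj.L (f j)" by (rule odd_laplace_eq[where f = f, OF nv j smoothD(1)[OF f(1) j]])
  have hf: "homogeneous e (f k)" for k using f(2) by (simp add: fam_homogeneous_def)
  have \<rho>d: "\<rho> \<in> densities M 1" using nv by (simp add: nondegenerate_volume_def)
  let ?X = "\<lambda>a. restr T.Vi (Ci.X e (f i) a)" and ?Y = "\<lambda>b. restr T.Vj (Cj.X e (f j) b)"
  have "T.I.sdiv (restr T.Vi (\<rho> i)) (e + 1) ?X = T.\<phi> (T.J.sdiv (restr T.Vj (\<rho> j)) (e + 1) ?Y)"
  proof (rule T.div_transform)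
    show "?X a \<in> T.I.R" if "a < p + q" for a
      by (rule restr_closed[OF i j Ci.X_closed[OF that smoothD(1)[OF f(1) i]]])
    show "?Y b \<in> T.J.R" if "b < p + q" for b
      by (rule restr_closed_j[OF i j Cj.X_closed[OF that smoothD(1)[OF f(1) j]]])
    show "homogeneous (par M a + (e + 1)) (?X a)" if "a < p + q" for a
      by (rule homogeneous_restr[OF Ci.X_homogeneous[OF that hf]])
    show "homogeneous (par M a + (e + 1)) (?Y a)" if "a < p + q" for a
      by (rule homogeneous_restr[OF Cj.X_homogeneous[OF that hf]])
    show "T.\<phi> (?Y b) = (\<Sum>a<p + q. ?X a * T.Jac a b)" if "b < p + q" for b
      using ham_field_transform[OF nv i j f that]
      unfolding change_eq ham_field_eq[OF nv i] ham_field_eq[OF nv j] jacobian_eq[OF i j] .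
    show "restr T.Vj (\<rho> j) \<in> T.J.R" by (rule restr_closed_j[OF i j Cj.\<rho>_facts(1)])
    show "homogeneous 0 (restr T.Vj (\<rho> j))" by (rule homogeneous_restr[OF Cj.\<rho>_facts(2)])
    show "gr_body (restr T.Vj (\<rho> j) x) \<noteq> 0" if "x \<in> T.Vj" for x
      using that Cj.\<rho>_body[of x] sub(2) by auto
    show "restr T.Vi (\<rho> i) = T.SM.berf * T.\<phi> (restr T.Vj (\<rho> j))"
      using densityD(3)[OF \<rho>d i j] bf_simps(5)[OF i j] by (simp add: change_eq)
  qed
  then show "restr (OL i j) (odd_laplace M S \<rho> f i) = change M i j (odd_laplace M S \<rho> f j)"
    unfolding L Lj change_eq Ci.sdiv_X[OF smoothD(1)[OF f(1) i], of e, symmetric]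
      Cj.sdiv_X[OF smoothD(1)[OF f(1) j], of e, symmetric]
      Ci.sdiv_restr[OF T.I.V sub(1)] Cj.sdiv_restr[OF T.J.V sub(2)] .
next
  fix i assume "i \<notin> charts M"
  then show "odd_laplace M S \<rho> f i = 0" by (simp add: odd_laplace_def)
qed

lemma odd_laplace_add:
  assumes nv: "nondegenerate_volume M \<rho>" and f: "f \<in> smooth_functions M" and g: "g \<in> smooth_functions M"
  shows "odd_laplace M S \<rho> (f + g) = odd_laplace M S \<rho> f + odd_laplace M S \<rho> g"
proof (rule ext)
  fix i show "odd_laplace M S \<rho> (f + g) i = (odd_laplace M S \<rho> f + odd_laplace M S \<rho> g) i"
  proof (cases "i \<in> charts M")
    case True
    interpret local_poisson p q "vdom M i" "S i" "\<rho> i" by (rule local_poisson[OF nv True])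
    note fg = smoothD(1)[OF f True] smoothD(1)[OF g True]
    show ?thesis using L_add[OF fg] superfun_add[OF fg]
      by (simp add: odd_laplace_eq[OF nv True] fg)
  qed (simp add: odd_laplace_def)
qed

lemma smooth_part: "f \<in> smooth_functions M \<Longrightarrow> fam_part e f \<in> smooth_functions M"
  unfolding smooth_functions_eq by (rule densities_part)

theorem odd_laplace_smooth:
  assumes nv: "nondegenerate_volume M \<rho>" and f: "f \<in> smooth_functions M"
  shows "odd_laplace M S \<rho> f \<in> smooth_functions M"
proof -
  have "odd_laplace M S \<rho> (fam_part e f) \<in> smooth_functions M" for e
    by (rule odd_laplace_homogeneous_smooth[OF nv smooth_part[OF f] fam_homogeneous_part])
  then have "odd_laplace M S \<rho> (fam_part 0 f + fam_part 1 f) \<in> smooth_functions M"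
    unfolding odd_laplace_add[OF nv smooth_part[OF f] smooth_part[OF f]] unfolding smooth_functions_eq
    by (intro densities_add)
  then show ?thesis by (simp only: fam_part_sum)
qed

subsection \<open>Differential operators and their parity components\<close>

lemma diff_operatorI:
  assumes "\<And>s. s \<in> densities M w \<Longrightarrow> \<Delta> s \<in> densities M w"
    and "\<And>i. i \<in> charts M \<Longrightarrow> superdomain.local_operator p q (vdom M i) N (F i)"
    and "\<And>i s. i \<in> charts M \<Longrightarrow> s \<in> densities M w \<Longrightarrow> \<Delta> s i = F i (s i)"
  shows "diff_operator M w \<Delta>"
  unfolding diff_operator_def sfuns_chart cdim_eq
proof (intro conjI exI[of _ N] ballI)
  fix i assume i: "i \<in> charts M"
  interpret superdomain p q "vdom M i" by (rule chart_domain[OF i])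
  obtain c where c: "\<forall>as. c as \<in> R" "\<forall>s\<in>R. F i s = (\<Sum>as\<in>multi_indices N. c as * foldr D as s)"
    using assms(2)[OF i] unfolding local_operator_def by blast
  then have "\<forall>s\<in>densities M w. \<Delta> s i = (\<Sum>as | set as \<subseteq> {..<p + q} \<and> length as \<le> N. c as * foldr D as (s i))"
    using assms(3)[OF i] densityD(1)[OF _ i] by (simp add: multi_indices_def)
  then show "\<exists>c. (\<forall>as. c as \<in> Rc i) \<and> (\<forall>s\<in>densities M w. \<Delta> s i = (\<Sum>as | set as \<subseteq> {..<p + q} \<and> length as \<le> N. c as * foldr (dx M i) as (s i)))"
    using c(1) by blast
qed (rule assms(1))

lemma diff_operatorD:
  assumes "diff_operator M w \<Delta>"
  obtains N F where "\<And>i. i \<in> charts M \<Longrightarrow> superdomain.local_operator p q (vdom M i) N (F i)"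
    "\<And>i s. i \<in> charts M \<Longrightarrow> s \<in> densities M w \<Longrightarrow> \<Delta> s i = F i (s i)"
proof -
  obtain N where N: "\<forall>i\<in>charts M. \<exists>c. (\<forall>as. c as \<in> Rc i) \<and>
      (\<forall>s\<in>densities M w. \<Delta> s i = (\<Sum>as | set as \<subseteq> {..<p + q} \<and> length as \<le> N. c as * foldr (dx M i) as (s i)))"
    using assms unfolding diff_operator_def sfuns_chart cdim_eq by blast
  obtain c where c: "\<forall>i\<in>charts M. (\<forall>as. c i as \<in> Rc i) \<and>
      (\<forall>s\<in>densities M w. \<Delta> s i = (\<Sum>as | set as \<subseteq> {..<p + q} \<and> length as \<le> N. c i as * foldr (dx M i) as (s i)))"
    using bchoice[OF N] ..
  let ?F = "\<lambda>i s. \<Sum>as | set as \<subseteq> {..<p + q} \<and> length as \<le> N. c i as * foldr (dx M i) as s"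
  have "superdomain.local_operator p q (vdom M i) N (?F i)" if i: "i \<in> charts M" for i
  proof -
    interpret superdomain p q "vdom M i" by (rule chart_domain[OF i])
    show ?thesis
    proof (rule local_operatorI)
      show "c i as \<in> R" for as using c i by blast
      show "?F i s = (\<Sum>as\<in>multi_indices N. c i as * foldr D as s)" for s unfolding multi_indices_def ..
    qed
  qed
  moreover have "\<Delta> s i = ?F i (s i)" if "i \<in> charts M" "s \<in> densities M w" for i s using c that by blast
  ultimately show thesis by (rule that)
qed

lemma diff_operator_closed: "diff_operator M w \<Delta> \<Longrightarrow> s \<in> densities M w \<Longrightarrow> \<Delta> s \<in> densities M w"
  by (simp add: diff_operator_def)

text \<open>Linearity is not part of the definition of a differential operator; it follows from the
  local formula, and off the atlas all values are zero.\<close>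

lemma diff_operator_add:
  assumes \<Delta>: "diff_operator M w \<Delta>" and s: "s \<in> densities M w" and t: "t \<in> densities M w"
  shows "\<Delta> (s + t) = \<Delta> s + \<Delta> t"
proof (rule ext)
  fix i
  note st = densities_add[OF s t]
  show "\<Delta> (s + t) i = (\<Delta> s + \<Delta> t) i"
  proof (cases "i \<in> charts M")
    case i: True
    obtain N F where F: "\<And>i. i \<in> charts M \<Longrightarrow> superdomain.local_operator p q (vdom M i) N (F i)"
      "\<And>i s. i \<in> charts M \<Longrightarrow> s \<in> densities M w \<Longrightarrow> \<Delta> s i = F i (s i)" using diff_operatorD[OF \<Delta>] by metis
    interpret superdomain p q "vdom M i" by (rule chart_domain[OF i])
    obtain c where c: "\<forall>s\<in>R. F i s = (\<Sum>as\<in>multi_indices N. c as * foldr D as s)"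
      using F(1)[OF i] unfolding local_operator_def by blast
    note R = densityD(1)[OF s i] densityD(1)[OF t i]
    have "foldr D as (s i + t i) = foldr D as (s i) + foldr D as (t i)" for as
    proof (induction as)
      case (Cons a as)
      show ?case
        unfolding foldr.simps o_apply Cons.IH by (rule pd_add[OF superfun_foldr[OF R(1)] superfun_foldr[OF R(2)]])
    qed (simp only: foldr.simps id_apply)
    then have "F i (s i + t i) = F i (s i) + F i (t i)"
      using c R superfun_add[OF R] by (simp add: distrib_left sum.distrib)
    then show ?thesis using F(2)[OF i] s t st by simp
  next
    case False
    then show ?thesis
      using densityD(2)[OF diff_operator_closed[OF \<Delta> st]] densityD(2)[OF diff_operator_closed[OF \<Delta> s]]
        densityD(2)[OF diff_operator_closed[OF \<Delta> t]] by simp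
  qed
qed

lemma diff_operator_0: "diff_operator M w \<Delta> \<Longrightarrow> \<Delta> 0 = 0"
  using diff_operator_add[of w \<Delta> 0 0] densities_0 by simp

lemma fam_homogeneous_mult: "fam_homogeneous e f \<Longrightarrow> fam_homogeneous k s \<Longrightarrow> fam_homogeneous (e + k) (f * s)"
  by (simp add: fam_homogeneous_def homogeneous_mult)

lemma fam_homogeneous_cong: "even (e + e') \<Longrightarrow> fam_homogeneous e f \<Longrightarrow> fam_homogeneous e' f"
  unfolding fam_homogeneous_def using homogeneous_cong by blast

lemma fam_homogeneous_diff: "fam_homogeneous e f \<Longrightarrow> fam_homogeneous e g \<Longrightarrow> fam_homogeneous e (f - g)"
  by (simp add: fam_homogeneous_def homogeneous_diff)

lemma fam_homogeneous_add: "fam_homogeneous e f \<Longrightarrow> fam_homogeneous e g \<Longrightarrow> fam_homogeneous e (f + g)"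
  by (simp add: fam_homogeneous_def homogeneous_add)

lemma fam_homogeneous_neg1: "fam_homogeneous e f \<Longrightarrow> fam_homogeneous e ((-1) ^ n * f)"
  by (cases "even n") (simp_all add: minus_one_power_iff fam_homogeneous_def homogeneous_uminus)

lemma fam_commute:
  fixes f s :: "'b fam"
  assumes "fam_homogeneous e f" "fam_homogeneous k s" shows "f * s = (-1) ^ (e * k) * (s * f)"
proof (intro ext)
  fix i x
  have "f i x * s i x = (-1) ^ (e * k) * (s i x * f i x)"
    using assms by (intro gr_mult_commute) (auto simp: fam_homogeneous_def homogeneous_def)
  then show "(f * s) i x = ((-1) ^ (e * k) * (s * f)) i x" by (simp add: power_fun_apply)
qed

lemma fam_part_add: "fam_part e (s + t) = fam_part e s + fam_part e t"
  by (intro ext) (simp add: fam_part_def)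

lemma fam_part_mod: "even (e + e') \<Longrightarrow> fam_part e s = fam_part e' s"
proof -
  assume "even (e + e')"
  then have "e mod 2 = e' mod 2" by presburger
  then show ?thesis by (intro ext gr_eqI) (simp add: fam_part_def gr_coeff_part)
qed

lemma fam_part_mult:
  assumes s: "fam_homogeneous k s" shows "fam_part (k + d) (C * s) = fam_part d C * s"
proof -
  have h: "fam_part (k + d) (fam_part e C * s) = (if even (e + d) then fam_part e C * s else 0)" for e
    using fam_part_homogeneous[OF fam_homogeneous_mult[OF fam_homogeneous_part[of e C] s], of "k + d"] by auto
  have "fam_part (k + d) (C * s) = fam_part (k + d) (fam_part 0 C * s + fam_part 1 C * s)"
    using fam_part_sum[of C] by (metis distrib_right)
  also have "\<dots> = fam_part d C * s"
    unfolding fam_part_add h using fam_part_mod[of 0 d C] fam_part_mod[of 1 d C] by (cases "even d") auto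
  finally show ?thesis .
qed

lemma op_part_eq: "op_part d \<Delta> s = fam_part d (\<Delta> (fam_part 0 s)) + fam_part (1 + d) (\<Delta> (fam_part 1 s))"
  by (simp add: op_part_def numeral_2_eq_2)

lemma op_part_sum:
  assumes \<Delta>: "diff_operator M w \<Delta>" and s: "s \<in> densities M w"
  shows "op_part 0 \<Delta> s + op_part 1 \<Delta> s = \<Delta> s"
proof -
  have "op_part 0 \<Delta> s + op_part 1 \<Delta> s = (fam_part 0 (\<Delta> (fam_part 0 s)) + fam_part 1 (\<Delta> (fam_part 0 s)))
     + (fam_part 0 (\<Delta> (fam_part 1 s)) + fam_part 1 (\<Delta> (fam_part 1 s)))"
    unfolding op_part_eq using fam_part_mod[of "1 + 1" 0 "\<Delta> (fam_part 1 s)"] by (simp add: add_ac)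
  also have "\<dots> = \<Delta> (fam_part 0 s) + \<Delta> (fam_part 1 s)" unfolding fam_part_sum ..
  also have "\<dots> = \<Delta> (fam_part 0 s + fam_part 1 s)"
    using diff_operator_add[OF \<Delta> densities_part[OF s] densities_part[OF s]] by simp
  finally show ?thesis unfolding fam_part_sum .
qed

lemma op_part_homogeneous:
  assumes \<Delta>: "diff_operator M w \<Delta>" and s: "fam_homogeneous k s"
  shows "op_part d \<Delta> s = fam_part (k + d) (\<Delta> s)"
proof -
  have z: "fam_part n 0 = (0 :: 'b fam)" for n by (intro ext) (simp add: fam_part_def)
  show ?thesis
    unfolding op_part_eq fam_part_homogeneous[OF s] using diff_operator_0[OF \<Delta>]
      fam_part_mod[of d "k + d" "\<Delta> s"] fam_part_mod[of "1 + d" "k + d" "\<Delta> s"]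
    by (cases "even k") (simp_all add: z)
qed

lemma supercommutator_eq:
  "supercommutator \<Delta> e f s = (op_part 0 \<Delta> (f * s) - f * op_part 0 \<Delta> s) + (op_part 1 \<Delta> (f * s) - (-1) ^ e * (f * op_part 1 \<Delta> s))"
  by (simp add: supercommutator_def numeral_2_eq_2)

lemma supercommutator_odd:
  assumes \<Delta>: "diff_operator M w \<Delta>" "odd_operator M w \<Delta>" and s: "s \<in> densities M w" and f: "f \<in> smooth_functions M"
  shows "supercommutator \<Delta> e f s = \<Delta> (f * s) - (-1) ^ e * (f * \<Delta> s)"
proof -
  have o: "op_part 0 \<Delta> t = 0" "op_part 1 \<Delta> t = \<Delta> t" if t: "t \<in> densities M w" for t
  proof -
    have h: "fam_homogeneous (e + 1) (\<Delta> (fam_part e t))" for e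
      using \<Delta>(2) densities_part[OF t] fam_homogeneous_part unfolding odd_operator_def by blast
    show "op_part 0 \<Delta> t = 0"
      unfolding op_part_eq using fam_part_homogeneous[OF h[of 0], of 0] fam_part_homogeneous[OF h[of 1], of 1] by simp
    then show "op_part 1 \<Delta> t = \<Delta> t" using op_part_sum[OF \<Delta>(1) t] by simp
  qed
  have "f * s \<in> densities M w" using densities_mult[of f 0 s w] f s by (simp add: smooth_functions_eq)
  then show ?thesis unfolding supercommutator_eq using o s by simp
qed

end

lemma double_cancel:
  fixes F G :: "'b fam" assumes "2 * F = 2 * G" shows "F = G"
proof (intro ext)
  fix i x
  have "F i x + F i x = G i x + G i x" using assms unfolding mult_2 by (metis plus_fun_apply)
  then show "F i x = G i x" by (metis scaleR_half_double)
qed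

lemma smul_add: "smul r (f + g) = smul r f + smul r g" "smul (r + t) f = smul r f + smul t f"
  and smul_mult: "smul r f * g = smul r (f * g)" "f * smul r g = smul r (f * g)"
  by (simp_all add: smul_def fun_eq_iff scaleR_right_distrib scaleR_left_distrib)

lemma fam_even_commute: "fam_homogeneous 0 z \<Longrightarrow> z * s = s * z" for z s :: "'b fam"
  using gr_even_commute[of "z _ _" "s _ _"] by (intro ext) (simp add: fam_homogeneous_def homogeneous_def)

locale poisson_volume = poisson +
  fixes \<rho> :: "'b fam"
  assumes nv: "nondegenerate_volume M \<rho>"
begin

abbreviation "vp \<equiv> vol_powr M \<rho>"

abbreviation "P i \<equiv> superdomain.powf q (\<rho> i)"

lemmas vp_density = density_vol_powr[OF nv]
lemmas vp_even = fam_homogeneous_vol_powr[OF nv]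

lemma density_0_mult: "f \<in> smooth_functions M \<Longrightarrow> s \<in> densities M w \<Longrightarrow> f * s \<in> densities M w"
  using densities_mult[of f 0 s w] by (simp add: smooth_functions_eq)

lemma density_vp: "f \<in> smooth_functions M \<Longrightarrow> f * vp w \<in> densities M w"
  using density_0_mult vp_density by blast

lemma vp_coefficient: "s \<in> densities M w \<Longrightarrow> s * vp (- w) \<in> smooth_functions M"
  using densities_mult[OF _ vp_density, of s w "- w"] by (simp add: smooth_functions_eq)

lemma vp_cancel: "s \<in> densities M v \<Longrightarrow> s * vp w * vp (- w) = s" "s \<in> densities M v \<Longrightarrow> s * vp (- w) * vp w = s"
  using vol_powr_mult[OF nv, of s v w] vol_powr_mult[OF nv, of s v "- w"] by simp_all

lemma lie_ham_powf:
  assumes i: "i \<in> charts M" and f: "f \<in> smooth_functions M" "fam_homogeneous e f"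
    and u: "u \<in> Rc i" and s: "s i = u * P i w"
  shows "lie_ham M S w e f s i = ((\<Sum>a<p + q. local_poisson.X p q (vdom M i) (S i) e (f i) a * dx M i a u)
      + smul w (local_poisson.L p q (vdom M i) (S i) (\<rho> i) (f i)) * u) * P i w"
proof -
  interpret local_poisson p q "vdom M i" "S i" "\<rho> i" by (rule local_poisson[OF nv i])
  have f': "f i \<in> R" "homogeneous e (f i)" using smoothD(1)[OF f(1) i] f(2) by (simp_all add: fam_homogeneous_def)
  have "lie_ham M S w e f s i = (\<Sum>a<p + q. X e (f i) a * D a (s i)) + smul w (sdiv (const_on (vdom M i) 1) (e + 1) (X e (f i))) * s i"
    using i by (simp only: lie_ham_def lie_density_def divergence_eq[OF i] ham_field_eq[OF nv i] cdim_eq if_True)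
  then show ?thesis unfolding s lie_powf[OF f' u] .
qed

lemma density_chart:
  assumes s: "s \<in> densities M w" and i: "i \<in> charts M"
  obtains u where "u \<in> Rc i" "s i = u * P i w" "u = (s * vp (- w)) i"
proof
  show "(s * vp (- w)) i \<in> Rc i" by (rule smoothD(1)[OF vp_coefficient[OF s] i])
  have "(s * vp (- w) * vp w) i = s i" by (simp only: vp_cancel(2)[OF s])
  then show "s i = (s * vp (- w)) i * P i w" by (simp add: vol_powr_eq[OF i])
qed (rule refl)

text \<open>Fixes the parity of the right-hand side of the equation, by which the contributions of
  the even and the odd part of a solution can be separated.\<close>

lemma lie_ham_homogeneous:
  assumes f: "f \<in> smooth_functions M" "fam_homogeneous e f" and s: "s \<in> densities M w" "fam_homogeneous k s"
  shows "fam_homogeneous (e + k + 1) (lie_ham M S w e f s)"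
  unfolding fam_homogeneous_def
proof
  fix i
  show "homogeneous (e + k + 1) (lie_ham M S w e f s i)"
  proof (cases "i \<in> charts M")
    case i: True
    interpret local_poisson p q "vdom M i" "S i" "\<rho> i" by (rule local_poisson[OF nv i])
    obtain u where u: "u \<in> R" "s i = u * powf (\<rho> i) w" "u = (s * vp (- w)) i" by (rule density_chart[OF s(1) i])
    have "fam_homogeneous (k + 0) (s * vp (- w))" by (intro fam_homogeneous_mult s vp_even)
    then have uh: "homogeneous k u" by (simp only: u(3) fam_homogeneous_def add_0_right)
    have fh: "homogeneous e (f i)" using f(2) by (simp add: fam_homogeneous_def)
    have "homogeneous (e + k + 1) (X e (f i) a * D a u)" if a: "a < p + q" for a
      using homogeneous_mult[OF X_homogeneous[OF a fh] homogeneous_pd[OF uh, of p a "vdom M i"]]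
      by (rule homogeneous_cong[rotated]) auto
    moreover have "homogeneous (e + k + 1) (smul w (L (f i)) * u)"
      using homogeneous_mult[OF homogeneous_smul[OF L_homogeneous[OF fh], of w] uh] by (simp add: add_ac)
    ultimately have "homogeneous (e + k + 1) ((\<Sum>a<p + q. X e (f i) a * D a u) + smul w (L (f i)) * u)"
      by (intro homogeneous_add homogeneous_sum) auto
    moreover have "homogeneous 0 (powf (\<rho> i) w)" using pos_fun_powf[OF \<rho>] by (simp add: pos_fun_def)
    ultimately have "homogeneous (e + k + 1 + 0) (lie_ham M S w e f s i)"
      unfolding lie_ham_powf[where s = s, OF i f u(1,2)] by (rule homogeneous_mult)
    then show ?thesis by simp
  qed (simp add: lie_ham_def)
qed

subsection \<open>Existence\<close>

definition half_laplace :: "'b fam \<Rightarrow> 'b fam" where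
  "half_laplace s = odd_laplace M S \<rho> (s * vp (- (1 / 2))) * vp (1 / 2)"

lemma half_laplace_density: "s \<in> densities M (1 / 2) \<Longrightarrow> half_laplace s \<in> densities M (1 / 2)"
  unfolding half_laplace_def by (intro density_vp odd_laplace_smooth[OF nv] vp_coefficient)

lemma half_laplace_chart:
  assumes i: "i \<in> charts M" and s: "s \<in> densities M (1 / 2)"
  shows "half_laplace s i = local_poisson.L p q (vdom M i) (S i) (\<rho> i) ((s * vp (- (1 / 2))) i) * P i (1 / 2)"
  using odd_laplace_eq[where f = "s * vp (- (1 / 2))", OF nv i smoothD(1)[OF vp_coefficient[OF s] i]] by (simp add: half_laplace_def vol_powr_eq[OF i])

lemma half_laplace_diff_operator: "diff_operator M (1 / 2) half_laplace"
proof (rule diff_operatorI)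
  show "half_laplace s \<in> densities M (1 / 2)" if "s \<in> densities M (1 / 2)" for s by (rule half_laplace_density[OF that])
  let ?F = "\<lambda>i s. P i (1 / 2) * local_poisson.L p q (vdom M i) (S i) (\<rho> i) (P i (- (1 / 2)) * s)"
  fix i assume i: "i \<in> charts M"
  interpret local_poisson p q "vdom M i" "S i" "\<rho> i" by (rule local_poisson[OF nv i])
  show "local_operator 2 (?F i)" by (rule local_operator_L) (rule superfun_powf[OF \<rho>])+
  fix s assume s: "s \<in> densities M (1 / 2)"
  have c: "powf (\<rho> i) w * z = z * powf (\<rho> i) w" for w z
    using pos_fun_powf[OF \<rho>, of w] by (intro sfun_even_commute) (simp add: pos_fun_def)
  show "half_laplace s i = ?F i (s i)"
    unfolding half_laplace_chart[OF i s] by (simp only: c times_fun_apply vol_powr_eq[OF i])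
qed

lemma half_laplace_odd: "odd_operator M (1 / 2) half_laplace"
  unfolding odd_operator_def fam_homogeneous_def
proof (intro allI ballI impI)
  fix e i s assume s: "s \<in> densities M (1 / 2)" and h: "\<forall>i. homogeneous e (s i)"
  show "homogeneous (e + 1) (half_laplace s i)"
  proof (cases "i \<in> charts M")
    case i: True
    interpret local_poisson p q "vdom M i" "S i" "\<rho> i" by (rule local_poisson[OF nv i])
    have e: "homogeneous 0 (vp w i)" for w using vp_even by (simp add: fam_homogeneous_def)
    have "homogeneous (e + 0) (s i * vp (- (1 / 2)) i)" by (rule homogeneous_mult[OF _ e]) (use h in blast)
    then have "homogeneous (e + 0) ((s * vp (- (1 / 2))) i)" by (subst times_fun_apply)
    from homogeneous_mult[OF L_homogeneous[OF this] e[of "1 / 2"]]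
    show ?thesis unfolding half_laplace_chart[OF i s] vol_powr_eq[OF i] by simp
  qed (simp add: half_laplace_def odd_laplace_def)
qed

theorem half_laplace_solution: "lie_solution M S (1 / 2) half_laplace"
  unfolding lie_solution_def
proof (intro conjI allI impI ballI half_laplace_diff_operator)
  fix e :: nat and f s assume f: "f \<in> smooth_functions M" "fam_homogeneous e f" and s: "s \<in> densities M (1 / 2)"
  show "supercommutator half_laplace e f s = 2 * lie_ham M S (1 / 2) e f s"
    unfolding supercommutator_odd[OF half_laplace_diff_operator half_laplace_odd s f(1)]
  proof (rule ext)
    fix i
    show "(half_laplace (f * s) - (-1) ^ e * (f * half_laplace s)) i = (2 * lie_ham M S (1 / 2) e f s) i"
    proof (cases "i \<in> charts M")
      case i: True
      interpret local_poisson p q "vdom M i" "S i" "\<rho> i" by (rule local_poisson[OF nv i])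
      obtain u where u: "u \<in> R" "s i = u * powf (\<rho> i) (1 / 2)" "u = (s * vp (- (1 / 2))) i" by (rule density_chart[OF s i])
      have f': "f i \<in> R" "homogeneous e (f i)" using smoothD(1)[OF f(1) i] f(2) by (simp_all add: fam_homogeneous_def)
      let ?Q = "powf (\<rho> i) (1 / 2)"
      let ?B = "\<Sum>a<p + q. X e (f i) a * D a u"
      have fu: "(f * s * vp (- (1 / 2))) i = f i * u" by (simp only: u(3) times_fun_apply mult.assoc)
      have "half_laplace (f * s) i = L (f i) * u * ?Q + (-1) ^ e * (f i * (L u * ?Q)) + 2 * ?B * ?Q"
        unfolding half_laplace_chart[OF i density_0_mult[OF f(1) s]] fu L_mult[OF f' u(1)]
        by (simp only: distrib_right mult.assoc)
      moreover have "half_laplace s i = L u * ?Q" unfolding half_laplace_chart[OF i s] u(3) ..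
      moreover have "((-1) ^ e * (f * half_laplace s)) i = (-1) ^ e * (f i * half_laplace s i)"
        by (simp add: power_fun_apply)
      ultimately have "(half_laplace (f * s) - (-1) ^ e * (f * half_laplace s)) i = (L (f i) * u + 2 * ?B) * ?Q"
        by (simp add: distrib_right)
      \<comment> \<open>The term \<open>L (f i)\<close> enters with coefficient one, and the weight
        supplies it as twice one half.\<close>
      also have "L (f i) * u = 2 * (smul (1 / 2) (L (f i)) * u)"
        unfolding mult_2 smul_mult by (simp add: smul_def fun_eq_iff flip: scaleR_left_distrib)
      also have "(2 * (smul (1 / 2) (L (f i)) * u) + 2 * ?B) * ?Q = 2 * ((?B + smul (1 / 2) (L (f i)) * u) * ?Q)"
        by (simp only: distrib_left distrib_right mult.assoc add.commute)
      also have "\<dots> = (2 * lie_ham M S (1 / 2) e f s) i"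
        unfolding lie_ham_powf[where s = s, OF i f u(1,2), symmetric] by (simp add: mult_2)
      finally show ?thesis .
    next
      case False
      then show ?thesis
        using densityD(2)[OF half_laplace_density[OF s]] densityD(2)[OF half_laplace_density[OF density_0_mult[OF f(1) s]]]
        by (simp add: lie_ham_def mult_2)
    qed
  qed
qed

subsection \<open>Uniqueness\<close>

text \<open>On homogeneous arguments the two parts of the supercommutator have opposite parities,
  and the right-hand side has that of the odd part; the even part drops out.\<close>

lemma solution_odd_part:
  assumes \<Delta>: "lie_solution M S w \<Delta>" and f: "f \<in> smooth_functions M" "fam_homogeneous e f" "e < 2"
    and s: "s \<in> densities M w" "fam_homogeneous k s"
  shows "op_part 1 \<Delta> (f * s) - (-1) ^ e * (f * op_part 1 \<Delta> s) = 2 * lie_ham M S w e f s"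
proof -
  have \<Delta>d: "diff_operator M w \<Delta>" and sol: "supercommutator \<Delta> e f s = 2 * lie_ham M S w e f s"
    using \<Delta> f s(1) unfolding lie_solution_def by blast+
  have h: "fam_homogeneous (k + d) (op_part d \<Delta> s)" "fam_homogeneous (e + k + d) (op_part d \<Delta> (f * s))" for d
    unfolding op_part_homogeneous[OF \<Delta>d s(2)] op_part_homogeneous[OF \<Delta>d fam_homogeneous_mult[OF f(2) s(2)]]
    by (rule fam_homogeneous_part)+
  let ?A = "op_part 0 \<Delta> (f * s) - f * op_part 0 \<Delta> s" and ?B = "op_part 1 \<Delta> (f * s) - (-1) ^ e * (f * op_part 1 \<Delta> s)"
    and ?C = "2 * lie_ham M S w e f s"
  have "fam_homogeneous (e + k + d) (f * op_part d \<Delta> s)" for d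
    using fam_homogeneous_mult[OF f(2) h(1)[of d]] by (simp only: add.assoc)
  then have A: "fam_homogeneous (e + k + 0) ?A" and B: "fam_homogeneous (e + k + 1) ?B"
    by (intro fam_homogeneous_diff fam_homogeneous_neg1 h; blast)+
  have C: "fam_homogeneous (e + k + 1) ?C"
    unfolding mult_2 by (intro fam_homogeneous_add lie_ham_homogeneous f s)
  have "fam_part (e + k + 1) (?A + ?B) = fam_part (e + k + 1) ?C" using sol by (simp only: supercommutator_eq)
  then show ?thesis
    unfolding fam_part_add fam_part_homogeneous[OF A] fam_part_homogeneous[OF B] fam_part_homogeneous[OF C] by simp
qed

text \<open>The supercommutator is linear in the operator, so the difference of two solutions
  supercommutes with multiplications. The candidate \<open>?C\<close> is its value on
  \<open>vp w\<close>, divided by \<open>vp w\<close>.\<close>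

theorem solutions_differ:
  assumes \<Delta>: "lie_solution M S w \<Delta>" "lie_solution M S w \<Delta>'"
  shows "\<exists>C\<in>smooth_functions M. \<forall>s\<in>densities M w. \<Delta>' s = \<Delta> s + C * s"
proof -
  have \<Delta>d: "diff_operator M w \<Delta>" "diff_operator M w \<Delta>'" using \<Delta> unfolding lie_solution_def by blast+
  let ?T = "\<lambda>s. \<Delta>' s - \<Delta> s" and ?T' = "\<lambda>d s. op_part d \<Delta>' s - op_part d \<Delta> s"
  let ?\<sigma> = "vp w"
  have Tsum: "?T s = ?T' 0 s + ?T' 1 s" if "s \<in> densities M w" for s
    using op_part_sum[OF \<Delta>d(1) that] op_part_sum[OF \<Delta>d(2) that] by (metis add_diff_add)
  have op: "fam_homogeneous d (?T' d ?\<sigma>)" for d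
    using fam_homogeneous_part[of "0 + d"] unfolding op_part_homogeneous[OF \<Delta>d(1) vp_even] op_part_homogeneous[OF \<Delta>d(2) vp_even]
    by (intro fam_homogeneous_diff) simp_all
  \<comment> \<open>Writing \<open>g\<close> on the right cancels the sign of the odd part, so the
    two parity parts recombine into multiplication by \<open>?T ?\<sigma>\<close>.\<close>
  have hom: "?T (g * ?\<sigma>) = ?T ?\<sigma> * g" if g: "g \<in> smooth_functions M" "fam_homogeneous e g" "e < 2" for e g
  proof -
    have "supercommutator \<Delta>' e g ?\<sigma> = supercommutator \<Delta> e g ?\<sigma>"
      using \<Delta> g vp_density unfolding lie_solution_def by metis
    then have "?T' 0 (g * ?\<sigma>) + ?T' 1 (g * ?\<sigma>) = g * ?T' 0 ?\<sigma> + (-1) ^ e * (g * ?T' 1 ?\<sigma>)"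
      unfolding supercommutator_eq by (simp add: algebra_simps)
    also have "\<dots> = ?T' 0 ?\<sigma> * g + ?T' 1 ?\<sigma> * g"
    proof -
      have "g * ?T' 0 ?\<sigma> = ?T' 0 ?\<sigma> * g" using fam_commute[OF g(2) op[of 0]] by simp
      moreover have "(-1) ^ e * (g * ?T' 1 ?\<sigma>) = (-1) ^ e * ((-1) ^ e * (?T' 1 ?\<sigma> * g))"
        using fam_commute[OF g(2) op[of 1]] by simp
      moreover have "(-1) ^ e * ((-1) ^ e * z) = z" for z :: "'b fam" by (cases "even e") simp_all
      ultimately show ?thesis by simp
    qed
    finally show ?thesis unfolding Tsum[OF density_vp[OF g(1)]] Tsum[OF vp_density] distrib_right .
  qed
  let ?C = "?T ?\<sigma> * vp (- w)"
  have "?C \<in> smooth_functions M"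
    by (rule vp_coefficient[OF densities_diff[OF diff_operator_closed[OF \<Delta>d(2) vp_density] diff_operator_closed[OF \<Delta>d(1) vp_density]]])
  moreover have "\<Delta>' s = \<Delta> s + ?C * s" if s: "s \<in> densities M w" for s
  proof -
    let ?g = "s * vp (- w)"
    have g: "fam_part e ?g \<in> smooth_functions M" for e by (rule smooth_part[OF vp_coefficient[OF s]])
    have gs: "fam_part 0 ?g * ?\<sigma> + fam_part 1 ?g * ?\<sigma> = s"
      unfolding distrib_right[symmetric] fam_part_sum vp_cancel(2)[OF s] ..
    have "?T s = ?T (fam_part 0 ?g * ?\<sigma>) + ?T (fam_part 1 ?g * ?\<sigma>)"
      using diff_operator_add[OF \<Delta>d(1) density_vp[OF g] density_vp[OF g], of 0 1]
        diff_operator_add[OF \<Delta>d(2) density_vp[OF g] density_vp[OF g], of 0 1] unfolding gs by simp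
    also have "\<dots> = ?T ?\<sigma> * (fam_part 0 ?g + fam_part 1 ?g)"
      using hom[OF g fam_homogeneous_part, of 0] hom[OF g fam_homogeneous_part, of 1] by (simp add: distrib_left)
    also have "\<dots> = ?T ?\<sigma> * (s * vp (- w))" unfolding fam_part_sum ..
    also have "s * vp (- w) = vp (- w) * s" by (rule fam_even_commute[OF vp_even, symmetric])
    finally have "?T s = ?C * s" by (simp only: mult.assoc)
    from diff_eq_eq[THEN iffD1, OF this] show ?thesis by (simp only: add.commute)
  qed
  ultimately show ?thesis by blast
qed

text \<open>The parity parts of multiplication by \<open>C\<close> are multiplications by the parity
  parts of \<open>C\<close>, and these supercommute with functions.\<close>

theorem solution_plus_function:
  assumes \<Delta>: "lie_solution M S w \<Delta>" and C: "C \<in> smooth_functions M"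
    and \<Delta>': "\<And>s. s \<in> densities M w \<Longrightarrow> \<Delta>' s = \<Delta> s + C * s"
  shows "lie_solution M S w \<Delta>'"
  unfolding lie_solution_def
proof (intro conjI allI impI ballI)
  have \<Delta>d: "diff_operator M w \<Delta>" using \<Delta> unfolding lie_solution_def by blast
  obtain N F where F: "\<And>i. i \<in> charts M \<Longrightarrow> superdomain.local_operator p q (vdom M i) N (F i)"
    "\<And>i s. i \<in> charts M \<Longrightarrow> s \<in> densities M w \<Longrightarrow> \<Delta> s i = F i (s i)" using diff_operatorD[OF \<Delta>d] by metis
  show "diff_operator M w \<Delta>'"
  proof (rule diff_operatorI)
    show "\<Delta>' s \<in> densities M w" if "s \<in> densities M w" for s
      unfolding \<Delta>'[OF that] by (rule densities_add[OF diff_operator_closed[OF \<Delta>d that] density_0_mult[OF C that]])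
    fix i assume i: "i \<in> charts M"
    interpret superdomain p q "vdom M i" by (rule chart_domain[OF i])
    show "local_operator N (\<lambda>s. F i s + C i * s)"
      by (intro local_operator_add F(1)[OF i] local_operator_mono[OF local_operator_const[OF smoothD(1)[OF C i]]]) simp
    show "\<Delta>' s i = F i (s i) + C i * s i" if "s \<in> densities M w" for s using \<Delta>'[OF that] F(2)[OF i that] by simp
  qed
  fix e f s assume e: "e < (2 :: nat)" and f: "f \<in> smooth_functions M" "fam_homogeneous e f" and s: "s \<in> densities M w"
  have op: "op_part d \<Delta>' t = op_part d \<Delta> t + fam_part d C * t" if t: "t \<in> densities M w" for d t
  proof -
    have "fam_part d (C * fam_part 0 t) = fam_part d C * fam_part 0 t"
      "fam_part (1 + d) (C * fam_part 1 t) = fam_part d C * fam_part 1 t"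
      using fam_part_mult[OF fam_homogeneous_part, of 0 d C t] fam_part_mult[OF fam_homogeneous_part, of 1 d C t] by simp_all
    then have "op_part d \<Delta>' t = op_part d \<Delta> t + fam_part d C * (fam_part 0 t + fam_part 1 t)"
      unfolding op_part_eq \<Delta>'[OF densities_part[OF t]] fam_part_add by (simp only: distrib_left add_ac)
    then show ?thesis unfolding fam_part_sum .
  qed
  have c0: "fam_part 0 C * (f * s) = f * (fam_part 0 C * s)"
    using fam_even_commute[OF fam_homogeneous_part, of C f] by (simp only: mult.assoc[symmetric])
  have c1: "fam_part 1 C * (f * s) = (-1) ^ e * (f * (fam_part 1 C * s))"
    using fam_commute[OF fam_homogeneous_part f(2), of 1 C] by (simp add: mult.assoc[symmetric])
  have "supercommutator \<Delta>' e f s = supercommutator \<Delta> e f s"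
    unfolding supercommutator_eq op[OF s] op[OF density_0_mult[OF f(1) s]] c0 c1 by (simp add: distrib_left)
  then show "supercommutator \<Delta>' e f s = 2 * lie_ham M S w e f s"
    using \<Delta> e f s unfolding lie_solution_def by simp
qed

lemma solution_formula:
  assumes \<Delta>: "lie_solution M S (1 / 2) \<Delta>"
  shows "\<exists>C\<in>smooth_functions M. \<forall>s\<in>smooth_functions M.
      \<Delta> (s * vp (1 / 2)) = odd_laplace M S \<rho> s * vp (1 / 2) + C * (s * vp (1 / 2))"
proof -
  obtain C where C: "C \<in> smooth_functions M" "\<And>s. s \<in> densities M (1 / 2) \<Longrightarrow> \<Delta> s = half_laplace s + C * s"
    using solutions_differ[OF half_laplace_solution \<Delta>] by blast
  have "half_laplace (s * vp (1 / 2)) = odd_laplace M S \<rho> s * vp (1 / 2)" if "s \<in> smooth_functions M" for s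
    using vp_cancel(1)[of s 0 "1 / 2"] that unfolding half_laplace_def smooth_functions_eq by simp
  then show ?thesis using C density_vp by metis
qed

subsection \<open>The weight\<close>

text \<open>Comparing \<open>\<Delta> (f g \<sigma>)\<close> computed with \<open>f g\<close> and with \<open>f\<close> after \<open>g\<close>, for \<open>\<sigma> = \<rho>\<^sup>w\<close>.\<close>

theorem solution_bracket:
  assumes \<Delta>: "lie_solution M S w \<Delta>" and w: "w \<noteq> 1 / 2"
    and f: "f \<in> smooth_functions M" "fam_homogeneous e f" "e < 2"
    and g: "g \<in> smooth_functions M" "fam_homogeneous e' g" "e' < 2" and i: "i \<in> charts M"
  shows "(\<Sum>a<p + q. local_poisson.X p q (vdom M i) (S i) e (f i) a * dx M i a (g i)) = 0"
proof -
  interpret local_poisson p q "vdom M i" "S i" "\<rho> i" by (rule local_poisson[OF nv i])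
  \<comment> \<open>\<open>lie_solution\<close> speaks only of the parities 0 and 1, hence the
    reduction modulo 2 for the product \<open>f * g\<close>.\<close>
  let ?\<sigma> = "vp w" and ?T = "op_part 1 \<Delta>" and ?d = "(e + e') mod 2" and ?P = "powf (\<rho> i) w"
  note lie = solution_odd_part[OF \<Delta>]
  have fg: "f * g \<in> smooth_functions M" using densities_mult[of f 0 g 0] f(1) g(1) by (simp add: smooth_functions_eq)
  have fgh: "fam_homogeneous ?d (f * g)"
    by (rule fam_homogeneous_cong[OF _ fam_homogeneous_mult[OF f(2) g(2)]]) presburger
  have 1: "?T (f * (g * ?\<sigma>)) = (-1) ^ e * (f * ?T (g * ?\<sigma>)) + 2 * lie_ham M S w e f (g * ?\<sigma>)"
    using lie[OF f density_vp[OF g(1)] fam_homogeneous_mult[OF g(2) vp_even]] by (metis add.commute diff_add_cancel)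
  have 2: "?T (g * ?\<sigma>) = (-1) ^ e' * (g * ?T ?\<sigma>) + 2 * lie_ham M S w e' g ?\<sigma>"
    using lie[OF g vp_density vp_even] by (metis add.commute diff_add_cancel)
  have 3: "?T (f * g * ?\<sigma>) = (-1) ^ ?d * (f * g * ?T ?\<sigma>) + 2 * lie_ham M S w ?d (f * g) ?\<sigma>"
    using lie[OF fg fgh _ vp_density vp_even] by (metis add.commute diff_add_cancel mod_less_divisor zero_less_numeral)
  have 4: "(-1) ^ e * (f * ((-1) ^ e' * (g * z))) = (-1) ^ ?d * (f * g * z)" for z :: "'b fam"
    unfolding neg1_commute(2)[of f] by (cases "even e"; cases "even e'") (simp_all add: mult.assoc mod2_eq_if)
  have 5: "(-1) ^ e * (f * (2 * z)) = 2 * ((-1) ^ e * (f * z))" for z :: "'b fam"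
    by (simp only: mult_2 distrib_left)
  have "2 * lie_ham M S w ?d (f * g) ?\<sigma> = 2 * ((-1) ^ e * (f * lie_ham M S w e' g ?\<sigma>) + lie_ham M S w e f (g * ?\<sigma>))"
    using 1 3 unfolding 2 distrib_left 4 5 mult.assoc by simp
  then have "lie_ham M S w ?d (f * g) ?\<sigma> = (-1) ^ e * (f * lie_ham M S w e' g ?\<sigma>) + lie_ham M S w e f (g * ?\<sigma>)"
    by (rule double_cancel)
  then have eq: "lie_ham M S w ?d (f * g) ?\<sigma> i = (-1) ^ e * (f i * lie_ham M S w e' g ?\<sigma> i) + lie_ham M S w e f (g * ?\<sigma>) i"
    by (simp add: power_fun_apply)
  have f': "f i \<in> R" "homogeneous e (f i)" and g': "g i \<in> R" "homogeneous e' (g i)"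
    using smoothD(1)[OF f(1) i] smoothD(1)[OF g(1) i] f(2) g(2) by (simp_all add: fam_homogeneous_def)
  have PR: "?P \<in> R" by (rule superfun_powf[OF \<rho>])
  have one: "const_on (vdom M i) 1 \<in> R" by simp
  have s1: "?\<sigma> i = const_on (vdom M i) 1 * ?P" unfolding vol_powr_eq[OF i] superfun_one_mult(1)[OF PR] ..
  have s2: "(g * ?\<sigma>) i = g i * ?P" by (simp add: vol_powr_eq[OF i])
  let ?B = "\<Sum>a<p + q. X e (f i) a * D a (g i)"
  have BR: "?B \<in> R" using f'(1) g'(1) by (intro superfun_sum) simp
  have l: "lie_ham M S w k h ?\<sigma> i = smul w (L (h i)) * ?P"
    if h: "h \<in> smooth_functions M" "fam_homogeneous k h" for k h
    unfolding lie_ham_powf[where s = ?\<sigma>, OF i h one s1]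
    using superfun_one_mult(2)[of "smul w (L (h i))"] smoothD(1)[OF h(1) i] by (simp add: pd_one)
  have "smul w (L (f i * g i)) * ?P = (-1) ^ e * (f i * (smul w (L (g i)) * ?P)) + (?B + smul w (L (f i)) * g i) * ?P"
    using eq unfolding l[OF fg fgh] l[OF g(1,2)] lie_ham_powf[where s = "g * ?\<sigma>", OF i f(1,2) g'(1) s2] by simp
  moreover have "smul w (L (f i * g i)) = smul w (L (f i)) * g i + (-1) ^ e * (f i * smul w (L (g i))) + smul w (2 * ?B)"
    unfolding L_mult[OF f' g'(1)] smul_add smul_mult by (cases "even e") (simp_all add: smul_def fun_eq_iff)
  \<comment> \<open>The Leibniz rule for \<open>L (f * g)\<close> brings in the bracket with
    coefficient \<open>2 * w\<close>, whereas the Lie derivative along \<open>f\<close> of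
    \<open>g * ?\<sigma>\<close> contains it with coefficient one.\<close>
  ultimately have "smul w (2 * ?B) * ?P = ?B * ?P" by (simp add: distrib_right mult.assoc)
  then have "smul w (2 * ?B) * ?P * powf (\<rho> i) (- w) = ?B * ?P * powf (\<rho> i) (- w)" by simp
  moreover have "?P * powf (\<rho> i) (- w) = const_on (vdom M i) 1"
    using powf_add[OF \<rho>, of w "- w"] powf_0[OF \<rho>] by simp
  ultimately have "smul w (2 * ?B) = ?B" using BR by (simp add: mult.assoc superfun_one_mult mult_2)
  then have B: "smul w (?B + ?B) x = ?B x" for x by (simp only: mult_2)
  have "b = 0" if "w *\<^sub>R (b + b) = b" for b :: grassmann
  proof -
    have "(2 * w - 1) *\<^sub>R b = w *\<^sub>R (b + b) - b"
      by (simp only: mult_2 scaleR_left_diff_distrib scaleR_right_distrib scaleR_left_distrib scaleR_one)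
    then show ?thesis using w that by simp
  qed
  then have "?B x = 0" for x using B[of x] unfolding smul_def plus_fun_apply .
  then show ?thesis by (intro ext) (simp only: zero_fun_apply)
qed

end

section \<open>Functions supported in a chart\<close>

context smfd
begin

lemma change_restr:
  assumes kl: "k \<in> charts M" "l \<in> charts M" and W: "openin (base M) W" "W \<subseteq> overlap M k l" and g: "g \<in> Rc l"
  shows "restr (img M k W) (change M k l g) = transition M k l W (restr (img M l W) g)"
proof -
  interpret T: transition_map M k l "overlap M k l" by (rule overlap_map[OF kl])
  have "restr (img M l W) (restr T.Vj g) = restr (img M l W) g"
    using W(2) by (auto simp: restr_simps(8) img_def intro!: arg_cong[of _ _ "\<lambda>A. restr A g"])
  then show ?thesis
    unfolding change_eq using T.\<phi>_restr[OF restr_closed_j[OF kl g] W] by simp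
qed

lemma transition_0: "k \<in> charts M \<Longrightarrow> l \<in> charts M \<Longrightarrow> openin (base M) W \<Longrightarrow> W \<subseteq> overlap M k l \<Longrightarrow> transition M k l W 0 = 0"
proof -
  assume kl: "k \<in> charts M" "l \<in> charts M" and W: "openin (base M) W" "W \<subseteq> overlap M k l"
  interpret T: transition_map M k l W using M kl W by unfold_locales auto
  show ?thesis by simp
qed

text \<open>\<open>change\<close> is zero off the overlap, so this is extension by zero; it is
  smooth only because of the compact support assumed below.\<close>

definition extension :: "'i \<Rightarrow> sfun \<Rightarrow> 'i fam" where
  "extension i h k = (if k \<in> charts M then change M k i h else 0)"

context
  fixes i :: 'i and h :: sfun and K :: "(nat \<Rightarrow> real) set"
  assumes i: "i \<in> charts M" and h: "h \<in> Rc i" and K: "compactin (Euclidean_space p) K" "K \<subseteq> vdom M i"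
    and hK: "\<And>x. x \<in> vdom M i \<Longrightarrow> x \<notin> K \<Longrightarrow> h x = 0"
begin

abbreviation "support_set \<equiv> {Q \<in> chart_dom M i. chart_map M i Q \<in> K}"

text \<open>The support is compact in the chart, hence compact in the base space, hence closed there
  by the Hausdorff property.\<close>

lemma closed_support: "closedin (base M) support_set"
proof -
  have "compactin (subtopology (Euclidean_space p) (vdom M i)) K"
    using K by (simp add: compactin_subtopology)
  moreover have "K = chart_map M i ` support_set" using K(2) by (auto simp: vdom_def img_def)
  ultimately have "compactin (subtopology (base M) (chart_dom M i)) support_set"
    using homeomorphic_map_compactness[OF supermanifold_chart(3)[OF M i], of support_set] chart_topspace[OF M i] by auto
  then have "compactin (base M) support_set" by (simp add: compactin_subtopology)
  then show ?thesis using M compactin_imp_closedin by (auto simp: supermanifold_def)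
qed

text \<open>In the part of \<open>W\<close> that meets the chart \<open>i\<close>, the local
  coefficient is the transition of a zero restriction of \<open>h\<close>; elsewhere
  \<open>change\<close> already vanishes.\<close>

lemma extension_0:
  assumes k: "k \<in> charts M" and W: "openin (base M) W" "W \<subseteq> chart_dom M k" "W \<inter> support_set = {}"
  shows "restr (img M k W) (extension i h k) = 0"
proof (rule ext)
  fix x
  interpret T: transition_map M k i "overlap M k i" by (rule overlap_map[OF k i])
  let ?W = "W \<inter> overlap M k i"
  have W': "openin (base M) ?W" using W(1) T.U(1) by blast
  have "restr (img M i ?W) h = 0"
    using W(3) hK by (auto simp: restr_def fun_eq_iff img_def overlap_def vdom_def)
  then have 0: "restr (img M k ?W) (change M k i h) = 0"
    using change_restr[OF k i W' _ h] transition_0[OF k i W'] by simp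
  have out: "change M k i h x = 0" if "x \<notin> T.Vi" for x
    using T.I.superfun_outside[OF change_simps(1)[OF k i h h] that] .
  show "restr (img M k W) (extension i h k) x = 0 x"
  proof (cases "x \<in> img M k W \<and> x \<in> T.Vi")
    case True
    then obtain Q Q' where Q: "Q \<in> W" "x = chart_map M k Q" "Q' \<in> overlap M k i" "x = chart_map M k Q'"
      by (auto simp: img_def)
    then have "Q = Q'" using inj_onD[OF chart_inj[OF M k], of Q Q'] W(2) by (auto simp: overlap_def)
    then have "x \<in> img M k ?W" using Q by (auto simp: img_def)
    then show ?thesis using fun_cong[OF 0, of x] True k by (simp add: extension_def)
  next
    case False
    then show ?thesis using out[of x] k by (auto simp: extension_def restr_def)
  qed
qed

text \<open>Smoothness is local. Near a point of the chart \<open>i\<close> the extension is a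
  transition of \<open>h\<close>; near any other point it is zero, because the complement of the
  support is open.\<close>

lemma extension_closed:
  assumes k: "k \<in> charts M" shows "extension i h k \<in> Rc k"
proof -
  interpret C: superdomain p q "vdom M k" by (rule chart_domain[OF k])
  interpret T: transition_map M k i "overlap M k i" by (rule overlap_map[OF k i])
  have c: "change M k i h \<in> T.I.R" by (rule change_simps(1)[OF k i h h])
  have e: "extension i h k = change M k i h" using k by (simp add: extension_def)
  show ?thesis
  proof (rule C.superfunI)
    show "extension i h k x = 0" if "x \<notin> vdom M k" for x
      unfolding e by (rule T.I.superfun_outside[OF c]) (use that OL_subset(1)[of k i] in blast)
    show "extension i h k x \<in> Grassmann q" for x unfolding e by (rule T.I.superfun_Grassmann[OF c])
    fix I :: "nat set"
    show "smooth_fun p (vdom M k) (\<lambda>x. gr_coeff (extension i h k x) I)"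
    proof (rule smooth_fun_local[OF C.V])
      fix x assume "x \<in> vdom M k"
      then obtain Q where Q: "Q \<in> chart_dom M k" "x = chart_map M k Q" by (auto simp: vdom_def img_def)
      show "\<exists>V'. open_dom p V' \<and> x \<in> V' \<and> V' \<subseteq> vdom M k \<and> smooth_fun p V' (\<lambda>x. gr_coeff (extension i h k x) I)"
      proof (cases "Q \<in> chart_dom M i")
        case True
        then have "x \<in> T.Vi" using Q by (auto simp: img_def overlap_def)
        then show ?thesis unfolding e using T.I.V OL_subset(1)[of k i] T.I.superfun_smooth[OF c] by blast
      next
        case False
        let ?W = "chart_dom M k - support_set"
        have W: "openin (base M) ?W" "?W \<subseteq> chart_dom M k" "?W \<inter> support_set = {}"
          using openin_diff[OF supermanifold_chart(1)[OF M k] closed_support] by auto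
        have o: "open_dom p (img M k ?W)" by (rule open_img[OF M k W(1,2)])
        have "smooth_fun p (img M k ?W) (\<lambda>x. gr_coeff (extension i h k x) I)"
        proof -
          have "extension i h k z = 0" if "z \<in> img M k ?W" for z
            using fun_cong[OF extension_0[OF k W], of z] that by simp
          then show ?thesis by (intro smooth_fun_cong[OF o _ smooth_fun_const[OF o, of 0]]) simp
        qed
        moreover have "x \<in> img M k ?W" using Q False by (auto simp: img_def)
        ultimately show ?thesis using o by (auto simp: img_def vdom_def intro!: exI[of _ "img M k ?W"])
      qed
    qed
  qed
qed

lemma extension_restr:
  assumes k: "k \<in> charts M" and W: "openin (base M) W" "W \<subseteq> overlap M k i"
  shows "restr (img M k W) (extension i h k) = transition M k i W (restr (img M i W) h)"
  using change_restr[OF k i W h] k by (simp add: extension_def)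

text \<open>The same two kinds of neighbourhood: inside the chart \<open>i\<close> agreement is the
  cocycle condition for the three charts, and away from the support both sides are zero.\<close>

lemma extension_smooth: "extension i h \<in> smooth_functions M"
  unfolding smooth_functions_def local_family_def sfuns_chart
proof (intro CollectI conjI ballI allI impI extension_closed)
  fix k l assume k: "k \<in> charts M" and l: "l \<in> charts M"
  interpret T: transition_map M k l "overlap M k l" by (rule overlap_map[OF k l])
  have c: "change M k l (extension i h l) \<in> T.I.R" by (rule change_simps(1)[OF k l extension_closed[OF l] extension_closed[OF l]])
  show "restr T.Vi (extension i h k) = change M k l (extension i h l)"
  proof (rule T.I.superfun_eqI[OF _ c])
    show "restr T.Vi (extension i h k) \<in> T.I.R" by (rule restr_closed[OF k l extension_closed[OF k]])
    fix x assume "x \<in> T.Vi"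
    then obtain Q where Q: "Q \<in> overlap M k l" "x = chart_map M k Q" by (auto simp: img_def)
    have "\<exists>W. openin (base M) W \<and> W \<subseteq> overlap M k l \<and> Q \<in> W \<and>
        restr (img M k W) (extension i h k) = restr (img M k W) (change M k l (extension i h l))"
    proof (cases "Q \<in> chart_dom M i")
      case True
      let ?W = "overlap M k l \<inter> chart_dom M i"
      have W: "openin (base M) ?W" using T.U(1) supermanifold_chart(1)[OF M i] by blast
      have "restr (img M k ?W) (change M k l (extension i h l))
          = transition M k l ?W (transition M l i ?W (restr (img M i ?W) h))"
        using change_restr[OF k l W _ extension_closed[OF l]] extension_restr[OF l W] by (auto simp: overlap_def)
      also have "\<dots> = transition M k i ?W (restr (img M i ?W) h)"
      proof -
        interpret Ti: transition_map M i i "chart_dom M i" using overlap_map[OF i i] by (simp add: overlap_def)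
        have "restr (img M i ?W) h \<in> sfuns M i ?W"
          unfolding sfuns_def
          by (rule superdomain.superfun_restr[OF chart_domain[OF i] h open_img[OF M i W]]) (auto simp: img_def vdom_def)
        moreover have "?W \<subseteq> chart_dom M k \<inter> chart_dom M l \<inter> chart_dom M i" by (auto simp: overlap_def)
        ultimately show ?thesis
          using M[unfolded supermanifold_def, THEN conjunct2, THEN conjunct2, THEN conjunct2, THEN conjunct2, THEN conjunct2,
            THEN conjunct2, rule_format, OF k l i, OF conjI, OF W] by simp
      qed
      also have "\<dots> = restr (img M k ?W) (extension i h k)"
        by (rule extension_restr[OF k W, symmetric]) (auto simp: overlap_def)
      finally show ?thesis using W True Q(1) by (intro exI[of _ ?W]) auto
    next
      case False
      let ?W = "overlap M k l - support_set"
      have W: "openin (base M) ?W" by (rule openin_diff[OF T.U(1) closed_support])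
      have "restr (img M k ?W) (extension i h k) = 0" "restr (img M l ?W) (extension i h l) = 0"
        using W by (auto intro!: extension_0 k l simp: overlap_def)
      then have "restr (img M k ?W) (extension i h k) = restr (img M k ?W) (change M k l (extension i h l))"
        using change_restr[OF k l W _ extension_closed[OF l]] transition_0[OF k l W] by auto
      then show ?thesis using W False Q(1) by (intro exI[of _ ?W]) auto
    qed
    then obtain W where W: "W \<subseteq> overlap M k l" "Q \<in> W"
      "restr (img M k W) (extension i h k) = restr (img M k W) (change M k l (extension i h l))" by blast
    then have "x \<in> img M k W" using Q by (auto simp: img_def)
    then show "restr T.Vi (extension i h k) x = change M k l (extension i h l) x"
      using fun_cong[OF W(3), of x] \<open>x \<in> T.Vi\<close> by simp
  qed
qed (simp_all add: extension_def)

lemma extension_homogeneous: "homogeneous e h \<Longrightarrow> fam_homogeneous e (extension i h)"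
  using change_simps(5)[OF _ i h h] by (simp add: fam_homogeneous_def extension_def)

lemma extension_same: "extension i h i = h"
proof -
  interpret Ti: transition_map M i i "chart_dom M i" using overlap_map[OF i i] by (simp add: overlap_def)
  have "overlap M i i = chart_dom M i" by (simp add: overlap_def)
  have eq: "restr (vdom M i) h = h" using superdomain.superfun_outside[OF chart_domain[OF i] h] by (auto simp: restr_def fun_eq_iff)
  have "transition M i i (chart_dom M i) h = h"
    using M i h Ti.U(1) unfolding supermanifold_def sfuns_def vdom_def by blast
  then show ?thesis using i eq by (simp add: extension_def change_def overlap_def vdom_def)
qed

end

end

section \<open>The structure is recovered from brackets of cut-off coordinates\<close>

context poisson_volume
begin

theorem solution_weight:
  assumes \<Delta>: "lie_solution M S w \<Delta>" and nz: "nonzero_structure M S"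
  shows "w = 1 / 2"
proof (rule ccontr)
  assume w: "w \<noteq> 1 / 2"
  obtain i c b where i: "i \<in> charts M" and c: "c < p + q" and b: "b < p + q" and "S i c b \<noteq> 0"
    using nz by (auto simp: nonzero_structure_def cdim_eq)
  then obtain y where y0: "S i c b y \<noteq> 0" by (auto simp: fun_eq_iff)
  interpret local_poisson p q "vdom M i" "S i" "\<rho> i" by (rule local_poisson[OF nv i])
  have y: "y \<in> vdom M i" using superfun_outside[OF SR[OF c b]] y0 by blast
  obtain r where r: "r > 0" "box_dom p y r \<subseteq> vdom M i" using box_dom_neighbourhood[OF V y] by blast
  \<comment> \<open>Half the radius puts the compact support inside the image of the chart.\<close>
  let ?K = "closed_box p y (r / 2)"
  have K: "compactin (Euclidean_space p) ?K" "?K \<subseteq> vdom M i"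
  proof -
    show "compactin (Euclidean_space p) ?K" by (rule compactin_closed_box)
    have "?K \<subseteq> box_dom p y r" using r(1) by (force simp: closed_box_def box_dom_def)
    then show "?K \<subseteq> vdom M i" using r(2) by blast
  qed
  obtain t where t: "smooth_fun p (vdom M i) t" "t y > 0" "\<And>k. k < p \<Longrightarrow> partial k t y = 0"
    "\<And>z. z \<in> vdom M i \<Longrightarrow> z \<notin> ?K \<Longrightarrow> t z = 0"
    using bump_function[OF V, of "r / 2" y] r(1) by (metis half_gt_zero)
  let ?t = "real_sfun (vdom M i) t"
  \<comment> \<open>The first derivatives of \<open>t\<close> vanish at \<open>y\<close>, so those
    of \<open>?h d\<close> at \<open>y\<close> are \<open>t y\<close> times those of the coordinate.
    The bracket of \<open>?h b\<close> and \<open>?h c\<close> at \<open>y\<close> is then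
    \<open>(t y)\<^sup>2\<close> times \<open>S i c b y\<close>, up to sign.\<close>
  let ?h = "\<lambda>d. ?t * coord p (vdom M i) d"
  have tR: "?t \<in> R" by (rule superfun_real[OF t(1)])
  have hR: "?h d \<in> R" if "d < p + q" for d using tR that by simp
  have hh: "homogeneous (cpar p d) (?h d)" for d
    using homogeneous_mult[OF homogeneous_real_sfun[of "vdom M i" t] homogeneous_coord[of p d "vdom M i"]] by simp
  have hK: "?h d x = 0" if "x \<in> vdom M i" "x \<notin> ?K" for d x using t(4)[OF that] that(1) by (simp add: real_sfun_def)
  have Dt: "D a ?t y = 0" for a
  proof (cases "a < p")
    case True
    have "partial a (\<lambda>x. gr_coeff (?t x) I) y = partial a (\<lambda>x. if I = {} then t x else 0) y" for I
      by (rule partial_cong[OF V y True]) (simp add: real_sfun_def gr_coeff_of_real)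
    also have "partial a (\<lambda>x. if I = {} then t x else 0) y = 0" for I
      using t(3)[OF True] by (cases "I = {}") (simp_all add: partial_def)
    finally show ?thesis using True y by (intro gr_eqI) (simp add: pd_def gr_coeff_partial)
  next
    case False
    then show ?thesis using y by (intro gr_eqI) (auto simp: pd_def real_sfun_def gr_coeff_deriv gr_coeff_of_real)
  qed
  have Dh: "D a (?h d) y = of_real (t y) * of_bool (a = d)" if d: "d < p + q" for a d
    using pd_mult_even[OF tR superfun_coord[OF d] homogeneous_real_sfun, of a] pd_coord[OF d, of a] Dt[of a] y
    by (simp add: real_sfun_def)
  let ?f = "extension i (?h b)" and ?g = "extension i (?h c)"
  have fg: "?f \<in> smooth_functions M" "?g \<in> smooth_functions M" "?f i = ?h b" "?g i = ?h c"
    "fam_homogeneous (cpar p b) ?f" "fam_homogeneous (cpar p c) ?g"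
    by (rule extension_smooth[OF i hR K hK] extension_same[OF i hR K hK] extension_homogeneous[OF i hR K hK] b c hh; assumption?)+
  have "(\<Sum>a<p + q. X (cpar p b) (?h b) a * D a (?h c)) = 0"
    using solution_bracket[OF \<Delta> w fg(1,5) _ fg(2,6) _ i] unfolding fg(3,4) by (simp add: cpar_def)
  then have "(\<Sum>a<p + q. X (cpar p b) (?h b) a y * D a (?h c) y) = 0"
    by (simp add: fun_eq_iff sum_fun_apply)
  moreover have "X (cpar p b) (?h b) a y * D a (?h c) y = (if a = c then (-1) ^ (cpar p c * cpar p b) * ((t y)\<^sup>2 *\<^sub>R S i c b y) else 0)"
    if a: "a < p + q" for a
  proof -
    have "G (?h b) a y = (\<Sum>d<p + q. if d = b then t y *\<^sub>R S i a b y else 0)"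
      unfolding G_def sum_fun_apply by (intro sum.cong refl) (auto simp: Dh[OF b] of_real_def)
    then have "G (?h b) a y = t y *\<^sub>R S i a b y" using b by (simp add: sum.delta)
    then show ?thesis unfolding Dh[OF c] by (simp add: X_def power_fun_apply of_real_def power2_eq_square)
  qed
  ultimately have "(\<Sum>a<p + q. if a = c then (-1) ^ (cpar p c * cpar p b) * ((t y)\<^sup>2 *\<^sub>R S i c b y) else 0) = 0" by simp
  then have "(-1) ^ (cpar p c * cpar p b) * ((t y)\<^sup>2 *\<^sub>R S i c b y) = 0" using c by (simp add: sum.delta)
  then show False using y0 t(2) by (cases "even (cpar p c * cpar p b)") simp_all
qed

end

text \<open>If the structure vanishes, all \<open>\<L>_f\<close> are zero and the zero operator is a
  solution in every weight; hence the equivalence is stated for a nonzero structure only, while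
  existence and uniqueness for half-densities hold without this restriction.\<close>

theorem theorem2p3:
  fixes M :: "('x, 'i) supermfd"
    and S :: "'i \<Rightarrow> nat \<Rightarrow> nat \<Rightarrow> sfun"
    and w :: real
  assumes "supermanifold M"
    and "oriented M"
    and "\<exists>\<rho>. nondegenerate_volume M \<rho>"
    and "odd_poisson M S"
  shows "(nonzero_structure M S \<longrightarrow> ((\<exists>\<Delta>. lie_solution M S w \<Delta>) \<longleftrightarrow> w = 1 / 2))
    \<and> (\<exists>\<Delta>. lie_solution M S (1 / 2) \<Delta> \<and> odd_operator M (1 / 2) \<Delta>)
    \<and> (\<forall>\<Delta> \<Delta>'. lie_solution M S (1 / 2) \<Delta> \<longrightarrow>
         (lie_solution M S (1 / 2) \<Delta>' \<longleftrightarrow>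
            (\<exists>C\<in>smooth_functions M. \<forall>s\<in>densities M (1 / 2). \<Delta>' s = \<Delta> s + C * s)))
    \<and> (\<forall>\<Delta> \<rho>. lie_solution M S (1 / 2) \<Delta> \<and> nondegenerate_volume M \<rho> \<longrightarrow>
         (\<exists>C\<in>smooth_functions M. \<forall>s\<in>smooth_functions M.
            \<Delta> (s * vol_powr M \<rho> (1 / 2)) =
              odd_laplace M S \<rho> s * vol_powr M \<rho> (1 / 2) + C * (s * vol_powr M \<rho> (1 / 2))))"
proof -
  have loc: "poisson_volume M S \<rho>" if "nondegenerate_volume M \<rho>" for \<rho>
    using assms(1,2,4) that by unfold_locales
  obtain \<rho> where "nondegenerate_volume M \<rho>" using assms(3) by blast
  then interpret poisson_volume M S \<rho> by (rule loc)
  have ex: "lie_solution M S (1 / 2) half_laplace \<and> odd_operator M (1 / 2) half_laplace"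
    using half_laplace_solution half_laplace_odd ..
  show ?thesis
  proof (intro conjI impI allI)
    show "(\<exists>\<Delta>. lie_solution M S w \<Delta>) \<longleftrightarrow> w = 1 / 2" if "nonzero_structure M S"
      using solution_weight[OF _ that] ex by blast
    show "\<exists>\<Delta>. lie_solution M S (1 / 2) \<Delta> \<and> odd_operator M (1 / 2) \<Delta>" using ex by blast
    show "lie_solution M S (1 / 2) \<Delta>' \<longleftrightarrow> (\<exists>C\<in>smooth_functions M. \<forall>s\<in>densities M (1 / 2). \<Delta>' s = \<Delta> s + C * s)"
      if "lie_solution M S (1 / 2) \<Delta>" for \<Delta> \<Delta>'
      using solutions_differ[OF that] solution_plus_function[OF that] by blast
    fix \<Delta> \<rho>' assume *: "lie_solution M S (1 / 2) \<Delta> \<and> nondegenerate_volume M \<rho>'"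
    \<comment> \<open>The local formula is claimed for every volume form, not just for the one from
      which the existing solution was built.\<close>
    then interpret V: poisson_volume M S \<rho>' by (intro loc) simp
    show "\<exists>C\<in>smooth_functions M. \<forall>s\<in>smooth_functions M. \<Delta> (s * vol_powr M \<rho>' (1 / 2)) =
        odd_laplace M S \<rho>' s * vol_powr M \<rho>' (1 / 2) + C * (s * vol_powr M \<rho>' (1 / 2))"
      using V.solution_formula * by blast
  qed
qed

end
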